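(* Let $R$ and $S$ be rings, let $d\ge 1$ be an integer, let $n$ be an integer or $n=\infty$ with $n>d+1$, and let ${}_S(K_{d-1})_R$ be a special semidualizing bimodule (with respect to some super finitely presented bimodule ${}_SC_R$). Then: (1) If $0\to M\to N\to L\to 0$ is a short exact sequence of $R$-modules with $M\in\mathcal{I}_{K_{d-1}}^{(n,d)}(R)$ and $L\in\mathcal{I}_{K_{d-1}}^{(n,d)}(R)$, then $N\in\mathcal{I}_{K_{d-1}}^{(n,d)}(R)$; (2) If $0\to M\to N\to L\to 0$ is a short exact sequence of $S$-modules with $M\in\mathcal{F}_{K_{d-1}}^{(n,d)}(S)$ and $L\in\mathcal{F}_{K_{d-1}}^{(n,d)}(S)$, then $N\in\mathcal{F}_{K_{d-1}}^{(n,d)}(S)$.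
   Context: Rings are associative with unity; modules are unital left modules; right $R$-modules are identified with left $R^{op}$-modules. A module $U$ over a ring $T$ is finitely $n$-presented ($n$ finite) if there is an exact sequence $F_n\to F_{n-1}\to\cdots\to F_0\to U\to 0$ of $T$-modules with each $F_i$ finitely generated free; for $n=\infty$, finitely $\infty$-presented means super finitely presented, i.e. there is an exact sequence $\cdots\to F_1\to F_0\to U\to 0$ with each $F_i$ finitely generated free. An $S$-module $M$ is $(n,d)$-injective if $\mathrm{Ext}_S^{d+1}(U,M)=0$ for every finitely $n$-presented $S$-module $U$. An $R$-module $N$ is $(n,d)$-flat if $\mathrm{Tor}^R_{d+1}(U,N)=0$ for every finitely $n$-presented $R^{op}$-module $U$. $\mathcal{I}^{(n,d)}(S)$ and $\mathcal{F}^{(n,d)}(R)$ denote the classes of all $(n,d)$-injective $S$-modules and all $(n,d)$-flat $R$-modules. An $(S,R)$-bimodule $K$ is semidualizing if: ${}_SK$ and $K_R$ each have a resolution by finitely generated projectives (over $S$, resp. $R^{op}$); the homothety maps $S\to\mathrm{Hom}_{R^{op}}(K,K)$ and $R\to\mathrm{Hom}_S(K,K)$ are isomorphisms; and $\mathrm{Ext}_S^i(K,K)=0=\mathrm{Ext}_{R^{op}}^i(K,K)$ for all $i\ge1$. Special semidualizing: let ${}_SC_R$ be a super finitely presented bimodule, i.e. there is an exact sequence of $(S,R)$-bimodules $\cdots\to F_1\to F_0\to C\to 0$ with each $F_i$ finitely generated free as a left $S$-module and as a right $R$-module. Put $K_{d-1}=\mathrm{Ker}(F_{d-1}\to F_{d-2})$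 (with $F_{-1}=C$), the $(d-1)$th syzygy. If $K_{d-1}$ is a semidualizing $(S,R)$-bimodule, then $K_{d-1}$ is called a special semidualizing bimodule (with respect to $C$). $\mathcal{I}_{K_{d-1}}^{(n,d)}(R)$ is the class of $R$-modules (isomorphic to one) of the form $\mathrm{Hom}_S(K_{d-1},I)$ with $I\in\mathcal{I}^{(n,d)}(S)$; $\mathcal{F}_{K_{d-1}}^{(n,d)}(S)$ is the class of $S$-modules (isomorphic to one) of the form $K_{d-1}\otimes_RF$ with $F\in\mathcal{F}^{(n,d)}(R)$. *)

theory Defs
  imports
    "HOL-Algebra.Module" "HOL-Algebra.AbelCoset" "HOL-Algebra.Elementary_Groups"
    "HOL-Algebra.Free_Abelian_Groups" "HOL-Library.Extended_Nat"
begin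

section \<open>Modules over noncommutative rings\<close>

text \<open>The locale \<open>module\<close> of the library demands a commutative ring of scalars. Its record type is
  reused here; the fields \<open>mult\<close> and \<open>one\<close> which that record inherits from rings play no role
  (as in the library).\<close>

locale lmodule = R?: ring R + M?: abelian_group M for R (structure) and M (structure) +
  assumes smult_closed [simp, intro]:
      "\<lbrakk>a \<in> carrier R; x \<in> carrier M\<rbrakk> \<Longrightarrow> a \<odot>\<^bsub>M\<^esub> x \<in> carrier M"
    and smult_l_distr:
      "\<lbrakk>a \<in> carrier R; b \<in> carrier R; x \<in> carrier M\<rbrakk> \<Longrightarrow>
        (a \<oplus>\<^bsub>R\<^esub> b) \<odot>\<^bsub>M\<^esub> x = a \<odot>\<^bsub>M\<^esub> x \<oplus>\<^bsub>M\<^esub> b \<odot>\<^bsub>M\<^esub> x"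
    and smult_r_distr:
      "\<lbrakk>a \<in> carrier R; x \<in> carrier M; y \<in> carrier M\<rbrakk> \<Longrightarrow>
        a \<odot>\<^bsub>M\<^esub> (x \<oplus>\<^bsub>M\<^esub> y) = a \<odot>\<^bsub>M\<^esub> x \<oplus>\<^bsub>M\<^esub> a \<odot>\<^bsub>M\<^esub> y"
    and smult_assoc1:
      "\<lbrakk>a \<in> carrier R; b \<in> carrier R; x \<in> carrier M\<rbrakk> \<Longrightarrow>
        (a \<otimes>\<^bsub>R\<^esub> b) \<odot>\<^bsub>M\<^esub> x = a \<odot>\<^bsub>M\<^esub> (b \<odot>\<^bsub>M\<^esub> x)"
    and smult_one [simp]:
      "x \<in> carrier M \<Longrightarrow> \<one>\<^bsub>R\<^esub> \<odot>\<^bsub>M\<^esub> x = x"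

definition op_ring :: "'r ring \<Rightarrow> 'r ring" where
  "op_ring R = R\<lparr>monoid.mult := \<lambda>x y. y \<otimes>\<^bsub>R\<^esub> x\<rparr>"

text \<open>Homomorphisms are not required to be extensional, since only their values on the carrier matter.
  The Hom groups below consist of the extensional ones.\<close>

definition lmod_hom :: "'t ring \<Rightarrow> ('t, 'm) module \<Rightarrow> ('t, 'n) module \<Rightarrow> ('m \<Rightarrow> 'n) set" where
  "lmod_hom T M N = {f \<in> carrier M \<rightarrow> carrier N.
     (\<forall>x\<in>carrier M. \<forall>y\<in>carrier M. f (x \<oplus>\<^bsub>M\<^esub> y) = f x \<oplus>\<^bsub>N\<^esub> f y) \<and>
     (\<forall>a\<in>carrier T. \<forall>x\<in>carrier M. f (a \<odot>\<^bsub>M\<^esub> x) = a \<odot>\<^bsub>N\<^esub> f x)}"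

definition lmod_iso :: "'t ring \<Rightarrow> ('t, 'm) module \<Rightarrow> ('t, 'n) module \<Rightarrow> bool" where
  "lmod_iso T M N \<longleftrightarrow> (\<exists>h\<in>lmod_hom T M N. bij_betw h (carrier M) (carrier N))"

definition short_exact ::
  "'t ring \<Rightarrow> ('t, 'm) module \<Rightarrow> ('t, 'n) module \<Rightarrow> ('t, 'l) module \<Rightarrow> ('m \<Rightarrow> 'n) \<Rightarrow> ('n \<Rightarrow> 'l) \<Rightarrow> bool"
  where
  "short_exact T M N L f g \<longleftrightarrow>
     lmodule T M \<and> lmodule T N \<and> lmodule T L \<and>
     f \<in> lmod_hom T M N \<and> g \<in> lmod_hom T N L \<and>
     inj_on f (carrier M) \<and> f ` carrier M = a_kernel N L g \<and> g ` carrier N = carrier L"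

text \<open>The free module with basis indexed by \<open>X\<close>: finitely supported families of scalars.\<close>

definition free_module :: "'t ring \<Rightarrow> 'x set \<Rightarrow> ('t, 'x \<Rightarrow> 't) module" where
  "free_module T X = \<lparr>
     carrier = {f. (\<forall>x\<in>X. f x \<in> carrier T) \<and> (\<forall>x. x \<notin> X \<longrightarrow> f x = \<zero>\<^bsub>T\<^esub>) \<and> finite {x. f x \<noteq> \<zero>\<^bsub>T\<^esub>}},
     monoid.mult = undefined, monoid.one = undefined,
     ring.zero = (\<lambda>x. \<zero>\<^bsub>T\<^esub>), ring.add = (\<lambda>f g x. f x \<oplus>\<^bsub>T\<^esub> g x),
     module.smult = (\<lambda>a f x. a \<otimes>\<^bsub>T\<^esub> f x)\<rparr>"

definition fg_free :: "'t ring \<Rightarrow> ('t, 'm) module \<Rightarrow> bool" where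
  "fg_free T M \<longleftrightarrow> lmodule T M \<and> (\<exists>k::nat. lmod_iso T (free_module T {..<k}) M)"

definition fin_gen :: "'t ring \<Rightarrow> ('t, 'm) module \<Rightarrow> bool" where
  "fin_gen T M \<longleftrightarrow> lmodule T M \<and>
     (\<exists>X. finite X \<and> X \<subseteq> carrier M \<and>
       (\<forall>m\<in>carrier M. \<exists>a\<in>X \<rightarrow> carrier T. m = (\<Oplus>\<^bsub>M\<^esub>x\<in>X. a x \<odot>\<^bsub>M\<^esub> x)))"

text \<open>The lifting property. HOL cannot quantify over the types of the test modules \<open>A\<close> and \<open>B\<close>.
  The types chosen suffice, as they admit the canonical surjection from the free module on
  \<open>carrier M\<close> onto \<open>M\<close>; a lift of the identity of \<open>M\<close> along it makes \<open>M\<close> a direct summand of a free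
  module, so that \<open>M\<close> has the lifting property for test modules of all types.\<close>

definition projective :: "'t ring \<Rightarrow> ('t, 'm) module \<Rightarrow> bool" where
  "projective T M \<longleftrightarrow> lmodule T M \<and>
     (\<forall>(A :: ('t, 'm \<Rightarrow> 't) module) (B :: ('t, 'm) module) g f.
        lmodule T A \<and> lmodule T B \<and> g \<in> lmod_hom T A B \<and> g ` carrier A = carrier B \<and>
        f \<in> lmod_hom T M B \<longrightarrow>
        (\<exists>h\<in>lmod_hom T M A. \<forall>x\<in>carrier M. g (h x) = f x))"


section \<open>Resolutions and finite presentation\<close>

text \<open>Exactness of \<open>P\<^sub>n \<rightarrow> \<dots> \<rightarrow> P\<^sub>1 \<rightarrow> P\<^sub>0 \<rightarrow> U \<rightarrow> 0\<close>, where \<open>\<delta> i\<close> maps \<open>P (Suc i)\<close> to \<open>P i\<close> and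
  \<open>\<epsilon>\<close> maps \<open>P 0\<close> to \<open>U\<close>; nothing is required at \<open>P\<^sub>n\<close>. For \<open>n = \<infinity>\<close> the sequence does not end.\<close>

definition exact_augmented ::
  "enat \<Rightarrow> ('u, 'z) ring_scheme \<Rightarrow> (nat \<Rightarrow> ('p, 'y) ring_scheme) \<Rightarrow> (nat \<Rightarrow> 'p \<Rightarrow> 'p) \<Rightarrow> ('p \<Rightarrow> 'u) \<Rightarrow> bool"
  where
  "exact_augmented n U P \<delta> \<epsilon> \<longleftrightarrow>
     \<epsilon> ` carrier (P 0) = carrier U \<and>
     (0 < n \<longrightarrow> \<delta> 0 ` carrier (P 1) = a_kernel (P 0) U \<epsilon>) \<and>
     (\<forall>i. enat (Suc i) < n \<longrightarrow>
        \<delta> (Suc i) ` carrier (P (Suc (Suc i))) = a_kernel (P (Suc i)) (P i) (\<delta> i))"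

definition resolution ::
  "'t ring \<Rightarrow> enat \<Rightarrow> ('t, 'u) module \<Rightarrow> (nat \<Rightarrow> ('t, 'p) module) \<Rightarrow> (nat \<Rightarrow> 'p \<Rightarrow> 'p) \<Rightarrow> ('p \<Rightarrow> 'u) \<Rightarrow> bool"
  where
  "resolution T n U P \<delta> \<epsilon> \<longleftrightarrow>
     lmodule T U \<and> (\<forall>i. enat i \<le> n \<longrightarrow> lmodule T (P i)) \<and>
     \<epsilon> \<in> lmod_hom T (P 0) U \<and>
     (\<forall>i. enat i < n \<longrightarrow> \<delta> i \<in> lmod_hom T (P (Suc i)) (P i)) \<and>
     exact_augmented n U P \<delta> \<epsilon>"

text \<open>Every finitely generated module has an isomorphic copy whose elements are of type
  \<open>nat \<Rightarrow> 't\<close> (choose a representative of each coset in a quotient of a free module on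
  \<open>{..<k}\<close>), so this carrier type is no restriction here and in the definitions below where finitely
  generated modules are quantified.\<close>

definition fin_n_presented :: "'t ring \<Rightarrow> enat \<Rightarrow> ('t, 'u) module \<Rightarrow> bool" where
  "fin_n_presented T n U \<longleftrightarrow>
     (\<exists>(F :: nat \<Rightarrow> ('t, nat \<Rightarrow> 't) module) \<delta> \<epsilon>.
        resolution T n U F \<delta> \<epsilon> \<and> (\<forall>i. enat i \<le> n \<longrightarrow> fg_free T (F i)))"

definition has_fg_projective_resolution :: "'t ring \<Rightarrow> ('t, 'u) module \<Rightarrow> bool" where
  "has_fg_projective_resolution T U \<longleftrightarrow>
     (\<exists>(P :: nat \<Rightarrow> ('t, nat \<Rightarrow> 't) module) \<delta> \<epsilon>.
        resolution T \<infinity> U P \<delta> \<epsilon> \<and> (\<forall>i. fin_gen T (P i) \<and> projective T (P i)))"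

definition projective_resolution ::
  "'t ring \<Rightarrow> ('t, 'u) module \<Rightarrow> (nat \<Rightarrow> ('t, 'p) module) \<Rightarrow> (nat \<Rightarrow> 'p \<Rightarrow> 'p) \<Rightarrow> ('p \<Rightarrow> 'u) \<Rightarrow> bool"
  where
  "projective_resolution T U P \<delta> \<epsilon> \<longleftrightarrow> resolution T \<infinity> U P \<delta> \<epsilon> \<and> (\<forall>i. projective T (P i))"


section \<open>Ext\<close>

definition hom_group :: "'t ring \<Rightarrow> ('t, 'm) module \<Rightarrow> ('t, 'n) module \<Rightarrow> ('m \<Rightarrow> 'n) monoid" where
  "hom_group T M N = \<lparr>
     carrier = lmod_hom T M N \<inter> extensional (carrier M),
     monoid.mult = (\<lambda>f g. \<lambda>x\<in>carrier M. f x \<oplus>\<^bsub>N\<^esub> g x),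
     monoid.one = (\<lambda>x\<in>carrier M. \<zero>\<^bsub>N\<^esub>)\<rparr>"

definition coboundary ::
  "(nat \<Rightarrow> ('t, 'p) module) \<Rightarrow> (nat \<Rightarrow> 'p \<Rightarrow> 'p) \<Rightarrow> nat \<Rightarrow> ('p \<Rightarrow> 'm) \<Rightarrow> ('p \<Rightarrow> 'm)" where
  "coboundary P \<delta> i f = compose (carrier (P (Suc i))) f (\<delta> i)"

text \<open>The cohomology group \<open>H\<^sup>i(Hom\<^sub>T(P, M))\<close>, that is, \<open>Ext\<^sub>T\<^sup>i(U, M)\<close> computed with the projective
  resolution \<open>P\<close> of \<open>U\<close>.\<close>

definition Ext_group ::
  "'t ring \<Rightarrow> (nat \<Rightarrow> ('t, 'p) module) \<Rightarrow> (nat \<Rightarrow> 'p \<Rightarrow> 'p) \<Rightarrow> ('t, 'm) module \<Rightarrow> nat \<Rightarrow> ('p \<Rightarrow> 'm) set monoid"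
  where
  "Ext_group T P \<delta> M i =
     (hom_group T (P i) M)
       \<lparr>carrier := kernel (hom_group T (P i) M) (hom_group T (P (Suc i)) M) (coboundary P \<delta> i)\<rparr>
     Mod (case i of 0 \<Rightarrow> {\<one>\<^bsub>hom_group T (P 0) M\<^esub>}
            | Suc j \<Rightarrow> coboundary P \<delta> j ` carrier (hom_group T (P j) M))"

text \<open>Vanishing of Ext. The group does not depend on the resolution, up to isomorphism, whence the
  universal quantifier. The carrier type is large enough to contain a resolution of every \<open>U\<close>, see the
  lemma \<open>projective_resolution_exists\<close> below.\<close>

definition Ext_zero :: "'t ring \<Rightarrow> ('t, 'u) module \<Rightarrow> ('t, 'm) module \<Rightarrow> nat \<Rightarrow> bool" where
  "Ext_zero T U M i \<longleftrightarrow>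
     (\<forall>(P :: nat \<Rightarrow> ('t, 'u + 't + nat \<Rightarrow> 't) module) \<delta> \<epsilon>.
        projective_resolution T U P \<delta> \<epsilon> \<longrightarrow> trivial_group (Ext_group T P \<delta> M i))"


section \<open>Tensor products and Tor\<close>

text \<open>The tensor product of a right \<open>R\<close>-module \<open>U\<close>, given as a left module over \<open>op_ring R\<close>
  (so that \<open>r \<odot>\<^bsub>U\<^esub> u\<close> stands for \<open>ur\<close>), with a left \<open>R\<close>-module \<open>N\<close>: the free abelian group on
  \<open>U \<times> N\<close> modulo the usual relations.\<close>

definition tensor_rels :: "'r ring \<Rightarrow> ('r, 'u) module \<Rightarrow> ('r, 'n) module \<Rightarrow> (('u \<times> 'n) \<Rightarrow>\<^sub>0 int) set" where
  "tensor_rels R U N =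
     {frag_of (u \<oplus>\<^bsub>U\<^esub> u', y) - frag_of (u, y) - frag_of (u', y) | u u' y.
        u \<in> carrier U \<and> u' \<in> carrier U \<and> y \<in> carrier N} \<union>
     {frag_of (u, y \<oplus>\<^bsub>N\<^esub> y') - frag_of (u, y) - frag_of (u, y') | u y y'.
        u \<in> carrier U \<and> y \<in> carrier N \<and> y' \<in> carrier N} \<union>
     {frag_of (r \<odot>\<^bsub>U\<^esub> u, y) - frag_of (u, r \<odot>\<^bsub>N\<^esub> y) | r u y.
        r \<in> carrier R \<and> u \<in> carrier U \<and> y \<in> carrier N}"

definition tensor_ker :: "'r ring \<Rightarrow> ('r, 'u) module \<Rightarrow> ('r, 'n) module \<Rightarrow> (('u \<times> 'n) \<Rightarrow>\<^sub>0 int) set" where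
  "tensor_ker R U N = generate (free_Abelian_group (carrier U \<times> carrier N)) (tensor_rels R U N)"

definition tensor_group ::
  "'r ring \<Rightarrow> ('r, 'u) module \<Rightarrow> ('r, 'n) module \<Rightarrow> (('u \<times> 'n) \<Rightarrow>\<^sub>0 int) set monoid" where
  "tensor_group R U N = free_Abelian_group (carrier U \<times> carrier N) Mod tensor_ker R U N"

text \<open>The map \<open>f \<otimes> g\<close> into \<open>V \<otimes> W\<close>. Its arguments are cosets; all members of the indexed union are
  the same coset when \<open>f\<close> and \<open>g\<close> are homomorphisms.\<close>

definition tensor_map ::
  "'r ring \<Rightarrow> ('r, 'v) module \<Rightarrow> ('r, 'w) module \<Rightarrow> ('u \<Rightarrow> 'v) \<Rightarrow> ('n \<Rightarrow> 'w) \<Rightarrow>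
   (('u \<times> 'n) \<Rightarrow>\<^sub>0 int) set \<Rightarrow> (('v \<times> 'w) \<Rightarrow>\<^sub>0 int) set" where
  "tensor_map R V W f g A =
     (\<Union>a\<in>A. tensor_ker R V W #>\<^bsub>free_Abelian_group (carrier V \<times> carrier W)\<^esub>
               frag_extend (\<lambda>(u, y). frag_of (f u, g y)) a)"

text \<open>The homology group \<open>H\<^sub>i(P \<otimes>\<^sub>R N)\<close>, that is, \<open>Tor\<^sup>R\<^sub>i(U, N)\<close> computed with the projective
  resolution \<open>P\<close> of the right module \<open>U\<close>.\<close>

definition Tor_group ::
  "'r ring \<Rightarrow> (nat \<Rightarrow> ('r, 'p) module) \<Rightarrow> (nat \<Rightarrow> 'p \<Rightarrow> 'p) \<Rightarrow> ('r, 'n) module \<Rightarrow> nat \<Rightarrow>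
   (('p \<times> 'n) \<Rightarrow>\<^sub>0 int) set set monoid" where
  "Tor_group R P \<delta> N i =
     (tensor_group R (P i) N)
       \<lparr>carrier := (case i of 0 \<Rightarrow> carrier (tensor_group R (P 0) N)
          | Suc j \<Rightarrow> kernel (tensor_group R (P i) N) (tensor_group R (P j) N)
                       (tensor_map R (P j) N (\<delta> j) id))\<rparr>
     Mod (tensor_map R (P i) N (\<delta> i) id ` carrier (tensor_group R (P (Suc i)) N))"

definition Tor_zero :: "'r ring \<Rightarrow> ('r, 'u) module \<Rightarrow> ('r, 'n) module \<Rightarrow> nat \<Rightarrow> bool" where
  "Tor_zero R U N i \<longleftrightarrow>
     (\<forall>(P :: nat \<Rightarrow> ('r, 'u + 'r + nat \<Rightarrow> 'r) module) \<delta> \<epsilon>.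
        projective_resolution (op_ring R) U P \<delta> \<epsilon> \<longrightarrow> trivial_group (Tor_group R P \<delta> N i))"


section \<open>Relative injectivity and flatness\<close>

definition nd_injective :: "'s ring \<Rightarrow> enat \<Rightarrow> nat \<Rightarrow> ('s, 'm) module \<Rightarrow> bool" where
  "nd_injective S n d M \<longleftrightarrow> lmodule S M \<and>
     (\<forall>U :: ('s, nat \<Rightarrow> 's) module. fin_n_presented S n U \<longrightarrow> Ext_zero S U M (d + 1))"

definition nd_flat :: "'r ring \<Rightarrow> enat \<Rightarrow> nat \<Rightarrow> ('r, 'm) module \<Rightarrow> bool" where
  "nd_flat R n d N \<longleftrightarrow> lmodule R N \<and>
     (\<forall>U :: ('r, nat \<Rightarrow> 'r) module. fin_n_presented (op_ring R) n U \<longrightarrow> Tor_zero R U N (d + 1))"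


section \<open>Bimodules\<close>

text \<open>The inherited scalar multiplication is the left action.\<close>

record ('s, 'r, 'k) bimod = "('s, 'k) module" +
  rsmult :: "'k \<Rightarrow> 'r \<Rightarrow> 'k"

definition left_mod :: "('s, 'r, 'k) bimod \<Rightarrow> ('s, 'k) module" where
  "left_mod K = module.truncate K"

definition right_mod :: "('s, 'r, 'k) bimod \<Rightarrow> ('r, 'k) module" where
  "right_mod K = \<lparr>carrier = carrier K, monoid.mult = monoid.mult K, monoid.one = monoid.one K, ring.zero = ring.zero K, ring.add = ring.add K,
     module.smult = (\<lambda>r x. rsmult K x r)\<rparr>"

definition bimodule :: "'s ring \<Rightarrow> 'r ring \<Rightarrow> ('s, 'r, 'k) bimod \<Rightarrow> bool" where
  "bimodule S R K \<longleftrightarrow>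
     lmodule S (left_mod K) \<and> lmodule (op_ring R) (right_mod K) \<and>
     (\<forall>s\<in>carrier S. \<forall>r\<in>carrier R. \<forall>x\<in>carrier K.
        rsmult K (s \<odot>\<^bsub>K\<^esub> x) r = s \<odot>\<^bsub>K\<^esub> rsmult K x r)"

definition bimodule_hom ::
  "'s ring \<Rightarrow> 'r ring \<Rightarrow> ('s, 'r, 'k) bimod \<Rightarrow> ('s, 'r, 'l) bimod \<Rightarrow> ('k \<Rightarrow> 'l) set" where
  "bimodule_hom S R K L =
     lmod_hom S (left_mod K) (left_mod L) \<inter> lmod_hom (op_ring R) (right_mod K) (right_mod L)"

text \<open>\<open>Hom\<^sub>S(K, I)\<close> as a left \<open>R\<close>-module, with \<open>(rf)(x) = f(xr)\<close>.\<close>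

definition Hom_module :: "'s ring \<Rightarrow> ('s, 'r, 'k) bimod \<Rightarrow> ('s, 'i) module \<Rightarrow> ('r, 'k \<Rightarrow> 'i) module" where
  "Hom_module S K I = \<lparr>
     carrier = carrier (hom_group S (left_mod K) I),
     monoid.mult = undefined, monoid.one = undefined,
     ring.zero = \<one>\<^bsub>hom_group S (left_mod K) I\<^esub>, ring.add = monoid.mult (hom_group S (left_mod K) I),
     module.smult = (\<lambda>r f. \<lambda>x\<in>carrier K. f (rsmult K x r))\<rparr>"

text \<open>\<open>K \<otimes>\<^sub>R F\<close> as a left \<open>S\<close>-module, with \<open>s(x \<otimes> y) = sx \<otimes> y\<close>.\<close>

definition tensor_module ::
  "'r ring \<Rightarrow> ('s, 'r, 'k) bimod \<Rightarrow> ('r, 'f) module \<Rightarrow> ('s, (('k \<times> 'f) \<Rightarrow>\<^sub>0 int) set) module" where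
  "tensor_module R K F = \<lparr>
     carrier = carrier (tensor_group R (right_mod K) F),
     monoid.mult = undefined, monoid.one = undefined,
     ring.zero = \<one>\<^bsub>tensor_group R (right_mod K) F\<^esub>, ring.add = monoid.mult (tensor_group R (right_mod K) F),
     module.smult = (\<lambda>s. tensor_map R (right_mod K) F (\<lambda>x. s \<odot>\<^bsub>K\<^esub> x) id)\<rparr>"

text \<open>The homothety maps are \<open>s \<mapsto> (x \<mapsto> sx)\<close> and \<open>r \<mapsto> (x \<mapsto> xr)\<close>. They are compatible with all the
  structure in sight for every bimodule, so being an isomorphism amounts to being a bijection.\<close>

definition semidualizing :: "'s ring \<Rightarrow> 'r ring \<Rightarrow> ('s, 'r, 'k) bimod \<Rightarrow> bool" where
  "semidualizing S R K \<longleftrightarrow>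
     bimodule S R K \<and>
     has_fg_projective_resolution S (left_mod K) \<and>
     has_fg_projective_resolution (op_ring R) (right_mod K) \<and>
     bij_betw (\<lambda>s. \<lambda>x\<in>carrier K. s \<odot>\<^bsub>K\<^esub> x) (carrier S)
       (carrier (hom_group (op_ring R) (right_mod K) (right_mod K))) \<and>
     bij_betw (\<lambda>r. \<lambda>x\<in>carrier K. rsmult K x r) (carrier R)
       (carrier (hom_group S (left_mod K) (left_mod K))) \<and>
     (\<forall>i\<ge>1. Ext_zero S (left_mod K) (left_mod K) i \<and>
             Ext_zero (op_ring R) (right_mod K) (right_mod K) i)"

text \<open>\<open>F\<close> exhibits \<open>C\<close> as a super finitely presented bimodule.\<close>

definition super_fp_bimodule_resolution ::
  "'s ring \<Rightarrow> 'r ring \<Rightarrow> ('s, 'r, 'c) bimod \<Rightarrow> (nat \<Rightarrow> ('s, 'r, 'k) bimod) \<Rightarrow>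
   (nat \<Rightarrow> 'k \<Rightarrow> 'k) \<Rightarrow> ('k \<Rightarrow> 'c) \<Rightarrow> bool" where
  "super_fp_bimodule_resolution S R C F \<delta> \<epsilon> \<longleftrightarrow>
     bimodule S R C \<and>
     (\<forall>i. bimodule S R (F i) \<and> fg_free S (left_mod (F i)) \<and> fg_free (op_ring R) (right_mod (F i))) \<and>
     \<epsilon> \<in> bimodule_hom S R (F 0) C \<and> (\<forall>i. \<delta> i \<in> bimodule_hom S R (F (Suc i)) (F i)) \<and>
     exact_augmented \<infinity> C F \<delta> \<epsilon>"

text \<open>The \<open>i\<close>th syzygy \<open>K\<^sub>i = Ker(F\<^sub>i \<rightarrow> F\<^bsub>i-1\<^esub>)\<close>, with \<open>F\<^bsub>-1\<^esub> = C\<close>.\<close>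

definition syzygy ::
  "('s, 'r, 'c) bimod \<Rightarrow> (nat \<Rightarrow> ('s, 'r, 'k) bimod) \<Rightarrow> (nat \<Rightarrow> 'k \<Rightarrow> 'k) \<Rightarrow> ('k \<Rightarrow> 'c) \<Rightarrow> nat \<Rightarrow>
   ('s, 'r, 'k) bimod" where
  "syzygy C F \<delta> \<epsilon> i = (F i)\<lparr>carrier :=
     (case i of 0 \<Rightarrow> a_kernel (F 0) C \<epsilon> | Suc j \<Rightarrow> a_kernel (F (Suc j)) (F j) (\<delta> j))\<rparr>"

definition special_semidualizing ::
  "'s ring \<Rightarrow> 'r ring \<Rightarrow> ('s, 'r, 'c) bimod \<Rightarrow> (nat \<Rightarrow> ('s, 'r, 'k) bimod) \<Rightarrow>
   (nat \<Rightarrow> 'k \<Rightarrow> 'k) \<Rightarrow> ('k \<Rightarrow> 'c) \<Rightarrow> nat \<Rightarrow> ('s, 'r, 'k) bimod \<Rightarrow> bool" where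
  "special_semidualizing S R C F \<delta> \<epsilon> d K \<longleftrightarrow>
     super_fp_bimodule_resolution S R C F \<delta> \<epsilon> \<and> 1 \<le> d \<and>
     K = syzygy C F \<delta> \<epsilon> (d - 1) \<and> semidualizing S R K"


section \<open>The classes of modules attached to a bimodule\<close>

text \<open>The type of the elements of the module \<open>I\<close> (resp. \<open>F\<close>) witnessing membership cannot be
  quantified inside a definition and is an explicit parameter. A theorem whose hypotheses mention the
  class at a type variable covers witnesses of every type. In a conclusion, the types of
  \<open>K \<otimes>\<^sub>R M\<close> for \<open>in_IK\<close> and of \<open>Hom\<^sub>S(K, M)\<close> for \<open>in_FK\<close> are the natural choice, because for the bimodules
  considered here the evaluation \<open>K \<otimes>\<^sub>R Hom\<^sub>S(K, I) \<rightarrow> I\<close> and the coevaluation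
  \<open>F \<rightarrow> Hom\<^sub>S(K, K \<otimes>\<^sub>R F)\<close> are isomorphisms.\<close>

definition in_IK ::
  "'i itself \<Rightarrow> 's ring \<Rightarrow> 'r ring \<Rightarrow> ('s, 'r, 'k) bimod \<Rightarrow> enat \<Rightarrow> nat \<Rightarrow> ('r, 'm) module \<Rightarrow> bool" where
  "in_IK _ S R K n d M \<longleftrightarrow> lmodule R M \<and>
     (\<exists>I :: ('s, 'i) module. nd_injective S n d I \<and> lmod_iso R (Hom_module S K I) M)"

definition in_FK ::
  "'f itself \<Rightarrow> 's ring \<Rightarrow> 'r ring \<Rightarrow> ('s, 'r, 'k) bimod \<Rightarrow> enat \<Rightarrow> nat \<Rightarrow> ('s, 'm) module \<Rightarrow> bool" where
  "in_FK _ S R K n d M \<longleftrightarrow> lmodule S M \<and>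
     (\<exists>F :: ('r, 'f) module. nd_flat R n d F \<and> lmod_iso S (tensor_module R K F) M)"


section \<open>Existence of projective resolutions\<close>

text \<open>The types over which \<open>Ext_zero\<close> and \<open>Tor_zero\<close> quantify do contain projective resolutions.\<close>

lemma (in lmodule) smult_zero_left: "x \<in> carrier M \<Longrightarrow> \<zero>\<^bsub>R\<^esub> \<odot>\<^bsub>M\<^esub> x = \<zero>\<^bsub>M\<^esub>"
  by (metis M.add.r_cancel_one' R.zero_closed R.l_zero smult_closed smult_l_distr)

lemma (in lmodule) smult_zero_right: "a \<in> carrier R \<Longrightarrow> a \<odot>\<^bsub>M\<^esub> \<zero>\<^bsub>M\<^esub> = \<zero>\<^bsub>M\<^esub>"
  by (metis M.add.r_cancel_one' M.zero_closed M.l_zero smult_closed smult_r_distr)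

lemma (in lmodule) smult_minus_right:
  assumes "a \<in> carrier R" "x \<in> carrier M"
  shows "a \<odot>\<^bsub>M\<^esub> (\<ominus>\<^bsub>M\<^esub> x) = \<ominus>\<^bsub>M\<^esub> (a \<odot>\<^bsub>M\<^esub> x)"
proof -
  have "a \<odot>\<^bsub>M\<^esub> (\<ominus>\<^bsub>M\<^esub> x) \<oplus>\<^bsub>M\<^esub> a \<odot>\<^bsub>M\<^esub> x = a \<odot>\<^bsub>M\<^esub> ((\<ominus>\<^bsub>M\<^esub> x) \<oplus>\<^bsub>M\<^esub> x)"
    using assms by (simp add: smult_r_distr)
  also have "\<dots> = \<zero>\<^bsub>M\<^esub>" using assms by (simp add: M.l_neg smult_zero_right)
  finally show ?thesis using assms
    by (metis M.a_inv_closed M.minus_equality smult_closed)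
qed

lemma lmod_hom_zero:
  assumes "lmodule T M" "lmodule T N" "f \<in> lmod_hom T M N"
  shows "f \<zero>\<^bsub>M\<^esub> = \<zero>\<^bsub>N\<^esub>"
proof -
  interpret M: lmodule T M by fact
  interpret N: lmodule T N by fact
  have z: "f \<zero>\<^bsub>M\<^esub> \<in> carrier N" using assms(3) by (auto simp: lmod_hom_def)
  have "f (\<zero>\<^bsub>M\<^esub> \<oplus>\<^bsub>M\<^esub> \<zero>\<^bsub>M\<^esub>) = f \<zero>\<^bsub>M\<^esub> \<oplus>\<^bsub>N\<^esub> f \<zero>\<^bsub>M\<^esub>" using assms(3) M.M.zero_closed unfolding lmod_hom_def by blast
  then show ?thesis using z by (metis M.M.l_zero M.M.zero_closed N.M.add.r_cancel_one')
qed

lemma lmodule_a_kernel: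
  assumes M: "lmodule T M" and N: "lmodule T N" and f: "f \<in> lmod_hom T M N"
  shows "lmodule T (M\<lparr>carrier := a_kernel M N f\<rparr>)"
proof -
  interpret M: lmodule T M by fact
  interpret N: lmodule T N by fact
  note f0 = lmod_hom_zero[OF M N f]
  have add: "f (x \<oplus>\<^bsub>M\<^esub> y) = f x \<oplus>\<^bsub>N\<^esub> f y" if "x \<in> carrier M" "y \<in> carrier M" for x y
    using f that by (simp add: lmod_hom_def)
  have sm: "f (a \<odot>\<^bsub>M\<^esub> y) = a \<odot>\<^bsub>N\<^esub> f y" if "a \<in> carrier T" "y \<in> carrier M" for a y
    using f that by (simp add: lmod_hom_def)
  have neg: "f (\<ominus>\<^bsub>M\<^esub> x) = \<zero>\<^bsub>N\<^esub>" if "x \<in> carrier M" "f x = \<zero>\<^bsub>N\<^esub>" for x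
  proof -
    have "f (\<ominus>\<^bsub>M\<^esub> x) \<in> carrier N" using f that by (auto simp: lmod_hom_def)
    moreover have "f (\<ominus>\<^bsub>M\<^esub> x \<oplus>\<^bsub>M\<^esub> x) = f (\<ominus>\<^bsub>M\<^esub> x) \<oplus>\<^bsub>N\<^esub> f x" using that by (intro add) auto
    ultimately show ?thesis using that f0 by (simp add: M.M.l_neg)
  qed
  show ?thesis
  proof (intro lmodule.intro lmodule_axioms.intro M.R.ring_axioms abelian_groupI)
    fix x assume "x \<in> carrier (M\<lparr>carrier := a_kernel M N f\<rparr>)"
    then show "\<exists>y\<in>carrier (M\<lparr>carrier := a_kernel M N f\<rparr>).
        y \<oplus>\<^bsub>M\<lparr>carrier := a_kernel M N f\<rparr>\<^esub> x = \<zero>\<^bsub>M\<lparr>carrier := a_kernel M N f\<rparr>\<^esub>"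
      by (intro bexI[of _ "\<ominus>\<^bsub>M\<^esub> x"]) (auto simp: a_kernel_def' neg M.M.l_neg)
  qed (auto simp: a_kernel_def' add sm f0 N.smult_zero_right M.M.a_ac
        M.smult_l_distr M.smult_r_distr M.smult_assoc1)
qed

lemma free_module_simps:
  "carrier (free_module T X) = {f. (\<forall>x\<in>X. f x \<in> carrier T) \<and> (\<forall>x. x \<notin> X \<longrightarrow> f x = \<zero>\<^bsub>T\<^esub>) \<and> finite {x. f x \<noteq> \<zero>\<^bsub>T\<^esub>}}"
  "\<zero>\<^bsub>free_module T X\<^esub> = (\<lambda>x. \<zero>\<^bsub>T\<^esub>)"
  "f \<oplus>\<^bsub>free_module T X\<^esub> g = (\<lambda>x. f x \<oplus>\<^bsub>T\<^esub> g x)"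
  "a \<odot>\<^bsub>free_module T X\<^esub> f = (\<lambda>x. a \<otimes>\<^bsub>T\<^esub> f x)"
  by (simp_all add: free_module_def)

lemma lmodule_free_module:
  assumes "ring T" shows "lmodule T (free_module T X)"
proof -
  interpret ring T by fact
  have c: "f x \<in> carrier T" if "f \<in> carrier (free_module T X)" for f x
    using that by (cases "x \<in> X") (auto simp: free_module_simps)
  have add: "(\<lambda>x. f x \<oplus>\<^bsub>T\<^esub> g x) \<in> carrier (free_module T X)"
    if "f \<in> carrier (free_module T X)" "g \<in> carrier (free_module T X)" for f g
    using that
    by (auto simp: free_module_simps
        intro: rev_finite_subset[of "{x. f x \<noteq> \<zero>\<^bsub>T\<^esub>} \<union> {x. g x \<noteq> \<zero>\<^bsub>T\<^esub>}"])
  have sm: "(\<lambda>x. a \<otimes>\<^bsub>T\<^esub> f x) \<in> carrier (free_module T X)"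
    if "f \<in> carrier (free_module T X)" "a \<in> carrier T" for f a
    using that
    by (auto simp: free_module_simps intro: rev_finite_subset[of "{x. f x \<noteq> \<zero>\<^bsub>T\<^esub>}"])
  have neg: "(\<lambda>x. \<ominus>\<^bsub>T\<^esub> f x) \<in> carrier (free_module T X)"
    if "f \<in> carrier (free_module T X)" for f
    using that
    by (auto simp: free_module_simps intro: rev_finite_subset[of "{x. f x \<noteq> \<zero>\<^bsub>T\<^esub>}"])
  have z: "(\<lambda>x. \<zero>\<^bsub>T\<^esub>) \<in> carrier (free_module T X)" by (simp add: free_module_simps)
  show ?thesis
  proof (intro lmodule.intro lmodule_axioms.intro abelian_groupI)
    fix f assume f: "f \<in> carrier (free_module T X)"
    show "\<exists>y\<in>carrier (free_module T X). y \<oplus>\<^bsub>free_module T X\<^esub> f = \<zero>\<^bsub>free_module T X\<^esub>"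
      by (rule bexI[OF _ neg[OF f]]) (simp add: free_module_simps(2,3) l_neg c[OF f])
  qed (auto simp: free_module_simps(2-4) add sm z c a_ac l_distr r_distr m_assoc
      intro: ring_axioms)
qed

definition lin_ext :: "'t ring \<Rightarrow> 'x set \<Rightarrow> ('t, 'm) module \<Rightarrow> ('x \<Rightarrow> 'm) \<Rightarrow> ('x \<Rightarrow> 't) \<Rightarrow> 'm" where
  "lin_ext T X M \<phi> f = (\<Oplus>\<^bsub>M\<^esub>x\<in>{x. f x \<noteq> \<zero>\<^bsub>T\<^esub>}. f x \<odot>\<^bsub>M\<^esub> \<phi> x)"

lemma lin_ext_superset:
  assumes M: "lmodule T M" and \<phi>: "\<phi> \<in> X \<rightarrow> carrier M" and f: "f \<in> carrier (free_module T X)"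
    and A: "finite A" "{x. f x \<noteq> \<zero>\<^bsub>T\<^esub>} \<subseteq> A" "A \<subseteq> X"
  shows "lin_ext T X M \<phi> f = (\<Oplus>\<^bsub>M\<^esub>x\<in>A. f x \<odot>\<^bsub>M\<^esub> \<phi> x)"
proof -
  interpret lmodule T M by fact
  show ?thesis unfolding lin_ext_def
    using assms by (intro M.add.finprod_mono_neutral_cong_left)
      (auto simp: free_module_simps Pi_def intro!: smult_zero_left smult_closed)
qed

lemma lin_ext_hom:
  assumes M: "lmodule T M" and \<phi>: "\<phi> \<in> X \<rightarrow> carrier M"
  shows "lin_ext T X M \<phi> \<in> lmod_hom T (free_module T X) M"
proof -
  interpret lmodule T M by fact
  interpret F: lmodule T "free_module T X" by (rule lmodule_free_module) (rule R.ring_axioms)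
  let ?F = "free_module T X"
  have supp: "finite {x. f x \<noteq> \<zero>\<^bsub>T\<^esub>}" "{x. f x \<noteq> \<zero>\<^bsub>T\<^esub>} \<subseteq> X" if "f \<in> carrier ?F" for f
    using that by (auto simp: free_module_simps)
  have c: "f x \<odot>\<^bsub>M\<^esub> \<phi> x \<in> carrier M" if "f \<in> carrier ?F" "x \<in> X" for f x
    using that \<phi> by (auto simp: free_module_simps)
  show ?thesis
    unfolding lmod_hom_def
  proof (intro CollectI conjI ballI funcsetI)
    fix f assume f: "f \<in> carrier ?F"
    show "lin_ext T X M \<phi> f \<in> carrier M" unfolding lin_ext_def
      using supp[OF f] c[OF f] by (intro M.finsum_closed) auto
    {
      fix g assume g: "g \<in> carrier ?F"
      let ?A = "{x. f x \<noteq> \<zero>\<^bsub>T\<^esub>} \<union> {x. g x \<noteq> \<zero>\<^bsub>T\<^esub>}"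
      have A: "finite ?A" "?A \<subseteq> X" using supp[OF f] supp[OF g] by auto
      have fg: "f \<oplus>\<^bsub>?F\<^esub> g \<in> carrier ?F" using f g by (rule F.M.a_closed)
      have s: "{x. (f \<oplus>\<^bsub>?F\<^esub> g) x \<noteq> \<zero>\<^bsub>T\<^esub>} \<subseteq> ?A" by (auto simp: free_module_simps)
      have "lin_ext T X M \<phi> (f \<oplus>\<^bsub>?F\<^esub> g) = (\<Oplus>\<^bsub>M\<^esub>x\<in>?A. f x \<odot>\<^bsub>M\<^esub> \<phi> x \<oplus>\<^bsub>M\<^esub> g x \<odot>\<^bsub>M\<^esub> \<phi> x)"
        unfolding lin_ext_superset[OF M \<phi> fg A(1) s A(2)]
      proof (rule M.finsum_cong'[OF refl])
        show "(\<lambda>x. f x \<odot>\<^bsub>M\<^esub> \<phi> x \<oplus>\<^bsub>M\<^esub> g x \<odot>\<^bsub>M\<^esub> \<phi> x) \<in> ?A \<rightarrow> carrier M"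
          using A c[OF f] c[OF g] by (intro funcsetI M.a_closed) blast+
        fix i assume "i \<in> ?A"
        then have "i \<in> X" using A by blast
        then show "(f \<oplus>\<^bsub>?F\<^esub> g) i \<odot>\<^bsub>M\<^esub> \<phi> i = f i \<odot>\<^bsub>M\<^esub> \<phi> i \<oplus>\<^bsub>M\<^esub> g i \<odot>\<^bsub>M\<^esub> \<phi> i"
          using f g \<phi> by (auto simp: free_module_simps intro!: smult_l_distr)
      qed
      also have "\<dots> = lin_ext T X M \<phi> f \<oplus>\<^bsub>M\<^esub> lin_ext T X M \<phi> g"
        using A c[OF f] c[OF g] unfolding lin_ext_superset[OF M \<phi> f A(1) Un_upper1 A(2)] lin_ext_superset[OF M \<phi> g A(1) Un_upper2 A(2)]
        by (intro M.finsum_addf funcsetI) blast+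
      finally show "lin_ext T X M \<phi> (f \<oplus>\<^bsub>?F\<^esub> g) = lin_ext T X M \<phi> f \<oplus>\<^bsub>M\<^esub> lin_ext T X M \<phi> g" .
    }
  next
    fix a f assume a: "a \<in> carrier T" and f: "f \<in> carrier ?F"
    let ?A = "{x. f x \<noteq> \<zero>\<^bsub>T\<^esub>}"
    have A: "finite ?A" "?A \<subseteq> X" using supp[OF f] by auto
    have af: "a \<odot>\<^bsub>?F\<^esub> f \<in> carrier ?F" using a f by (rule F.smult_closed)
    have s: "{x. (a \<odot>\<^bsub>?F\<^esub> f) x \<noteq> \<zero>\<^bsub>T\<^esub>} \<subseteq> ?A" using a by (auto simp: free_module_simps)
    have sd: "a \<odot>\<^bsub>M\<^esub> (\<Oplus>\<^bsub>M\<^esub>x\<in>B. h x) = (\<Oplus>\<^bsub>M\<^esub>x\<in>B. a \<odot>\<^bsub>M\<^esub> h x)"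
      if "finite B" "h \<in> B \<rightarrow> carrier M" for B :: "'c set" and h
      using that by (induction B) (auto simp: a smult_zero_right smult_r_distr M.finsum_closed Pi_def)
    have "lin_ext T X M \<phi> (a \<odot>\<^bsub>?F\<^esub> f) = (\<Oplus>\<^bsub>M\<^esub>x\<in>?A. a \<odot>\<^bsub>M\<^esub> (f x \<odot>\<^bsub>M\<^esub> \<phi> x))"
      unfolding lin_ext_superset[OF M \<phi> af A(1) s A(2)]
    proof (rule M.finsum_cong'[OF refl])
      show "(\<lambda>x. a \<odot>\<^bsub>M\<^esub> (f x \<odot>\<^bsub>M\<^esub> \<phi> x)) \<in> ?A \<rightarrow> carrier M"
      proof (rule funcsetI)
        fix i assume "i \<in> ?A"
        then have "i \<in> X" using A by blast
        then show "a \<odot>\<^bsub>M\<^esub> (f i \<odot>\<^bsub>M\<^esub> \<phi> i) \<in> carrier M" by (intro smult_closed[OF a] c[OF f])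
      qed
      fix i assume "i \<in> ?A"
      then have "i \<in> X" using A by blast
      then show "(a \<odot>\<^bsub>?F\<^esub> f) i \<odot>\<^bsub>M\<^esub> \<phi> i = a \<odot>\<^bsub>M\<^esub> (f i \<odot>\<^bsub>M\<^esub> \<phi> i)"
        using f a \<phi> by (auto simp: free_module_simps intro!: smult_assoc1)
    qed
    also have "\<dots> = a \<odot>\<^bsub>M\<^esub> lin_ext T X M \<phi> f"
      unfolding lin_ext_def using A c[OF f] by (subst sd) auto
    finally show "lin_ext T X M \<phi> (a \<odot>\<^bsub>?F\<^esub> f) = a \<odot>\<^bsub>M\<^esub> lin_ext T X M \<phi> f" .
  qed
qed

definition unit_vec :: "'t ring \<Rightarrow> 'x \<Rightarrow> 'x \<Rightarrow> 't" where
  "unit_vec T x = (\<lambda>y. if y = x then \<one>\<^bsub>T\<^esub> else \<zero>\<^bsub>T\<^esub>)"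

lemma unit_vec_carrier: "ring T \<Longrightarrow> x \<in> X \<Longrightarrow> unit_vec T x \<in> carrier (free_module T X)"
  using finite_subset[of "{y. unit_vec T x y \<noteq> \<zero>\<^bsub>T\<^esub>}" "{x}"]
  by (auto simp: free_module_simps unit_vec_def ring.ring_simprules)

lemma lin_ext_unit_vec:
  assumes M: "lmodule T M" and \<phi>: "\<phi> \<in> X \<rightarrow> carrier M" and x: "x \<in> X"
  shows "lin_ext T X M \<phi> (unit_vec T x) = \<phi> x"
proof -
  interpret lmodule T M by fact
  have "lin_ext T X M \<phi> (unit_vec T x) = (\<Oplus>\<^bsub>M\<^esub>y\<in>{x}. unit_vec T x y \<odot>\<^bsub>M\<^esub> \<phi> y)"
    using x by (intro lin_ext_superset[OF M \<phi>] unit_vec_carrier R.ring_axioms) (auto simp: unit_vec_def)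
  then show ?thesis using x \<phi> by (auto simp: unit_vec_def Pi_def)
qed

lemma hom_eq_on_basis:
  assumes M: "lmodule T M"
    and f: "f \<in> lmod_hom T (free_module T X) M" and g: "g \<in> lmod_hom T (free_module T X) M"
    and eq: "\<And>x. x \<in> X \<Longrightarrow> f (unit_vec T x) = g (unit_vec T x)"
    and v: "v \<in> carrier (free_module T X)"
  shows "f v = g v"
proof -
  interpret lmodule T M by fact
  interpret F: lmodule T "free_module T X" by (rule lmodule_free_module) (rule R.ring_axioms)
  let ?F = "free_module T X"
  have "finite A \<Longrightarrow> v \<in> carrier ?F \<Longrightarrow> {x. v x \<noteq> \<zero>\<^bsub>T\<^esub>} \<subseteq> A \<Longrightarrow> f v = g v" for A v
  proof (induction A arbitrary: v rule: finite_induct)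
    case empty
    then have "v = \<zero>\<^bsub>?F\<^esub>" by (auto simp: free_module_simps)
    then show ?case
      using lmod_hom_zero[OF F.lmodule_axioms M f] lmod_hom_zero[OF F.lmodule_axioms M g] by simp
  next
    case (insert x A)
    show ?case
    proof (cases "x \<in> X")
      case False
      then have "v x = \<zero>\<^bsub>T\<^esub>" using insert.prems by (auto simp: free_module_simps)
      then show ?thesis using insert by auto
    next
      case True
      define w where "w = v(x := \<zero>\<^bsub>T\<^esub>)"
      have w: "w \<in> carrier ?F"
        using insert.prems
        by (auto simp: w_def free_module_simps intro: rev_finite_subset[of "{y. v y \<noteq> \<zero>\<^bsub>T\<^esub>}"])
      have fw: "f w = g w" using insert.prems by (intro insert.IH[OF w]) (auto simp: w_def)
      note u = unit_vec_carrier[OF R.ring_axioms True]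
      have vx: "v x \<in> carrier T" using insert.prems True by (auto simp: free_module_simps)
      have veq: "v = v x \<odot>\<^bsub>?F\<^esub> unit_vec T x \<oplus>\<^bsub>?F\<^esub> w"
      proof
        fix y
        have "v y \<in> carrier T" using insert.prems by (cases "y \<in> X") (auto simp: free_module_simps)
        then show "v y = (v x \<odot>\<^bsub>?F\<^esub> unit_vec T x \<oplus>\<^bsub>?F\<^esub> w) y"
          using vx by (simp add: w_def free_module_simps unit_vec_def)
      qed
      have s: "v x \<odot>\<^bsub>?F\<^esub> unit_vec T x \<in> carrier ?F" using vx u by (rule F.smult_closed)
      have "f v = v x \<odot>\<^bsub>M\<^esub> f (unit_vec T x) \<oplus>\<^bsub>M\<^esub> f w"
        apply (subst veq) using f s w vx u by (simp add: lmod_hom_def)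
      moreover have "g v = v x \<odot>\<^bsub>M\<^esub> g (unit_vec T x) \<oplus>\<^bsub>M\<^esub> g w"
        apply (subst veq) using g s w vx u by (simp add: lmod_hom_def)
      ultimately show ?thesis using fw eq[OF True] by simp
    qed
  qed
  from this[of "{x. v x \<noteq> \<zero>\<^bsub>T\<^esub>}" v] v show ?thesis by (auto simp: free_module_simps)
qed

lemma projective_free_module:
  assumes T: "ring T" shows "projective T (free_module T X)"
  unfolding projective_def
proof (intro conjI allI impI lmodule_free_module T)
  fix A :: "('a, ('b \<Rightarrow> 'a) \<Rightarrow> 'a) module" and B :: "('a, 'b \<Rightarrow> 'a) module" and g f
  assume a: "lmodule T A \<and> lmodule T B \<and> g \<in> lmod_hom T A B \<and> g ` carrier A = carrier B \<and>
    f \<in> lmod_hom T (free_module T X) B"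
  define \<phi> where "\<phi> x = (SOME a. a \<in> carrier A \<and> g a = f (unit_vec T x))" for x
  have \<phi>: "\<phi> x \<in> carrier A \<and> g (\<phi> x) = f (unit_vec T x)" if "x \<in> X" for x
  proof -
    have "f (unit_vec T x) \<in> carrier B"
      using a unit_vec_carrier[OF T that] by (auto simp: lmod_hom_def)
    then have "f (unit_vec T x) \<in> g ` carrier A" using a by simp
    then obtain b where "f (unit_vec T x) = g b" "b \<in> carrier A" by (rule imageE)
    then have "b \<in> carrier A \<and> g b = f (unit_vec T x)" by simp
    then show ?thesis unfolding \<phi>_def by (rule someI[where P = "\<lambda>b. b \<in> carrier A \<and> g b = f (unit_vec T x)"])
  qed
  let ?h = "lin_ext T X A \<phi>"
  have h: "?h \<in> lmod_hom T (free_module T X) A" using \<phi> a by (intro lin_ext_hom) auto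
  have gh: "(\<lambda>v. g (?h v)) \<in> lmod_hom T (free_module T X) B"
    using h a by (auto simp: lmod_hom_def Pi_def)
  have "g (?h v) = f v" if "v \<in> carrier (free_module T X)" for v
  proof (rule hom_eq_on_basis[of T B "\<lambda>v. g (?h v)" X f])
    fix x assume x: "x \<in> X"
    have "?h (unit_vec T x) = \<phi> x" using a \<phi> x by (intro lin_ext_unit_vec) simp_all
    then show "g (?h (unit_vec T x)) = f (unit_vec T x)" using \<phi>[OF x] by simp
  qed (use a gh that in simp_all)
  then show "\<exists>h\<in>lmod_hom T (free_module T X) A. \<forall>x\<in>carrier (free_module T X). g (h x) = f x"
    using h by blast
qed

lemma free_module_card:
  assumes "inj (i :: 't \<Rightarrow> 'x)" "inj (j :: nat \<Rightarrow> 'x)"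
  shows "\<exists>c. inj_on (c :: ('x \<Rightarrow> 't) \<Rightarrow> 'x) (carrier (free_module T X))"
proof -
  have inf: "infinite (UNIV :: 'x set)" using assms(2)
    by (metis infinite_UNIV_nat finite_imageD finite_subset subset_UNIV)
  let ?F = "carrier (free_module T X)"
  let ?e = "\<lambda>f :: 'x \<Rightarrow> 't. (\<lambda>x. (x, i (f x))) ` {x. f x \<noteq> \<zero>\<^bsub>T\<^esub>}"
  have mem: "(x, i (f x)) \<in> ?e f \<longleftrightarrow> f x \<noteq> \<zero>\<^bsub>T\<^esub>" for f :: "'x \<Rightarrow> 't" and x by auto
  have "inj_on ?e ?F"
  proof (rule inj_onI, rule ext)
    fix f g :: "'x \<Rightarrow> 't" and x assume eq: "?e f = ?e g"
    show "f x = g x"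
    proof (cases "f x = \<zero>\<^bsub>T\<^esub>")
      case True
      then have "\<And>y. (x, y) \<notin> ?e f" by auto
      then have "(x, i (g x)) \<notin> ?e g" using eq by simp
      then show ?thesis using True by (simp only: mem) simp
    next
      case False
      then have "(x, i (f x)) \<in> ?e g" using eq by auto
      then show ?thesis using assms(1) by (auto dest: injD)
    qed
  qed
  then have "|?F| \<le>o |Fpow (UNIV :: ('x \<times> 'x) set)|"
    by (intro card_of_ordLeqI[of ?e]) (auto simp: Fpow_def free_module_simps)
  also have "|Fpow (UNIV :: ('x \<times> 'x) set)| =o |UNIV :: ('x \<times> 'x) set|"
    using inf by (intro card_of_Fpow_infinite) (simp add: finite_prod)
  also have "|UNIV :: ('x \<times> 'x) set| =o |UNIV :: 'x set|"
    using card_of_Times_same_infinite[OF inf] by simp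
  finally show ?thesis
    by (metis card_of_ordLeq)
qed

lemma free_cover:
  assumes V: "lmodule T V" and c: "inj_on (c :: 'v \<Rightarrow> 'x) (carrier V)"
  shows "\<exists>X \<epsilon>. \<epsilon> \<in> lmod_hom T (free_module T (X :: 'x set)) V \<and>
           \<epsilon> ` carrier (free_module T X) = carrier V"
proof -
  interpret lmodule T V by fact
  let ?X = "c ` carrier V" and ?\<phi> = "inv_into (carrier V) c"
  have \<phi>: "?\<phi> \<in> ?X \<rightarrow> carrier V" by (auto intro: inv_into_into)
  let ?\<epsilon> = "lin_ext T ?X V ?\<phi>"
  have h: "?\<epsilon> \<in> lmod_hom T (free_module T ?X) V" by (rule lin_ext_hom[OF V \<phi>])
  moreover have "v \<in> ?\<epsilon> ` carrier (free_module T ?X)" if "v \<in> carrier V" for v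
    using lin_ext_unit_vec[OF V \<phi>, of "c v"] unit_vec_carrier[OF R.ring_axioms, of "c v" ?X] that c
    by (metis image_eqI inv_into_f_f)
  ultimately show ?thesis
    by (intro exI[of _ ?X] exI[of _ ?\<epsilon>]) (auto simp: lmod_hom_def)
qed

lemma projective_resolution_exists:
  fixes U :: "('t, 'u) module"
  assumes U: "lmodule T U"
  shows "\<exists>(P :: nat \<Rightarrow> ('t, 'u + 't + nat \<Rightarrow> 't) module) \<delta> \<epsilon>. projective_resolution T U P \<delta> \<epsilon>"
proof -
  have T: "ring T" using U by (simp add: lmodule_def)
  let ?F = "\<lambda>X :: ('u + 't + nat) set. free_module T X"
  obtain X0 \<epsilon> where \<epsilon>: "\<epsilon> \<in> lmod_hom T (?F X0) U" "\<epsilon> ` carrier (?F X0) = carrier U"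
    using free_cover[OF U, of "Inl :: 'u \<Rightarrow> 'u + 't + nat"] by auto
  define invar where "invar = (\<lambda>(X, k). lmodule T (?F X\<lparr>carrier := k\<rparr>) \<and> k \<subseteq> carrier (?F X))"
  define step where "step = (\<lambda>(X, k) (X', k'). \<exists>\<delta>\<in>lmod_hom T (?F X') (?F X).
    \<delta> ` carrier (?F X') = k \<and> k' = a_kernel (?F X') (?F X) \<delta>)"
  note F = lmodule_free_module[OF T]
  have ker: "invar (X, a_kernel (?F X) V f)" if "f \<in> lmod_hom T (?F X) V" "lmodule T V"
    for X f and V :: "('t, 'v) module"
    using lmodule_a_kernel[OF F that(2,1)] by (auto simp: invar_def a_kernel_def')
  have next1: "\<exists>q'. invar q' \<and> step q q'" if q: "invar q" for q
  proof -
    obtain X k where [simp]: "q = (X, k)" by (cases q)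
    let ?K = "?F X\<lparr>carrier := k\<rparr>"
    have K: "lmodule T ?K" and k: "k \<subseteq> carrier (?F X)" using q by (auto simp: invar_def)
    obtain c :: "('u + 't + nat \<Rightarrow> 't) \<Rightarrow> 'u + 't + nat" where "inj_on c (carrier (?F X))"
      using free_module_card[of "\<lambda>t. Inr (Inl t)" "\<lambda>n. Inr (Inr n)" T X] by (auto simp: inj_def)
    then have "inj_on c (carrier ?K)" using k by (auto intro: inj_on_subset)
    from free_cover[OF K this] obtain X' \<delta>
      where \<delta>: "\<delta> \<in> lmod_hom T (?F X') ?K" "\<delta> ` carrier (?F X') = k" by auto
    then have \<delta>': "\<delta> \<in> lmod_hom T (?F X') (?F X)" using k by (auto simp: lmod_hom_def)
    with \<delta> show ?thesis using ker[OF \<delta>' F]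
      by (intro exI[of _ "(X', a_kernel (?F X') (?F X) \<delta>)"]) (auto simp: step_def)
  qed
  have "\<exists>q. \<forall>n::nat. (invar (q n) \<and> (n = 0 \<longrightarrow> q n = (X0, a_kernel (?F X0) U \<epsilon>))) \<and> step (q n) (q (Suc n))"
    using next1 ker[OF \<epsilon>(1) U] by (intro dependent_nat_choice) auto
  then obtain q where q0: "q 0 = (X0, a_kernel (?F X0) U \<epsilon>)" and st: "\<And>n. step (q n) (q (Suc n))" by blast
  define P where "P n = ?F (fst (q n))" for n
  have "\<forall>n. \<exists>\<delta>. \<delta> \<in> lmod_hom T (P (Suc n)) (P n) \<and> \<delta> ` carrier (P (Suc n)) = snd (q n) \<and>
      snd (q (Suc n)) = a_kernel (P (Suc n)) (P n) \<delta>"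
  proof
    fix n
    have "step (fst (q n), snd (q n)) (fst (q (Suc n)), snd (q (Suc n)))" using st[of n] by simp
    then show "\<exists>\<delta>. \<delta> \<in> lmod_hom T (P (Suc n)) (P n) \<and> \<delta> ` carrier (P (Suc n)) = snd (q n) \<and>
        snd (q (Suc n)) = a_kernel (P (Suc n)) (P n) \<delta>"
      unfolding step_def P_def prod.case by blast
  qed
  then obtain \<delta> where \<delta>: "\<And>n. \<delta> n \<in> lmod_hom T (P (Suc n)) (P n)"
    "\<And>n. \<delta> n ` carrier (P (Suc n)) = snd (q n)"
    "\<And>n. snd (q (Suc n)) = a_kernel (P (Suc n)) (P n) (\<delta> n)" by metis
  have "projective_resolution T U P \<delta> \<epsilon>"
    unfolding projective_resolution_def resolution_def exact_augmented_def
  proof (intro conjI allI impI U)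
    show "lmodule T (P i)" "projective T (P i)" for i
      unfolding P_def by (rule F, rule projective_free_module[OF T])
    show "\<epsilon> \<in> lmod_hom T (P 0) U" "\<epsilon> ` carrier (P 0) = carrier U"
      using \<epsilon> q0 by (simp_all add: P_def)
    show "\<delta> 0 ` carrier (P 1) = a_kernel (P 0) U \<epsilon>"
      using \<delta>(2)[of 0] q0 by (simp add: P_def)
  qed (simp_all only: \<delta>)
  then show ?thesis by blast
qed

end

theory Submission imports Defs Complex_Main begin

text \<open>Let \<open>K\<close> be the special semidualizing bimodule. A resolution of \<open>K\<close> over \<open>R\<^sup>o\<^sup>p\<close> by finitely generated free
  modules, to which \<open>Hom(-, K)\<close> is applied, gives an exact complex
  \<open>0 \<rightarrow> S \<rightarrow> K\<^bsup>m 0\<^esup> \<rightarrow> K\<^bsup>m 1\<^esup> \<rightarrow> \<dots>\<close> of super finitely presented left \<open>S\<close>-modules. If \<open>I\<close> is \<open>(n,d)\<close>-injective, then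
  \<open>Ext\<^sup>i(K, I) = 0\<close> for \<open>i \<ge> 1\<close>, because \<open>K\<close> is a \<open>d\<close>-th syzygy of a super finitely presented module, and
  shifting dimensions \<open>d\<close> times to the right along the complex gives \<open>Ext\<^sup>1 = 0\<close> for all its kernels. So
  the complex stays exact under \<open>Hom(-, I)\<close>. Since the tensor product with \<open>K\<close> is computed by the same matrices, this
  says that \<open>K \<otimes> Hom(K, I) \<cong> I\<close> and \<open>Tor\<^sub>1(K, Hom(K, I)) = 0\<close>. In (1) the sequence
  \<open>0 \<rightarrow> K \<otimes> M \<rightarrow> K \<otimes> N \<rightarrow> K \<otimes> L \<rightarrow> 0\<close> is therefore exact with \<open>(n,d)\<close>-injective ends, hence an injective middle,
  and \<open>N \<cong> Hom(K, K \<otimes> N)\<close> by a diagram chase.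

  Part (2) is dual. Let \<open>X\<^sup>+\<close> be the group of characters of \<open>X\<close> with values in the unit circle.
  Then \<open>F\<close> is \<open>(n,d)\<close>-flat if and only if \<open>F\<^sup>+\<close> is \<open>(n,d)\<close>-injective, and \<open>(K \<otimes> F)\<^sup>+ \<cong> Hom(K, F\<^sup>+)\<close>, so that (1) applies
  to \<open>0 \<rightarrow> L\<^sup>+ \<rightarrow> N\<^sup>+ \<rightarrow> M\<^sup>+ \<rightarrow> 0\<close> over the opposite rings. As \<open>K\<close> is finitely presented,
  \<open>K \<otimes> N\<^sup>+ \<cong> Hom(K, N)\<^sup>+\<close>; hence \<open>Hom(K, N)\<close> is \<open>(n,d)\<close>-flat, and the evaluation \<open>K \<otimes> Hom(K, N) \<rightarrow> N\<close> is bijective because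
  its dual is.\<close>

section \<open>Homomorphisms and submodules\<close>

text \<open>\<open>Ext_zero\<close> speaks of modules and resolutions at fixed types, and no
  definition can quantify over types. Vanishing of Ext is therefore recast in \<open>ext_van\<close>
  through iterated kernels of maps out of \<open>fpow T m\<close>: these kernels have element type
  \<open>nat \<Rightarrow> 't\<close> whatever the type of the resolved module, so that one can
  recurse on them. The same reason gives super finite presentation its coinductive form. The link
  back is that a super finitely presented module, copied to that type, is finitely
  \<open>n\<close>-presented for every \<open>n\<close>; hence \<open>(n,d)\<close>-injectivity can
  be tested on it, in degree \<open>d + 1\<close>, which is \<open>ext_van\<close> at
  \<open>d\<close>. The resolution of \<open>K\<close> as a right module is kept as matrices because
  the same matrix gives a map between powers of \<open>K\<close> by acting on rows
  (\<open>dmap\<close>) and a map between powers of \<open>N\<close> by acting on columns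
  (\<open>amap\<close>). For a module of the form \<open>Hom(K, I)\<close> the second is
  \<open>Hom(-, I)\<close> applied to the first. The circle serves as the target of characters
  because it has enough roots: characters extend, and they separate points.\<close>

lemma lmod_homI:
  assumes "\<And>x. x \<in> carrier M \<Longrightarrow> f x \<in> carrier N"
    and "\<And>x y. x \<in> carrier M \<Longrightarrow> y \<in> carrier M \<Longrightarrow> f (x \<oplus>\<^bsub>M\<^esub> y) = f x \<oplus>\<^bsub>N\<^esub> f y"
    and "\<And>a x. a \<in> carrier T \<Longrightarrow> x \<in> carrier M \<Longrightarrow> f (a \<odot>\<^bsub>M\<^esub> x) = a \<odot>\<^bsub>N\<^esub> f x"
  shows "f \<in> lmod_hom T M N"
  using assms by (auto simp: lmod_hom_def)

lemma lmod_hom_closed: "f \<in> lmod_hom T M N \<Longrightarrow> x \<in> carrier M \<Longrightarrow> f x \<in> carrier N"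
  by (auto simp: lmod_hom_def)

lemma lmod_hom_add:
  "f \<in> lmod_hom T M N \<Longrightarrow> x \<in> carrier M \<Longrightarrow> y \<in> carrier M \<Longrightarrow> f (x \<oplus>\<^bsub>M\<^esub> y) = f x \<oplus>\<^bsub>N\<^esub> f y"
  by (auto simp: lmod_hom_def)

lemma lmod_hom_smult:
  "f \<in> lmod_hom T M N \<Longrightarrow> a \<in> carrier T \<Longrightarrow> x \<in> carrier M \<Longrightarrow> f (a \<odot>\<^bsub>M\<^esub> x) = a \<odot>\<^bsub>N\<^esub> f x"
  by (auto simp: lmod_hom_def)

lemma lmod_hom_comp:
  assumes "f \<in> lmod_hom T M N" "g \<in> lmod_hom T N L" shows "(\<lambda>x. g (f x)) \<in> lmod_hom T M L"
  using assms by (auto simp: lmod_hom_def Pi_def)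

lemma lmod_hom_cong:
  assumes "f \<in> lmod_hom T M N" "lmodule T M" "\<And>x. x \<in> carrier M \<Longrightarrow> f x = g x"
  shows "g \<in> lmod_hom T M N"
proof -
  interpret lmodule T M by fact
  show ?thesis using assms(1) by (intro lmod_homI)
      (auto simp flip: assms(3) simp: lmod_hom_closed lmod_hom_add lmod_hom_smult)
qed

text \<open>\<open>N\<close> is only assumed to have operations that \<open>h\<close> respects;
  closure of these operations on its carrier is first transported along the bijection.\<close>

lemma lmod_hom_inv_into:
  assumes M: "lmodule T M" and h: "h \<in> lmod_hom T M N" and b: "bij_betw h (carrier M) (carrier N)"
  shows "inv_into (carrier M) h \<in> lmod_hom T N M"
proof -
  interpret M: lmodule T M by fact
  let ?k = "inv_into (carrier M) h"
  have k: "?k y \<in> carrier M" "h (?k y) = y" if "y \<in> carrier N" for y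
    using b that by (auto simp: bij_betw_def inv_into_into f_inv_into_f)
  have inj: "x = y" if "x \<in> carrier M" "y \<in> carrier M" "h x = h y" for x y
    using b that by (auto simp: bij_betw_def dest: inj_onD)
  have ac: "x \<oplus>\<^bsub>N\<^esub> y \<in> carrier N" if "x \<in> carrier N" "y \<in> carrier N" for x y
    using lmod_hom_add[OF h k(1)[OF that(1)] k(1)[OF that(2)]] k that
    by (metis M.M.a_closed lmod_hom_closed[OF h])
  have sc: "a \<odot>\<^bsub>N\<^esub> y \<in> carrier N" if "a \<in> carrier T" "y \<in> carrier N" for a y
    using lmod_hom_smult[OF h that(1) k(1)[OF that(2)]] k that
    by (metis M.smult_closed lmod_hom_closed[OF h])
  show ?thesis
    by (intro lmod_homI) (auto intro!: inj simp: k ac sc lmod_hom_add[OF h] lmod_hom_smult[OF h])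
qed

context lmodule
begin

text \<open>Expresses negation through scalars, so that anything closed under sums and scalar
  multiples is closed under differences.\<close>

lemma smult_neg_one: "x \<in> carrier M \<Longrightarrow> (\<ominus>\<^bsub>R\<^esub> \<one>\<^bsub>R\<^esub>) \<odot>\<^bsub>M\<^esub> x = \<ominus>\<^bsub>M\<^esub> x"
proof -
  assume x: "x \<in> carrier M"
  have "(\<ominus>\<^bsub>R\<^esub> \<one>\<^bsub>R\<^esub>) \<odot>\<^bsub>M\<^esub> x \<oplus>\<^bsub>M\<^esub> \<one>\<^bsub>R\<^esub> \<odot>\<^bsub>M\<^esub> x = (\<ominus>\<^bsub>R\<^esub> \<one>\<^bsub>R\<^esub> \<oplus>\<^bsub>R\<^esub> \<one>\<^bsub>R\<^esub>) \<odot>\<^bsub>M\<^esub> x"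
    using x by (intro smult_l_distr[symmetric]) auto
  also have "\<dots> = \<zero>\<^bsub>M\<^esub>" using x by (simp add: R.l_neg smult_zero_left)
  finally show ?thesis using x by (metis R.one_closed R.a_inv_closed smult_one smult_closed M.minus_equality)
qed

lemma minus_self: "x \<in> carrier M \<Longrightarrow> x \<ominus>\<^bsub>M\<^esub> x = \<zero>\<^bsub>M\<^esub>"
  by (simp add: a_minus_def M.r_neg)

lemma minus_eq_zero_iff: "x \<in> carrier M \<Longrightarrow> y \<in> carrier M \<Longrightarrow> x \<ominus>\<^bsub>M\<^esub> y = \<zero>\<^bsub>M\<^esub> \<longleftrightarrow> x = y"
  by (metis M.minus_eq M.a_inv_closed M.minus_equality M.minus_minus minus_self)

lemma minus_add_cancel: "x \<in> carrier M \<Longrightarrow> y \<in> carrier M \<Longrightarrow> (x \<ominus>\<^bsub>M\<^esub> y) \<oplus>\<^bsub>M\<^esub> y = x"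
  by (simp add: a_minus_def M.a_assoc M.l_neg)

lemma add_minus_cancel: "x \<in> carrier M \<Longrightarrow> y \<in> carrier M \<Longrightarrow> y \<oplus>\<^bsub>M\<^esub> (x \<ominus>\<^bsub>M\<^esub> y) = x"
  by (metis M.a_comm M.minus_closed minus_add_cancel)

lemma add_minus_cancel': "x \<in> carrier M \<Longrightarrow> y \<in> carrier M \<Longrightarrow> (y \<oplus>\<^bsub>M\<^esub> x) \<ominus>\<^bsub>M\<^esub> y = x"
  by (simp add: a_minus_def M.a_comm[of y x] M.a_assoc M.r_neg)

lemma minus_add_distrib:
  "\<lbrakk>x \<in> carrier M; y \<in> carrier M; u \<in> carrier M; v \<in> carrier M\<rbrakk> \<Longrightarrow>
    (x \<oplus>\<^bsub>M\<^esub> u) \<ominus>\<^bsub>M\<^esub> (y \<oplus>\<^bsub>M\<^esub> v) = (x \<ominus>\<^bsub>M\<^esub> y) \<oplus>\<^bsub>M\<^esub> (u \<ominus>\<^bsub>M\<^esub> v)"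
  by (simp add: a_minus_def M.minus_add M.a_ac)

lemma smult_minus: 
  "\<lbrakk>a \<in> carrier R; x \<in> carrier M; y \<in> carrier M\<rbrakk> \<Longrightarrow> a \<odot>\<^bsub>M\<^esub> (x \<ominus>\<^bsub>M\<^esub> y) = a \<odot>\<^bsub>M\<^esub> x \<ominus>\<^bsub>M\<^esub> a \<odot>\<^bsub>M\<^esub> y"
  by (simp add: a_minus_def smult_r_distr smult_minus_right)

lemma smult_finsum:
  "finite A \<Longrightarrow> a \<in> carrier R \<Longrightarrow> h \<in> A \<rightarrow> carrier M \<Longrightarrow>
    a \<odot>\<^bsub>M\<^esub> (\<Oplus>\<^bsub>M\<^esub>x\<in>A. h x) = (\<Oplus>\<^bsub>M\<^esub>x\<in>A. a \<odot>\<^bsub>M\<^esub> h x)"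
  by (induction A rule: finite_induct) (auto simp: smult_zero_right smult_r_distr M.finsum_closed Pi_def)

lemma finsum_smult:
  "finite A \<Longrightarrow> x \<in> carrier M \<Longrightarrow> h \<in> A \<rightarrow> carrier R \<Longrightarrow>
    (\<Oplus>\<^bsub>R\<^esub>i\<in>A. h i) \<odot>\<^bsub>M\<^esub> x = (\<Oplus>\<^bsub>M\<^esub>i\<in>A. h i \<odot>\<^bsub>M\<^esub> x)"
  by (induction A rule: finite_induct) (auto simp: smult_zero_left smult_l_distr R.finsum_closed Pi_def)

end

lemma lmod_hom_minus:
  assumes "lmodule T M" "lmodule T N" "f \<in> lmod_hom T M N" "x \<in> carrier M"
  shows "f (\<ominus>\<^bsub>M\<^esub> x) = \<ominus>\<^bsub>N\<^esub> f x"
proof -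
  interpret M: lmodule T M by fact
  interpret N: lmodule T N by fact
  show ?thesis using assms(3,4)
    by (simp flip: M.smult_neg_one N.smult_neg_one add: lmod_hom_smult lmod_hom_closed)
qed

lemma lmod_hom_diff:
  assumes "lmodule T M" "lmodule T N" "f \<in> lmod_hom T M N" "x \<in> carrier M" "y \<in> carrier M"
  shows "f (x \<ominus>\<^bsub>M\<^esub> y) = f x \<ominus>\<^bsub>N\<^esub> f y"
proof -
  interpret M: lmodule T M by fact
  show ?thesis using assms
    by (simp add: a_minus_def lmod_hom_add[OF assms(3)] lmod_hom_minus[OF assms(1-3)])
qed

lemma lmod_hom_finsum:
  assumes "lmodule T M" "lmodule T N" "f \<in> lmod_hom T M N" "finite A" "h \<in> A \<rightarrow> carrier M"
  shows "f (\<Oplus>\<^bsub>M\<^esub>x\<in>A. h x) = (\<Oplus>\<^bsub>N\<^esub>x\<in>A. f (h x))"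
proof -
  interpret M: lmodule T M by fact
  interpret N: lmodule T N by fact
  show ?thesis using assms(4,5)
    by (induction A rule: finite_induct)
      (auto simp: lmod_hom_zero[OF assms(1-3)] lmod_hom_add[OF assms(3)] M.M.finsum_closed
        lmod_hom_closed[OF assms(3)] Pi_def)
qed

lemma lmod_hom_inj_iff:
  assumes "lmodule T M" "lmodule T N" "f \<in> lmod_hom T M N"
  shows "inj_on f (carrier M) \<longleftrightarrow> (\<forall>x\<in>carrier M. f x = \<zero>\<^bsub>N\<^esub> \<longrightarrow> x = \<zero>\<^bsub>M\<^esub>)"
proof -
  interpret M: lmodule T M by fact
  interpret N: lmodule T N by fact
  show ?thesis
  proof (intro iffI ballI impI inj_onI)
    fix x assume "inj_on f (carrier M)" "x \<in> carrier M" "f x = \<zero>\<^bsub>N\<^esub>"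
    then show "x = \<zero>\<^bsub>M\<^esub>" using lmod_hom_zero[OF assms] inj_onD[of f "carrier M" x "\<zero>\<^bsub>M\<^esub>"] by simp
  next
    fix x y assume a: "\<forall>x\<in>carrier M. f x = \<zero>\<^bsub>N\<^esub> \<longrightarrow> x = \<zero>\<^bsub>M\<^esub>" "x \<in> carrier M" "y \<in> carrier M" "f x = f y"
    then have "f (x \<ominus>\<^bsub>M\<^esub> y) = \<zero>\<^bsub>N\<^esub>"
      using lmod_hom_diff[OF assms, of x y] by (simp add: N.minus_self lmod_hom_closed[OF assms(3)])
    moreover have "x \<ominus>\<^bsub>M\<^esub> y \<in> carrier M" using a(2,3) by simp
    ultimately have "x \<ominus>\<^bsub>M\<^esub> y = \<zero>\<^bsub>M\<^esub>" using a(1) by blast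
    then show "x = y" using a(2,3) by (simp add: M.minus_eq_zero_iff)
  qed
qed

lemma a_kernel_iff: "x \<in> a_kernel M N f \<longleftrightarrow> x \<in> carrier M \<and> f x = \<zero>\<^bsub>N\<^esub>"
  by (auto simp: a_kernel_def')

text \<open>Homomorphisms are defined below by their graphs; this replaces the use of quotients and
  direct sums.\<close>

lemma hom_from_graph:
  assumes B: "lmodule T B" and I: "lmodule T I"
    and sub: "\<And>b i. (b, i) \<in> G \<Longrightarrow> b \<in> carrier B \<and> i \<in> carrier I"
    and add: "\<And>b i b' i'. (b, i) \<in> G \<Longrightarrow> (b', i') \<in> G \<Longrightarrow> (b \<oplus>\<^bsub>B\<^esub> b', i \<oplus>\<^bsub>I\<^esub> i') \<in> G"
    and smult: "\<And>a b i. a \<in> carrier T \<Longrightarrow> (b, i) \<in> G \<Longrightarrow> (a \<odot>\<^bsub>B\<^esub> b, a \<odot>\<^bsub>I\<^esub> i) \<in> G"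
    and total: "\<And>b. b \<in> carrier B \<Longrightarrow> \<exists>i. (b, i) \<in> G"
    and func: "\<And>i. (\<zero>\<^bsub>B\<^esub>, i) \<in> G \<Longrightarrow> i = \<zero>\<^bsub>I\<^esub>"
  shows "\<exists>h\<in>lmod_hom T B I. \<forall>b i. (b, i) \<in> G \<longrightarrow> h b = i"
proof -
  interpret B: lmodule T B by fact
  interpret I: lmodule T I by fact
  have uniq: "i = i'" if "(b, i) \<in> G" "(b, i') \<in> G" for b i i'
  proof -
    have c: "b \<in> carrier B" "i \<in> carrier I" "i' \<in> carrier I" using sub that by auto
    \<comment> \<open>The relation is closed under sums and scalar multiples, so the difference of
      the two pairs is formed with the scalar -1; \<open>func\<close> then applies to a pair over
      zero.\<close>
    have "(b \<oplus>\<^bsub>B\<^esub> (\<ominus>\<^bsub>T\<^esub> \<one>\<^bsub>T\<^esub>) \<odot>\<^bsub>B\<^esub> b, i \<oplus>\<^bsub>I\<^esub> (\<ominus>\<^bsub>T\<^esub> \<one>\<^bsub>T\<^esub>) \<odot>\<^bsub>I\<^esub> i') \<in> G"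
      by (intro add smult that) auto
    then have "(\<zero>\<^bsub>B\<^esub>, i \<ominus>\<^bsub>I\<^esub> i') \<in> G"
      using c by (simp add: B.smult_neg_one I.smult_neg_one B.M.r_neg a_minus_def)
    then show ?thesis using func c I.minus_eq_zero_iff by blast
  qed
  define h where "h b = (THE i. (b, i) \<in> G)" for b
  have h: "h b = i" if "(b, i) \<in> G" for b i
    unfolding h_def using that uniq by blast
  have hG: "(b, h b) \<in> G" if "b \<in> carrier B" for b using total[OF that] h by auto
  have "h \<in> lmod_hom T B I"
    by (intro lmod_homI) (auto dest: hG sub intro!: h add smult hG)
  then show ?thesis using h by blast
qed

text \<open>The universal property of a quotient, with the quotient replaced by an arbitrary
  epimorphic image \<open>C\<close> of \<open>B\<close>. The graph is the image of \<open>B\<close>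
  under \<open>(q, f)\<close>, and the hypothesis on kernels makes it single valued.\<close>

lemma hom_factor:
  assumes B: "lmodule T B" and C: "lmodule T C" and I: "lmodule T I"
    and q: "q \<in> lmod_hom T B C" "q ` carrier B = carrier C" and f: "f \<in> lmod_hom T B I"
    and ker: "\<And>x. x \<in> carrier B \<Longrightarrow> q x = \<zero>\<^bsub>C\<^esub> \<Longrightarrow> f x = \<zero>\<^bsub>I\<^esub>"
  shows "\<exists>h\<in>lmod_hom T C I. \<forall>x\<in>carrier B. h (q x) = f x"
proof -
  interpret B: lmodule T B by fact
  have "\<exists>h\<in>lmod_hom T C I. \<forall>b i. (b, i) \<in> (\<lambda>x. (q x, f x)) ` carrier B \<longrightarrow> h b = i"
  proof (rule hom_from_graph[OF C I])
    fix b i b' i'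
    assume "(b, i) \<in> (\<lambda>x. (q x, f x)) ` carrier B" "(b', i') \<in> (\<lambda>x. (q x, f x)) ` carrier B"
    then obtain x y where "x \<in> carrier B" "y \<in> carrier B" "b = q x" "i = f x" "b' = q y" "i' = f y" by auto
    then show "(b \<oplus>\<^bsub>C\<^esub> b', i \<oplus>\<^bsub>I\<^esub> i') \<in> (\<lambda>x. (q x, f x)) ` carrier B"
      by (intro image_eqI[of _ _ "x \<oplus>\<^bsub>B\<^esub> y"]) (auto simp: lmod_hom_add[OF q(1)] lmod_hom_add[OF f])
  next
    fix a b i assume a: "a \<in> carrier T" and "(b, i) \<in> (\<lambda>x. (q x, f x)) ` carrier B"
    then obtain x where "x \<in> carrier B" "b = q x" "i = f x" by auto
    then show "(a \<odot>\<^bsub>C\<^esub> b, a \<odot>\<^bsub>I\<^esub> i) \<in> (\<lambda>x. (q x, f x)) ` carrier B" using a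
      by (intro image_eqI[of _ _ "a \<odot>\<^bsub>B\<^esub> x"]) (auto simp: lmod_hom_smult[OF q(1)] lmod_hom_smult[OF f])
  next
    fix b assume "b \<in> carrier C"
    then have "b \<in> q ` carrier B" using q(2) by simp
    then show "\<exists>i. (b, i) \<in> (\<lambda>x. (q x, f x)) ` carrier B" by auto
  next
    fix i assume "(\<zero>\<^bsub>C\<^esub>, i) \<in> (\<lambda>x. (q x, f x)) ` carrier B"
    then obtain x where "x \<in> carrier B" "q x = \<zero>\<^bsub>C\<^esub>" "i = f x" by (elim imageE) simp
    then show "i = \<zero>\<^bsub>I\<^esub>" by (simp add: ker)
  qed (auto simp: lmod_hom_closed[OF q(1)] lmod_hom_closed[OF f])
  then obtain h where "h \<in> lmod_hom T C I" and h: "\<And>b i. (b, i) \<in> (\<lambda>x. (q x, f x)) ` carrier B \<Longrightarrow> h b = i"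
    by blast
  moreover have "h (q x) = f x" if "x \<in> carrier B" for x using that by (intro h image_eqI[of _ _ x]) simp_all
  ultimately show ?thesis by blast
qed

section \<open>Finite presentations\<close>

abbreviation fpow :: "'t ring \<Rightarrow> nat \<Rightarrow> ('t, nat \<Rightarrow> 't) module" where
  "fpow T m \<equiv> free_module T {..<m}"

text \<open>Only generators are fixed; a finite presentation arises by presenting the kernel once
  more.\<close>

definition presents :: "'t ring \<Rightarrow> ('t, 'u) module \<Rightarrow> nat \<Rightarrow> ((nat \<Rightarrow> 't) \<Rightarrow> 'u) \<Rightarrow> bool" where
  "presents T U m p \<longleftrightarrow> p \<in> lmod_hom T (fpow T m) U \<and> p ` carrier (fpow T m) = carrier U"

text \<open>The element type is that of \<open>M\<close>, so that passing to syzygies inside free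
  modules never changes types.\<close>

definition ker_mod :: "('t, 'm) module \<Rightarrow> ('t, 'n) module \<Rightarrow> ('m \<Rightarrow> 'n) \<Rightarrow> ('t, 'm) module" where
  "ker_mod M N f = M\<lparr>carrier := a_kernel M N f\<rparr>"

lemma ker_mod_simps [simp]:
  "x \<in> carrier (ker_mod M N f) \<longleftrightarrow> x \<in> carrier M \<and> f x = \<zero>\<^bsub>N\<^esub>"
  "\<zero>\<^bsub>ker_mod M N f\<^esub> = \<zero>\<^bsub>M\<^esub>" "x \<oplus>\<^bsub>ker_mod M N f\<^esub> y = x \<oplus>\<^bsub>M\<^esub> y" "a \<odot>\<^bsub>ker_mod M N f\<^esub> x = a \<odot>\<^bsub>M\<^esub> x"
  by (auto simp: ker_mod_def a_kernel_iff)

lemma lmodule_ker_mod: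
  assumes "lmodule T M" "lmodule T N" "f \<in> lmod_hom T M N" shows "lmodule T (ker_mod M N f)"
  unfolding ker_mod_def by (rule lmodule_a_kernel[OF assms])

lemma lmodule_fpow: "lmodule T U \<Longrightarrow> lmodule T (fpow T m)"
  by (rule lmodule_free_module) (simp add: lmodule_def)

text \<open>Goes beyond the definition of \<open>projective\<close>: the test modules may have any
  type, and \<open>g\<close> only has to reach the image of \<open>f\<close>. Preimages are chosen
  on the basis and extended linearly.\<close>

lemma lift_free:
  assumes A: "lmodule T A" and B: "lmodule T B" and g: "g \<in> lmod_hom T A B" 
    and f: "f \<in> lmod_hom T (free_module T X) B"
    and onto: "\<And>v. v \<in> carrier (free_module T X) \<Longrightarrow> f v \<in> g ` carrier A"
  shows "\<exists>h\<in>lmod_hom T (free_module T X) A. \<forall>v\<in>carrier (free_module T X). g (h v) = f v"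
proof -
  have T: "ring T" using A by (simp add: lmodule_def)
  define \<phi> where "\<phi> x = (SOME a. a \<in> carrier A \<and> g a = f (unit_vec T x))" for x
  have \<phi>: "\<phi> x \<in> carrier A \<and> g (\<phi> x) = f (unit_vec T x)" if "x \<in> X" for x
  proof -
    have "f (unit_vec T x) \<in> g ` carrier A" by (rule onto[OF unit_vec_carrier[OF T that]])
    then obtain b where "f (unit_vec T x) = g b" "b \<in> carrier A" by (rule imageE)
    then have "b \<in> carrier A \<and> g b = f (unit_vec T x)" by simp
    then show ?thesis unfolding \<phi>_def by (rule someI[where P = "\<lambda>b. b \<in> carrier A \<and> g b = f (unit_vec T x)"])
  qed
  let ?h = "lin_ext T X A \<phi>"
  have h: "?h \<in> lmod_hom T (free_module T X) A" using \<phi> A by (intro lin_ext_hom) auto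
  have gh: "(\<lambda>v. g (?h v)) \<in> lmod_hom T (free_module T X) B" by (rule lmod_hom_comp[OF h g])
  have "g (?h v) = f v" if "v \<in> carrier (free_module T X)" for v
  proof (rule hom_eq_on_basis[OF B gh f _ that])
    fix x assume x: "x \<in> X"
    have "?h (unit_vec T x) = \<phi> x" using A \<phi> x by (intro lin_ext_unit_vec) simp_all
    then show "g (?h (unit_vec T x)) = f (unit_vec T x)" using \<phi>[OF x] by simp
  qed
  then show ?thesis using h by blast
qed

text \<open>An injective map does not change a kernel. The syzygies of isomorphic modules are thus
  equal, and no isomorphism has to be carried through the recursive predicates below.\<close>

lemma presents_iso:
  assumes p: "presents T U m p" and h: "h \<in> lmod_hom T U V" "bij_betw h (carrier U) (carrier V)"
    and U: "lmodule T U" and V: "lmodule T V"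
  shows "presents T V m (\<lambda>x. h (p x))" "ker_mod (fpow T m) V (\<lambda>x. h (p x)) = ker_mod (fpow T m) U p"
proof -
  have p': "p \<in> lmod_hom T (fpow T m) U" "p ` carrier (fpow T m) = carrier U"
    using p by (auto simp: presents_def)
  have "(\<lambda>x. h (p x)) ` carrier (fpow T m) = h ` carrier U" by (simp add: p'(2)[symmetric] image_image)
  then show "presents T V m (\<lambda>x. h (p x))"
    using lmod_hom_comp[OF p'(1) h(1)] h(2) by (simp add: presents_def bij_betw_def)
  have "inj_on h (carrier U)" using h(2) by (simp add: bij_betw_def)
  then have "h x = \<zero>\<^bsub>V\<^esub> \<longleftrightarrow> x = \<zero>\<^bsub>U\<^esub>" if "x \<in> carrier U" for x
    using that lmod_hom_zero[OF U V h(1)] iffD1[OF lmod_hom_inj_iff[OF U V h(1)]] by metis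
  then have "a_kernel (fpow T m) V (\<lambda>x. h (p x)) = a_kernel (fpow T m) U p"
    using lmod_hom_closed[OF p'(1)] lmod_hom_zero[OF U V h(1)] by (auto simp: a_kernel_iff)
  then show "ker_mod (fpow T m) V (\<lambda>x. h (p x)) = ker_mod (fpow T m) U p" by (simp add: ker_mod_def)
qed

lemma short_exactD:
  assumes "short_exact T A B C \<iota> \<pi>"
  shows "lmodule T A" "lmodule T B" "lmodule T C" "\<iota> \<in> lmod_hom T A B" "\<pi> \<in> lmod_hom T B C"
    "inj_on \<iota> (carrier A)" "\<And>a. a \<in> carrier A \<Longrightarrow> \<pi> (\<iota> a) = \<zero>\<^bsub>C\<^esub>"
    "\<And>b. b \<in> carrier B \<Longrightarrow> \<pi> b = \<zero>\<^bsub>C\<^esub> \<Longrightarrow> \<exists>a\<in>carrier A. b = \<iota> a"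
    "\<And>c. c \<in> carrier C \<Longrightarrow> \<exists>b\<in>carrier B. c = \<pi> b"
    "\<And>a. a \<in> carrier A \<Longrightarrow> \<iota> a = \<zero>\<^bsub>B\<^esub> \<Longrightarrow> a = \<zero>\<^bsub>A\<^esub>"
proof -
  note a = assms[unfolded short_exact_def]
  show "lmodule T A" "lmodule T B" "lmodule T C" "\<iota> \<in> lmod_hom T A B" "\<pi> \<in> lmod_hom T B C"
    "inj_on \<iota> (carrier A)" using a by auto
  have "\<iota> x \<in> a_kernel B C \<pi>" if "x \<in> carrier A" for x using a that by blast
  then show "\<And>a. a \<in> carrier A \<Longrightarrow> \<pi> (\<iota> a) = \<zero>\<^bsub>C\<^esub>" by (simp add: a_kernel_iff)
  show "\<exists>a\<in>carrier A. b = \<iota> a" if "b \<in> carrier B" "\<pi> b = \<zero>\<^bsub>C\<^esub>" for b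
  proof -
    have "b \<in> \<iota> ` carrier A" using a that by (simp add: a_kernel_iff)
    then show ?thesis by auto
  qed
  show "\<exists>b\<in>carrier B. c = \<pi> b" if "c \<in> carrier C" for c
  proof -
    have "c \<in> \<pi> ` carrier B" using a that by simp
    then show ?thesis by auto
  qed
  show "\<And>a. a \<in> carrier A \<Longrightarrow> \<iota> a = \<zero>\<^bsub>B\<^esub> \<Longrightarrow> a = \<zero>\<^bsub>A\<^esub>"
    using a lmod_hom_inj_iff[of T A B \<iota>] by blast
qed

lemma short_exactI:
  assumes "lmodule T A" "lmodule T B" "lmodule T C" "\<iota> \<in> lmod_hom T A B" "\<pi> \<in> lmod_hom T B C"
    "\<And>a. a \<in> carrier A \<Longrightarrow> \<iota> a = \<zero>\<^bsub>B\<^esub> \<Longrightarrow> a = \<zero>\<^bsub>A\<^esub>"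
    "\<And>a. a \<in> carrier A \<Longrightarrow> \<pi> (\<iota> a) = \<zero>\<^bsub>C\<^esub>"
    "\<And>b. b \<in> carrier B \<Longrightarrow> \<pi> b = \<zero>\<^bsub>C\<^esub> \<Longrightarrow> \<exists>a\<in>carrier A. b = \<iota> a"
    "\<And>c. c \<in> carrier C \<Longrightarrow> \<exists>b\<in>carrier B. c = \<pi> b"
  shows "short_exact T A B C \<iota> \<pi>"
  unfolding short_exact_def
proof (intro conjI)
  show "inj_on \<iota> (carrier A)" using assms lmod_hom_inj_iff[of T A B \<iota>] by blast
  show "\<iota> ` carrier A = a_kernel B C \<pi>"
    using assms(7,8) lmod_hom_closed[OF assms(4)] by (auto simp: a_kernel_iff image_iff)
  show "\<pi> ` carrier B = carrier C"
    using assms(9) lmod_hom_closed[OF assms(5)] by auto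
qed (use assms in auto)

lemma lmod_hom_id: "(\<lambda>x. x) \<in> lmod_hom T M M"
  by (simp add: lmod_hom_def)

lemma lmod_hom_sum:
  assumes "lmodule T M" "lmodule T N" "f \<in> lmod_hom T M N" "g \<in> lmod_hom T M N"
  shows "(\<lambda>x. f x \<oplus>\<^bsub>N\<^esub> g x) \<in> lmod_hom T M N"
proof -
  interpret N: lmodule T N by fact
  show ?thesis using assms(3,4)
    by (intro lmod_homI) (auto simp: lmod_hom_closed lmod_hom_add lmod_hom_smult N.M.a_ac N.smult_r_distr)
qed

lemma lmod_hom_difference:
  assumes "lmodule T M" "lmodule T N" "f \<in> lmod_hom T M N" "g \<in> lmod_hom T M N"
  shows "(\<lambda>x. f x \<ominus>\<^bsub>N\<^esub> g x) \<in> lmod_hom T M N"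
proof -
  interpret N: lmodule T N by fact
  show ?thesis using assms(3,4)
    by (intro lmod_homI) (auto simp: lmod_hom_closed lmod_hom_add lmod_hom_smult N.minus_add_distrib N.smult_minus)
qed

lemma lmod_hom_ker_mod: "f \<in> lmod_hom T M N \<Longrightarrow> f \<in> lmod_hom T (ker_mod M L p) N"
  by (auto simp: lmod_hom_def)

lemma lmod_hom_into_ker_mod:
  "f \<in> lmod_hom T M N \<Longrightarrow> (\<And>x. x \<in> carrier M \<Longrightarrow> q (f x) = \<zero>\<^bsub>L\<^esub>) \<Longrightarrow> f \<in> lmod_hom T M (ker_mod N L q)"
  by (auto simp: lmod_hom_def)

text \<open>A map from the direct sum of \<open>A\<close> and \<open>G\<close> descends to its
  epimorphic image \<open>B\<close>. The direct sum is never formed: the graph pairs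
  \<open>q a + q' x\<close> with \<open>f a + f' x\<close>.\<close>

lemma hom_from_two_maps:
  assumes A: "lmodule T A" and G: "lmodule T G" and B: "lmodule T B" and I: "lmodule T I"
    and q: "q \<in> lmod_hom T A B" "q' \<in> lmod_hom T G B"
    and f: "f \<in> lmod_hom T A I" "f' \<in> lmod_hom T G I"
    and onto: "\<And>b. b \<in> carrier B \<Longrightarrow> \<exists>a\<in>carrier A. \<exists>x\<in>carrier G. b = q a \<oplus>\<^bsub>B\<^esub> q' x"
    and ker: "\<And>a x. a \<in> carrier A \<Longrightarrow> x \<in> carrier G \<Longrightarrow> q a \<oplus>\<^bsub>B\<^esub> q' x = \<zero>\<^bsub>B\<^esub> \<Longrightarrow> f a \<oplus>\<^bsub>I\<^esub> f' x = \<zero>\<^bsub>I\<^esub>"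
  shows "\<exists>h\<in>lmod_hom T B I. (\<forall>a\<in>carrier A. h (q a) = f a) \<and> (\<forall>x\<in>carrier G. h (q' x) = f' x)"
proof -
  interpret A: lmodule T A by fact
  interpret G: lmodule T G by fact
  interpret B: lmodule T B by fact
  interpret I: lmodule T I by fact
  let ?\<Gamma> = "{(q a \<oplus>\<^bsub>B\<^esub> q' x, f a \<oplus>\<^bsub>I\<^esub> f' x) | a x. a \<in> carrier A \<and> x \<in> carrier G}"
  note cl = lmod_hom_closed[OF q(1)] lmod_hom_closed[OF q(2)] lmod_hom_closed[OF f(1)] lmod_hom_closed[OF f(2)]
  have "\<exists>h\<in>lmod_hom T B I. \<forall>b i. (b, i) \<in> ?\<Gamma> \<longrightarrow> h b = i"
  proof (rule hom_from_graph[OF B I])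
    fix b i b' i' assume "(b, i) \<in> ?\<Gamma>" "(b', i') \<in> ?\<Gamma>"
    then obtain a x a' x' where e: "a \<in> carrier A" "x \<in> carrier G" "a' \<in> carrier A" "x' \<in> carrier G"
      "b = q a \<oplus>\<^bsub>B\<^esub> q' x" "i = f a \<oplus>\<^bsub>I\<^esub> f' x" "b' = q a' \<oplus>\<^bsub>B\<^esub> q' x'" "i' = f a' \<oplus>\<^bsub>I\<^esub> f' x'" by blast
    then have "b \<oplus>\<^bsub>B\<^esub> b' = q (a \<oplus>\<^bsub>A\<^esub> a') \<oplus>\<^bsub>B\<^esub> q' (x \<oplus>\<^bsub>G\<^esub> x')" "i \<oplus>\<^bsub>I\<^esub> i' = f (a \<oplus>\<^bsub>A\<^esub> a') \<oplus>\<^bsub>I\<^esub> f' (x \<oplus>\<^bsub>G\<^esub> x')"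
      by (auto simp: lmod_hom_add[OF q(1)] lmod_hom_add[OF q(2)] lmod_hom_add[OF f(1)] lmod_hom_add[OF f(2)]
          cl B.M.a_ac I.M.a_ac)
    then show "(b \<oplus>\<^bsub>B\<^esub> b', i \<oplus>\<^bsub>I\<^esub> i') \<in> ?\<Gamma>" using e(1-4) by blast
  next
    fix c b i assume c: "c \<in> carrier T" and "(b, i) \<in> ?\<Gamma>"
    then obtain a x where e: "a \<in> carrier A" "x \<in> carrier G" 
      "b = q a \<oplus>\<^bsub>B\<^esub> q' x" "i = f a \<oplus>\<^bsub>I\<^esub> f' x" by blast
    then have "c \<odot>\<^bsub>B\<^esub> b = q (c \<odot>\<^bsub>A\<^esub> a) \<oplus>\<^bsub>B\<^esub> q' (c \<odot>\<^bsub>G\<^esub> x)" "c \<odot>\<^bsub>I\<^esub> i = f (c \<odot>\<^bsub>A\<^esub> a) \<oplus>\<^bsub>I\<^esub> f' (c \<odot>\<^bsub>G\<^esub> x)"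
      using c by (auto simp: lmod_hom_smult[OF q(1)] lmod_hom_smult[OF q(2)] lmod_hom_smult[OF f(1)]
          lmod_hom_smult[OF f(2)] cl B.smult_r_distr I.smult_r_distr)
    then show "(c \<odot>\<^bsub>B\<^esub> b, c \<odot>\<^bsub>I\<^esub> i) \<in> ?\<Gamma>" using e(1-2) c A.smult_closed G.smult_closed by blast
  next
    fix b assume "b \<in> carrier B"
    then show "\<exists>i. (b, i) \<in> ?\<Gamma>" using onto by blast
  next
    fix i assume "(\<zero>\<^bsub>B\<^esub>, i) \<in> ?\<Gamma>"
    then obtain a x where "a \<in> carrier A" "x \<in> carrier G" "\<zero>\<^bsub>B\<^esub> = q a \<oplus>\<^bsub>B\<^esub> q' x" "i = f a \<oplus>\<^bsub>I\<^esub> f' x" by blast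
    then show "i = \<zero>\<^bsub>I\<^esub>" using ker[of a x] by metis
  next
    fix b i assume "(b, i) \<in> ?\<Gamma>"
    then show "b \<in> carrier B \<and> i \<in> carrier I" using cl B.M.a_closed I.M.a_closed by blast
  qed
  then obtain h where hom: "h \<in> lmod_hom T B I" and h: "\<And>b i. (b, i) \<in> ?\<Gamma> \<Longrightarrow> h b = i" by blast
  have "h (q a) = f a" if "a \<in> carrier A" for a
  proof (rule h, safe intro!: exI)
    show "a \<in> carrier A" "\<zero>\<^bsub>G\<^esub> \<in> carrier G" using that by auto
    show "q a = q a \<oplus>\<^bsub>B\<^esub> q' \<zero>\<^bsub>G\<^esub>" "f a = f a \<oplus>\<^bsub>I\<^esub> f' \<zero>\<^bsub>G\<^esub>"
      using that cl by (simp_all add: lmod_hom_zero[OF G B q(2)] lmod_hom_zero[OF G I f(2)])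
  qed
  moreover have "h (q' x) = f' x" if "x \<in> carrier G" for x
  proof (rule h, safe intro!: exI)
    show "\<zero>\<^bsub>A\<^esub> \<in> carrier A" "x \<in> carrier G" using that by auto
    show "q' x = q \<zero>\<^bsub>A\<^esub> \<oplus>\<^bsub>B\<^esub> q' x" "f' x = f \<zero>\<^bsub>A\<^esub> \<oplus>\<^bsub>I\<^esub> f' x"
      using that cl by (simp_all add: lmod_hom_zero[OF A B q(1)] lmod_hom_zero[OF A I f(1)])
  qed
  ultimately show ?thesis using hom by blast
qed

text \<open>Corestriction to the image of an injection; linearity of \<open>inv_into\<close> along
  \<open>r\<close> comes from injectivity of \<open>\<iota>\<close>.\<close>

lemma hom_through_inj:
  assumes A: "lmodule T A" and B: "lmodule T B" and \<iota>: "\<iota> \<in> lmod_hom T A B" "inj_on \<iota> (carrier A)"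
    and W: "lmodule T W" and r: "r \<in> lmod_hom T W B"
    and im: "r ` carrier W \<subseteq> \<iota> ` carrier A"
  shows "\<And>v. v \<in> carrier W \<Longrightarrow> inv_into (carrier A) \<iota> (r v) \<in> carrier A"
    and "\<And>v. v \<in> carrier W \<Longrightarrow> \<iota> (inv_into (carrier A) \<iota> (r v)) = r v"
    and "(\<lambda>v. inv_into (carrier A) \<iota> (r v)) \<in> lmod_hom T W A"
proof -
  interpret A: lmodule T A by fact
  interpret W: lmodule T W by fact
  let ?k = "\<lambda>v. inv_into (carrier A) \<iota> (r v)"
  show k: "?k v \<in> carrier A" "\<iota> (?k v) = r v" if "v \<in> carrier W" for v
    using subsetD[OF im imageI[OF that]] by (auto simp: inv_into_into f_inv_into_f)
  have eq: "a = a'" if "\<iota> a = \<iota> a'" "a \<in> carrier A" "a' \<in> carrier A" for a a'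
    using \<iota>(2) that by (auto dest: inj_onD)
  show "?k \<in> lmod_hom T W A"
    by (intro lmod_homI eq) (simp_all add: k lmod_hom_add[OF \<iota>(1)] lmod_hom_smult[OF \<iota>(1)]
        flip: lmod_hom_add[OF r] lmod_hom_smult[OF r])
qed

lemma lift_presents:
  assumes "lmodule T A" "lmodule T B" "g \<in> lmod_hom T A B" "g ` carrier A = carrier B" "presents T B m p"
  shows "\<exists>h\<in>lmod_hom T (fpow T m) A. \<forall>v\<in>carrier (fpow T m). g (h v) = p v"
proof (rule lift_free[OF assms(1-3)])
  show "p \<in> lmod_hom T (fpow T m) B" using assms(5) by (simp add: presents_def)
  then show "p v \<in> g ` carrier A" if "v \<in> carrier (fpow T m)" for v
    unfolding assms(4) by (rule lmod_hom_closed[OF _ that])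
qed

lemma short_exact_onto: "short_exact T A B C \<iota> \<pi> \<Longrightarrow> \<pi> ` carrier B = carrier C"
  by (simp add: short_exact_def)

section \<open>Vanishing of Ext in terms of syzygies\<close>

text \<open>Intended for a submodule \<open>W\<close> of \<open>F\<close>: restriction from
  \<open>Hom(F, I)\<close> to \<open>Hom(W, I)\<close> is onto. For \<open>F\<close> free and
  \<open>W\<close> the kernel of a surjection from \<open>F\<close> to \<open>U\<close> this is
  \<open>Ext^1(U, I) = 0\<close>.\<close>

definition extends :: "'t ring \<Rightarrow> ('t, 'i) module \<Rightarrow> ('t, 'm) module \<Rightarrow> ('t, 'm) module \<Rightarrow> bool" where
  "extends T I W F \<longleftrightarrow> (\<forall>f\<in>lmod_hom T W I. \<exists>g\<in>lmod_hom T F I. \<forall>x\<in>carrier W. g x = f x)"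

text \<open>The recursion has to stay at one type and therefore runs over syzygies; \<open>m\<close>
  records the ambient free module for level 0. Quantifying over all presentations makes the notion
  independent of choices.\<close>

primrec ker_ext_van :: "'t ring \<Rightarrow> ('t, 'i) module \<Rightarrow> nat \<Rightarrow> nat \<Rightarrow> ('t, nat \<Rightarrow> 't) module \<Rightarrow> bool" where
  "ker_ext_van T I 0 m W = extends T I W (fpow T m)"
| "ker_ext_van T I (Suc k) m W =
     (\<forall>l p. presents T W l p \<longrightarrow> ker_ext_van T I k l (ker_mod (fpow T l) W p))"

text \<open>For a finitely presented \<open>U\<close>, this says that \<open>Ext\<^sup>k\<^sup>+\<^sup>1(U, I) = 0\<close>: note the index shift.\<close>

definition ext_van :: "'t ring \<Rightarrow> ('t, 'i) module \<Rightarrow> nat \<Rightarrow> ('t, 'u) module \<Rightarrow> bool" where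
  "ext_van T I k U \<longleftrightarrow>
     (\<forall>m p. presents T U m p \<longrightarrow> ker_ext_van T I k m (ker_mod (fpow T m) U p))"

lemma ker_ext_van_Suc: "ker_ext_van T I (Suc k) m W \<longleftrightarrow> ext_van T I k W"
  by (simp add: ext_van_def)

lemma ext_van_0D:
  assumes "ext_van T I 0 U" "presents T U m p" "f \<in> lmod_hom T (ker_mod (fpow T m) U p) I"
  shows "\<exists>g\<in>lmod_hom T (fpow T m) I. \<forall>x\<in>carrier (ker_mod (fpow T m) U p). g x = f x"
  using assms unfolding ext_van_def ker_ext_van.simps extends_def by blast

lemma ext_van_iso:
  assumes "ext_van T I k V" "h \<in> lmod_hom T U V" "bij_betw h (carrier U) (carrier V)"
    "lmodule T U" "lmodule T V"
  shows "ext_van T I k U"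
  using assms(1) presents_iso[OF _ assms(2-5)] unfolding ext_van_def by metis

text \<open>Part of the long exact sequence: the obstruction to extending \<open>f\<close> lies in
  \<open>Ext^1(C, I)\<close>. A lift \<open>\<phi>\<close> of \<open>p\<close> to \<open>B\<close>
  maps the syzygy of \<open>C\<close> into \<open>A\<close>; there \<open>f\<close> extends to the
  free module, and the two maps are glued because \<open>B\<close> is the sum of the images of
  \<open>A\<close> and of the free module. A presentation of \<open>C\<close> is assumed because
  \<open>ext_van\<close> is vacuous without one.\<close>

lemma ext_van_0_extends:
  assumes ex: "short_exact T A B C \<iota> \<pi>" and I: "lmodule T I" and C0: "ext_van T I 0 C"
    and p: "presents T C m p" and f: "f \<in> lmod_hom T A I"
  shows "\<exists>g\<in>lmod_hom T B I. \<forall>a\<in>carrier A. g (\<iota> a) = f a"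
proof -
  note x = short_exactD[OF ex]
  interpret A: lmodule T A by fact
  interpret B: lmodule T B by fact
  interpret C: lmodule T C by fact
  interpret I: lmodule T I by fact
  let ?G = "fpow T m" and ?W = "ker_mod (fpow T m) C p"
  have G: "lmodule T ?G" by (rule lmodule_fpow[OF x(1)])
  interpret G: lmodule T ?G by (rule G)
  have p': "p \<in> lmod_hom T ?G C" "p ` carrier ?G = carrier C" using p by (auto simp: presents_def)
  obtain \<phi> where \<phi>: "\<phi> \<in> lmod_hom T ?G B" "\<And>v. v \<in> carrier ?G \<Longrightarrow> \<pi> (\<phi> v) = p v"
    using lift_presents[OF x(2,3,5) short_exact_onto[OF ex] p] by blast
  have W: "lmodule T ?W" by (rule lmodule_ker_mod[OF G x(3) p'(1)])
  define \<psi> where "\<psi> v = inv_into (carrier A) \<iota> (\<phi> v)" for v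
  have "\<phi> ` carrier ?W \<subseteq> \<iota> ` carrier A"
  proof (rule image_subsetI)
    fix v assume v: "v \<in> carrier ?W"
    then have "\<phi> v \<in> carrier B" "\<pi> (\<phi> v) = \<zero>\<^bsub>C\<^esub>" using \<phi>(2)[of v] lmod_hom_closed[OF \<phi>(1)] by auto
    then show "\<phi> v \<in> \<iota> ` carrier A" using x(8)[of "\<phi> v"] by auto
  qed
  note \<psi> = hom_through_inj[OF x(1,2,4,6) W lmod_hom_ker_mod[OF \<phi>(1)] this, folded \<psi>_def]
  note \<psi>hom = \<psi>(3)
  have "\<exists>g\<in>lmod_hom T ?G I. \<forall>v\<in>carrier ?W. g v = f (\<psi> v)"
    by (rule ext_van_0D[OF C0 p lmod_hom_comp[OF \<psi>hom f]])
  then obtain g where g: "g \<in> lmod_hom T ?G I" "\<And>v. v \<in> carrier ?W \<Longrightarrow> g v = f (\<psi> v)" by blast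
  have "\<exists>h\<in>lmod_hom T B I. (\<forall>a\<in>carrier A. h (\<iota> a) = f a) \<and> (\<forall>v\<in>carrier ?G. h (\<phi> v) = g v)"
  proof (rule hom_from_two_maps[OF x(1) G x(2) I x(4) \<phi>(1) f g(1)])
    fix b assume b: "b \<in> carrier B"
    then have "\<pi> b \<in> p ` carrier ?G" using p'(2) lmod_hom_closed[OF x(5)] by simp
    then obtain v where v: "v \<in> carrier ?G" "\<pi> b = p v" by auto
    have "\<pi> (b \<ominus>\<^bsub>B\<^esub> \<phi> v) = \<zero>\<^bsub>C\<^esub>"
      using b v \<phi> lmod_hom_closed[OF \<phi>(1)] lmod_hom_closed[OF p'(1)]
      by (simp add: lmod_hom_diff[OF x(2,3,5)] C.minus_self)
    then obtain a where "a \<in> carrier A" "b \<ominus>\<^bsub>B\<^esub> \<phi> v = \<iota> a"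
      using x(8)[of "b \<ominus>\<^bsub>B\<^esub> \<phi> v"] b v lmod_hom_closed[OF \<phi>(1)] by auto
    then show "\<exists>a\<in>carrier A. \<exists>v\<in>carrier ?G. b = \<iota> a \<oplus>\<^bsub>B\<^esub> \<phi> v"
      using b v lmod_hom_closed[OF \<phi>(1)] B.minus_add_cancel[of b "\<phi> v"] by auto
  next
    fix a v assume a: "a \<in> carrier A" and v: "v \<in> carrier ?G" and z: "\<iota> a \<oplus>\<^bsub>B\<^esub> \<phi> v = \<zero>\<^bsub>B\<^esub>"
    note cl = lmod_hom_closed[OF x(4) a] lmod_hom_closed[OF \<phi>(1) v]
    have "\<pi> (\<iota> a \<oplus>\<^bsub>B\<^esub> \<phi> v) = \<zero>\<^bsub>C\<^esub>" using z lmod_hom_zero[OF x(2,3,5)] by simp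
    then have "p v = \<zero>\<^bsub>C\<^esub>" using a v cl by (simp add: lmod_hom_add[OF x(5)] x(7) \<phi> lmod_hom_closed[OF p'(1)])
    then have vW: "v \<in> carrier ?W" using v by simp
    have "\<iota> (a \<oplus>\<^bsub>A\<^esub> \<psi> v) = \<zero>\<^bsub>B\<^esub>" using z a \<psi>(1,2)[OF vW] by (simp add: lmod_hom_add[OF x(4)])
    then have "a \<oplus>\<^bsub>A\<^esub> \<psi> v = \<zero>\<^bsub>A\<^esub>" using a \<psi>(1,2)[OF vW] x(10) by auto
    then have "f (a \<oplus>\<^bsub>A\<^esub> \<psi> v) = \<zero>\<^bsub>I\<^esub>" using lmod_hom_zero[OF x(1) I f] by simp
    then show "f a \<oplus>\<^bsub>I\<^esub> g v = \<zero>\<^bsub>I\<^esub>" using g(2)[OF vW] a \<psi>(1,2)[OF vW] by (simp add: lmod_hom_add[OF f])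
  qed
  then show ?thesis by blast
qed

text \<open>Inside the free module, the kernel of \<open>\<pi> o r\<close> contains the kernel of
  \<open>r\<close>, and \<open>r\<close> identifies the quotient with \<open>A\<close>. This rotates
  a short exact sequence: \<open>A\<close> becomes the third term, behind syzygies of
  \<open>B\<close> and \<open>C\<close>.\<close>

lemma presents_cokernel:
  assumes ex: "short_exact T A B C \<iota> \<pi>" and r: "presents T B m r"
  shows "presents T C m (\<lambda>v. \<pi> (r v))"
    and "short_exact T (ker_mod (fpow T m) B r) (ker_mod (fpow T m) C (\<lambda>v. \<pi> (r v))) A
           (\<lambda>v. v) (\<lambda>v. inv_into (carrier A) \<iota> (r v))"
proof -
  note x = short_exactD[OF ex]
  interpret A: lmodule T A by fact
  interpret B: lmodule T B by fact
  interpret C: lmodule T C by fact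
  let ?G = "fpow T m" and ?W = "ker_mod (fpow T m) C (\<lambda>v. \<pi> (r v))" and ?V = "ker_mod (fpow T m) B r"
  have G: "lmodule T ?G" by (rule lmodule_fpow[OF x(1)])
  interpret G: lmodule T ?G by (rule G)
  have r': "r \<in> lmod_hom T ?G B" "r ` carrier ?G = carrier B" using r by (auto simp: presents_def)
  have "(\<lambda>v. \<pi> (r v)) ` carrier ?G = \<pi> ` carrier B" using r'(2) by (metis image_image)
  also have "\<dots> = carrier C" using ex by (simp add: short_exact_def)
  finally show "presents T C m (\<lambda>v. \<pi> (r v))" using lmod_hom_comp[OF r'(1) x(5)] by (simp add: presents_def)
  have W: "lmodule T ?W" by (rule lmodule_ker_mod[OF G x(3) lmod_hom_comp[OF r'(1) x(5)]])
  have V: "lmodule T ?V" by (rule lmodule_ker_mod[OF G x(2) r'(1)])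
  define \<psi> where "\<psi> v = inv_into (carrier A) \<iota> (r v)" for v
  have "r ` carrier ?W \<subseteq> \<iota> ` carrier A"
  proof (rule image_subsetI)
    fix v assume v: "v \<in> carrier ?W"
    then show "r v \<in> \<iota> ` carrier A" using x(8)[of "r v"] lmod_hom_closed[OF r'(1)] by auto
  qed
  note \<psi> = hom_through_inj[OF x(1,2,4,6) W lmod_hom_ker_mod[OF r'(1)] this, folded \<psi>_def]
  note \<psi>hom = \<psi>(3)
  have \<iota>eq: "a = a'" if "\<iota> a = \<iota> a'" "a \<in> carrier A" "a' \<in> carrier A" for a a'
    using x(6) that by (auto dest: inj_onD)
  have "short_exact T ?V ?W A (\<lambda>v. v) \<psi>"
  proof (rule short_exactI[OF V W x(1) _ \<psi>hom])
    show "(\<lambda>v. v) \<in> lmod_hom T ?V ?W"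
      by (intro lmod_homI) (auto simp: lmod_hom_zero[OF x(2,3,5)])
    fix v assume v: "v \<in> carrier ?V"
    then have vW: "v \<in> carrier ?W" by (auto simp: lmod_hom_zero[OF x(2,3,5)])
    then have "\<iota> (\<psi> v) = \<zero>\<^bsub>B\<^esub>" using v \<psi>(1,2)[OF vW] by simp
    then show "\<psi> v = \<zero>\<^bsub>A\<^esub>" using x(10) \<psi>(1,2)[OF vW] by blast
  next
    fix v assume vW: "v \<in> carrier ?W" and "\<psi> v = \<zero>\<^bsub>A\<^esub>"
    then have "r v = \<zero>\<^bsub>B\<^esub>" using \<psi>(1,2)[OF vW] lmod_hom_zero[OF x(1,2,4)] by simp
    then show "\<exists>u\<in>carrier ?V. v = u" using vW by auto
  next
    fix a assume a: "a \<in> carrier A"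
    then have "\<iota> a \<in> r ` carrier ?G" using r'(2) lmod_hom_closed[OF x(4)] by simp
    then obtain v where v: "v \<in> carrier ?G" "\<iota> a = r v" by auto
    then have vW: "v \<in> carrier ?W" using x(7)[OF a] by simp
    then show "\<exists>v\<in>carrier ?W. a = \<psi> v" using \<psi>(1,2)[OF vW] v a by (intro bexI[of _ v]) (auto intro: \<iota>eq)
  qed auto
  then show "short_exact T (ker_mod (fpow T m) B r) (ker_mod (fpow T m) C (\<lambda>v. \<pi> (r v))) A
           (\<lambda>v. v) (\<lambda>v. inv_into (carrier A) \<iota> (r v))"
    by (simp add: \<psi>_def[abs_def])
qed


text \<open>A piece of the long exact sequence: \<open>Ext\<^sup>1(B, I) = 0\<close> and \<open>Ext\<^sup>2(C, I) = 0\<close> imply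
  \<open>Ext\<^sup>1(A, I) = 0\<close>. The kernel of \<open>\<pi> \<circ> r\<close> is the first syzygy of \<open>C\<close>.\<close>

lemma ext_van_0_shift:
  assumes ex: "short_exact T A B C \<iota> \<pi>" and I: "lmodule T I" and r: "presents T B m r"
    and s: "presents T (ker_mod (fpow T m) C (\<lambda>v. \<pi> (r v))) l s"
    and B0: "ext_van T I 0 B" and W0: "ext_van T I 0 (ker_mod (fpow T m) C (\<lambda>v. \<pi> (r v)))"
  shows "ext_van T I 0 A"
  unfolding ext_van_def ker_ext_van.simps extends_def
proof (intro allI impI ballI)
  note x = short_exactD[OF ex]
  interpret A: lmodule T A by fact
  interpret B: lmodule T B by fact
  interpret C: lmodule T C by fact
  interpret I: lmodule T I by fact
  fix k p f assume p: "presents T A k p" and f: "f \<in> lmod_hom T (ker_mod (fpow T k) A p) I"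
  let ?G = "fpow T m" and ?F = "fpow T k" and ?H = "fpow T l"
  let ?V = "ker_mod ?F A p" and ?W = "ker_mod ?G C (\<lambda>v. \<pi> (r v))" and ?OB = "ker_mod ?G B r"
  have free: "lmodule T (fpow T i)" for i by (rule lmodule_fpow[OF x(1)])
  interpret F: lmodule T ?F by (rule free)
  interpret H: lmodule T ?H by (rule free)
  have p': "p \<in> lmod_hom T ?F A" "p ` carrier ?F = carrier A" using p by (auto simp: presents_def)
  have r': "r \<in> lmod_hom T ?G B" "r ` carrier ?G = carrier B" using r by (auto simp: presents_def)
  have s': "s \<in> lmod_hom T ?H ?W" "s ` carrier ?H = carrier ?W" using s by (auto simp: presents_def)
  note \<pi>r = lmod_hom_comp[OF r'(1) x(5)]
  have W: "lmodule T ?W" by (rule lmodule_ker_mod[OF free x(3) \<pi>r])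
  have OB: "lmodule T ?OB" by (rule lmodule_ker_mod[OF free x(2) r'(1)])
  have V: "lmodule T ?V" by (rule lmodule_ker_mod[OF free x(1) p'(1)])
  interpret W: lmodule T ?W by (rule W)
  have sG: "s \<in> lmod_hom T ?H ?G" using s'(1) by (auto simp: lmod_hom_def)
  note rs = lmod_hom_comp[OF sG r'(1)]
  have \<iota>p: "(\<lambda>v. \<iota> (p v)) \<in> lmod_hom T ?F B" by (rule lmod_hom_comp[OF p'(1) x(4)])
  \<comment> \<open>\<open>W\<close> maps onto \<open>A\<close> through \<open>r\<close>;
    \<open>g\<close> covers this map on the chosen free modules over \<open>W\<close> and
    \<open>A\<close>.\<close>
  have "\<exists>g\<in>lmod_hom T ?H ?F. \<forall>v\<in>carrier ?H. \<iota> (p (g v)) = r (s v)"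
  proof (rule lift_free[OF free x(2) \<iota>p rs])
    fix v assume v: "v \<in> carrier ?H"
    then have "s v \<in> carrier ?W" by (rule lmod_hom_closed[OF s'(1)])
    then obtain a where a: "a \<in> carrier A" "r (s v) = \<iota> a"
      using x(8)[of "r (s v)"] lmod_hom_closed[OF rs v] by auto
    moreover from a obtain y where "y \<in> carrier ?F" "a = p y" using p'(2) by (metis imageE)
    ultimately show "r (s v) \<in> (\<lambda>v. \<iota> (p v)) ` carrier ?F" by auto
  qed
  then obtain g where g: "g \<in> lmod_hom T ?H ?F" "\<And>v. v \<in> carrier ?H \<Longrightarrow> \<iota> (p (g v)) = r (s v)" by blast
  have gV: "g v \<in> carrier ?V \<longleftrightarrow> r (s v) = \<zero>\<^bsub>B\<^esub>" if "v \<in> carrier ?H" for v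
    using g(2)[OF that] x(10)[of "p (g v)"] lmod_hom_closed[OF g(1) that]
      lmod_hom_closed[OF p'(1)] lmod_hom_zero[OF x(1,2,4)] by auto
  have W_onto: "\<exists>v\<in>carrier ?H. w = s v" if "w \<in> carrier ?W" for w
  proof -
    have "w \<in> s ` carrier ?H" using s'(2) that by blast
    then show ?thesis by auto
  qed
  let ?U = "ker_mod ?H ?W s"
  have sz: "r (s v) = \<zero>\<^bsub>B\<^esub>" if "v \<in> carrier ?U" for v
    using that lmod_hom_zero[OF free x(2) r'(1)] by simp
  have pgU: "p (g v) = \<zero>\<^bsub>A\<^esub>" if "v \<in> carrier ?U" for v using gV[of v] sz[OF that] that by simp
  have fgU: "(\<lambda>v. f (g v)) \<in> lmod_hom T ?U I"
    using lmod_hom_ker_mod[OF g(1)] pgU by (intro lmod_hom_comp[OF _ f] lmod_hom_into_ker_mod) auto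
  \<comment> \<open>Since \<open>Ext^1(W, I) = 0\<close>, the restriction of \<open>f o g\<close> to
    the kernel of \<open>s\<close> extends to all of \<open>T^l\<close>.\<close>
  then obtain e where e: "e \<in> lmod_hom T ?H I" "\<And>v. v \<in> carrier ?U \<Longrightarrow> e v = f (g v)"
    using ext_van_0D[OF W0 s fgU] by blast
  let ?E = "ker_mod ?H B (\<lambda>v. r (s v))"
  have E: "lmodule T ?E" by (rule lmodule_ker_mod[OF free x(2) rs])
  have fgE: "(\<lambda>v. f (g v)) \<in> lmod_hom T ?E I"
    using lmod_hom_ker_mod[OF g(1)] gV by (intro lmod_hom_comp[OF _ f] lmod_hom_into_ker_mod) auto
  have sE: "s \<in> lmod_hom T ?E ?OB"
    using lmod_hom_ker_mod[OF sG] by (intro lmod_hom_into_ker_mod) auto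
  \<comment> \<open>\<open>f o g\<close> makes sense on \<open>?E\<close>, where
    \<open>r o s\<close> vanishes. Its difference to \<open>e\<close> is zero on the kernel of
    \<open>s\<close>, hence descends to the kernel of \<open>r\<close>, and
    \<open>Ext^1(B, I) = 0\<close> extends it further to \<open>T^m\<close>.\<close>
  have "\<exists>c\<in>lmod_hom T ?OB I. \<forall>v\<in>carrier ?E. c (s v) = e v \<ominus>\<^bsub>I\<^esub> f (g v)"
  proof (rule hom_factor[OF E OB I sE _ lmod_hom_difference[OF E I lmod_hom_ker_mod[OF e(1)] fgE]])
    have "w \<in> s ` carrier ?E" if "w \<in> carrier ?OB" for w
    proof -
      have "w \<in> carrier ?W" using that lmod_hom_zero[OF x(2,3,5)] by auto
      then show ?thesis using W_onto[of w] that by auto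
    qed
    then show "s ` carrier ?E = carrier ?OB" using lmod_hom_closed[OF sE] by blast
  next
    fix v assume "v \<in> carrier ?E" "s v = \<zero>\<^bsub>?OB\<^esub>"
    then have v: "v \<in> carrier ?U" "v \<in> carrier ?E" by auto
    show "e v \<ominus>\<^bsub>I\<^esub> f (g v) = \<zero>\<^bsub>I\<^esub>" using e(2)[OF v(1)] lmod_hom_closed[OF fgE v(2)] by (simp add: I.minus_self)
  qed
  then obtain c where c: "c \<in> lmod_hom T ?OB I" "\<And>v. v \<in> carrier ?E \<Longrightarrow> c (s v) = e v \<ominus>\<^bsub>I\<^esub> f (g v)" by blast
  obtain c' where c': "c' \<in> lmod_hom T ?G I" "\<And>w. w \<in> carrier ?OB \<Longrightarrow> c' w = c w"
    using ext_van_0D[OF B0 r c(1)] by blast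
  note c's = lmod_hom_comp[OF sG c'(1)]
  \<comment> \<open>\<open>T^k\<close> is the sum of the image of \<open>g\<close> and
    \<open>?V\<close>. Over their intersection \<open>e\<close> corrected by \<open>c' o s\<close>
    equals \<open>f o g\<close>, so the two prescriptions agree.\<close>
  have "\<exists>h\<in>lmod_hom T ?F I. (\<forall>v\<in>carrier ?H. h (g v) = e v \<ominus>\<^bsub>I\<^esub> c' (s v)) \<and> (\<forall>y\<in>carrier ?V. h y = f y)"
  proof (rule hom_from_two_maps[OF free V free I g(1) lmod_hom_ker_mod[OF lmod_hom_id]
        lmod_hom_difference[OF free I e(1) c's] f])
    fix y assume y: "y \<in> carrier ?F"
    let ?b = "\<iota> (p y)"
    have b: "?b \<in> carrier B" "\<pi> ?b = \<zero>\<^bsub>C\<^esub>" using lmod_hom_closed[OF \<iota>p y] x(7) lmod_hom_closed[OF p'(1) y] by auto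
    then obtain w where w: "w \<in> carrier ?G" "?b = r w" using r'(2) by (metis imageE)
    then obtain v where v: "v \<in> carrier ?H" "w = s v" using W_onto[of w] b by auto
    have gv: "g v \<in> carrier ?F" by (rule lmod_hom_closed[OF g(1) v(1)])
    have "\<iota> (p (y \<ominus>\<^bsub>?F\<^esub> g v)) = \<zero>\<^bsub>B\<^esub>"
      using lmod_hom_diff[OF free x(2) \<iota>p y gv] g(2)[OF v(1)] w v b by (simp add: B.minus_self)
    then have "y \<ominus>\<^bsub>?F\<^esub> g v \<in> carrier ?V" using x(10) y gv lmod_hom_closed[OF p'(1)] by auto
    then show "\<exists>a\<in>carrier ?H. \<exists>x\<in>carrier ?V. y = g a \<oplus>\<^bsub>?F\<^esub> x"
      using v(1) F.add_minus_cancel[OF y gv] by metis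
  next
    fix v y assume v: "v \<in> carrier ?H" and y: "y \<in> carrier ?V" and z: "g v \<oplus>\<^bsub>?F\<^esub> y = \<zero>\<^bsub>?F\<^esub>"
    have gv: "g v \<in> carrier ?F" by (rule lmod_hom_closed[OF g(1) v(1)])
    have "p (g v \<oplus>\<^bsub>?F\<^esub> y) = p (g v)" using gv y by (simp add: lmod_hom_add[OF p'(1)] lmod_hom_closed[OF p'(1)])
    then have pv: "p (g v) = \<zero>\<^bsub>A\<^esub>" using z lmod_hom_zero[OF free x(1) p'(1)] by simp
    then have gvV: "g v \<in> carrier ?V" using gv by simp
    then have vE: "v \<in> carrier ?E" using gV[OF v] v by simp
    have sOB: "s v \<in> carrier ?OB" by (rule lmod_hom_closed[OF sE vE])
    have cl: "e v \<in> carrier I" "f (g v) \<in> carrier I" "f y \<in> carrier I"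
      using lmod_hom_closed[OF e(1) v] lmod_hom_closed[OF fgE vE] lmod_hom_closed[OF f y] .
    have "f (g v) \<oplus>\<^bsub>I\<^esub> f y = f (g v \<oplus>\<^bsub>?F\<^esub> y)" using lmod_hom_add[OF f gvV y] by simp
    also have "\<dots> = \<zero>\<^bsub>I\<^esub>" using lmod_hom_zero[OF V I f] z by simp
    finally have fz: "f (g v) \<oplus>\<^bsub>I\<^esub> f y = \<zero>\<^bsub>I\<^esub>" .
    have "e v \<ominus>\<^bsub>I\<^esub> c' (s v) = e v \<ominus>\<^bsub>I\<^esub> (e v \<ominus>\<^bsub>I\<^esub> f (g v))" using c(2)[OF vE] c'(2)[OF sOB] by simp
    also have "\<dots> = f (g v)" using cl
      by (metis I.M.minus_closed I.add_minus_cancel I.minus_add_cancel I.M.a_comm I.add_minus_cancel')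
    finally show "e v \<ominus>\<^bsub>I\<^esub> c' (s v) \<oplus>\<^bsub>I\<^esub> f y = \<zero>\<^bsub>I\<^esub>" using fz by simp
  qed
  then show "\<exists>h\<in>lmod_hom T ?F I. \<forall>y\<in>carrier ?V. h y = f y" by blast
qed

section \<open>Sums of finite free modules and the horseshoe lemma\<close>

lemma fpow_carrier:
  "v \<in> carrier (fpow T m) \<longleftrightarrow> (\<forall>i<m. v i \<in> carrier T) \<and> (\<forall>i. \<not> i < m \<longrightarrow> v i = \<zero>\<^bsub>T\<^esub>)"
proof -
  have "finite {x. v x \<noteq> \<zero>\<^bsub>T\<^esub>}" if "\<forall>i. \<not> i < m \<longrightarrow> v i = \<zero>\<^bsub>T\<^esub>"
    by (rule finite_subset[of _ "{..<m}"]) (use that in auto)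
  then show ?thesis by (auto simp: free_module_simps)
qed

text \<open>Together with \<open>fpr1\<close> and \<open>fpr2\<close> this identifies
  \<open>T^m + T^l\<close> with \<open>T^(m+l)\<close>. Entries beyond the index range must be zero,
  as membership in \<open>free_module\<close> demands.\<close>

definition fjoin :: "'t ring \<Rightarrow> nat \<Rightarrow> nat \<Rightarrow> (nat \<Rightarrow> 't) \<Rightarrow> (nat \<Rightarrow> 't) \<Rightarrow> nat \<Rightarrow> 't" where
  "fjoin T m l x y = (\<lambda>i. if i < m then x i else if i < m + l then y (i - m) else \<zero>\<^bsub>T\<^esub>)"

definition fpr1 :: "'t ring \<Rightarrow> nat \<Rightarrow> (nat \<Rightarrow> 't) \<Rightarrow> nat \<Rightarrow> 't" where
  "fpr1 T m v = (\<lambda>i. if i < m then v i else \<zero>\<^bsub>T\<^esub>)"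

definition fpr2 :: "'t ring \<Rightarrow> nat \<Rightarrow> nat \<Rightarrow> (nat \<Rightarrow> 't) \<Rightarrow> nat \<Rightarrow> 't" where
  "fpr2 T m l v = (\<lambda>i. if i < l then v (i + m) else \<zero>\<^bsub>T\<^esub>)"

lemma fjoin_carrier:
  "x \<in> carrier (fpow T m) \<Longrightarrow> y \<in> carrier (fpow T l) \<Longrightarrow> fjoin T m l x y \<in> carrier (fpow T (m + l))"
  unfolding fpow_carrier fjoin_def by auto

lemma fpr_fjoin:
  assumes "x \<in> carrier (fpow T m)" "y \<in> carrier (fpow T l)"
  shows "fpr1 T m (fjoin T m l x y) = x" "fpr2 T m l (fjoin T m l x y) = y"
  using assms unfolding fpow_carrier fpr1_def fpr2_def fjoin_def by auto

lemma fjoin_fpr: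
  assumes "v \<in> carrier (fpow T (m + l))"
  shows "fjoin T m l (fpr1 T m v) (fpr2 T m l v) = v"
  using assms unfolding fpow_carrier fpr1_def fpr2_def fjoin_def by auto

lemma fpr_hom:
  assumes "ring T"
  shows "fpr1 T m \<in> lmod_hom T (fpow T (m + l)) (fpow T m)"
    and "fpr2 T m l \<in> lmod_hom T (fpow T (m + l)) (fpow T l)"
proof -
  interpret ring T by fact
  show "fpr1 T m \<in> lmod_hom T (fpow T (m + l)) (fpow T m)"
    by (intro lmod_homI) (auto simp: fpow_carrier, auto simp: free_module_simps(3,4) fpr1_def)
  show "fpr2 T m l \<in> lmod_hom T (fpow T (m + l)) (fpow T l)"
    by (intro lmod_homI) (auto simp: fpow_carrier, auto simp: free_module_simps(3,4) fpr2_def)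
qed

lemma fjoin_hom:
  assumes "ring T"
  shows "(\<lambda>x. fjoin T m l x (\<lambda>i. \<zero>\<^bsub>T\<^esub>)) \<in> lmod_hom T (fpow T m) (fpow T (m + l))"
proof -
  interpret ring T by fact
  show ?thesis
    by (intro lmod_homI) (auto simp: fpow_carrier, auto simp: free_module_simps(3,4) fjoin_def)
qed

text \<open>\<open>r\<close> is \<open>\<iota> o p\<close> on the first \<open>m\<close> coordinates
  and a lift of \<open>q\<close> to \<open>B\<close> on the remaining \<open>l\<close>; the kernels
  then form a short exact sequence by a diagram chase. A single step suffices, since resolutions are
  only built step by step.\<close>

lemma horseshoe:
  assumes ex: "short_exact T A B C \<iota> \<pi>" and p: "presents T A m p" and q: "presents T C l q"
  shows "\<exists>r \<iota>' \<pi>'. presents T B (m + l) r \<and>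
    short_exact T (ker_mod (fpow T m) A p) (ker_mod (fpow T (m + l)) B r) (ker_mod (fpow T l) C q) \<iota>' \<pi>'"
proof -
  note x = short_exactD[OF ex]
  interpret A: lmodule T A by fact
  interpret B: lmodule T B by fact
  interpret C: lmodule T C by fact
  let ?F = "fpow T m" and ?H = "fpow T l" and ?G = "fpow T (m + l)"
  have T: "ring T" by (rule A.R.ring_axioms)
  have free: "lmodule T (fpow T i)" for i by (rule lmodule_fpow[OF x(1)])
  interpret F: lmodule T ?F by (rule free)
  interpret H: lmodule T ?H by (rule free)
  interpret G: lmodule T ?G by (rule free)
  have p': "p \<in> lmod_hom T ?F A" "p ` carrier ?F = carrier A" using p by (auto simp: presents_def)
  have q': "q \<in> lmod_hom T ?H C" "q ` carrier ?H = carrier C" using q by (auto simp: presents_def)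
  obtain s where s: "s \<in> lmod_hom T ?H B" "\<And>v. v \<in> carrier ?H \<Longrightarrow> \<pi> (s v) = q v"
    using lift_presents[OF x(2,3,5) short_exact_onto[OF ex] q] by blast
  let ?p1 = "fpr1 T m" and ?p2 = "fpr2 T m l" and ?j = "fjoin T m l"
  have zF: "\<zero>\<^bsub>?F\<^esub> = (\<lambda>i. \<zero>\<^bsub>T\<^esub>)" "\<zero>\<^bsub>?H\<^esub> = (\<lambda>i. \<zero>\<^bsub>T\<^esub>)" by (simp_all add: free_module_simps)
  have p1: "?p1 \<in> lmod_hom T ?G ?F" and p2: "?p2 \<in> lmod_hom T ?G ?H" using fpr_hom[OF T] by auto
  define r where "r = (\<lambda>v. \<iota> (p (?p1 v)) \<oplus>\<^bsub>B\<^esub> s (?p2 v))"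
  have \<iota>p: "(\<lambda>v. \<iota> (p v)) \<in> lmod_hom T ?F B" by (rule lmod_hom_comp[OF p'(1) x(4)])
  have r: "r \<in> lmod_hom T ?G B" unfolding r_def
    by (rule lmod_hom_sum[OF free x(2) lmod_hom_comp[OF p1 \<iota>p] lmod_hom_comp[OF p2 s(1)]])
  have rj: "r (?j u w) = \<iota> (p u) \<oplus>\<^bsub>B\<^esub> s w" if "u \<in> carrier ?F" "w \<in> carrier ?H" for u w
    using that by (simp add: r_def fpr_fjoin)
  have \<pi>\<iota>p: "\<pi> (\<iota> (p u)) = \<zero>\<^bsub>C\<^esub>" if "u \<in> carrier ?F" for u by (rule x(7)[OF lmod_hom_closed[OF p'(1) that]])
  have \<pi>r: "\<pi> (r v) = q (?p2 v)" if "v \<in> carrier ?G" for v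
    using lmod_hom_closed[OF p1 that] lmod_hom_closed[OF p2 that]
    by (simp add: r_def lmod_hom_add[OF x(5)] lmod_hom_closed[OF \<iota>p] lmod_hom_closed[OF s(1)] \<pi>\<iota>p s(2)
        lmod_hom_closed[OF q'(1)])
  have kerp: "\<exists>u\<in>carrier ?F. b = \<iota> (p u)" if "b \<in> carrier B" "\<pi> b = \<zero>\<^bsub>C\<^esub>" for b
    using x(8)[OF that] p'(2) by (metis imageE)
  have "b \<in> r ` carrier ?G" if b: "b \<in> carrier B" for b
  proof -
    obtain w where w: "w \<in> carrier ?H" "\<pi> b = q w"
      using q'(2) lmod_hom_closed[OF x(5) b] by (metis imageE)
    have sw: "s w \<in> carrier B" by (rule lmod_hom_closed[OF s(1) w(1)])
    have "\<pi> (b \<ominus>\<^bsub>B\<^esub> s w) = \<zero>\<^bsub>C\<^esub>" using b sw w lmod_hom_closed[OF q'(1)]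
      by (simp add: lmod_hom_diff[OF x(2,3,5)] s(2) C.minus_self)
    then obtain u where "u \<in> carrier ?F" "b \<ominus>\<^bsub>B\<^esub> s w = \<iota> (p u)" using kerp[of "b \<ominus>\<^bsub>B\<^esub> s w"] b sw by auto
    then have "u \<in> carrier ?F" "b = r (?j u w)" using rj[of u w] w(1) B.minus_add_cancel[OF b sw] by auto
    then show ?thesis using fjoin_carrier[of u T m w l] w(1) by blast
  qed
  then have pr: "presents T B (m + l) r" using r lmod_hom_closed[OF r] by (auto simp: presents_def)
  let ?A = "ker_mod ?F A p" and ?B = "ker_mod ?G B r" and ?C = "ker_mod ?H C q"
  let ?i = "\<lambda>u. ?j u (\<lambda>i. \<zero>\<^bsub>T\<^esub>)"
  have i: "?i \<in> lmod_hom T ?F ?G" by (rule fjoin_hom[OF T])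
  have s0: "s (\<lambda>i. \<zero>\<^bsub>T\<^esub>) = \<zero>\<^bsub>B\<^esub>" using lmod_hom_zero[OF free x(2) s(1)] by (simp add: zF)
  have z: "(\<lambda>i. \<zero>\<^bsub>T\<^esub>) \<in> carrier ?H" using H.M.zero_closed by (simp add: zF)
  have ri: "r (?i u) = \<iota> (p u)" if "u \<in> carrier ?F" for u
    using rj[OF that z] lmod_hom_closed[OF \<iota>p that] s0 by simp
  have r2: "q (?p2 v) = \<zero>\<^bsub>C\<^esub>" if "v \<in> carrier ?B" for v
    using \<pi>r[of v] that lmod_hom_zero[OF x(2,3,5)] by simp
  have "short_exact T ?A ?B ?C ?i ?p2"
  proof (rule short_exactI)
    show "lmodule T ?A" "lmodule T ?B" "lmodule T ?C"
      using lmodule_ker_mod[OF free x(1) p'(1)] lmodule_ker_mod[OF free x(2) r] lmodule_ker_mod[OF free x(3) q'(1)] .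
    show "?i \<in> lmod_hom T ?A ?B"
      using lmod_hom_ker_mod[OF i] lmod_hom_zero[OF x(1,2,4)] ri by (intro lmod_hom_into_ker_mod) auto
    show "?p2 \<in> lmod_hom T ?B ?C" using lmod_hom_ker_mod[OF p2] r2 by (intro lmod_hom_into_ker_mod)
    fix a assume a: "a \<in> carrier ?A"
    then show "?p2 (?i a) = \<zero>\<^bsub>?C\<^esub>" using fpr_fjoin(2)[OF _ z] by (simp add: zF)
    assume "?i a = \<zero>\<^bsub>?B\<^esub>"
    then have "a = ?p1 \<zero>\<^bsub>?G\<^esub>" using a fpr_fjoin(1)[of a T m "\<lambda>i. \<zero>\<^bsub>T\<^esub>" l] z by simp
    then show "a = \<zero>\<^bsub>?A\<^esub>" using lmod_hom_zero[OF free free p1] by simp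
  next
    fix v assume v: "v \<in> carrier ?B" "?p2 v = \<zero>\<^bsub>?C\<^esub>"
    then have vG: "v \<in> carrier ?G" by simp
    have p1v: "?p1 v \<in> carrier ?F" by (rule lmod_hom_closed[OF p1 vG])
    have veq: "v = ?i (?p1 v)" using fjoin_fpr[OF vG] v by (simp add: zF)
    then have "\<iota> (p (?p1 v)) = \<zero>\<^bsub>B\<^esub>" using ri[OF p1v] v by simp
    then have "p (?p1 v) = \<zero>\<^bsub>A\<^esub>" using x(10) lmod_hom_closed[OF p'(1) p1v] by blast
    then show "\<exists>a\<in>carrier ?A. v = ?i a" using veq p1v by (intro bexI[of _ "?p1 v"]) auto
  next
    fix w assume w: "w \<in> carrier ?C"
    then have wH: "w \<in> carrier ?H" by simp
    have sw: "s w \<in> carrier B" by (rule lmod_hom_closed[OF s(1) wH])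
    \<comment> \<open>The lift \<open>s w\<close> of \<open>q w = 0\<close> need not vanish, but it
      lies in the image of \<open>A\<close>, so the first coordinates can cancel it.\<close>
    have "\<pi> (\<ominus>\<^bsub>B\<^esub> s w) = \<zero>\<^bsub>C\<^esub>" using w s(2)[OF wH] sw by (simp add: lmod_hom_minus[OF x(2,3,5)])
    then obtain u where u: "u \<in> carrier ?F" "\<ominus>\<^bsub>B\<^esub> s w = \<iota> (p u)" using kerp[of "\<ominus>\<^bsub>B\<^esub> s w"] sw by auto
    have "r (?j u w) = \<zero>\<^bsub>B\<^esub>" using rj[OF u(1) wH] sw by (simp flip: u(2) add: B.M.l_neg)
    then show "\<exists>v\<in>carrier ?B. w = ?p2 v" using fjoin_carrier[OF u(1) wH] fpr_fjoin(2)[OF u(1) wH]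
      by (intro bexI[of _ "?j u w"]) auto
  qed
  then show ?thesis using pr by blast
qed

section \<open>Super finitely presented modules\<close>

text \<open>Replaces the choice of an infinite resolution, so that closure properties reduce to one
  step each. The predicate lives at the type of syzygies; \<open>super_fp\<close> adds the first
  step for modules of any type.\<close>

coinductive fp_syzygies :: "'t ring \<Rightarrow> ('t, nat \<Rightarrow> 't) module \<Rightarrow> bool" for T where
  "\<lbrakk>lmodule T W; presents T W m p; fp_syzygies T (ker_mod (fpow T m) W p)\<rbrakk> \<Longrightarrow> fp_syzygies T W"

definition super_fp :: "'t ring \<Rightarrow> ('t, 'u) module \<Rightarrow> bool" where
  "super_fp T U \<longleftrightarrow> lmodule T U \<and> (\<exists>m p. presents T U m p \<and> fp_syzygies T (ker_mod (fpow T m) U p))"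

lemma fp_syzygiesD:
  "fp_syzygies T W \<Longrightarrow> \<exists>m p. presents T W m p \<and> fp_syzygies T (ker_mod (fpow T m) W p)"
  by (erule fp_syzygies.cases) blast

lemma fp_syzygies_iff: "fp_syzygies T W \<longleftrightarrow> super_fp T W"
  unfolding super_fp_def by (subst fp_syzygies.simps) blast

text \<open>Coinduction with the invariant of being the middle term of such a sequence, which
  \<open>horseshoe\<close> hands on to the syzygies.\<close>

lemma fp_syzygies_extension:
  fixes T :: "'t ring"
  assumes "short_exact T A B C \<iota> \<pi>" "fp_syzygies T A" "fp_syzygies T C"
  shows "fp_syzygies T B"
proof -
  define X :: "('t, nat \<Rightarrow> 't) module \<Rightarrow> bool" where "X B \<longleftrightarrow> (\<exists>A C \<iota> \<pi>. short_exact T A B C \<iota> \<pi> \<and> fp_syzygies T A \<and> fp_syzygies T C)" for B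
  have "X B" using assms unfolding X_def by blast
  then show ?thesis
  proof (coinduct B rule: fp_syzygies.coinduct)
    case (fp_syzygies B)
    then obtain A C \<iota> \<pi> where ex: "short_exact T A B C \<iota> \<pi>" "fp_syzygies T A" "fp_syzygies T C"
      unfolding X_def by blast
    then obtain m p l q where p: "presents T A m p" "fp_syzygies T (ker_mod (fpow T m) A p)"
      and q: "presents T C l q" "fp_syzygies T (ker_mod (fpow T l) C q)"
      using fp_syzygiesD by metis
    from horseshoe[OF ex(1) p(1) q(1)] p q have "\<exists>r. presents T B (m + l) r \<and> X (ker_mod (fpow T (m + l)) B r)"
      unfolding X_def by blast
    then show ?case using short_exactD(2)[OF ex(1)] by blast
  qed
qed

lemma super_fp_extension:
  assumes ex: "short_exact T A B C \<iota> \<pi>" and "super_fp T A" "super_fp T C"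
  shows "super_fp T B"
proof -
  obtain m p l q where p: "presents T A m p" "fp_syzygies T (ker_mod (fpow T m) A p)"
    and q: "presents T C l q" "fp_syzygies T (ker_mod (fpow T l) C q)"
    using assms unfolding super_fp_def by blast
  from horseshoe[OF ex(1) p(1) q(1)] p q fp_syzygies_extension short_exactD(2)[OF ex]
  show ?thesis unfolding super_fp_def by blast
qed

text \<open>By \<open>presents_cokernel\<close> a syzygy of \<open>C\<close> is an extension of
  \<open>A\<close> by a syzygy of \<open>B\<close>.\<close>

lemma super_fp_cokernel:
  assumes ex: "short_exact T A B C \<iota> \<pi>" and A: "super_fp T A" and B: "super_fp T B"
  shows "super_fp T C"
proof -
  obtain m r where r: "presents T B m r" "fp_syzygies T (ker_mod (fpow T m) B r)"
    using B unfolding super_fp_def by blast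
  note c = presents_cokernel[OF ex r(1)]
  have "super_fp T (ker_mod (fpow T m) C (\<lambda>v. \<pi> (r v)))"
    using super_fp_extension[OF c(2)] r(2) A by (simp add: fp_syzygies_iff)
  then show ?thesis using c(1) short_exactD(3)[OF ex]
    unfolding super_fp_def[of T C] fp_syzygies_iff[symmetric] by blast
qed

lemma super_fp_iso:
  assumes "super_fp T U" "h \<in> lmod_hom T U V" "bij_betw h (carrier U) (carrier V)" "lmodule T V"
  shows "super_fp T V"
  using assms presents_iso[OF _ assms(2,3) _ assms(4)] unfolding super_fp_def by metis

lemma super_fp_presents: "super_fp T U \<Longrightarrow> \<exists>m p. presents T U m p"
  unfolding super_fp_def by blast

text \<open>Presented by \<open>T^0\<close> with a kernel that is zero again and of the same type,
  which closes the coinduction.\<close>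

lemma zero_module_fp:
  fixes W :: "('t, nat \<Rightarrow> 't) module"
  assumes "lmodule T W" "carrier W = {\<zero>\<^bsub>W\<^esub>}"
  shows "fp_syzygies T W"
  using assms
proof (coinduction arbitrary: W rule: fp_syzygies.coinduct)
  case (fp_syzygies W)
  interpret W: lmodule T W by fact
  have free: "lmodule T (fpow T 0)" by (rule lmodule_fpow[OF fp_syzygies(1)])
  have z: "carrier (fpow T 0) = {\<zero>\<^bsub>fpow T 0\<^esub>}" by (auto simp: free_module_simps)
  have h: "(\<lambda>_. \<zero>\<^bsub>W\<^esub>) \<in> lmod_hom T (fpow T 0) W" by (auto simp: lmod_hom_def W.smult_zero_right)
  have "presents T W 0 (\<lambda>_. \<zero>\<^bsub>W\<^esub>)" unfolding presents_def
    using h z fp_syzygies by auto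
  moreover have "lmodule T (ker_mod (fpow T 0) W (\<lambda>_. \<zero>\<^bsub>W\<^esub>))"
    by (rule lmodule_ker_mod[OF free fp_syzygies(1) h])
  moreover have "carrier (ker_mod (fpow T 0) W (\<lambda>_. \<zero>\<^bsub>W\<^esub>)) = {\<zero>\<^bsub>ker_mod (fpow T 0) W (\<lambda>_. \<zero>\<^bsub>W\<^esub>)\<^esub>}"
    using z by (simp add: set_eq_iff)
  ultimately show ?case using fp_syzygies(1) by blast
qed

lemma super_fp_zero:
  assumes "lmodule T W" "carrier W = {\<zero>\<^bsub>W\<^esub>}"
  shows "super_fp T W"
proof -
  interpret W: lmodule T W by fact
  have free: "lmodule T (fpow T 0)" by (rule lmodule_fpow[OF assms(1)])
  have z: "carrier (fpow T 0) = {\<zero>\<^bsub>fpow T 0\<^esub>}" by (auto simp: free_module_simps)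
  have h: "(\<lambda>_. \<zero>\<^bsub>W\<^esub>) \<in> lmod_hom T (fpow T 0) W" by (auto simp: lmod_hom_def W.smult_zero_right)
  have "presents T W 0 (\<lambda>_. \<zero>\<^bsub>W\<^esub>)" unfolding presents_def using h z assms by auto
  moreover have "fp_syzygies T (ker_mod (fpow T 0) W (\<lambda>_. \<zero>\<^bsub>W\<^esub>))"
  proof (rule zero_module_fp[OF lmodule_ker_mod[OF free assms(1) h]])
    show "carrier (ker_mod (fpow T 0) W (\<lambda>_. \<zero>\<^bsub>W\<^esub>)) = {\<zero>\<^bsub>ker_mod (fpow T 0) W (\<lambda>_. \<zero>\<^bsub>W\<^esub>)\<^esub>}"
      using z by (simp add: set_eq_iff)
  qed
  ultimately show ?thesis unfolding super_fp_def using assms(1) by blast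
qed

lemma super_fp_fpow:
  assumes "ring T" shows "super_fp T (fpow T m)"
proof -
  have free: "lmodule T (fpow T m)" by (rule lmodule_free_module[OF assms])
  interpret F: lmodule T "fpow T m" by (rule free)
  let ?K = "ker_mod (fpow T m) (fpow T m) (\<lambda>v. v)"
  have "presents T (fpow T m) m (\<lambda>v. v)" by (simp add: presents_def lmod_hom_id)
  moreover have "fp_syzygies T ?K"
  proof (rule zero_module_fp[OF lmodule_ker_mod[OF free free lmod_hom_id]])
    show "carrier ?K = {\<zero>\<^bsub>?K\<^esub>}" by auto
  qed
  ultimately show ?thesis unfolding super_fp_def using free by blast
qed

text \<open>The kernel \<open>P\<close> of \<open>(x, y) \<mapsto> p x - q y\<close> on \<open>T\<^sup>m \<oplus> T\<^sup>l\<close> is an extension of \<open>T\<^sup>m\<close> by the kernel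
  of \<open>q\<close>, and the kernel of \<open>p\<close> is the cokernel of a map \<open>T\<^sup>l \<rightarrow> P\<close>.\<close>

lemma super_fp_ker:
  assumes A: "super_fp T A" and p: "presents T A m p"
  shows "super_fp T (ker_mod (fpow T m) A p)"
proof -
  obtain l q where q: "presents T A l q" "super_fp T (ker_mod (fpow T l) A q)"
    using A unfolding super_fp_def[of T A] fp_syzygies_iff by blast
  have Am: "lmodule T A" using A by (simp add: super_fp_def)
  interpret A: lmodule T A by (rule Am)
  let ?F = "fpow T m" and ?H = "fpow T l" and ?G = "fpow T (m + l)"
  have T: "ring T" by (rule A.R.ring_axioms)
  have free: "lmodule T (fpow T i)" for i by (rule lmodule_fpow[OF Am])
  interpret F: lmodule T ?F by (rule free)
  interpret H: lmodule T ?H by (rule free)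
  interpret G: lmodule T ?G by (rule free)
  have p': "p \<in> lmod_hom T ?F A" "p ` carrier ?F = carrier A" using p by (auto simp: presents_def)
  have q': "q \<in> lmod_hom T ?H A" "q ` carrier ?H = carrier A" using q by (auto simp: presents_def)
  let ?p1 = "fpr1 T m" and ?p2 = "fpr2 T m l" and ?j = "fjoin T m l"
  have p1: "?p1 \<in> lmod_hom T ?G ?F" and p2: "?p2 \<in> lmod_hom T ?G ?H" using fpr_hom[OF T] by auto
  \<comment> \<open>The kernel \<open>?P\<close> of \<open>t\<close> is the pullback of
    \<open>p\<close> and \<open>q\<close>, as in Schanuel's lemma.\<close>
  define t where "t = (\<lambda>v. p (?p1 v) \<ominus>\<^bsub>A\<^esub> q (?p2 v))"
  have t: "t \<in> lmod_hom T ?G A" unfolding t_def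
    by (rule lmod_hom_difference[OF free Am lmod_hom_comp[OF p1 p'(1)] lmod_hom_comp[OF p2 q'(1)]])
  let ?P = "ker_mod ?G A t" and ?K = "ker_mod ?F A p" and ?L = "ker_mod ?H A q"
  have P: "lmodule T ?P" by (rule lmodule_ker_mod[OF free Am t])
  have K: "lmodule T ?K" by (rule lmodule_ker_mod[OF free Am p'(1)])
  have L: "lmodule T ?L" by (rule lmodule_ker_mod[OF free Am q'(1)])
  have cl: "p u \<in> carrier A" "q w \<in> carrier A" if "u \<in> carrier ?F" "w \<in> carrier ?H" for u w
    using that lmod_hom_closed[OF p'(1)] lmod_hom_closed[OF q'(1)] by auto
  have jP: "?j u w \<in> carrier ?P \<longleftrightarrow> p u = q w" if "u \<in> carrier ?F" "w \<in> carrier ?H" for u w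
    using that fjoin_carrier[OF that] cl[OF that] by (simp add: t_def fpr_fjoin A.minus_eq_zero_iff)
  have Pj: "\<exists>u\<in>carrier ?F. \<exists>w\<in>carrier ?H. v = ?j u w \<and> p u = q w" if v: "v \<in> carrier ?P" for v
  proof -
    have c: "?p1 v \<in> carrier ?F" "?p2 v \<in> carrier ?H"
      using v lmod_hom_closed[OF p1] lmod_hom_closed[OF p2] by auto
    have "v = ?j (?p1 v) (?p2 v)" using fjoin_fpr[of v T m l] v by simp
    then show ?thesis using jP[OF c] c v by auto
  qed
  have z: "(\<lambda>i. \<zero>\<^bsub>T\<^esub>) \<in> carrier (fpow T i)" "\<zero>\<^bsub>fpow T i\<^esub> = (\<lambda>i. \<zero>\<^bsub>T\<^esub>)" for i
    by (simp_all add: free_module_simps A.R.ring_simprules)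
  have p0: "p (\<lambda>i. \<zero>\<^bsub>T\<^esub>) = \<zero>\<^bsub>A\<^esub>" "q (\<lambda>i. \<zero>\<^bsub>T\<^esub>) = \<zero>\<^bsub>A\<^esub>"
    using lmod_hom_zero[OF free Am p'(1)] lmod_hom_zero[OF free Am q'(1)] by (simp_all add: z)
  have jadd: "?j u w \<oplus>\<^bsub>?G\<^esub> ?j u' w' = ?j (u \<oplus>\<^bsub>?F\<^esub> u') (w \<oplus>\<^bsub>?H\<^esub> w')" for u w u' w'
    by (auto simp: free_module_simps(3) fjoin_def A.R.ring_simprules)
  have jsm: "a \<in> carrier T \<Longrightarrow> a \<odot>\<^bsub>?G\<^esub> ?j u w = ?j (a \<odot>\<^bsub>?F\<^esub> u) (a \<odot>\<^bsub>?H\<^esub> w)" for a u w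
    by (auto simp: free_module_simps(4) fjoin_def A.R.ring_simprules)
  have "short_exact T ?L ?P ?F (\<lambda>w. ?j (\<lambda>i. \<zero>\<^bsub>T\<^esub>) w) ?p1"
  proof (rule short_exactI[OF L P free _ lmod_hom_ker_mod[OF p1]])
    show "(\<lambda>w. ?j (\<lambda>i. \<zero>\<^bsub>T\<^esub>) w) \<in> lmod_hom T ?L ?P"
    proof (rule lmod_homI)
      fix w assume "w \<in> carrier ?L"
      then show "?j (\<lambda>i. \<zero>\<^bsub>T\<^esub>) w \<in> carrier ?P" using jP[OF z(1)] p0 by auto
    qed (auto simp: free_module_simps(3,4) fjoin_def A.R.ring_simprules)
  next
    fix w assume w: "w \<in> carrier ?L"
    show "?p1 (?j (\<lambda>i. \<zero>\<^bsub>T\<^esub>) w) = \<zero>\<^bsub>?F\<^esub>" using w fpr_fjoin(1)[OF z(1)] by (simp add: z)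
    assume "?j (\<lambda>i. \<zero>\<^bsub>T\<^esub>) w = \<zero>\<^bsub>?P\<^esub>"
    then have "w = ?p2 \<zero>\<^bsub>?G\<^esub>" using w fpr_fjoin(2)[OF z(1), of w l m] by simp
    then show "w = \<zero>\<^bsub>?L\<^esub>" using lmod_hom_zero[OF free free p2] by simp
  next
    fix v assume "v \<in> carrier ?P" "?p1 v = \<zero>\<^bsub>?F\<^esub>"
    then show "\<exists>w\<in>carrier ?L. v = ?j (\<lambda>i. \<zero>\<^bsub>T\<^esub>) w"
      using Pj[of v] fpr_fjoin(1) p0 z by fastforce
  next
    fix u assume u: "u \<in> carrier ?F"
    then have "p u \<in> q ` carrier ?H" using q'(2) lmod_hom_closed[OF p'(1)] by simp
    then obtain w where w: "w \<in> carrier ?H" "p u = q w" by auto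
    then show "\<exists>v\<in>carrier ?P. u = ?p1 v" using jP[OF u w(1)] fpr_fjoin(1)[OF u w(1)] by (intro bexI[of _ "?j u w"]) auto
  qed
  from super_fp_extension[OF this q(2) super_fp_fpow[OF T]] have sP: "super_fp T ?P" .
  \<comment> \<open>A lift \<open>g\<close> of \<open>q\<close> along \<open>p\<close> embeds
    \<open>T^l\<close> into the pullback by \<open>w \<mapsto> (g w, w)\<close>; the cokernel is the
    kernel of \<open>p\<close>, reached by \<open>(u, w) \<mapsto> u - g w\<close>.\<close>
  obtain g where g: "g \<in> lmod_hom T ?H ?F" "\<And>v. v \<in> carrier ?H \<Longrightarrow> p (g v) = q v"
    using lift_presents[OF free Am p'(1,2) q(1)] by blast
  note gc = lmod_hom_closed[OF g(1)]
  let ?d = "\<lambda>v. ?p1 v \<ominus>\<^bsub>?F\<^esub> g (?p2 v)"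
  have d: "?d \<in> lmod_hom T ?G ?F" by (rule lmod_hom_difference[OF free free p1 lmod_hom_comp[OF p2 g(1)]])
  have dj: "?d (?j u w) = u \<ominus>\<^bsub>?F\<^esub> g w" if "u \<in> carrier ?F" "w \<in> carrier ?H" for u w
    using that by (simp add: fpr_fjoin)
  have pd: "p (?d v) = \<zero>\<^bsub>A\<^esub>" if v: "v \<in> carrier ?P" for v
  proof -
    from Pj[OF v] obtain u w where uw: "u \<in> carrier ?F" "w \<in> carrier ?H" "v = ?j u w" "p u = q w" by blast
    have "p (u \<ominus>\<^bsub>?F\<^esub> g w) = \<zero>\<^bsub>A\<^esub>" using uw(1,2,4) cl(2)[OF uw(1,2)] gc[OF uw(2)]
      by (simp add: lmod_hom_diff[OF free Am p'(1)] g(2) A.minus_self)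
    then show ?thesis by (simp only: uw(3) dj[OF uw(1,2)])
  qed
  have "short_exact T ?H ?P ?K (\<lambda>w. ?j (g w) w) ?d"
  proof (rule short_exactI[OF free P K])
    show "?d \<in> lmod_hom T ?P ?K" by (intro lmod_hom_into_ker_mod[OF lmod_hom_ker_mod[OF d]] pd)
    show "(\<lambda>w. ?j (g w) w) \<in> lmod_hom T ?H ?P"
      by (rule lmod_homI) (simp_all add: jP gc g(2) lmod_hom_add[OF g(1)] lmod_hom_smult[OF g(1)] jadd jsm
          del: ker_mod_simps(1))
  next
    fix w assume w: "w \<in> carrier ?H"
    show "?d (?j (g w) w) = \<zero>\<^bsub>?K\<^esub>" unfolding dj[OF gc[OF w] w] using gc[OF w] by (simp add: F.minus_self)
    assume "?j (g w) w = \<zero>\<^bsub>?P\<^esub>"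
    then have "w = ?p2 \<zero>\<^bsub>?G\<^esub>" using w fpr_fjoin(2)[OF gc[OF w] w] by simp
    then show "w = \<zero>\<^bsub>?H\<^esub>" using lmod_hom_zero[OF free free p2] by simp
  next
    fix v assume v: "v \<in> carrier ?P" "?d v = \<zero>\<^bsub>?K\<^esub>"
    from Pj[OF v(1)] obtain u w where uw: "u \<in> carrier ?F" "w \<in> carrier ?H" "v = ?j u w" by blast
    have "?d v = u \<ominus>\<^bsub>?F\<^esub> g w" unfolding uw(3) by (rule dj[OF uw(1,2)])
    then have "u \<ominus>\<^bsub>?F\<^esub> g w = \<zero>\<^bsub>?F\<^esub>" using v(2) by simp
    then have "u = g w" using uw gc by (simp add: F.minus_eq_zero_iff)
    then show "\<exists>w\<in>carrier ?H. v = ?j (g w) w" using uw by blast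
  next
    fix u assume u: "u \<in> carrier ?K"
    then have uF: "u \<in> carrier ?F" by simp
    have "?j u (\<lambda>i. \<zero>\<^bsub>T\<^esub>) \<in> carrier ?P" using jP[OF uF z(1)] u p0 by (simp del: ker_mod_simps(1)) simp
    moreover have "u = ?d (?j u (\<lambda>i. \<zero>\<^bsub>T\<^esub>))"
    proof -
      have "?d (?j u (\<lambda>i. \<zero>\<^bsub>T\<^esub>)) = u \<ominus>\<^bsub>?F\<^esub> g \<zero>\<^bsub>?H\<^esub>" using dj[OF uF z(1)] by (simp only: z(2))
      also have "\<dots> = u" using lmod_hom_zero[OF free free g(1)] uF
        by (simp add: a_minus_def)
      finally show ?thesis by simp
    qed
    ultimately show "\<exists>v\<in>carrier ?P. u = ?d v" by blast
  qed
  from super_fp_cokernel[OF this super_fp_fpow[OF T] sP] show ?thesis .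
qed

section \<open>Dimension shifting and extensions for \<open>ext_van\<close>\<close>

lemma ext_van_SucD:
  "ext_van T I (Suc k) U \<Longrightarrow> presents T U m p \<Longrightarrow> ext_van T I k (ker_mod (fpow T m) U p)"
  unfolding ext_van_def[of T I "Suc k" U] ker_ext_van_Suc by blast

lemma ext_van_SucI:
  "(\<And>m p. presents T U m p \<Longrightarrow> ext_van T I k (ker_mod (fpow T m) U p)) \<Longrightarrow> ext_van T I (Suc k) U"
  unfolding ext_van_def[of T I "Suc k" U] ker_ext_van_Suc by blast

lemma ext_van_shift_0:
  assumes ex: "short_exact T A B C \<iota> \<pi>" and I: "lmodule T I" and A: "super_fp T A" and C: "super_fp T C"
    and B0: "ext_van T I 0 B" and C1: "ext_van T I (Suc 0) C"
  shows "ext_van T I 0 A"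
proof -
  have "super_fp T B" by (rule super_fp_extension[OF ex A C])
  then obtain m r where r: "presents T B m r" using super_fp_presents by blast
  note c = presents_cokernel[OF ex r]
  obtain l s where s: "presents T (ker_mod (fpow T m) C (\<lambda>v. \<pi> (r v))) l s"
    using super_fp_presents[OF super_fp_ker[OF C c(1)]] by blast
  show ?thesis by (rule ext_van_0_shift[OF ex I r s B0 ext_van_SucD[OF C1 c(1)]])
qed

text \<open>The claim for syzygies enters as the hypothesis \<open>step\<close>. An induction
  hypothesis is available at one type only, and that has to be the type of syzygies, whereas
  \<open>A\<close>, \<open>B\<close>, \<open>C\<close> here may have other types.\<close>

lemma ext_van_shift_step:
  assumes ex: "short_exact T A B C \<iota> \<pi>" and A: "super_fp T A" and C: "super_fp T C"
    and step: "\<And>(A' :: ('t, nat \<Rightarrow> 't) module) (B' :: ('t, nat \<Rightarrow> 't) module) (C' :: ('t, nat \<Rightarrow> 't) module) \<iota>' \<pi>'.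
      \<lbrakk>short_exact T A' B' C' \<iota>' \<pi>'; super_fp T A'; super_fp T C'; ext_van T I k B'; ext_van T I (Suc k) C'\<rbrakk>
        \<Longrightarrow> ext_van T I k A'"
    and B1: "ext_van T I (Suc k) B" and C2: "ext_van T I (Suc (Suc k)) C"
  shows "ext_van T I (Suc k) A"
proof (rule ext_van_SucI)
  fix m p assume p: "presents T A m p"
  obtain l q where q: "presents T C l q" using super_fp_presents[OF C] by blast
  from horseshoe[OF ex p q] obtain r \<iota>' \<pi>' where r: "presents T B (m + l) r"
    "short_exact T (ker_mod (fpow T m) A p) (ker_mod (fpow T (m + l)) B r) (ker_mod (fpow T l) C q) \<iota>' \<pi>'"
    by blast
  show "ext_van T I k (ker_mod (fpow T m) A p)"
    by (rule step[OF r(2) super_fp_ker[OF A p] super_fp_ker[OF C q] ext_van_SucD[OF B1 r(1)] ext_van_SucD[OF C2 q]])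
qed

lemma ext_van_shift_syzygies:
  fixes A B C :: "('t, nat \<Rightarrow> 't) module"
  assumes "short_exact T A B C \<iota> \<pi>" "super_fp T A" "super_fp T C" "lmodule T I"
    "ext_van T I k B" "ext_van T I (Suc k) C"
  shows "ext_van T I k A"
  using assms
proof (induction k arbitrary: A B C \<iota> \<pi>)
  case 0
  show ?case by (rule ext_van_shift_0[OF 0(1,4,2,3,5,6)])
next
  case (Suc k)
  show ?case
  proof (rule ext_van_shift_step[OF Suc.prems(1-3) _ Suc.prems(5,6)])
    fix A' B' C' :: "('t, nat \<Rightarrow> 't) module" and \<iota>' \<pi>'
    assume a: "short_exact T A' B' C' \<iota>' \<pi>'" "super_fp T A'" "super_fp T C'"
      "ext_van T I k B'" "ext_van T I (Suc k) C'"
    show "ext_van T I k A'" by (rule Suc.IH[OF a(1-3) Suc.prems(4) a(4,5)])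
  qed
qed

text \<open>From the exact sequence
  \<open>Ext^(k+1)(B, I) -> Ext^(k+1)(A, I) -> Ext^(k+2)(C, I)\<close>. Only the outermost step is
  at arbitrary types; below it \<open>ext_van_shift_syzygies\<close> takes over.\<close>

lemma ext_van_shift:
  assumes ex: "short_exact T A B C \<iota> \<pi>" and A: "super_fp T A" and C: "super_fp T C" and I: "lmodule T I"
    and B: "ext_van T I k B" "ext_van T I (Suc k) C"
  shows "ext_van T I k A"
proof (cases k)
  case 0
  then show ?thesis using B ext_van_shift_0[OF ex I A C] by simp
next
  case (Suc j)
  show ?thesis unfolding Suc
  proof (rule ext_van_shift_step[OF ex A C _ B[unfolded Suc]])
    fix A' B' C' :: "('a, nat \<Rightarrow> 'a) module" and \<iota>' \<pi>'
    assume a: "short_exact T A' B' C' \<iota>' \<pi>'" "super_fp T A'" "super_fp T C'"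
      "ext_van T I j B'" "ext_van T I (Suc j) C'"
    show "ext_van T I j A'" by (rule ext_van_shift_syzygies[OF a(1-3) I a(4,5)])
  qed
qed

text \<open>By \<open>presents_cokernel\<close> a syzygy \<open>V\<close> of \<open>B\<close> lies
  in a syzygy \<open>W\<close> of \<open>C\<close> with quotient \<open>A\<close>. For
  \<open>k = 0\<close> a map on \<open>V\<close> extends to \<open>W\<close> because of
  \<open>A\<close> and then to the free module because of \<open>C\<close>; for larger
  \<open>k\<close> the shift along \<open>V -> W -> A\<close> gives the claim.\<close>

lemma ext_van_extension:
  assumes ex: "short_exact T A B C \<iota> \<pi>" and A: "super_fp T A" and C: "super_fp T C" and I: "lmodule T I"
    and Ak: "ext_van T I k A" and Ck: "ext_van T I k C"
  shows "ext_van T I k B"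
proof (cases k)
  case 0
  show ?thesis unfolding 0 ext_van_def ker_ext_van.simps extends_def
  proof (intro allI impI ballI)
    fix m r f assume r: "presents T B m r" and f: "f \<in> lmod_hom T (ker_mod (fpow T m) B r) I"
    note c = presents_cokernel[OF ex r]
    obtain l s where s: "presents T A l s" using super_fp_presents[OF A] by blast
    let ?W = "ker_mod (fpow T m) C (\<lambda>v. \<pi> (r v))"
    obtain g where g: "g \<in> lmod_hom T ?W I" "\<And>v. v \<in> carrier (ker_mod (fpow T m) B r) \<Longrightarrow> g v = f v"
      using ext_van_0_extends[OF c(2) I _ s f] Ak 0 by auto
    obtain h where h: "h \<in> lmod_hom T (fpow T m) I" "\<And>v. v \<in> carrier ?W \<Longrightarrow> h v = g v"
      using ext_van_0D[OF _ c(1) g(1)] Ck 0 by auto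
    have "v \<in> carrier ?W" if "v \<in> carrier (ker_mod (fpow T m) B r)" for v
      using lmod_hom_closed[OF short_exactD(4)[OF c(2)] that] .
    then show "\<exists>g\<in>lmod_hom T (fpow T m) I. \<forall>x\<in>carrier (ker_mod (fpow T m) B r). g x = f x"
      using h g(2) by (intro bexI[of _ h]) auto
  qed
next
  case (Suc j)
  show ?thesis unfolding Suc
  proof (rule ext_van_SucI)
    fix m r assume r: "presents T B m r"
    note c = presents_cokernel[OF ex r]
    have "super_fp T B" by (rule super_fp_extension[OF ex A C])
    then have "super_fp T (ker_mod (fpow T m) B r)" by (rule super_fp_ker[OF _ r])
    from ext_van_shift[OF c(2) this A I ext_van_SucD[OF Ck[unfolded Suc] c(1)] Ak[unfolded Suc]]
    show "ext_van T I j (ker_mod (fpow T m) B r)" .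
  qed
qed

section \<open>Comparison with the Ext groups\<close>

lemma trivial_factor_group_iff:
  assumes "comm_group G" "subgroup B G"
  shows "trivial_group (G Mod B) \<longleftrightarrow> carrier G \<subseteq> B"
proof -
  interpret comm_group G by fact
  have n: "B \<lhd> G" by (rule subgroup_imp_normal[OF assms(2)])
  interpret n: normal B G by (rule n)
  have "carrier (G Mod B) = {B} \<longleftrightarrow> carrier G \<subseteq> B"
  proof
    assume "carrier (G Mod B) = {B}"
    then have "B #>\<^bsub>G\<^esub> x = B" if "x \<in> carrier G" for x using that by (auto simp: FactGroup_def RCOSETS_def)
    then show "carrier G \<subseteq> B" using rcos_self[OF _ assms(2)] by blast
  next
    assume "carrier G \<subseteq> B"
    then have "B #>\<^bsub>G\<^esub> x = B" if "x \<in> carrier G" for x using that by (metis coset_join2 subsetD assms(2))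
    then show "carrier (G Mod B) = {B}" by (auto simp: FactGroup_def RCOSETS_def)
  qed
  then show ?thesis using n.factorgroup_is_group by (simp add: trivial_group_def FactGroup_def)
qed

lemma hom_group_simps [simp]:
  "f \<in> carrier (hom_group T M N) \<longleftrightarrow> f \<in> lmod_hom T M N \<and> f \<in> extensional (carrier M)"
  "f \<otimes>\<^bsub>hom_group T M N\<^esub> g = (\<lambda>x\<in>carrier M. f x \<oplus>\<^bsub>N\<^esub> g x)"
  "\<one>\<^bsub>hom_group T M N\<^esub> = (\<lambda>x\<in>carrier M. \<zero>\<^bsub>N\<^esub>)"
  by (auto simp: hom_group_def)

lemma restrict_lmod_hom: "lmodule T M \<Longrightarrow> f \<in> lmod_hom T M N \<Longrightarrow> restrict f (carrier M) \<in> lmod_hom T M N"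
  by (erule lmod_hom_cong) auto

lemma comm_group_hom_group:
  assumes M: "lmodule T M" and N: "lmodule T N"
  shows "comm_group (hom_group T M N)"
proof -
  interpret M: lmodule T M by fact
  interpret N: lmodule T N by fact
  show ?thesis
  proof (rule comm_groupI)
    fix f g h assume f: "f \<in> carrier (hom_group T M N)" and g: "g \<in> carrier (hom_group T M N)"
    show "f \<otimes>\<^bsub>hom_group T M N\<^esub> g \<in> carrier (hom_group T M N)"
      using f g lmod_hom_sum[OF M N, of f g] by (auto intro: restrict_lmod_hom[OF M])
    show "f \<otimes>\<^bsub>hom_group T M N\<^esub> g = g \<otimes>\<^bsub>hom_group T M N\<^esub> f"
      using f g by (auto simp: fun_eq_iff restrict_def lmod_hom_closed N.M.a_comm)
    assume "h \<in> carrier (hom_group T M N)"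
    then show "f \<otimes>\<^bsub>hom_group T M N\<^esub> g \<otimes>\<^bsub>hom_group T M N\<^esub> h = f \<otimes>\<^bsub>hom_group T M N\<^esub> (g \<otimes>\<^bsub>hom_group T M N\<^esub> h)"
      using f g by (auto simp: fun_eq_iff restrict_def lmod_hom_closed N.M.a_assoc)
  next
    have "(\<lambda>x. \<zero>\<^bsub>N\<^esub>) \<in> lmod_hom T M N" by (intro lmod_homI) (auto simp: N.smult_zero_right)
    then show "\<one>\<^bsub>hom_group T M N\<^esub> \<in> carrier (hom_group T M N)" by (simp add: restrict_lmod_hom[OF M])
  next
    fix f assume f: "f \<in> carrier (hom_group T M N)"
    then show "\<one>\<^bsub>hom_group T M N\<^esub> \<otimes>\<^bsub>hom_group T M N\<^esub> f = f"
      by (auto simp: fun_eq_iff restrict_def lmod_hom_closed extensional_def)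
    have "(\<lambda>x. \<ominus>\<^bsub>N\<^esub> f x) \<in> lmod_hom T M N"
      using f by (intro lmod_homI) (auto simp: lmod_hom_closed lmod_hom_add lmod_hom_smult N.M.minus_add N.smult_minus_right)
    then show "\<exists>g\<in>carrier (hom_group T M N). g \<otimes>\<^bsub>hom_group T M N\<^esub> f = \<one>\<^bsub>hom_group T M N\<^esub>"
      using f by (intro bexI[of _ "\<lambda>x\<in>carrier M. \<ominus>\<^bsub>N\<^esub> f x"])
        (auto simp: restrict_lmod_hom[OF M] N.M.l_neg lmod_hom_closed cong: restrict_cong)
  qed
qed

lemma trivial_subquotient_iff:
  assumes G: "comm_group G" and K: "subgroup K G" and B: "subgroup B G" "B \<subseteq> K"
  shows "trivial_group (G\<lparr>carrier := K\<rparr> Mod B) \<longleftrightarrow> K \<subseteq> B"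
proof -
  interpret comm_group G by fact
  interpret K: group "G\<lparr>carrier := K\<rparr>" by (rule subgroup_imp_group[OF K])
  have "comm_group (G\<lparr>carrier := K\<rparr>)"
    using subgroup.subset[OF K] by (intro K.group_comm_groupI) (auto intro: m_comm)
  from trivial_factor_group_iff[OF this subgroup_incl[OF B(1) K B(2)]] show ?thesis by simp
qed

text \<open>Exactness in degree \<open>Suc j\<close>, that is, \<open>Ext^(j+1) = 0\<close> for a
  projective resolution \<open>P\<close>, stated for arbitrary homomorphisms instead of the
  extensional members of \<open>hom_group\<close>.\<close>

definition cochain_exact ::
  "'t ring \<Rightarrow> (nat \<Rightarrow> ('t, 'p) module) \<Rightarrow> (nat \<Rightarrow> 'p \<Rightarrow> 'p) \<Rightarrow> ('t, 'm) module \<Rightarrow> nat \<Rightarrow> bool" where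
  "cochain_exact T P \<delta> M j \<longleftrightarrow>
     (\<forall>f\<in>lmod_hom T (P (Suc j)) M. (\<forall>x\<in>carrier (P (Suc (Suc j))). f (\<delta> (Suc j) x) = \<zero>\<^bsub>M\<^esub>) \<longrightarrow>
        (\<exists>h\<in>lmod_hom T (P j) M. \<forall>x\<in>carrier (P (Suc j)). f x = h (\<delta> j x)))"

lemma resolutionD:
  assumes "resolution T \<infinity> U P \<delta> \<epsilon>"
  shows "lmodule T U" "lmodule T (P i)" "\<epsilon> \<in> lmod_hom T (P 0) U" "\<delta> i \<in> lmod_hom T (P (Suc i)) (P i)"
    "\<epsilon> ` carrier (P 0) = carrier U" "\<delta> 0 ` carrier (P (Suc 0)) = a_kernel (P 0) U \<epsilon>"
    "\<delta> (Suc i) ` carrier (P (Suc (Suc i))) = a_kernel (P (Suc i)) (P i) (\<delta> i)"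
  using assms unfolding resolution_def exact_augmented_def by auto

lemma resolution_complex:
  assumes "resolution T \<infinity> U P \<delta> \<epsilon>" "x \<in> carrier (P (Suc (Suc i)))"
  shows "\<delta> i (\<delta> (Suc i) x) = \<zero>\<^bsub>P i\<^esub>"
proof -
  have "\<delta> (Suc i) x \<in> a_kernel (P (Suc i)) (P i) (\<delta> i)"
    using assms(2) resolutionD(7)[OF assms(1), of i] by blast
  then show ?thesis by (simp add: a_kernel_iff)
qed

text \<open>A subquotient is trivial exactly if every cocycle is a coboundary; restricting to the
  carrier passes between arbitrary and extensional homomorphisms.\<close>

lemma trivial_Ext_group_iff:
  assumes P: "resolution T \<infinity> U P \<delta> \<epsilon>" and M: "lmodule T M"
  shows "trivial_group (Ext_group T P \<delta> M (Suc j)) \<longleftrightarrow> cochain_exact T P \<delta> M j"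
proof -
  note r = resolutionD[OF P]
  interpret M: lmodule T M by fact
  let ?H = "\<lambda>i. hom_group T (P i) M"
  let ?d = "\<lambda>i. coboundary P \<delta> i"
  interpret H: comm_group "?H i" for i by (rule comm_group_hom_group[OF r(2) M])
  have d: "?d i \<in> hom (?H i) (?H (Suc i))" for i
  proof (rule homI)
    fix f assume f: "f \<in> carrier (?H i)"
    then have "(\<lambda>x. f (\<delta> i x)) \<in> lmod_hom T (P (Suc i)) M" by (auto intro: lmod_hom_comp[OF r(4)])
    then show "?d i f \<in> carrier (?H (Suc i))"
      by (auto simp: coboundary_def compose_def intro: restrict_lmod_hom[OF r(2)])
    fix g assume "g \<in> carrier (?H i)"
    then show "?d i (f \<otimes>\<^bsub>?H i\<^esub> g) = ?d i f \<otimes>\<^bsub>?H (Suc i)\<^esub> ?d i g"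
      using f by (auto simp: coboundary_def compose_def fun_eq_iff lmod_hom_closed[OF r(4)])
  qed
  interpret d: group_hom "?H i" "?H (Suc i)" "?d i" for i
    by (intro group_hom.intro group_hom_axioms.intro H.group_axioms d)
  let ?K = "kernel (?H (Suc j)) (?H (Suc (Suc j))) (?d (Suc j))"
  let ?B = "?d j ` carrier (?H j)"
  have K: "subgroup ?K (?H (Suc j))" by (rule d.subgroup_kernel)
  have B: "subgroup ?B (?H (Suc j))" by (rule d.img_is_subgroup)
  have "?d (Suc j) (?d j f) = \<one>\<^bsub>?H (Suc (Suc j))\<^esub>" if "f \<in> carrier (?H j)" for f
    using that lmod_hom_zero[OF r(2) M, of f] resolution_complex[OF P]
    by (auto simp: coboundary_def compose_def fun_eq_iff lmod_hom_closed[OF r(4)])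
  then have BK: "?B \<subseteq> ?K" using d.hom_closed by (auto simp: kernel_def simp del: hom_group_simps)
  have "trivial_group (Ext_group T P \<delta> M (Suc j)) \<longleftrightarrow> ?K \<subseteq> ?B"
    using trivial_subquotient_iff[OF H.comm_group_axioms K B BK] by (simp add: Ext_group_def)
  also have "\<dots> \<longleftrightarrow> cochain_exact T P \<delta> M j"
    unfolding cochain_exact_def
  proof (intro iffI ballI impI subsetI)
    fix f assume KB: "?K \<subseteq> ?B" and f: "f \<in> lmod_hom T (P (Suc j)) M"
      and z: "\<forall>x\<in>carrier (P (Suc (Suc j))). f (\<delta> (Suc j) x) = \<zero>\<^bsub>M\<^esub>"
    let ?f = "restrict f (carrier (P (Suc j)))"
    have "?f \<in> ?K" using f z by (auto simp: kernel_def restrict_lmod_hom[OF r(2)] coboundary_def compose_def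
        fun_eq_iff lmod_hom_closed[OF r(4)])
    then have "?f \<in> ?B" using KB by blast
    then obtain h where h: "h \<in> lmod_hom T (P j) M" "?f = ?d j h" by auto
    have "f x = h (\<delta> j x)" if "x \<in> carrier (P (Suc j))" for x
      using fun_cong[OF h(2), of x] that by (simp add: coboundary_def compose_def)
    then show "\<exists>h\<in>lmod_hom T (P j) M. \<forall>x\<in>carrier (P (Suc j)). f x = h (\<delta> j x)" using h(1) by blast
  next
    fix f assume ex: "\<forall>f\<in>lmod_hom T (P (Suc j)) M. (\<forall>x\<in>carrier (P (Suc (Suc j))). f (\<delta> (Suc j) x) = \<zero>\<^bsub>M\<^esub>) \<longrightarrow>
        (\<exists>h\<in>lmod_hom T (P j) M. \<forall>x\<in>carrier (P (Suc j)). f x = h (\<delta> j x))" and f: "f \<in> ?K"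
    have fz: "f (\<delta> (Suc j) x) = \<zero>\<^bsub>M\<^esub>" if "x \<in> carrier (P (Suc (Suc j)))" for x
    proof -
      have "?d (Suc j) f = \<one>\<^bsub>?H (Suc (Suc j))\<^esub>" using f by (simp add: kernel_def)
      from fun_cong[OF this, of x] that show ?thesis by (simp add: coboundary_def compose_def)
    qed
    have fh: "f \<in> lmod_hom T (P (Suc j)) M" "f \<in> extensional (carrier (P (Suc j)))" using f by (auto simp: kernel_def)
    with ex fz obtain h where h: "h \<in> lmod_hom T (P j) M" "\<And>x. x \<in> carrier (P (Suc j)) \<Longrightarrow> f x = h (\<delta> j x)" by blast
    let ?h = "restrict h (carrier (P j))"
    have "f = ?d j ?h" using fh(2) h(2)
      by (auto simp: coboundary_def compose_def fun_eq_iff lmod_hom_closed[OF r(4)] extensional_def)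
    moreover have "?h \<in> carrier (?H j)" using h(1) by (simp add: restrict_lmod_hom[OF r(2)])
    ultimately show "f \<in> ?B" by blast
  qed
  finally show ?thesis .
qed

lemma Ext_zero_iff:
  fixes U :: "('t, 'u) module"
  assumes "lmodule T M"
  shows "Ext_zero T U M (Suc j) \<longleftrightarrow>
    (\<forall>(P :: nat \<Rightarrow> ('t, 'u + 't + nat \<Rightarrow> 't) module) \<delta> \<epsilon>. projective_resolution T U P \<delta> \<epsilon> \<longrightarrow> cochain_exact T P \<delta> M j)"
  unfolding Ext_zero_def projective_resolution_def using trivial_Ext_group_iff[OF _ assms] by blast

text \<open>Frees the lifting property from the test types of \<open>projective\<close>: the module
  is a retract of the free module on its carrier, and free modules lift against modules of any
  type.\<close>

lemma projective_lift:
  assumes M: "projective T M" and A: "lmodule T A" and B: "lmodule T B"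
    and g: "g \<in> lmod_hom T A B" "g ` carrier A = carrier B" and f: "f \<in> lmod_hom T M B"
  shows "\<exists>h\<in>lmod_hom T M A. \<forall>x\<in>carrier M. g (h x) = f x"
proof -
  have Mm: "lmodule T M" using M by (simp add: projective_def)
  have T: "ring T" using A by (simp add: lmodule_def)
  let ?F = "free_module T (carrier M)"
  have F: "lmodule T ?F" by (rule lmodule_free_module[OF T])
  have \<phi>: "(\<lambda>x. x) \<in> carrier M \<rightarrow> carrier M" by simp
  define e where "e = lin_ext T (carrier M) M (\<lambda>x. x)"
  have e: "e \<in> lmod_hom T ?F M" unfolding e_def by (rule lin_ext_hom[OF Mm \<phi>])
  have "x \<in> e ` carrier ?F" if "x \<in> carrier M" for x
    using lin_ext_unit_vec[OF Mm \<phi> that] unit_vec_carrier[OF T that] unfolding e_def by (metis image_eqI)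
  then have onto: "e ` carrier ?F = carrier M" using lmod_hom_closed[OF e] by blast
  \<comment> \<open>The test types in \<open>projective\<close> are precisely those of
    \<open>?F\<close> and \<open>M\<close>.\<close>
  have "\<exists>s\<in>lmod_hom T M ?F. \<forall>x\<in>carrier M. e (s x) = x"
    using M[unfolded projective_def, THEN conjunct2, rule_format, of ?F M e "\<lambda>x. x"] F Mm e onto
    by (simp add: lmod_hom_id)
  then obtain s where s: "s \<in> lmod_hom T M ?F" "\<And>x. x \<in> carrier M \<Longrightarrow> e (s x) = x" by blast
  have fe: "(\<lambda>v. f (e v)) \<in> lmod_hom T ?F B" by (rule lmod_hom_comp[OF e f])
  obtain h where h: "h \<in> lmod_hom T ?F A" "\<And>v. v \<in> carrier ?F \<Longrightarrow> g (h v) = f (e v)"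
    using lift_free[OF A B g(1) fe] lmod_hom_closed[OF fe] unfolding g(2) by blast
  show ?thesis
    by (rule bexI[OF _ lmod_hom_comp[OF s(1) h(1)]]) (simp add: h(2) lmod_hom_closed[OF s(1)] s(2))
qed

text \<open>The long exact sequence in the second variable, at its middle term. Projectivity of
  \<open>P j\<close> is what lifts the cochain \<open>h\<close> from \<open>C\<close> to
  \<open>B\<close>.\<close>

lemma cochain_exact_extension:
  assumes ex: "short_exact T A B C \<iota> \<pi>" and P: "projective_resolution T U P \<delta> \<epsilon>"
    and A0: "cochain_exact T P \<delta> A j" and C0: "cochain_exact T P \<delta> C j"
  shows "cochain_exact T P \<delta> B j"
  unfolding cochain_exact_def
proof (intro ballI impI)
  note x = short_exactD[OF ex]
  interpret A: lmodule T A by fact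
  interpret B: lmodule T B by fact
  interpret C: lmodule T C by fact
  have res: "resolution T \<infinity> U P \<delta> \<epsilon>" and proj: "\<And>i. projective T (P i)"
    using P by (auto simp: projective_resolution_def)
  note r = resolutionD[OF res]
  fix f assume f: "f \<in> lmod_hom T (P (Suc j)) B" and z: "\<forall>x\<in>carrier (P (Suc (Suc j))). f (\<delta> (Suc j) x) = \<zero>\<^bsub>B\<^esub>"
  have "\<forall>x\<in>carrier (P (Suc (Suc j))). \<pi> (f (\<delta> (Suc j) x)) = \<zero>\<^bsub>C\<^esub>" using z lmod_hom_zero[OF x(2,3,5)] by simp
  then obtain h where h: "h \<in> lmod_hom T (P j) C" "\<And>x. x \<in> carrier (P (Suc j)) \<Longrightarrow> \<pi> (f x) = h (\<delta> j x)"
    using C0[unfolded cochain_exact_def, rule_format, OF lmod_hom_comp[OF f x(5)]] by blast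
  obtain h' where h': "h' \<in> lmod_hom T (P j) B" "\<And>x. x \<in> carrier (P j) \<Longrightarrow> \<pi> (h' x) = h x"
    using projective_lift[OF proj x(2,3,5) short_exact_onto[OF ex] h(1)] by blast
  note hd = lmod_hom_comp[OF r(4)[of j] h'(1)]
  \<comment> \<open>Subtracting the coboundary of \<open>h'\<close> leaves a cocycle with values in
    the image of \<open>A\<close>.\<close>
  define u where "u x = f x \<ominus>\<^bsub>B\<^esub> h' (\<delta> j x)" for x
  have u: "u \<in> lmod_hom T (P (Suc j)) B" unfolding u_def by (rule lmod_hom_difference[OF r(2) x(2) f hd])
  have "u ` carrier (P (Suc j)) \<subseteq> \<iota> ` carrier A"
  proof (rule image_subsetI)
    fix y assume y: "y \<in> carrier (P (Suc j))"
    have c: "f y \<in> carrier B" "h' (\<delta> j y) \<in> carrier B" "\<delta> j y \<in> carrier (P j)"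
      using lmod_hom_closed[OF f y] lmod_hom_closed[OF hd y] lmod_hom_closed[OF r(4) y] .
    have "\<pi> (u y) = \<zero>\<^bsub>C\<^esub>" unfolding u_def lmod_hom_diff[OF x(2,3,5) c(1,2)] h(2)[OF y] h'(2)[OF c(3)]
      using lmod_hom_closed[OF h(1) c(3)] by (simp add: C.minus_self)
    then show "u y \<in> \<iota> ` carrier A" using x(8)[OF lmod_hom_closed[OF u y]] by auto
  qed
  note v = hom_through_inj[OF x(1,2,4,6) r(2) u this]
  define v where "v y = inv_into (carrier A) \<iota> (u y)" for y
  note v = v[folded v_def]
  have "v (\<delta> (Suc j) y) = \<zero>\<^bsub>A\<^esub>" if y: "y \<in> carrier (P (Suc (Suc j)))" for y
  proof -
    have c: "\<delta> (Suc j) y \<in> carrier (P (Suc j))" by (rule lmod_hom_closed[OF r(4) y])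
    have "u (\<delta> (Suc j) y) = \<zero>\<^bsub>B\<^esub>"
      using z y resolution_complex[OF res y] lmod_hom_zero[OF r(2) x(2) h'(1)] by (simp add: u_def B.minus_self)
    then show ?thesis using v(1,2)[OF c] x(10) by simp
  qed
  then obtain w where w: "w \<in> lmod_hom T (P j) A" "\<And>y. y \<in> carrier (P (Suc j)) \<Longrightarrow> v y = w (\<delta> j y)"
    using A0[unfolded cochain_exact_def, rule_format, OF v(3)] by blast
  note \<iota>w = lmod_hom_comp[OF w(1) x(4)]
  have "f y = \<iota> (w (\<delta> j y)) \<oplus>\<^bsub>B\<^esub> h' (\<delta> j y)" if y: "y \<in> carrier (P (Suc j))" for y
  proof -
    have "\<iota> (w (\<delta> j y)) = u y" using v(2)[OF y] w(2)[OF y] by simp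
    then show ?thesis using lmod_hom_closed[OF f y] lmod_hom_closed[OF hd y] by (simp add: u_def B.minus_add_cancel)
  qed
  then show "\<exists>h\<in>lmod_hom T (P j) B. \<forall>x\<in>carrier (P (Suc j)). f x = h (\<delta> j x)"
    by (intro bexI[OF _ lmod_hom_sum[OF r(2) x(2) \<iota>w h'(1)]]) simp
qed

lemma nd_injective_extension:
  assumes ex: "short_exact S A B C \<iota> \<pi>" and "nd_injective S n d A" "nd_injective S n d C"
  shows "nd_injective S n d B"
proof -
  note m = short_exactD(1-3)[OF ex]
  show ?thesis using assms(2,3) cochain_exact_extension[OF ex]
    unfolding nd_injective_def Suc_eq_plus1[symmetric] Ext_zero_iff[OF m(1)] Ext_zero_iff[OF m(2)] Ext_zero_iff[OF m(3)]
    using m(2) by meson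
qed

text \<open>\<open>Ext_zero\<close> tests resolutions whose elements are functions on a sum type;
  this moves \<open>T^m\<close> to a free module on a finite subset of any index type that contains
  enough elements.\<close>

lemma free_module_reindex:
  assumes T: "ring T" and j: "inj_on j {..<m}"
  shows "(\<lambda>v i. if i < m then v (j i) else \<zero>\<^bsub>T\<^esub>) \<in> lmod_hom T (free_module T (j ` {..<m})) (fpow T m)"
    and "bij_betw (\<lambda>v i. if i < m then v (j i) else \<zero>\<^bsub>T\<^esub>) (carrier (free_module T (j ` {..<m}))) (carrier (fpow T m))"
proof -
  interpret ring T by fact
  let ?f = "\<lambda>v i. if i < m then v (j i) else \<zero>\<^bsub>T\<^esub>" and ?F = "free_module T (j ` {..<m})"
  let ?g = "\<lambda>w x. if x \<in> j ` {..<m} then w (inv_into {..<m} j x) else \<zero>\<^bsub>T\<^esub>"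
  have F: "v \<in> carrier ?F \<longleftrightarrow> (\<forall>x\<in>j ` {..<m}. v x \<in> carrier T) \<and> (\<forall>x. x \<notin> j ` {..<m} \<longrightarrow> v x = \<zero>\<^bsub>T\<^esub>)" for v
  proof -
    have "finite {x. v x \<noteq> \<zero>\<^bsub>T\<^esub>}" if "\<forall>x. x \<notin> j ` {..<m} \<longrightarrow> v x = \<zero>\<^bsub>T\<^esub>"
      by (rule finite_subset[of _ "j ` {..<m}"]) (use that in auto)
    then show ?thesis by (auto simp: free_module_simps)
  qed
  show "?f \<in> lmod_hom T ?F (fpow T m)"
    by (intro lmod_homI) (auto simp: fpow_carrier F, auto simp: free_module_simps(3,4))
  show "bij_betw ?f (carrier ?F) (carrier (fpow T m))"
  proof (rule bij_betw_byWitness[where f' = ?g])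
    show "\<forall>v\<in>carrier ?F. ?g (?f v) = v"
    proof (intro ballI ext)
      fix v x assume "v \<in> carrier ?F"
      then show "?g (?f v) x = v x"
        using inv_into_into[of x j "{..<m}"] f_inv_into_f[of x j "{..<m}"] by (auto simp: F)
    qed
    show "\<forall>w\<in>carrier (fpow T m). ?f (?g w) = w"
      using j by (auto simp: fpow_carrier fun_eq_iff inv_into_f_f)
    show "?f ` carrier ?F \<subseteq> carrier (fpow T m)" by (auto simp: fpow_carrier F)
    show "?g ` carrier (fpow T m) \<subseteq> carrier ?F"
      using inv_into_into[of _ j "{..<m}"] by (force simp: fpow_carrier F)
  qed
qed

text \<open>Splices \<open>T^m\<close>, reindexed along \<open>j\<close>, in front of a resolution
  of the syzygy, so all degrees move up by one. \<open>\<phi>\<close> is the reindexing isomorphism;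
  it turns maps on the new term \<open>P' 0\<close> back into maps on \<open>T^m\<close>.\<close>

lemma projective_resolution_prepend:
  fixes P :: "nat \<Rightarrow> ('t, 'x \<Rightarrow> 't) module" and j :: "nat \<Rightarrow> 'x"
  assumes U: "lmodule T U" and p: "presents T U m p" and j: "inj_on j {..<m}"
    and P: "projective_resolution T (ker_mod (fpow T m) U p) P \<delta> \<epsilon>"
  shows "\<exists>P' \<delta>' \<epsilon>' \<phi>. projective_resolution T U P' \<delta>' \<epsilon>' \<and> (\<forall>i. P' (Suc i) = P i \<and> \<delta>' (Suc i) = \<delta> i) \<and>
    \<phi> \<in> lmod_hom T (fpow T m) (P' 0) \<and> (\<forall>x\<in>carrier (P 0). \<delta>' 0 x = \<phi> (\<epsilon> x))"
proof -
  have res: "resolution T \<infinity> (ker_mod (fpow T m) U p) P \<delta> \<epsilon>" and proj: "\<And>i. projective T (P i)"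
    using P by (auto simp: projective_resolution_def)
  note r = resolutionD[OF res]
  interpret U: lmodule T U by fact
  have T: "ring T" by (rule U.R.ring_axioms)
  let ?F = "free_module T (j ` {..<m})" and ?G = "fpow T m" and ?K = "ker_mod (fpow T m) U p"
  define \<psi> where "\<psi> = (\<lambda>v i. if i < m then v (j i) else \<zero>\<^bsub>T\<^esub>)"
  have \<psi>: "\<psi> \<in> lmod_hom T ?F ?G" "bij_betw \<psi> (carrier ?F) (carrier ?G)"
    unfolding \<psi>_def by (rule free_module_reindex[OF T j])+
  have F: "lmodule T ?F" and G: "lmodule T ?G" by (rule lmodule_free_module[OF T])+
  interpret G: lmodule T ?G by (rule G)
  define \<phi> where "\<phi> = inv_into (carrier ?F) \<psi>"
  have \<phi>: "\<phi> \<in> lmod_hom T ?G ?F" unfolding \<phi>_def by (rule lmod_hom_inv_into[OF F \<psi>])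
  have \<psi>\<phi>: "\<psi> (\<phi> y) = y" if "y \<in> carrier ?G" for y
    using that \<psi>(2) by (simp add: \<phi>_def bij_betw_def f_inv_into_f)
  have \<phi>\<psi>: "\<phi> (\<psi> y) = y" if "y \<in> carrier ?F" for y
    using that \<psi>(2) by (simp add: \<phi>_def bij_betw_def inv_into_f_f)
  have p': "p \<in> lmod_hom T ?G U" "p ` carrier ?G = carrier U" using p by (auto simp: presents_def)
  define P' where "P' = case_nat ?F P"
  define \<delta>' where "\<delta>' = case_nat (\<lambda>x. \<phi> (\<epsilon> x)) \<delta>"
  define \<epsilon>' where "\<epsilon>' = (\<lambda>x. p (\<psi> x))"
  have \<epsilon>G: "\<epsilon> \<in> lmod_hom T (P 0) ?G" using r(3) by (auto simp: lmod_hom_def)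
  have onto: "\<epsilon>' ` carrier ?F = carrier U"
    using \<psi>(2) p'(2) unfolding \<epsilon>'_def bij_betw_def by (metis image_image)
  have k0: "(\<lambda>x. \<phi> (\<epsilon> x)) ` carrier (P 0) = a_kernel ?F U \<epsilon>'"
  proof (intro equalityI subsetI)
    fix y assume "y \<in> (\<lambda>x. \<phi> (\<epsilon> x)) ` carrier (P 0)"
    then obtain x where x: "x \<in> carrier (P 0)" "y = \<phi> (\<epsilon> x)" by blast
    have "\<epsilon> x \<in> carrier ?K" by (rule lmod_hom_closed[OF r(3) x(1)])
    then show "y \<in> a_kernel ?F U \<epsilon>'" using x(2) by (simp add: a_kernel_iff \<epsilon>'_def \<psi>\<phi> lmod_hom_closed[OF \<phi>])
  next
    fix y assume "y \<in> a_kernel ?F U \<epsilon>'"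
    then have y: "y \<in> carrier ?F" "\<psi> y \<in> carrier ?K" by (auto simp: a_kernel_iff \<epsilon>'_def lmod_hom_closed[OF \<psi>(1)])
    then have "\<psi> y \<in> \<epsilon> ` carrier (P 0)" using r(5) by blast
    then show "y \<in> (\<lambda>x. \<phi> (\<epsilon> x)) ` carrier (P 0)" using \<phi>\<psi>[OF y(1)] by force
  qed
  have k1: "\<delta> 0 ` carrier (P (Suc 0)) = a_kernel (P 0) ?F (\<lambda>x. \<phi> (\<epsilon> x))"
  proof -
    have "\<phi> v = \<zero>\<^bsub>?F\<^esub> \<longleftrightarrow> v = \<zero>\<^bsub>?G\<^esub>" if "v \<in> carrier ?G" for v
      using \<psi>\<phi>[OF that] lmod_hom_zero[OF F G \<psi>(1)] lmod_hom_zero[OF G F \<phi>] by metis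
    then have "a_kernel (P 0) ?F (\<lambda>x. \<phi> (\<epsilon> x)) = a_kernel (P 0) ?K \<epsilon>"
      using lmod_hom_closed[OF \<epsilon>G] by (auto simp: a_kernel_iff)
    then show ?thesis using r(6) by simp
  qed
  have "resolution T \<infinity> U P' \<delta>' \<epsilon>'"
    unfolding resolution_def exact_augmented_def
  proof (intro conjI allI impI U)
    show "lmodule T (P' i)" for i using F r(2) by (cases i) (auto simp: P'_def)
    show "\<epsilon>' \<in> lmod_hom T (P' 0) U" using lmod_hom_comp[OF \<psi>(1) p'(1)] by (simp add: P'_def \<epsilon>'_def)
    show "\<delta>' i \<in> lmod_hom T (P' (Suc i)) (P' i)" for i
      using lmod_hom_comp[OF \<epsilon>G \<phi>] r(4) by (cases i) (auto simp: P'_def \<delta>'_def)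
    show "\<epsilon>' ` carrier (P' 0) = carrier U" "\<delta>' 0 ` carrier (P' 1) = a_kernel (P' 0) U \<epsilon>'"
      using onto k0 by (simp_all add: P'_def \<delta>'_def)
    show "\<delta>' (Suc i) ` carrier (P' (Suc (Suc i))) = a_kernel (P' (Suc i)) (P' i) (\<delta>' i)" for i
      using k1 r(7) by (cases i) (simp_all add: P'_def \<delta>'_def)
  qed
  moreover have "projective T (P' i)" for i
    using projective_free_module[OF T] proj by (cases i) (auto simp: P'_def)
  ultimately have "projective_resolution T U P' \<delta>' \<epsilon>'" by (simp add: projective_resolution_def)
  then show ?thesis using \<phi>
    by (intro exI[of _ P'] exI[of _ \<delta>'] exI[of _ \<epsilon>'] exI[of _ \<phi>]) (simp add: P'_def \<delta>'_def)
qed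

text \<open>The type of \<open>U\<close> is that of its syzygies, so both are tested by resolutions
  of the same type and induction on \<open>k\<close> stays at one type. Each step prepends a
  presentation. At \<open>k = 0\<close>, \<open>f o \<epsilon>\<close> is a cocycle in degree 1 of
  the prepended resolution, and bounding it means extending \<open>f\<close>.\<close>

lemma Ext_zero_imp_ext_van:
  fixes U :: "('t, nat \<Rightarrow> 't) module"
  assumes "lmodule T U" "lmodule T I" "Ext_zero T U I (Suc k)"
  shows "ext_van T I k U"
  using assms
proof (induction k arbitrary: U)
  case (0 U)
  show ?case unfolding ext_van_def ker_ext_van.simps extends_def
  proof (intro allI impI ballI)
    fix m p f assume p: "presents T U m p" and f: "f \<in> lmod_hom T (ker_mod (fpow T m) U p) I"
    let ?K = "ker_mod (fpow T m) U p"
    have p': "p \<in> lmod_hom T (fpow T m) U" using p by (simp add: presents_def)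
    have K: "lmodule T ?K" by (rule lmodule_ker_mod[OF lmodule_fpow[OF 0(1)] 0(1) p'])
    obtain P :: "nat \<Rightarrow> ('t, (nat \<Rightarrow> 't) + 't + nat \<Rightarrow> 't) module" and \<delta> \<epsilon>
      where P: "projective_resolution T ?K P \<delta> \<epsilon>" using projective_resolution_exists[OF K] by blast
    have r: "resolution T \<infinity> ?K P \<delta> \<epsilon>" using P by (simp add: projective_resolution_def)
    note rd = resolutionD[OF r]
    obtain P' \<delta>' \<epsilon>' \<phi> where P': "projective_resolution T U P' \<delta>' \<epsilon>'"
      "\<And>i. P' (Suc i) = P i" "\<And>i. \<delta>' (Suc i) = \<delta> i"
      "\<phi> \<in> lmod_hom T (fpow T m) (P' 0)" "\<And>x. x \<in> carrier (P 0) \<Longrightarrow> \<delta>' 0 x = \<phi> (\<epsilon> x)"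
      using projective_resolution_prepend[OF 0(1) p _ P, of "\<lambda>i. Inr (Inr i)"] by (auto simp: inj_on_def)
    have "cochain_exact T P' \<delta>' I 0" using 0(3) P'(1) Ext_zero_iff[OF 0(2)] by blast
    moreover have "f (\<epsilon> (\<delta> 0 x)) = \<zero>\<^bsub>I\<^esub>" if "x \<in> carrier (P (Suc 0))" for x
    proof -
      have "\<delta> 0 x \<in> a_kernel (P 0) ?K \<epsilon>" using rd(6) that by blast
      then have "\<epsilon> (\<delta> 0 x) = \<zero>\<^bsub>?K\<^esub>" by (simp add: a_kernel_iff)
      then show ?thesis using lmod_hom_zero[OF K 0(2) f] by simp
    qed
    ultimately obtain h where h: "h \<in> lmod_hom T (P' 0) I" "\<And>x. x \<in> carrier (P 0) \<Longrightarrow> f (\<epsilon> x) = h (\<delta>' 0 x)"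
      unfolding cochain_exact_def using lmod_hom_comp[OF rd(3) f] P'(2,3) by auto
    have "h (\<phi> y) = f y" if "y \<in> carrier ?K" for y
    proof -
      have "y \<in> \<epsilon> ` carrier (P 0)" using rd(5) that by blast
      then show ?thesis using h(2) P'(5) by auto
    qed
    then show "\<exists>g\<in>lmod_hom T (fpow T m) I. \<forall>x\<in>carrier ?K. g x = f x"
      by (intro bexI[OF _ lmod_hom_comp[OF P'(4) h(1)]]) blast
  qed
next
  case (Suc k U)
  show ?case
  proof (rule ext_van_SucI)
    fix m p assume p: "presents T U m p"
    let ?K = "ker_mod (fpow T m) U p"
    have p': "p \<in> lmod_hom T (fpow T m) U" using p by (simp add: presents_def)
    have K: "lmodule T ?K" by (rule lmodule_ker_mod[OF lmodule_fpow[OF Suc.prems(1)] Suc.prems(1) p'])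
    show "ext_van T I k ?K"
    proof (rule Suc.IH[OF K Suc.prems(2)])
      show "Ext_zero T ?K I (Suc k)" unfolding Ext_zero_iff[OF Suc.prems(2)]
      proof (intro allI impI)
        fix P :: "nat \<Rightarrow> ('t, (nat \<Rightarrow> 't) + 't + nat \<Rightarrow> 't) module" and \<delta> \<epsilon>
        assume P: "projective_resolution T ?K P \<delta> \<epsilon>"
        obtain P' \<delta>' \<epsilon>' where P': "projective_resolution T U P' \<delta>' \<epsilon>'"
          "\<And>i. P' (Suc i) = P i" "\<And>i. \<delta>' (Suc i) = \<delta> i"
          using projective_resolution_prepend[OF Suc.prems(1) p _ P, of "\<lambda>i. Inr (Inr i)"]
          by (auto simp: inj_on_def)
        have "cochain_exact T P' \<delta>' I (Suc k)" using Suc.prems(3) P'(1) Ext_zero_iff[OF Suc.prems(2)] by blast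
        then show "cochain_exact T P \<delta> I k" by (simp add: cochain_exact_def P'(2,3))
      qed
    qed
  qed
qed

text \<open>Dependent choice unrolls the coinductive predicate into an infinite resolution by the
  modules \<open>fpow T i\<close>, which serves for every length \<open>n\<close>.\<close>

lemma fp_syzygies_fin_n_presented:
  fixes U :: "('t, nat \<Rightarrow> 't) module"
  assumes U: "fp_syzygies T U" shows "fin_n_presented T n U"
proof -
  define step where "step = (\<lambda>(W, m, p) (W', m' :: nat, p' :: (nat \<Rightarrow> 't) \<Rightarrow> nat \<Rightarrow> 't).
    W' = ker_mod (fpow T m) (W :: ('t, nat \<Rightarrow> 't) module) p)"
  define invar where "invar = (\<lambda>(W, m, p). fp_syzygies T W \<and> lmodule T W \<and> presents T W m p \<and> fp_syzygies T (ker_mod (fpow T m) W p))"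
  have ex: "\<exists>m p. invar (W, m, p)" if "fp_syzygies T W" for W
    using that unfolding invar_def prod.case by (subst (asm) fp_syzygies.simps) (auto intro: fp_syzygies.intros)
  obtain m0 p0 where i0: "invar (U, m0, p0)" using ex[OF U] by blast
  have nxt: "\<exists>q'. invar q' \<and> step q q'" if q: "invar q" for q
  proof -
    obtain W m p where [simp]: "q = (W, m, p)" by (cases q)
    have "fp_syzygies T (ker_mod (fpow T m) W p)" using q by (simp add: invar_def)
    from ex[OF this] show ?thesis unfolding step_def by auto
  qed
  have "\<exists>q. \<forall>n::nat. (invar (q n) \<and> (n = 0 \<longrightarrow> q n = (U, m0, p0))) \<and> step (q n) (q (Suc n))"
    using i0 nxt by (intro dependent_nat_choice) auto
  then obtain q where q: "\<And>n. invar (q n)" "q 0 = (U, m0, p0)" "\<And>n. step (q n) (q (Suc n))" by blast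
  define W where "W n = fst (q n)" for n
  define m where "m n = fst (snd (q n))" for n
  define p where "p n = snd (snd (q n))" for n
  have W0: "W 0 = U" by (simp add: W_def q)
  have "q n = (W n, m n, p n)" for n by (simp add: W_def m_def p_def)
  then have W: "lmodule T (W n)" "presents T (W n) (m n) (p n)" "W (Suc n) = ker_mod (fpow T (m n)) (W n) (p n)" for n
    using q(1)[of n] q(3)[of n] by (simp_all add: invar_def step_def)
  have p: "p n \<in> lmod_hom T (fpow T (m n)) (W n)" "p n ` carrier (fpow T (m n)) = carrier (W n)" for n
    using W(2) by (auto simp: presents_def)
  have \<delta>: "p (Suc n) \<in> lmod_hom T (fpow T (m (Suc n))) (fpow T (m n))" for n
    using p(1)[of "Suc n"] by (auto simp: W(3) lmod_hom_def)
  have free: "lmodule T (fpow T i)" for i by (rule lmodule_fpow[OF W(1)])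
  have fg: "fg_free T (fpow T i)" for i
    unfolding fg_free_def lmod_iso_def using free lmod_hom_id[of T "fpow T i"]
    by (intro conjI exI[of _ i] bexI[of _ "\<lambda>x. x"]) (auto simp: bij_betw_def)
  have "p (Suc (Suc i)) ` carrier (fpow T (m (Suc (Suc i)))) = a_kernel (fpow T (m (Suc i))) (fpow T (m i)) (p (Suc i))" for i
    unfolding p(2) W(3)[of "Suc i"] by (auto simp: a_kernel_iff W(3)[of i])
  moreover have "p (Suc 0) ` carrier (fpow T (m (Suc 0))) = a_kernel (fpow T (m 0)) U (p 0)"
    unfolding p(2) W(3)[of 0] by (auto simp: a_kernel_iff W0)
  ultimately have "resolution T n U (\<lambda>i. fpow T (m i)) (\<lambda>i. p (Suc i)) (p 0)"
    unfolding resolution_def exact_augmented_def using W(1)[of 0] free p[of 0] \<delta> by (simp add: W0)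
  then show ?thesis unfolding fin_n_presented_def using fg by blast
qed

lemma transport_lmodule:
  fixes U :: "('t, 'u) module" and s :: "'u \<Rightarrow> 'v"
  assumes U: "lmodule T U" and s: "inj_on s (carrier U)"
  shows "\<exists>V :: ('t, 'v) module. lmodule T V \<and> s \<in> lmod_hom T U V \<and> bij_betw s (carrier U) (carrier V)"
proof -
  interpret U: lmodule T U by fact
  let ?g = "inv_into (carrier U) s"
  define V :: "('t, 'v) module" where "V = \<lparr>carrier = s ` carrier U, monoid.mult = undefined, monoid.one = undefined,
    ring.zero = s \<zero>\<^bsub>U\<^esub>, ring.add = (\<lambda>x y. s (?g x \<oplus>\<^bsub>U\<^esub> ?g y)), module.smult = (\<lambda>a x. s (a \<odot>\<^bsub>U\<^esub> ?g x))\<rparr>"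
  have g: "?g (s x) = x" if "x \<in> carrier U" for x using s that by (rule inv_into_f_f)
  have "lmodule T V"
  proof (intro lmodule.intro lmodule_axioms.intro abelian_groupI U.R.ring_axioms)
    fix x assume "x \<in> carrier V"
    then obtain u where u: "u \<in> carrier U" "x = s u" by (auto simp: V_def)
    then show "\<exists>y\<in>carrier V. y \<oplus>\<^bsub>V\<^esub> x = \<zero>\<^bsub>V\<^esub>"
      by (intro bexI[of _ "s (\<ominus>\<^bsub>U\<^esub> u)"]) (auto simp: V_def g U.M.l_neg)
  qed (auto simp: V_def g U.M.a_ac U.smult_l_distr U.smult_r_distr U.smult_assoc1)
  moreover have "s \<in> lmod_hom T U V" by (intro lmod_homI) (auto simp: V_def g)
  ultimately show ?thesis using s by (intro exI[of _ V]) (auto simp: V_def bij_betw_def)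
qed

text \<open>Choosing a preimage of each element under a presentation copies \<open>U\<close> to the
  type over which \<open>nd_injective\<close> quantifies; the copy is finitely
  \<open>n\<close>-presented. By the index shift, \<open>ext_van\<close> at \<open>d\<close> is the
  \<open>Ext\<close> of degree \<open>d + 1\<close> in the definition.\<close>

lemma nd_injective_ext_van:
  assumes I: "nd_injective S n d I" and U: "super_fp S U"
  shows "ext_van S I d U"
proof -
  have Um: "lmodule S U" and Im: "lmodule S I" using I U by (auto simp: super_fp_def nd_injective_def)
  obtain m p where p: "p \<in> lmod_hom S (fpow S m) U" "p ` carrier (fpow S m) = carrier U"
    using super_fp_presents[OF U] by (auto simp: presents_def)
  define s where "s = inv_into (carrier (fpow S m)) p"
  have "inj_on s (carrier U)" unfolding s_def p(2)[symmetric] by (rule inj_on_inv_into) simp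
  from transport_lmodule[OF Um this] obtain V where
    V: "lmodule S V" "s \<in> lmod_hom S U V" "bij_betw s (carrier U) (carrier V)" by blast
  have "super_fp S V" by (rule super_fp_iso[OF U V(2,3,1)])
  then have "fin_n_presented S n V" by (intro fp_syzygies_fin_n_presented) (simp add: fp_syzygies_iff)
  then have "Ext_zero S V I (Suc d)" using I by (simp add: nd_injective_def)
  from Ext_zero_imp_ext_van[OF V(1) Im this] show ?thesis by (rule ext_van_iso[OF _ V(2,3) Um V(1)])
qed

section \<open>Resolutions by finitely generated free modules\<close>

lemma bij_betw_lmod_iso:
  assumes "lmodule T M" "lmodule T N" "h \<in> lmod_hom T M N"
    and "\<And>x. x \<in> carrier M \<Longrightarrow> h x = \<zero>\<^bsub>N\<^esub> \<Longrightarrow> x = \<zero>\<^bsub>M\<^esub>" "\<And>y. y \<in> carrier N \<Longrightarrow> \<exists>x\<in>carrier M. y = h x"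
  shows "bij_betw h (carrier M) (carrier N)"
  using assms(4,5) lmod_hom_inj_iff[OF assms(1-3)] lmod_hom_closed[OF assms(3)] unfolding bij_betw_def by blast

text \<open>Relates a given short exact sequence with free middle term to the syzygy that
  \<open>presents\<close> speaks of: the kernel inside \<open>fpow T m\<close> is a copy of
  \<open>A\<close>.\<close>

lemma presents_free_quotient:
  assumes ex: "short_exact T A B C \<iota> \<pi>" and h: "h \<in> lmod_hom T (fpow T m) B" "bij_betw h (carrier (fpow T m)) (carrier B)"
  shows "presents T C m (\<lambda>v. \<pi> (h v))"
    and "\<exists>\<theta>\<in>lmod_hom T A (ker_mod (fpow T m) C (\<lambda>v. \<pi> (h v))).
           bij_betw \<theta> (carrier A) (carrier (ker_mod (fpow T m) C (\<lambda>v. \<pi> (h v))))"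
proof -
  note x = short_exactD[OF ex]
  let ?W = "ker_mod (fpow T m) C (\<lambda>v. \<pi> (h v))"
  have F: "lmodule T (fpow T m)" by (rule lmodule_fpow[OF x(1)])
  have p: "presents T B m h" using h by (auto simp: presents_def bij_betw_def)
  note c = presents_cokernel[OF ex p]
  show "presents T C m (\<lambda>v. \<pi> (h v))" by (rule c(1))
  let ?\<psi> = "\<lambda>v. inv_into (carrier A) \<iota> (h v)"
  note y = short_exactD[OF c(2)]
  have "bij_betw ?\<psi> (carrier ?W) (carrier A)"
  proof (rule bij_betw_lmod_iso[OF y(2,3,5) _ y(9)])
    fix v assume v: "v \<in> carrier ?W" "?\<psi> v = \<zero>\<^bsub>A\<^esub>"
    then obtain u where "u \<in> carrier (ker_mod (fpow T m) B h)" "v = u" using y(8) by blast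
    then have "v \<in> carrier (fpow T m)" "h v = \<zero>\<^bsub>B\<^esub>" by auto
    moreover have "inj_on h (carrier (fpow T m))" using h(2) by (simp add: bij_betw_def)
    ultimately show "v = \<zero>\<^bsub>?W\<^esub>" using lmod_hom_inj_iff[OF F x(2) h(1)] by simp
  qed
  then show "\<exists>\<theta>\<in>lmod_hom T A ?W. bij_betw \<theta> (carrier A) (carrier ?W)"
    using lmod_hom_inv_into[OF y(2,5)] bij_betw_inv_into by blast
qed

text \<open>\<open>Ext^(k+1)(A, I)\<close> is \<open>Ext^(k+2)(C, I)\<close>, as \<open>A\<close> is
  a syzygy of \<open>C\<close> up to isomorphism.\<close>

lemma ext_van_free_quotient:
  assumes ex: "short_exact T A B C \<iota> \<pi>" and B: "fg_free T B" and v: "ext_van T I (Suc k) C"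
  shows "ext_van T I k A"
proof -
  obtain m h where h: "h \<in> lmod_hom T (fpow T m) B" "bij_betw h (carrier (fpow T m)) (carrier B)"
    using B unfolding fg_free_def lmod_iso_def by blast
  note p = presents_free_quotient[OF ex h]
  obtain \<theta> where \<theta>: "\<theta> \<in> lmod_hom T A (ker_mod (fpow T m) C (\<lambda>v. \<pi> (h v)))"
    "bij_betw \<theta> (carrier A) (carrier (ker_mod (fpow T m) C (\<lambda>v. \<pi> (h v))))" using p(2) by blast
  have K: "lmodule T (ker_mod (fpow T m) C (\<lambda>v. \<pi> (h v)))"
    using p(1) unfolding presents_def
    by (intro lmodule_ker_mod lmodule_fpow[OF short_exactD(1)[OF ex]] short_exactD(3)[OF ex]) auto
  show ?thesis by (rule ext_van_iso[OF ext_van_SucD[OF v p(1)] \<theta> short_exactD(1)[OF ex] K])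
qed

text \<open>Coinduction on being isomorphic to some \<open>W i\<close>: a syzygy of such a module,
  taken through the free module \<open>P i\<close>, is isomorphic to
  \<open>W (Suc i)\<close>.\<close>

lemma super_fp_chain:
  assumes ex: "\<And>i. short_exact T (W (Suc i)) (P i) (W i) (\<iota> i) (\<pi> i)" and P: "\<And>i. fg_free T (P i)"
  shows "super_fp T (W i)"
proof -
  define X :: "('a, nat \<Rightarrow> 'a) module \<Rightarrow> bool"
    where "X V \<longleftrightarrow> lmodule T V \<and> (\<exists>i. \<exists>\<theta>\<in>lmod_hom T (W i) V. bij_betw \<theta> (carrier (W i)) (carrier V))" for V
  have pres: "\<exists>m p. presents T (W i) m p \<and> X (ker_mod (fpow T m) (W i) p)" for i
  proof -
    obtain m h where h: "h \<in> lmod_hom T (fpow T m) (P i)" "bij_betw h (carrier (fpow T m)) (carrier (P i))"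
      using P[of i] unfolding fg_free_def lmod_iso_def by blast
    note p = presents_free_quotient[OF ex h]
    have "lmodule T (ker_mod (fpow T m) (W i) (\<lambda>v. \<pi> i (h v)))"
      using p(1) unfolding presents_def
      by (intro lmodule_ker_mod lmodule_fpow[OF short_exactD(1)[OF ex]] short_exactD(3)[OF ex]) auto
    then show ?thesis using p unfolding X_def by blast
  qed
  have "fp_syzygies T V" if "X V" for V
    using that
  proof (coinduct V rule: fp_syzygies.coinduct)
    case (fp_syzygies V)
    then obtain i \<theta> where V: "lmodule T V" "\<theta> \<in> lmod_hom T (W i) V" "bij_betw \<theta> (carrier (W i)) (carrier V)"
      unfolding X_def by blast
    obtain m p where p: "presents T (W i) m p" "X (ker_mod (fpow T m) (W i) p)" using pres by blast
    note q = presents_iso[OF p(1) V(2,3) short_exactD(3)[OF ex] V(1)]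
    show ?case using V(1) q(1) p(2) by (intro exI[of _ V] exI[of _ m] exI[of _ "\<lambda>v. \<theta> (p v)"]) (simp add: q(2))
  qed
  then show ?thesis using pres[of i] short_exactD(3)[OF ex[of i]] unfolding super_fp_def by blast
qed

text \<open>The syzygies of a resolution, starting with the resolved module itself: with \<open>i\<close> shifted by one
  from the paper's numbering.\<close>

lemma short_exact_ker_mod:
  assumes "lmodule T B" "lmodule T C" "\<pi> \<in> lmod_hom T B C" "\<pi> ` carrier B = carrier C"
  shows "short_exact T (ker_mod B C \<pi>) B C (\<lambda>x. x) \<pi>"
  using assms(4) by (intro short_exactI lmodule_ker_mod assms(1-3)) (auto simp: lmod_hom_def)

lemma short_exact_resolution_0:
  assumes "resolution T \<infinity> U P \<delta> \<epsilon>"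
  shows "short_exact T (ker_mod (P 0) U \<epsilon>) (P 0) U (\<lambda>x. x) \<epsilon>"
  using resolutionD[OF assms] by (intro short_exact_ker_mod)

lemma short_exact_resolution_1:
  assumes r: "resolution T \<infinity> U P \<delta> \<epsilon>"
  shows "short_exact T (ker_mod (P 1) (P 0) (\<delta> 0)) (P 1) (ker_mod (P 0) U \<epsilon>) (\<lambda>x. x) (\<delta> 0)"
proof -
  note rd = resolutionD[OF r]
  have K: "lmodule T (ker_mod (P 0) U \<epsilon>)" by (rule lmodule_ker_mod[OF rd(2,1,3)])
  have im: "\<delta> 0 ` carrier (P 1) = carrier (ker_mod (P 0) U \<epsilon>)" using rd(6) by (simp add: ker_mod_def)
  then have "\<delta> 0 \<in> lmod_hom T (P 1) (ker_mod (P 0) U \<epsilon>)"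
    using rd(4)[of 0] by (intro lmod_hom_into_ker_mod) auto
  from short_exact_ker_mod[OF rd(2)[of 1] K this im] show ?thesis by (simp add: ker_mod_def a_kernel_def')
qed

lemma short_exact_resolution_Suc:
  assumes r: "resolution T \<infinity> U P \<delta> \<epsilon>"
  shows "short_exact T (ker_mod (P (Suc (Suc i))) (P (Suc i)) (\<delta> (Suc i))) (P (Suc (Suc i)))
    (ker_mod (P (Suc i)) (P i) (\<delta> i)) (\<lambda>x. x) (\<delta> (Suc i))"
proof -
  note rd = resolutionD[OF r]
  have K: "lmodule T (ker_mod (P (Suc i)) (P i) (\<delta> i))" by (rule lmodule_ker_mod[OF rd(2,2,4)])
  have im: "\<delta> (Suc i) ` carrier (P (Suc (Suc i))) = carrier (ker_mod (P (Suc i)) (P i) (\<delta> i))"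
    using rd(7)[of i] by (simp add: ker_mod_def)
  then have "\<delta> (Suc i) \<in> lmod_hom T (P (Suc (Suc i))) (ker_mod (P (Suc i)) (P i) (\<delta> i))"
    using rd(4)[of "Suc i"] by (intro lmod_hom_into_ker_mod) auto
  from short_exact_ker_mod[OF rd(2) K this im] show ?thesis by (simp add: ker_mod_def a_kernel_def')
qed

text \<open>Index 0 is the kernel of the augmentation, in agreement with \<open>syzygy\<close>. The
  resolved module carries no index, which is why the lemmas treat it as a separate case.\<close>

definition syzygy_module :: "('t, 'u) module \<Rightarrow> (nat \<Rightarrow> ('t, 'p) module) \<Rightarrow> (nat \<Rightarrow> 'p \<Rightarrow> 'p) \<Rightarrow> ('p \<Rightarrow> 'u) \<Rightarrow> nat \<Rightarrow> ('t, 'p) module" where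
  "syzygy_module U P \<delta> \<epsilon> i = (case i of 0 \<Rightarrow> ker_mod (P 0) U \<epsilon> | Suc j \<Rightarrow> ker_mod (P (Suc j)) (P j) (\<delta> j))"

lemma short_exact_syzygy_module:
  assumes "resolution T \<infinity> U P \<delta> \<epsilon>"
  shows "short_exact T (syzygy_module U P \<delta> \<epsilon> (Suc i)) (P (Suc i)) (syzygy_module U P \<delta> \<epsilon> i) (\<lambda>x. x) (\<delta> i)"
  using short_exact_resolution_1[OF assms] short_exact_resolution_Suc[OF assms]
  by (cases i) (auto simp: syzygy_module_def)

lemma short_exact_syzygy_module_0:
  assumes "resolution T \<infinity> U P \<delta> \<epsilon>"
  shows "short_exact T (syzygy_module U P \<delta> \<epsilon> 0) (P 0) U (\<lambda>x. x) \<epsilon>"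
  using short_exact_resolution_0[OF assms] by (simp add: syzygy_module_def)

lemma super_fp_syzygy_module:
  assumes r: "resolution T \<infinity> U P \<delta> \<epsilon>" and P: "\<And>i. fg_free T (P i)"
  shows "super_fp T (syzygy_module U P \<delta> \<epsilon> i)"
  by (rule super_fp_chain[where P = "\<lambda>i. P (Suc i)" and W = "syzygy_module U P \<delta> \<epsilon>", OF short_exact_syzygy_module[OF r] P])

lemma super_fp_free_quotient:
  assumes ex: "short_exact T A B C \<iota> \<pi>" and B: "fg_free T B" and A: "super_fp T A"
  shows "super_fp T C"
proof -
  obtain m h where h: "h \<in> lmod_hom T (fpow T m) B" "bij_betw h (carrier (fpow T m)) (carrier B)"
    using B unfolding fg_free_def lmod_iso_def by blast
  note x = short_exactD[OF ex]
  have T: "ring T" using x(1) by (simp add: lmodule_def)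
  show ?thesis by (rule super_fp_cokernel[OF ex A super_fp_iso[OF super_fp_fpow[OF T] h x(2)]])
qed

text \<open>Going back \<open>d - k\<close> syzygies raises the degree of Ext from
  \<open>k + 1\<close> to \<open>d + 1\<close>, where it vanishes on every super finitely presented
  module. At most \<open>Suc i\<close> steps back are possible before the resolved module
  \<open>U\<close> is reached; this is the bound on \<open>d\<close>.\<close>

lemma ext_van_syzygy_module:
  assumes r: "resolution T \<infinity> U P \<delta> \<epsilon>" and P: "\<And>i. fg_free T (P i)" and I: "nd_injective T n d I"
    and k: "k \<le> d" "d \<le> Suc (i + k)"
  shows "ext_van T I k (syzygy_module U P \<delta> \<epsilon> i)"
proof -
  let ?K = "syzygy_module U P \<delta> \<epsilon>"
  have "ext_van T I k (?K i)" if "k \<le> d" "d \<le> Suc (i + k)" for k i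
    using that
  proof (induction "d - k" arbitrary: i k)
    case 0
    then have "k = d" by simp
    then show ?case using nd_injective_ext_van[OF I super_fp_syzygy_module[OF r P]] by simp
  next
    case (Suc l)
    show ?case
    proof (cases i)
      case 0
      then have "Suc k = d" using Suc by simp
      moreover have "super_fp T U"
        by (rule super_fp_free_quotient[OF short_exact_syzygy_module_0[OF r] P super_fp_syzygy_module[OF r P]])
      ultimately have "ext_van T I (Suc k) U" using nd_injective_ext_van[OF I] by blast
      from ext_van_free_quotient[OF short_exact_syzygy_module_0[OF r] P this] show ?thesis unfolding 0 .
    next
      case (Suc j)
      have "ext_van T I (Suc k) (?K j)" using Suc.hyps Suc.prems Suc by (intro Suc.hyps(1)) auto
      from ext_van_free_quotient[OF short_exact_syzygy_module[OF r] P this] show ?thesis unfolding Suc .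
    qed
  qed
  then show ?thesis using k by blast
qed

lemma resolution_iso:
  assumes r: "resolution T \<infinity> U P \<delta> \<epsilon>" and P': "\<And>i. lmodule T (P' i)"
    and h: "\<And>i. h i \<in> lmod_hom T (P' i) (P i)" "\<And>i. bij_betw (h i) (carrier (P' i)) (carrier (P i))"
  shows "resolution T \<infinity> U P' (\<lambda>i x. inv_into (carrier (P' i)) (h i) (\<delta> i (h (Suc i) x))) (\<lambda>x. \<epsilon> (h 0 x))"
proof -
  note rd = resolutionD[OF r]
  let ?k = "\<lambda>i. inv_into (carrier (P' i)) (h i)"
  note k = lmod_hom_inv_into[OF P' h]
  have kh: "?k i (h i x) = x" if "x \<in> carrier (P' i)" for i x
    using h(2)[of i] that by (simp add: bij_betw_def inv_into_f_f)
  have hk: "h i (?k i x) = x" if "x \<in> carrier (P i)" for i x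
    using h(2)[of i] that by (simp add: bij_betw_def f_inv_into_f)
  have him: "h i ` carrier (P' i) = carrier (P i)" for i using h(2)[of i] by (simp add: bij_betw_def)
  have \<delta>h: "(\<lambda>x. \<delta> i (h (Suc i) x)) \<in> lmod_hom T (P' (Suc i)) (P i)" for i by (rule lmod_hom_comp[OF h(1) rd(4)])
  have kz: "?k i x = \<zero>\<^bsub>P' i\<^esub> \<longleftrightarrow> x = \<zero>\<^bsub>P i\<^esub>" if "x \<in> carrier (P i)" for i x
    using hk[OF that] lmod_hom_zero[OF P' rd(2) h(1), of i] lmod_hom_zero[OF rd(2) P' k, of i] by metis
  have im: "(\<lambda>x. ?k i (\<delta> i (h (Suc i) x))) ` carrier (P' (Suc i)) = ?k i ` (\<delta> i ` carrier (P (Suc i)))" for i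
    unfolding him[symmetric] by (simp add: image_image)
  have kim: "?k i ` {x \<in> carrier (P i). Q x} = {x \<in> carrier (P' i). Q (h i x)}" for i Q
  proof (intro equalityI subsetI)
    fix y assume "y \<in> {x \<in> carrier (P' i). Q (h i x)}"
    then show "y \<in> ?k i ` {x \<in> carrier (P i). Q x}"
      using kh[of y i] lmod_hom_closed[OF h(1)] by (intro image_eqI[of _ _ "h i y"]) auto
  qed (auto simp: hk lmod_hom_closed[OF k])
  show ?thesis unfolding resolution_def exact_augmented_def
  proof (intro conjI allI impI rd(1) P')
    show "(\<lambda>x. \<epsilon> (h 0 x)) \<in> lmod_hom T (P' 0) U" by (rule lmod_hom_comp[OF h(1) rd(3)])
    show "(\<lambda>x. ?k i (\<delta> i (h (Suc i) x))) \<in> lmod_hom T (P' (Suc i)) (P' i)" for i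
      by (rule lmod_hom_comp[OF \<delta>h k])
    show "(\<lambda>x. \<epsilon> (h 0 x)) ` carrier (P' 0) = carrier U"
      using rd(5) unfolding him[symmetric] by (simp add: image_image)
    have "(\<lambda>x. ?k 0 (\<delta> 0 (h (Suc 0) x))) ` carrier (P' 1) = ?k 0 ` {x \<in> carrier (P 0). \<epsilon> x = \<zero>\<^bsub>U\<^esub>}"
      using im[of 0] rd(6) by (simp add: a_kernel_def')
    then show "(\<lambda>x. ?k 0 (\<delta> 0 (h (Suc 0) x))) ` carrier (P' 1) = a_kernel (P' 0) U (\<lambda>x. \<epsilon> (h 0 x))"
      unfolding kim by (simp add: a_kernel_def')
    fix i
    have "(\<lambda>x. ?k (Suc i) (\<delta> (Suc i) (h (Suc (Suc i)) x))) ` carrier (P' (Suc (Suc i)))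
        = ?k (Suc i) ` {x \<in> carrier (P (Suc i)). \<delta> i x = \<zero>\<^bsub>P i\<^esub>}"
      using im[of "Suc i"] rd(7) by (simp add: a_kernel_def')
    also have "\<dots> = {x \<in> carrier (P' (Suc i)). \<delta> i (h (Suc i) x) = \<zero>\<^bsub>P i\<^esub>}" by (rule kim)
    also have "\<dots> = a_kernel (P' (Suc i)) (P' i) (\<lambda>x. ?k i (\<delta> i (h (Suc i) x)))"
      using kz[OF lmod_hom_closed[OF \<delta>h]] by (auto simp: a_kernel_def')
    finally show "(\<lambda>x. ?k (Suc i) (\<delta> (Suc i) (h (Suc (Suc i)) x))) ` carrier (P' (Suc (Suc i)))
       = a_kernel (P' (Suc i)) (P' i) (\<lambda>x. ?k i (\<delta> i (h (Suc i) x)))" .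
  qed
qed

lemma cochain_exact_iso:
  assumes r: "resolution T \<infinity> U P \<delta> \<epsilon>" and P': "\<And>i. lmodule T (P' i)" and M: "lmodule T M"
    and h: "\<And>i. h i \<in> lmod_hom T (P' i) (P i)" "\<And>i. bij_betw (h i) (carrier (P' i)) (carrier (P i))"
    and ex: "cochain_exact T P' (\<lambda>i x. inv_into (carrier (P' i)) (h i) (\<delta> i (h (Suc i) x))) M j"
  shows "cochain_exact T P \<delta> M j"
  unfolding cochain_exact_def
proof (intro ballI impI)
  note rd = resolutionD[OF r]
  let ?k = "\<lambda>i. inv_into (carrier (P' i)) (h i)"
  note k = lmod_hom_inv_into[OF P' h]
  have hk: "h i (?k i x) = x" if "x \<in> carrier (P i)" for i x
    using h(2)[of i] that by (simp add: bij_betw_def f_inv_into_f)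
  fix f assume f: "f \<in> lmod_hom T (P (Suc j)) M" and z: "\<forall>x\<in>carrier (P (Suc (Suc j))). f (\<delta> (Suc j) x) = \<zero>\<^bsub>M\<^esub>"
  have "\<forall>x\<in>carrier (P' (Suc (Suc j))). f (h (Suc j) (?k (Suc j) (\<delta> (Suc j) (h (Suc (Suc j)) x)))) = \<zero>\<^bsub>M\<^esub>"
    using z by (simp add: hk lmod_hom_closed[OF rd(4)] lmod_hom_closed[OF h(1)])
  then obtain g where g: "g \<in> lmod_hom T (P' j) M"
    "\<And>x. x \<in> carrier (P' (Suc j)) \<Longrightarrow> f (h (Suc j) x) = g (?k j (\<delta> j (h (Suc j) x)))"
    using ex[unfolded cochain_exact_def, rule_format, OF lmod_hom_comp[OF h(1) f]] by blast
  have "f x = g (?k j (\<delta> j x))" if "x \<in> carrier (P (Suc j))" for x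
    using g(2)[OF lmod_hom_closed[OF k that]] by (simp add: hk[OF that])
  then show "\<exists>h\<in>lmod_hom T (P j) M. \<forall>x\<in>carrier (P (Suc j)). f x = h (\<delta> j x)"
    by (intro bexI[OF _ lmod_hom_comp[OF k g(1)]]) simp
qed

section \<open>Bimodules\<close>

lemma left_mod_simps [simp]:
  "carrier (left_mod K) = carrier K" "\<zero>\<^bsub>left_mod K\<^esub> = \<zero>\<^bsub>K\<^esub>" "x \<oplus>\<^bsub>left_mod K\<^esub> y = x \<oplus>\<^bsub>K\<^esub> y"
  "s \<odot>\<^bsub>left_mod K\<^esub> x = s \<odot>\<^bsub>K\<^esub> x"
  by (simp_all add: left_mod_def module.truncate_def)

lemma right_mod_simps [simp]:
  "carrier (right_mod K) = carrier K" "\<zero>\<^bsub>right_mod K\<^esub> = \<zero>\<^bsub>K\<^esub>" "x \<oplus>\<^bsub>right_mod K\<^esub> y = x \<oplus>\<^bsub>K\<^esub> y"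
  "r \<odot>\<^bsub>right_mod K\<^esub> x = rsmult K x r"
  by (simp_all add: right_mod_def)

lemma op_ring_simps [simp]:
  "carrier (op_ring R) = carrier R" "\<zero>\<^bsub>op_ring R\<^esub> = \<zero>\<^bsub>R\<^esub>" "\<one>\<^bsub>op_ring R\<^esub> = \<one>\<^bsub>R\<^esub>"
  "x \<oplus>\<^bsub>op_ring R\<^esub> y = x \<oplus>\<^bsub>R\<^esub> y" "x \<otimes>\<^bsub>op_ring R\<^esub> y = y \<otimes>\<^bsub>R\<^esub> x" "op_ring (op_ring R) = R"
  by (simp_all add: op_ring_def)

text \<open>\<open>K\<close> as a bimodule over the opposite rings. Left and right modules are
  exchanged by equality, not merely isomorphism, so whatever is proved for one side can be
  instantiated for the other.\<close>

definition swap :: "('s, 'r, 'k) bimod \<Rightarrow> ('r, 's, 'k) bimod" where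
  "swap K = \<lparr>carrier = carrier K, monoid.mult = monoid.mult K, monoid.one = monoid.one K, ring.zero = ring.zero K,
     ring.add = ring.add K, module.smult = (\<lambda>r x. rsmult K x r), rsmult = (\<lambda>x s. s \<odot>\<^bsub>K\<^esub> x)\<rparr>"

lemma swap_simps [simp]:
  "carrier (swap K) = carrier K" "\<zero>\<^bsub>swap K\<^esub> = \<zero>\<^bsub>K\<^esub>" "x \<oplus>\<^bsub>swap K\<^esub> y = x \<oplus>\<^bsub>K\<^esub> y"
  "module.smult (swap K) = (\<lambda>r x. rsmult K x r)" "rsmult (swap K) x s = s \<odot>\<^bsub>K\<^esub> x"
  "left_mod (swap K) = right_mod K" "right_mod (swap K) = left_mod K"
  by (simp_all add: swap_def left_mod_def right_mod_def module.truncate_def)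

lemma super_fp_bimodule_resolution_left:
  assumes "super_fp_bimodule_resolution S R C F \<delta> \<epsilon>"
  shows "resolution S \<infinity> (left_mod C) (\<lambda>i. left_mod (F i)) \<delta> \<epsilon>"
    and "resolution (op_ring R) \<infinity> (right_mod C) (\<lambda>i. right_mod (F i)) \<delta> \<epsilon>"
    and "fg_free S (left_mod (F i))" "fg_free (op_ring R) (right_mod (F i))"
  using assms unfolding super_fp_bimodule_resolution_def resolution_def exact_augmented_def
    bimodule_def bimodule_hom_def a_kernel_def' by auto

lemma syzygy_syzygy_module:
  "left_mod (syzygy C F \<delta> \<epsilon> i) = syzygy_module (left_mod C) (\<lambda>i. left_mod (F i)) \<delta> \<epsilon> i"
  "right_mod (syzygy C F \<delta> \<epsilon> i) = syzygy_module (right_mod C) (\<lambda>i. right_mod (F i)) \<delta> \<epsilon> i"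
  by (cases i; simp add: syzygy_def syzygy_module_def left_mod_def right_mod_def module.truncate_def ker_mod_def a_kernel_def')+

lemma swap_syzygy: "swap (syzygy C F \<delta> \<epsilon> i) = syzygy (swap C) (\<lambda>i. swap (F i)) \<delta> \<epsilon> i"
  by (cases i) (simp_all add: syzygy_def swap_def a_kernel_def')

lemma bimodule_swap: "bimodule S R K \<Longrightarrow> bimodule (op_ring R) (op_ring S) (swap K)"
  by (simp add: bimodule_def)

text \<open>The definition treats both sides alike. Through this, part (2) becomes an instance of
  part (1) over the opposite rings.\<close>

lemma special_semidualizing_swap:
  assumes "special_semidualizing S R C F \<delta> \<epsilon> d K"
  shows "special_semidualizing (op_ring R) (op_ring S) (swap C) (\<lambda>i. swap (F i)) \<delta> \<epsilon> d (swap K)"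
proof -
  have "super_fp_bimodule_resolution (op_ring R) (op_ring S) (swap C) (\<lambda>i. swap (F i)) \<delta> \<epsilon>"
    using assms unfolding special_semidualizing_def super_fp_bimodule_resolution_def
    by (auto simp: bimodule_hom_def exact_augmented_def a_kernel_def' intro: bimodule_swap)
  moreover have "semidualizing (op_ring R) (op_ring S) (swap K)"
    using assms bimodule_swap unfolding special_semidualizing_def semidualizing_def by auto
  ultimately show ?thesis using assms by (simp add: special_semidualizing_def swap_syzygy)
qed

section \<open>Powers of a module\<close>

text \<open>Zero outside the index range makes equality of tuples equality of functions.\<close>

definition pow_mod :: "('t, 'm) module \<Rightarrow> nat \<Rightarrow> ('t, nat \<Rightarrow> 'm) module" where
  "pow_mod M m = \<lparr>carrier = {f. (\<forall>i<m. f i \<in> carrier M) \<and> (\<forall>i. \<not> i < m \<longrightarrow> f i = \<zero>\<^bsub>M\<^esub>)},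
     monoid.mult = undefined, monoid.one = undefined, ring.zero = (\<lambda>i. \<zero>\<^bsub>M\<^esub>),
     ring.add = (\<lambda>f g i. f i \<oplus>\<^bsub>M\<^esub> g i), module.smult = (\<lambda>a f i. a \<odot>\<^bsub>M\<^esub> f i)\<rparr>"

lemma pow_mod_simps [simp]:
  "f \<in> carrier (pow_mod M m) \<longleftrightarrow> (\<forall>i<m. f i \<in> carrier M) \<and> (\<forall>i. \<not> i < m \<longrightarrow> f i = \<zero>\<^bsub>M\<^esub>)"
  "\<zero>\<^bsub>pow_mod M m\<^esub> = (\<lambda>i. \<zero>\<^bsub>M\<^esub>)" "f \<oplus>\<^bsub>pow_mod M m\<^esub> g = (\<lambda>i. f i \<oplus>\<^bsub>M\<^esub> g i)"
  "c \<odot>\<^bsub>pow_mod M m\<^esub> f = (\<lambda>i. c \<odot>\<^bsub>M\<^esub> f i)"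
  by (simp_all add: pow_mod_def)

lemma pow_mod_nth: "lmodule T M \<Longrightarrow> f \<in> carrier (pow_mod M m) \<Longrightarrow> f i \<in> carrier M"
  using abelian_group.axioms(1) abelian_monoid.zero_closed unfolding lmodule_def by (cases "i < m") force+

lemma lmodule_pow_mod:
  assumes M: "lmodule T M" shows "lmodule T (pow_mod M m)"
proof -
  interpret M: lmodule T M by fact
  note c = pow_mod_nth[OF M]
  show ?thesis
  proof (intro lmodule.intro lmodule_axioms.intro abelian_groupI M.R.ring_axioms)
    fix f assume f: "f \<in> carrier (pow_mod M m)"
    then show "\<exists>y\<in>carrier (pow_mod M m). y \<oplus>\<^bsub>pow_mod M m\<^esub> f = \<zero>\<^bsub>pow_mod M m\<^esub>"
      using c[OF f] by (intro bexI[of _ "\<lambda>i. \<ominus>\<^bsub>M\<^esub> f i"]) (auto simp: M.M.l_neg)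
    show "\<zero>\<^bsub>pow_mod M m\<^esub> \<oplus>\<^bsub>pow_mod M m\<^esub> f = f" "\<one>\<^bsub>T\<^esub> \<odot>\<^bsub>pow_mod M m\<^esub> f = f" using c[OF f] by auto
    fix g assume g: "g \<in> carrier (pow_mod M m)"
    show "f \<oplus>\<^bsub>pow_mod M m\<^esub> g = g \<oplus>\<^bsub>pow_mod M m\<^esub> f" using c[OF f] c[OF g] by (auto simp: M.M.a_comm)
    fix h assume "h \<in> carrier (pow_mod M m)"
    then show "f \<oplus>\<^bsub>pow_mod M m\<^esub> g \<oplus>\<^bsub>pow_mod M m\<^esub> h = f \<oplus>\<^bsub>pow_mod M m\<^esub> (g \<oplus>\<^bsub>pow_mod M m\<^esub> h)"
      using c[OF f] c[OF g] c[of h m] by (auto simp: M.M.a_assoc)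
  next
    fix b f assume b: "b \<in> carrier T" and f: "f \<in> carrier (pow_mod M m)"
    fix g assume g: "g \<in> carrier (pow_mod M m)"
    show "b \<odot>\<^bsub>pow_mod M m\<^esub> (f \<oplus>\<^bsub>pow_mod M m\<^esub> g) = b \<odot>\<^bsub>pow_mod M m\<^esub> f \<oplus>\<^bsub>pow_mod M m\<^esub> b \<odot>\<^bsub>pow_mod M m\<^esub> g"
      using b c[OF f] c[OF g] by (simp add: M.smult_r_distr)
  next
    fix b b' f assume b: "b \<in> carrier T" "b' \<in> carrier T" and f: "f \<in> carrier (pow_mod M m)"
    show "(b \<oplus>\<^bsub>T\<^esub> b') \<odot>\<^bsub>pow_mod M m\<^esub> f = b \<odot>\<^bsub>pow_mod M m\<^esub> f \<oplus>\<^bsub>pow_mod M m\<^esub> b' \<odot>\<^bsub>pow_mod M m\<^esub> f"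
      "b \<otimes>\<^bsub>T\<^esub> b' \<odot>\<^bsub>pow_mod M m\<^esub> f = b \<odot>\<^bsub>pow_mod M m\<^esub> (b' \<odot>\<^bsub>pow_mod M m\<^esub> f)"
      using b c[OF f] by (simp_all add: M.smult_l_distr M.smult_assoc1)
  qed (auto simp: M.smult_zero_right)
qed

definition single :: "('t, 'm) module \<Rightarrow> nat \<Rightarrow> 'm \<Rightarrow> nat \<Rightarrow> 'm" where
  "single M i x = (\<lambda>j. if j = i then x else \<zero>\<^bsub>M\<^esub>)"

lemma single_hom:
  assumes M: "lmodule T M" and i: "i < m"
  shows "single M i \<in> lmod_hom T M (pow_mod M m)"
proof -
  interpret M: lmodule T M by fact
  show ?thesis using i by (intro lmod_homI) (auto simp: single_def fun_eq_iff M.smult_zero_right)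
qed

lemma hom_from_tuple:
  assumes M: "lmodule T M" and N: "lmodule T N" and h: "\<And>i. i < m \<Longrightarrow> h i \<in> lmod_hom T M N"
  shows "(\<lambda>f. \<Oplus>\<^bsub>N\<^esub>i\<in>{..<m}. h i (f i)) \<in> lmod_hom T (pow_mod M m) N"
proof -
  interpret N: lmodule T N by fact
  have c: "h i (f i) \<in> carrier N" if "i < m" "f \<in> carrier (pow_mod M m)" for i f
    using lmod_hom_closed[OF h[OF that(1)]] that by simp
  show ?thesis
  proof (rule lmod_homI)
    fix f g assume f: "f \<in> carrier (pow_mod M m)" and g: "g \<in> carrier (pow_mod M m)"
    have "(\<Oplus>\<^bsub>N\<^esub>i\<in>{..<m}. h i ((f \<oplus>\<^bsub>pow_mod M m\<^esub> g) i)) = (\<Oplus>\<^bsub>N\<^esub>i\<in>{..<m}. h i (f i) \<oplus>\<^bsub>N\<^esub> h i (g i))"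
      using f g c by (intro N.M.finsum_cong') (auto simp: lmod_hom_add[OF h])
    also have "\<dots> = (\<Oplus>\<^bsub>N\<^esub>i\<in>{..<m}. h i (f i)) \<oplus>\<^bsub>N\<^esub> (\<Oplus>\<^bsub>N\<^esub>i\<in>{..<m}. h i (g i))"
      using c[OF _ f] c[OF _ g] by (intro N.M.finsum_addf) auto
    finally show "(\<Oplus>\<^bsub>N\<^esub>i\<in>{..<m}. h i ((f \<oplus>\<^bsub>pow_mod M m\<^esub> g) i)) = \<dots>" .
  next
    fix b f assume b: "b \<in> carrier T" and f: "f \<in> carrier (pow_mod M m)"
    have "(\<Oplus>\<^bsub>N\<^esub>i\<in>{..<m}. h i ((b \<odot>\<^bsub>pow_mod M m\<^esub> f) i)) = (\<Oplus>\<^bsub>N\<^esub>i\<in>{..<m}. b \<odot>\<^bsub>N\<^esub> h i (f i))"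
      using f b c by (intro N.M.finsum_cong') (auto simp: lmod_hom_smult[OF h])
    also have "\<dots> = b \<odot>\<^bsub>N\<^esub> (\<Oplus>\<^bsub>N\<^esub>i\<in>{..<m}. h i (f i))"
      using c[OF _ f] b by (intro N.smult_finsum[symmetric]) auto
    finally show "(\<Oplus>\<^bsub>N\<^esub>i\<in>{..<m}. h i ((b \<odot>\<^bsub>pow_mod M m\<^esub> f) i)) = \<dots>" .
  qed (use c in \<open>auto intro!: N.M.finsum_closed\<close>)
qed

lemma hom_pow_mod_sum:
  assumes M: "lmodule T M" and N: "lmodule T N" and \<theta>: "\<theta> \<in> lmod_hom T (pow_mod M m) N"
    and f: "f \<in> carrier (pow_mod M m)"
  shows "\<theta> f = (\<Oplus>\<^bsub>N\<^esub>i\<in>{..<m}. \<theta> (single M i (f i)))"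
proof -
  interpret M: lmodule T M by fact
  interpret N: lmodule T N by fact
  have fM: "f i \<in> carrier M" for i by (rule pow_mod_nth[OF M f])
  have sc: "single M i (f i) \<in> carrier (pow_mod M m)" if "i < m" for i
    using lmod_hom_closed[OF single_hom[OF M that] fM] .
  have "\<theta> (\<lambda>i. if i < k then f i else \<zero>\<^bsub>M\<^esub>) = (\<Oplus>\<^bsub>N\<^esub>i\<in>{..<k}. \<theta> (single M i (f i)))" if "k \<le> m" for k
    using that
  proof (induction k)
    case 0
    then show ?case using lmod_hom_zero[OF lmodule_pow_mod[OF M] N \<theta>] by simp
  next
    case (Suc k)
    let ?f = "\<lambda>i. if i < k then f i else \<zero>\<^bsub>M\<^esub>"
    have "(\<lambda>i. if i < Suc k then f i else \<zero>\<^bsub>M\<^esub>) = ?f \<oplus>\<^bsub>pow_mod M m\<^esub> single M k (f k)"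
      using fM by (auto simp: single_def fun_eq_iff less_Suc_eq)
    then have "\<theta> (\<lambda>i. if i < Suc k then f i else \<zero>\<^bsub>M\<^esub>) = \<theta> ?f \<oplus>\<^bsub>N\<^esub> \<theta> (single M k (f k))"
      using lmod_hom_add[OF \<theta> _ sc[of k], of ?f] fM Suc.prems by simp
    then show ?case using Suc sc lmod_hom_closed[OF \<theta>]
      by (simp add: lessThan_Suc N.M.finsum_insert Pi_def N.M.a_comm N.M.finsum_closed del: pow_mod_simps)
  qed
  moreover have "(\<lambda>i. if i < m then f i else \<zero>\<^bsub>M\<^esub>) = f" using f by auto
  ultimately show ?thesis by fastforce
qed

lemma short_exact_pow_mod:
  assumes M: "lmodule T M"
  shows "short_exact T M (pow_mod M (Suc m)) (pow_mod M m) (single M m) (\<lambda>f i. if i < m then f i else \<zero>\<^bsub>M\<^esub>)"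
proof -
  interpret M: lmodule T M by fact
  show ?thesis
  proof (rule short_exactI[OF M lmodule_pow_mod[OF M] lmodule_pow_mod[OF M] single_hom[OF M lessI]])
    show "(\<lambda>f i. if i < m then f i else \<zero>\<^bsub>M\<^esub>) \<in> lmod_hom T (pow_mod M (Suc m)) (pow_mod M m)"
      by (intro lmod_homI) (auto simp: fun_eq_iff M.smult_zero_right)
    fix x assume "x \<in> carrier M"
    show "(\<lambda>i. if i < m then single M m x i else \<zero>\<^bsub>M\<^esub>) = \<zero>\<^bsub>pow_mod M m\<^esub>" by (auto simp: single_def)
    assume "single M m x = \<zero>\<^bsub>pow_mod M (Suc m)\<^esub>"
    from fun_cong[OF this, of m] show "x = \<zero>\<^bsub>M\<^esub>" by (simp add: single_def)
  next
    fix f assume f: "f \<in> carrier (pow_mod M (Suc m))" "(\<lambda>i. if i < m then f i else \<zero>\<^bsub>M\<^esub>) = \<zero>\<^bsub>pow_mod M m\<^esub>"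
    have "f i = single M m (f m) i" for i
      using f(1) fun_cong[OF f(2), of i] by (auto simp: single_def split: if_splits)
    then have "f = single M m (f m)" by (rule ext)
    then show "\<exists>a\<in>carrier M. f = single M m a" using f(1) by (intro bexI[of _ "f m"]) simp_all
  next
    fix f assume f: "f \<in> carrier (pow_mod M m)"
    then show "\<exists>b\<in>carrier (pow_mod M (Suc m)). f = (\<lambda>i. if i < m then b i else \<zero>\<^bsub>M\<^esub>)"
      using pow_mod_nth[OF M f] by (intro bexI[of _ f]) auto
  qed
qed

lemma super_fp_pow_mod:
  assumes "super_fp T M" shows "super_fp T (pow_mod M m)"
proof (induction m)
  case 0
  have "lmodule T (pow_mod M 0)" using assms by (intro lmodule_pow_mod) (simp add: super_fp_def)
  then show ?case by (rule super_fp_zero) auto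
next
  case (Suc m)
  then show ?case using super_fp_extension[OF short_exact_pow_mod assms] assms by (simp add: super_fp_def)
qed

text \<open>Not immediate, since \<open>ext_van\<close> also concerns presentations of the zero
  module with nonzero kernel. Vanishing at \<open>d\<close> descends because the zero module is, up
  to isomorphism, its own syzygy in \<open>T^0\<close>.\<close>

lemma ext_van_zero_module:
  assumes I: "nd_injective T n d I" and W: "lmodule T W" "carrier W = {\<zero>\<^bsub>W\<^esub>}" and k: "k \<le> d"
  shows "ext_van T I k W"
  using W k
proof (induction "d - k" arbitrary: k W)
  case 0
  then show ?case using nd_injective_ext_van[OF I super_fp_zero[OF 0(2,3)]] by simp
next
  case (Suc l)
  interpret W: lmodule T W by fact
  have z0: "carrier (fpow T 0) = {\<zero>\<^bsub>fpow T 0\<^esub>}" by (auto simp: free_module_simps)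
  then have p: "presents T W 0 (\<lambda>_. \<zero>\<^bsub>W\<^esub>)"
    using Suc.prems(2) by (auto simp: presents_def lmod_hom_def W.smult_zero_right)
  let ?K = "ker_mod (fpow T 0) W (\<lambda>_. \<zero>\<^bsub>W\<^esub>)"
  have K: "lmodule T ?K" using p unfolding presents_def
    by (intro lmodule_ker_mod lmodule_fpow[OF Suc.prems(1)] Suc.prems(1)) auto
  interpret K: lmodule T ?K by (rule K)
  have h: "(\<lambda>_. \<zero>\<^bsub>?K\<^esub>) \<in> lmod_hom T W ?K"
  proof (rule lmod_homI)
    show "\<zero>\<^bsub>?K\<^esub> \<in> carrier ?K" by (rule K.M.zero_closed)
    show "\<zero>\<^bsub>?K\<^esub> = \<zero>\<^bsub>?K\<^esub> \<oplus>\<^bsub>?K\<^esub> \<zero>\<^bsub>?K\<^esub>" by (metis K.M.l_zero K.M.zero_closed)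
    show "\<zero>\<^bsub>?K\<^esub> = a \<odot>\<^bsub>?K\<^esub> \<zero>\<^bsub>?K\<^esub>" if "a \<in> carrier T" for a using K.smult_zero_right[OF that] by simp
  qed
  have cK: "carrier ?K = {\<zero>\<^bsub>?K\<^esub>}" using z0 by (simp add: set_eq_iff)
  have b: "bij_betw (\<lambda>_. \<zero>\<^bsub>?K\<^esub>) (carrier W) (carrier ?K)" unfolding Suc.prems(2) cK by (simp add: bij_betw_def)
  have "ext_van T I (Suc k) W" using Suc.hyps(2) Suc.prems by (intro Suc.hyps(1)) auto
  from ext_van_iso[OF ext_van_SucD[OF this p] h b Suc.prems(1) K] show ?case .
qed

lemma ext_van_pow_mod:
  assumes I: "nd_injective T n d I" and M: "super_fp T M" "ext_van T I k M" and k: "k \<le> d"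
  shows "ext_van T I k (pow_mod M m)"
proof (induction m)
  case 0
  have "lmodule T (pow_mod M 0)" using M by (intro lmodule_pow_mod) (simp add: super_fp_def)
  then show ?case by (rule ext_van_zero_module[OF I _ _ k]) auto
next
  case (Suc m)
  have "lmodule T M" "lmodule T I" using M I by (auto simp: super_fp_def nd_injective_def)
  then show ?case
    using ext_van_extension[OF short_exact_pow_mod M(1) super_fp_pow_mod[OF M(1)] _ M(2) Suc] by blast
qed

section \<open>Matrices of a resolution of a bimodule\<close>

text \<open>The matrices \<open>a j\<close> describe the differentials of a resolution of the right module \<open>K\<close> by the modules
  \<open>R\<^bsup>m j\<^esup>\<close>, and \<open>g\<close> its augmentation. \<open>dual0\<close> and \<open>dual\<close> say that the complex
  \<open>0 \<rightarrow> S \<rightarrow> K\<^bsup>m 0\<^esup> \<rightarrow> K\<^bsup>m 1\<^esup> \<rightarrow> \<dots>\<close> of left modules obtained by applying \<open>Hom(-, K)\<close> is exact, that is,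
  that the homothety map of \<open>S\<close> is bijective and that \<open>K\<close> has no self-extensions.\<close>

locale matrix_resolution =
  fixes S :: "'s ring" and R :: "'r ring" and K :: "('s, 'r, 'k) bimod"
    and m :: "nat \<Rightarrow> nat" and g :: "nat \<Rightarrow> 'k" and a :: "nat \<Rightarrow> nat \<Rightarrow> nat \<Rightarrow> 'r"
  assumes bimodule: "bimodule S R K" and ringR: "ring R"
    and g_closed: "x < m 0 \<Longrightarrow> g x \<in> carrier K"
    and a_closed: "x < m j \<Longrightarrow> y < m (Suc j) \<Longrightarrow> a j x y \<in> carrier R"
    and generators: "k \<in> carrier K \<Longrightarrow>
      \<exists>r\<in>{..<m 0} \<rightarrow> carrier R. k = (\<Oplus>\<^bsub>left_mod K\<^esub>x\<in>{..<m 0}. rsmult K (g x) (r x))"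
    and relations: "r \<in> {..<m 0} \<rightarrow> carrier R \<Longrightarrow> (\<Oplus>\<^bsub>left_mod K\<^esub>x\<in>{..<m 0}. rsmult K (g x) (r x)) = \<zero>\<^bsub>K\<^esub> \<Longrightarrow>
      \<exists>q\<in>{..<m 1} \<rightarrow> carrier R. \<forall>x<m 0. r x = (\<Oplus>\<^bsub>R\<^esub>y\<in>{..<m 1}. a 0 x y \<otimes>\<^bsub>R\<^esub> q y)"
    and complex0: "y < m 1 \<Longrightarrow> (\<Oplus>\<^bsub>left_mod K\<^esub>x\<in>{..<m 0}. rsmult K (g x) (a 0 x y)) = \<zero>\<^bsub>K\<^esub>"
    and complex: "x < m j \<Longrightarrow> z < m (Suc (Suc j)) \<Longrightarrow>
      (\<Oplus>\<^bsub>R\<^esub>y\<in>{..<m (Suc j)}. a j x y \<otimes>\<^bsub>R\<^esub> a (Suc j) y z) = \<zero>\<^bsub>R\<^esub>"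
    and dual_inj: "s \<in> carrier S \<Longrightarrow> (\<And>x. x < m 0 \<Longrightarrow> s \<odot>\<^bsub>K\<^esub> g x = \<zero>\<^bsub>K\<^esub>) \<Longrightarrow> s = \<zero>\<^bsub>S\<^esub>"
    and dual0: "f \<in> carrier (pow_mod (left_mod K) (m 0)) \<Longrightarrow>
      (\<And>y. y < m 1 \<Longrightarrow> (\<Oplus>\<^bsub>left_mod K\<^esub>x\<in>{..<m 0}. rsmult K (f x) (a 0 x y)) = \<zero>\<^bsub>K\<^esub>) \<Longrightarrow>
      \<exists>s\<in>carrier S. \<forall>x<m 0. f x = s \<odot>\<^bsub>K\<^esub> g x"
    and dual: "f \<in> carrier (pow_mod (left_mod K) (m (Suc j))) \<Longrightarrow>
      (\<And>z. z < m (Suc (Suc j)) \<Longrightarrow> (\<Oplus>\<^bsub>left_mod K\<^esub>y\<in>{..<m (Suc j)}. rsmult K (f y) (a (Suc j) y z)) = \<zero>\<^bsub>K\<^esub>) \<Longrightarrow>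
      \<exists>f'\<in>carrier (pow_mod (left_mod K) (m j)).
        \<forall>y<m (Suc j). f y = (\<Oplus>\<^bsub>left_mod K\<^esub>x\<in>{..<m j}. rsmult K (f' x) (a j x y))"

lemma hom_fpow_sum:
  assumes N: "lmodule T N" and \<theta>: "\<theta> \<in> lmod_hom T (fpow T m) N" and v: "v \<in> carrier (fpow T m)"
  shows "\<theta> v = (\<Oplus>\<^bsub>N\<^esub>i\<in>{..<m}. v i \<odot>\<^bsub>N\<^esub> \<theta> (unit_vec T i))"
proof -
  have T: "ring T" using N by (simp add: lmodule_def)
  have \<phi>: "(\<lambda>i. \<theta> (unit_vec T i)) \<in> {..<m} \<rightarrow> carrier N"
    using lmod_hom_closed[OF \<theta> unit_vec_carrier[OF T]] by auto
  have "\<theta> v = lin_ext T {..<m} N (\<lambda>i. \<theta> (unit_vec T i)) v"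
    by (rule hom_eq_on_basis[OF N \<theta> lin_ext_hom[OF N \<phi>] lin_ext_unit_vec[OF N \<phi>, symmetric] v])
  also have "\<dots> = (\<Oplus>\<^bsub>N\<^esub>i\<in>{..<m}. v i \<odot>\<^bsub>N\<^esub> \<theta> (unit_vec T i))"
    using v by (intro lin_ext_superset[OF N \<phi> v]) (auto simp: fpow_carrier linorder_not_less[symmetric])
  finally show ?thesis .
qed

lemma finsum_fpow_nth:
  assumes "lmodule T (fpow T m)" "finite A" "h \<in> A \<rightarrow> carrier (fpow T m)"
  shows "(\<Oplus>\<^bsub>fpow T m\<^esub>y\<in>A. h y) x = (\<Oplus>\<^bsub>T\<^esub>y\<in>A. h y x)"
proof -
  interpret F: lmodule T "fpow T m" by fact
  have c: "v x \<in> carrier T" if "v \<in> carrier (fpow T m)" for v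
    using that by (cases "x < m") (auto simp: fpow_carrier)
  show ?thesis using assms(2,3)
  proof (induction A rule: finite_induct)
    case empty
    then show ?case by (simp add: free_module_simps)
  next
    case (insert y A)
    then show ?case using c by (subst F.M.finsum_insert; (subst F.R.finsum_insert)?) (auto simp: free_module_simps(3))
  qed
qed

lemma finsum_op_ring: "finsum (op_ring R) f A = finsum R f A"
  by (simp add: finsum_def op_ring_def)

lemma finsum_right_mod:
  assumes K: "bimodule S R K" and "finite A" "f \<in> A \<rightarrow> carrier K"
  shows "finsum (right_mod K) f A = finsum (left_mod K) f A"
proof -
  interpret L: lmodule S "left_mod K" using K by (simp add: bimodule_def)
  interpret Q: lmodule "op_ring R" "right_mod K" using K by (simp add: bimodule_def)
  show ?thesis using assms(2,3)
    by (induction A rule: finite_induct) (simp_all add: Pi_def)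
qed

text \<open>A resolution cut off after a term resolves the syzygy in that place.\<close>

lemma resolution_tail:
  assumes r: "resolution T \<infinity> U P \<delta> \<epsilon>"
  shows "resolution T \<infinity> (syzygy_module U P \<delta> \<epsilon> e) (\<lambda>i. P (Suc e + i)) (\<lambda>i. \<delta> (Suc e + i)) (\<delta> e)"
proof -
  note ex = short_exact_syzygy_module[OF r]
  note x = short_exactD[OF ex[of e]]
  note rd = resolutionD[OF r]
  have z: "\<zero>\<^bsub>syzygy_module U P \<delta> \<epsilon> e\<^esub> = \<zero>\<^bsub>P e\<^esub>" by (cases e) (auto simp: syzygy_module_def)
  show ?thesis unfolding resolution_def exact_augmented_def
  proof (intro conjI allI impI)
    show "\<delta> e ` carrier (P (Suc e + 0)) = carrier (syzygy_module U P \<delta> \<epsilon> e)"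
      using short_exact_onto[OF ex[of e]] by simp
    show "\<delta> (Suc e + 0) ` carrier (P (Suc e + 1)) = a_kernel (P (Suc e + 0)) (syzygy_module U P \<delta> \<epsilon> e) (\<delta> e)"
      using rd(7)[of e] by (simp add: a_kernel_def' z)
  qed (use x(3,5) rd(2,4,7) in auto)
qed

lemma fg_free_resolution_fpow:
  assumes r: "resolution T \<infinity> U P \<delta> \<epsilon>" and P: "\<And>i. fg_free T (P i)"
  shows "\<exists>m \<delta>' \<epsilon>'. resolution T \<infinity> U (\<lambda>i. fpow T (m i)) \<delta>' \<epsilon>'"
proof -
  have "\<exists>m h. h \<in> lmod_hom T (fpow T m) (P i) \<and> bij_betw h (carrier (fpow T m)) (carrier (P i))" for i
    using P[of i] unfolding fg_free_def lmod_iso_def by blast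
  then obtain m h where h: "\<And>i. h i \<in> lmod_hom T (fpow T (m i)) (P i)"
    "\<And>i. bij_betw (h i) (carrier (fpow T (m i))) (carrier (P i))" by metis
  from resolution_iso[OF r lmodule_fpow[OF resolutionD(1)[OF r]] h] show ?thesis by blast
qed

text \<open>Resolutions by \<open>fpow\<close> do not have the type tested by
  \<open>Ext_zero\<close>; reindexing the bases by naturals inside the sum type gives an isomorphic
  resolution that does.\<close>

lemma cochain_exact_fpow:
  fixes U :: "('t, 'u) module"
  assumes r: "resolution T \<infinity> U (\<lambda>i. fpow T (m i)) \<delta> \<epsilon>" and M: "lmodule T M" and E: "Ext_zero T U M (Suc j)"
  shows "cochain_exact T (\<lambda>i. fpow T (m i)) \<delta> M j"
proof -
  have T: "ring T" using M by (simp add: lmodule_def)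
  define \<iota> :: "nat \<Rightarrow> 'u + 't + nat" where "\<iota> i = Inr (Inr i)" for i
  have \<iota>: "inj_on \<iota> {..<k}" for k by (auto simp: \<iota>_def inj_on_def)
  define P' where "P' i = free_module T (\<iota> ` {..<m i})" for i
  have P': "lmodule T (P' i)" "projective T (P' i)" for i
    unfolding P'_def by (rule lmodule_free_module[OF T], rule projective_free_module[OF T])
  define h where "h i = (\<lambda>v k. if k < m i then v (\<iota> k) else \<zero>\<^bsub>T\<^esub>)" for i
  have h: "h i \<in> lmod_hom T (P' i) (fpow T (m i))" "bij_betw (h i) (carrier (P' i)) (carrier (fpow T (m i)))" for i
    unfolding h_def P'_def by (rule free_module_reindex[OF T \<iota>])+
  from resolution_iso[OF r P'(1) h] P'(2) E show ?thesis
    using cochain_exact_iso[OF r P'(1) M h] unfolding Ext_zero_iff[OF M] projective_resolution_def by blast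
qed

text \<open>The axioms of the locale translate the semidualizing conditions on the right module:
  \<open>generators\<close> and \<open>relations\<close> are exactness of the resolution,
  \<open>dual_inj\<close> and \<open>dual0\<close> are bijectivity of the homothety map of
  \<open>S\<close>, and \<open>dual\<close> is the vanishing of \<open>Ext(K, K)\<close> over
  \<open>op_ring R\<close>.\<close>

lemma matrix_resolution_exists:
  assumes K: "special_semidualizing S R C F \<delta> \<epsilon> d K" and R: "ring R" and S: "ring S"
  shows "\<exists>m g a. matrix_resolution S R K m g a"
proof -
  let ?T = "op_ring R" and ?K = "right_mod K" and ?L = "left_mod K"
  have sd: "semidualizing S R K" and bi: "bimodule S R K" and KF: "K = syzygy C F \<delta> \<epsilon> (d - 1)"
    and F: "super_fp_bimodule_resolution S R C F \<delta> \<epsilon>"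
    using K by (auto simp: special_semidualizing_def semidualizing_def)
  interpret L: lmodule S ?L using bi by (simp add: bimodule_def)
  have Km: "lmodule ?T ?K" using bi by (simp add: bimodule_def)
  interpret Q: lmodule ?T ?K by (rule Km)
  interpret R: ring R by (rule R)
  have T: "ring ?T" by (rule Q.R.ring_axioms)
  note bF = super_fp_bimodule_resolution_left[OF F]
  \<comment> \<open>\<open>K\<close> is the syzygy with index \<open>d - 1\<close>, so the free
    right modules of the bimodule resolution from index \<open>Suc (d - 1)\<close> on resolve
    it.\<close>
  have "resolution ?T \<infinity> ?K (\<lambda>i. right_mod (F (Suc (d - 1) + i))) (\<lambda>i. \<delta> (Suc (d - 1) + i)) (\<delta> (d - 1))"
    using resolution_tail[OF bF(2), of "d - 1"] unfolding KF syzygy_syzygy_module .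
  from fg_free_resolution_fpow[OF this bF(4)] obtain m D e
    where r: "resolution ?T \<infinity> ?K (\<lambda>i. fpow ?T (m i)) D e" by blast
  note rd = resolutionD[OF r]
  have ce: "cochain_exact ?T (\<lambda>i. fpow ?T (m i)) D ?K j" for j
    using sd by (intro cochain_exact_fpow[OF r Km]) (simp add: semidualizing_def)
  define g where "g x = e (unit_vec ?T x)" for x
  \<comment> \<open>Column \<open>y\<close> is the image of the basis vector with index
    \<open>y\<close>; \<open>x\<close> selects the coordinate.\<close>
  define a where "a j x y = D j (unit_vec ?T y) x" for j x y
  have u: "unit_vec ?T x \<in> carrier (fpow ?T k)" if "x < k" for x k using that by (intro unit_vec_carrier T) auto
  have g: "g x \<in> carrier K" if "x < m 0" for x
    using lmod_hom_closed[OF rd(3) u[OF that]] by (simp add: g_def)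
  have Du: "D j (unit_vec ?T y) \<in> carrier (fpow ?T (m j))" if "y < m (Suc j)" for j y
    using lmod_hom_closed[OF rd(4) u[OF that]] .
  have a: "a j x y \<in> carrier R" if "x < m j" "y < m (Suc j)" for j x y
    using Du[OF that(2)] that(1) by (simp add: a_def fpow_carrier)
  have rs: "rsmult K x r \<in> carrier K" if "x \<in> carrier K" "r \<in> carrier R" for x r
    using Q.smult_closed[of r x] that by simp
  have sum: "(\<Oplus>\<^bsub>?K\<^esub>x\<in>A. rsmult K (k x) (q x)) = (\<Oplus>\<^bsub>?L\<^esub>x\<in>A. rsmult K (k x) (q x))"
    if "finite A" "\<And>x. x \<in> A \<Longrightarrow> k x \<in> carrier K" "\<And>x. x \<in> A \<Longrightarrow> q x \<in> carrier R" for k q A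
    using that rs by (intro finsum_right_mod[OF bi]) auto
  have ev: "\<theta> v = (\<Oplus>\<^bsub>?L\<^esub>x\<in>{..<k}. rsmult K (\<theta> (unit_vec ?T x)) (v x))"
    if \<theta>: "\<theta> \<in> lmod_hom ?T (fpow ?T k) ?K" and v: "v \<in> carrier (fpow ?T k)" for \<theta> v k
    using hom_fpow_sum[OF Km \<theta> v] lmod_hom_closed[OF \<theta> u] v
    by (subst sum[symmetric]) (auto simp: fpow_carrier)
  \<comment> \<open>Products in \<open>op_ring R\<close> are reversed, so the coefficient
    \<open>v y\<close> of a linear combination ends up to the right of the matrix entry.\<close>
  have Dev: "D j v x = (\<Oplus>\<^bsub>R\<^esub>y\<in>{..<m (Suc j)}. a j x y \<otimes>\<^bsub>R\<^esub> v y)" if v: "v \<in> carrier (fpow ?T (m (Suc j)))" for j v x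
  proof -
    have vc: "v y \<in> carrier ?T" if "y < m (Suc j)" for y using v that by (simp add: fpow_carrier)
    interpret G: lmodule ?T "fpow ?T (m j)" by (rule rd(2))
    have "D j v x = (\<Oplus>\<^bsub>?T\<^esub>y\<in>{..<m (Suc j)}. (v y \<odot>\<^bsub>fpow ?T (m j)\<^esub> D j (unit_vec ?T y)) x)"
      unfolding hom_fpow_sum[OF rd(2) rd(4) v]
      using Du vc by (intro finsum_fpow_nth[OF rd(2)]) (auto intro!: G.smult_closed)
    then show ?thesis unfolding finsum_op_ring by (simp add: free_module_simps(4) a_def)
  qed
  have tup: "\<exists>v\<in>carrier (fpow ?T k). \<forall>x<k. v x = q x" if "\<And>x. x < k \<Longrightarrow> q x \<in> carrier R" for q k
    using that by (intro bexI[of _ "\<lambda>x. if x < k then q x else \<zero>\<^bsub>R\<^esub>"]) (auto simp: fpow_carrier)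
  have vR: "v \<in> {..<k} \<rightarrow> carrier R" if "v \<in> carrier (fpow ?T k)" for v k using that by (auto simp: fpow_carrier)
  have ext0: "\<theta> v = \<zero>\<^bsub>?K\<^esub>" if \<theta>: "\<theta> \<in> lmod_hom ?T (fpow ?T k) ?K" and v: "v \<in> carrier (fpow ?T k)"
    and z: "\<And>x. x < k \<Longrightarrow> \<theta> (unit_vec ?T x) = \<zero>\<^bsub>K\<^esub>" for \<theta> v k
  proof -
    have zz: "(\<lambda>_. \<zero>\<^bsub>?K\<^esub>) \<in> lmod_hom ?T (fpow ?T k) ?K"
      using Q.smult_zero_right Q.M.zero_closed Q.M.l_zero[OF Q.M.zero_closed] by (intro lmod_homI) simp_all
    show ?thesis using z by (intro hom_eq_on_basis[OF Km \<theta> zz _ v]) simp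
  qed
  have lin: "\<exists>\<theta>\<in>lmod_hom ?T (fpow ?T k) ?K. \<forall>x<k. \<theta> (unit_vec ?T x) = f x"
    if f: "f \<in> carrier (pow_mod ?L k)" for f k
  proof -
    have \<phi>: "f \<in> {..<k} \<rightarrow> carrier ?K" using f by auto
    show ?thesis using lin_ext_unit_vec[OF Km \<phi>] by (intro bexI[OF _ lin_ext_hom[OF Km \<phi>]]) auto
  qed
  have \<theta>D: "\<theta> (D j (unit_vec ?T y)) = (\<Oplus>\<^bsub>?L\<^esub>x\<in>{..<m j}. rsmult K (\<theta> (unit_vec ?T x)) (a j x y))"
    if \<theta>: "\<theta> \<in> lmod_hom ?T (fpow ?T (m j)) ?K" and y: "y < m (Suc j)" for \<theta> j y
    using ev[OF \<theta> Du[OF y]] by (simp add: a_def)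
  have fcong: "(\<Oplus>\<^bsub>?L\<^esub>x\<in>{..<k}. rsmult K (p x) (q x)) = (\<Oplus>\<^bsub>?L\<^esub>x\<in>{..<k}. rsmult K (p' x) (q x))"
    if "\<And>x. x < k \<Longrightarrow> p x = p' x" "\<And>x. x < k \<Longrightarrow> p' x \<in> carrier K" "\<And>x. x < k \<Longrightarrow> q x \<in> carrier R" for p p' q k
    using that rs by (intro L.M.finsum_cong') auto
  have "matrix_resolution S R K m g a"
  proof (unfold_locales; (intro bi R g a)?; assumption?)
    fix k assume "k \<in> carrier K"
    then have "k \<in> e ` carrier (fpow ?T (m 0))" using rd(5) by simp
    then obtain v where v: "v \<in> carrier (fpow ?T (m 0))" "k = e v" by auto
    then show "\<exists>r\<in>{..<m 0} \<rightarrow> carrier R. k = (\<Oplus>\<^bsub>?L\<^esub>x\<in>{..<m 0}. rsmult K (g x) (r x))"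
      using ev[OF rd(3) v(1)] vR by (auto simp: g_def)
  next
    fix q assume q: "q \<in> {..<m 0} \<rightarrow> carrier R" and z: "(\<Oplus>\<^bsub>?L\<^esub>x\<in>{..<m 0}. rsmult K (g x) (q x)) = \<zero>\<^bsub>K\<^esub>"
    then obtain v where v: "v \<in> carrier (fpow ?T (m 0))" "\<And>x. x < m 0 \<Longrightarrow> v x = q x" using tup[of "m 0" q] by auto
    have "e v = (\<Oplus>\<^bsub>?L\<^esub>x\<in>{..<m 0}. rsmult K (g x) (q x))"
      unfolding ev[OF rd(3) v(1)] g_def[symmetric] using v(2) q rs g by (intro L.M.finsum_cong') (auto simp: Pi_iff)
    then have "v \<in> a_kernel (fpow ?T (m 0)) ?K e" using v z by (simp add: a_kernel_iff)
    then obtain w where w: "w \<in> carrier (fpow ?T (m (Suc 0)))" "v = D 0 w" using rd(6) by (metis imageE)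
    show "\<exists>w\<in>{..<m 1} \<rightarrow> carrier R. \<forall>x<m 0. q x = (\<Oplus>\<^bsub>R\<^esub>y\<in>{..<m 1}. a 0 x y \<otimes>\<^bsub>R\<^esub> w y)"
      using vR[OF w(1)] Dev[OF w(1)] w(2) v(2) by (intro bexI[of _ w]) auto
  next
    fix y assume "y < m 1"
    then have y: "y < m (Suc 0)" by simp
    have "D 0 (unit_vec ?T y) \<in> a_kernel (fpow ?T (m 0)) ?K e" using rd(6) u[OF y] by blast
    then show "(\<Oplus>\<^bsub>?L\<^esub>x\<in>{..<m 0}. rsmult K (g x) (a 0 x y)) = \<zero>\<^bsub>K\<^esub>"
      using \<theta>D[OF rd(3) y] by (simp add: a_kernel_iff g_def)
  next
    fix x j z assume xz: "x < m j" "z < m (Suc (Suc j))"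
    have "D j (D (Suc j) (unit_vec ?T z)) x = \<zero>\<^bsub>R\<^esub>"
      using resolution_complex[OF r u[OF xz(2)]] by (simp add: free_module_simps(2))
    then show "(\<Oplus>\<^bsub>R\<^esub>y\<in>{..<m (Suc j)}. a j x y \<otimes>\<^bsub>R\<^esub> a (Suc j) y z) = \<zero>\<^bsub>R\<^esub>"
      unfolding Dev[OF Du[OF xz(2)]] by (simp add: a_def)
  next
    fix s assume s: "s \<in> carrier S" and z: "\<And>x. x < m 0 \<Longrightarrow> s \<odot>\<^bsub>K\<^esub> g x = \<zero>\<^bsub>K\<^esub>"
    \<comment> \<open>Multiplication by \<open>s\<close> is right linear and vanishes on generators,
      hence everywhere; injectivity of the homothety map gives \<open>s = 0\<close>.\<close>
    have sh: "(\<lambda>k. s \<odot>\<^bsub>K\<^esub> k) \<in> lmod_hom ?T ?K ?K"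
      using L.smult_closed[OF s] L.smult_r_distr[OF s] bi s by (intro lmod_homI) (auto simp: bimodule_def)
    note se = lmod_hom_comp[OF rd(3) sh]
    have "s \<odot>\<^bsub>K\<^esub> k = \<zero>\<^bsub>K\<^esub>" if "k \<in> carrier K" for k
    proof -
      have "k \<in> e ` carrier (fpow ?T (m 0))" using rd(5) that by simp
      then obtain v where v: "v \<in> carrier (fpow ?T (m 0))" "k = e v" by auto
      show ?thesis using ext0[OF se v(1)] z by (simp add: g_def v(2))
    qed
    then have "(\<lambda>x\<in>carrier K. s \<odot>\<^bsub>K\<^esub> x) = (\<lambda>x\<in>carrier K. \<zero>\<^bsub>S\<^esub> \<odot>\<^bsub>K\<^esub> x)"
      using L.smult_zero_left by (auto simp: fun_eq_iff)
    moreover have "inj_on (\<lambda>s. \<lambda>x\<in>carrier K. s \<odot>\<^bsub>K\<^esub> x) (carrier S)"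
      using sd by (simp add: semidualizing_def bij_betw_def)
    ultimately show "s = \<zero>\<^bsub>S\<^esub>" using s by (auto dest: inj_onD)
  next
    fix f assume f: "f \<in> carrier (pow_mod ?L (m 0))"
      and z: "\<And>y. y < m 1 \<Longrightarrow> (\<Oplus>\<^bsub>?L\<^esub>x\<in>{..<m 0}. rsmult K (f x) (a 0 x y)) = \<zero>\<^bsub>K\<^esub>"
    obtain \<theta> where \<theta>: "\<theta> \<in> lmod_hom ?T (fpow ?T (m 0)) ?K" "\<And>x. x < m 0 \<Longrightarrow> \<theta> (unit_vec ?T x) = f x"
      using lin[OF f] by blast
    have "\<theta> (D 0 (unit_vec ?T y)) = \<zero>\<^bsub>K\<^esub>" if "y < m (Suc 0)" for y
    proof -
      have "\<theta> (D 0 (unit_vec ?T y)) = (\<Oplus>\<^bsub>?L\<^esub>x\<in>{..<m 0}. rsmult K (f x) (a 0 x y))"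
        unfolding \<theta>D[OF \<theta>(1) that] using \<theta>(2) f a[OF _ that] by (intro fcong) auto
      then show ?thesis using z that by simp
    qed
    then have \<theta>z: "\<theta> (D 0 w) = \<zero>\<^bsub>?K\<^esub>" if "w \<in> carrier (fpow ?T (m (Suc 0)))" for w
      using ext0[OF lmod_hom_comp[OF rd(4) \<theta>(1)] that] by simp
    \<comment> \<open>The kernel of \<open>e\<close> is the image of \<open>D 0\<close>, which
      \<open>\<theta>\<close> kills. The resulting endomorphism of \<open>K\<close> is
      multiplication by some \<open>s\<close>.\<close>
    have "\<exists>h\<in>lmod_hom ?T ?K ?K. \<forall>v\<in>carrier (fpow ?T (m 0)). h (e v) = \<theta> v"
    proof (rule hom_factor[OF rd(2) Km Km rd(3) rd(5) \<theta>(1)])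
      fix v assume "v \<in> carrier (fpow ?T (m 0))" "e v = \<zero>\<^bsub>?K\<^esub>"
      then have "v \<in> D 0 ` carrier (fpow ?T (m (Suc 0)))" unfolding rd(6) by (simp add: a_kernel_iff)
      then show "\<theta> v = \<zero>\<^bsub>?K\<^esub>" using \<theta>z by auto
    qed
    then obtain h where h: "h \<in> lmod_hom ?T ?K ?K" "\<And>v. v \<in> carrier (fpow ?T (m 0)) \<Longrightarrow> h (e v) = \<theta> v" by blast
    have "restrict h (carrier K) \<in> carrier (hom_group ?T ?K ?K)" using restrict_lmod_hom[OF Km h(1)] by simp
    moreover have "(\<lambda>s. \<lambda>x\<in>carrier K. s \<odot>\<^bsub>K\<^esub> x) ` carrier S = carrier (hom_group ?T ?K ?K)"
      using sd by (simp add: semidualizing_def bij_betw_def)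
    ultimately have "restrict h (carrier K) \<in> (\<lambda>s. \<lambda>x\<in>carrier K. s \<odot>\<^bsub>K\<^esub> x) ` carrier S" by simp
    then obtain s where s: "s \<in> carrier S" "restrict h (carrier K) = (\<lambda>x\<in>carrier K. s \<odot>\<^bsub>K\<^esub> x)" by blast
    have "f x = s \<odot>\<^bsub>K\<^esub> g x" if x: "x < m 0" for x
      using fun_cong[OF s(2), of "g x"] g[OF x] h(2)[OF u[OF x]] \<theta>(2)[OF x] by (simp add: g_def)
    then show "\<exists>s\<in>carrier S. \<forall>x<m 0. f x = s \<odot>\<^bsub>K\<^esub> g x" using s(1) by blast
  next
    fix f j assume f: "f \<in> carrier (pow_mod ?L (m (Suc j)))"
      and z: "\<And>z. z < m (Suc (Suc j)) \<Longrightarrow> (\<Oplus>\<^bsub>?L\<^esub>y\<in>{..<m (Suc j)}. rsmult K (f y) (a (Suc j) y z)) = \<zero>\<^bsub>K\<^esub>"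
    obtain \<theta> where \<theta>: "\<theta> \<in> lmod_hom ?T (fpow ?T (m (Suc j))) ?K" "\<And>x. x < m (Suc j) \<Longrightarrow> \<theta> (unit_vec ?T x) = f x"
      using lin[OF f] by blast
    have "\<theta> (D (Suc j) (unit_vec ?T y)) = \<zero>\<^bsub>K\<^esub>" if "y < m (Suc (Suc j))" for y
    proof -
      have "\<theta> (D (Suc j) (unit_vec ?T y)) = (\<Oplus>\<^bsub>?L\<^esub>x\<in>{..<m (Suc j)}. rsmult K (f x) (a (Suc j) x y))"
        unfolding \<theta>D[OF \<theta>(1) that] using \<theta>(2) f a[OF _ that] by (intro fcong) auto
      then show ?thesis using z that by simp
    qed
    then have "\<forall>w\<in>carrier (fpow ?T (m (Suc (Suc j)))). \<theta> (D (Suc j) w) = \<zero>\<^bsub>?K\<^esub>"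
      using ext0[OF lmod_hom_comp[OF rd(4) \<theta>(1)]] by simp
    \<comment> \<open>This is \<open>Ext^(j+1)(K, K) = 0\<close> over \<open>op_ring R\<close>, in
      the form \<open>ce\<close>.\<close>
    then obtain h where h: "h \<in> lmod_hom ?T (fpow ?T (m j)) ?K"
      "\<And>v. v \<in> carrier (fpow ?T (m (Suc j))) \<Longrightarrow> \<theta> v = h (D j v)"
      using ce[of j, unfolded cochain_exact_def] \<theta>(1) by blast
    have hc: "h (unit_vec ?T x) \<in> carrier K" if "x < m j" for x using lmod_hom_closed[OF h(1) u[OF that]] by simp
    let ?f = "\<lambda>x. if x < m j then h (unit_vec ?T x) else \<zero>\<^bsub>K\<^esub>"
    have "f y = (\<Oplus>\<^bsub>?L\<^esub>x\<in>{..<m j}. rsmult K (?f x) (a j x y))" if y: "y < m (Suc j)" for y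
    proof -
      have "f y = h (D j (unit_vec ?T y))" using \<theta>(2)[OF y] h(2)[OF u[OF y]] by simp
      also have "\<dots> = (\<Oplus>\<^bsub>?L\<^esub>x\<in>{..<m j}. rsmult K (?f x) (a j x y))"
        unfolding \<theta>D[OF h(1) y] using hc a[OF _ y] by (intro fcong) auto
      finally show ?thesis .
    qed
    then show "\<exists>f'\<in>carrier (pow_mod ?L (m j)).
        \<forall>y<m (Suc j). f y = (\<Oplus>\<^bsub>?L\<^esub>x\<in>{..<m j}. rsmult K (f' x) (a j x y))"
      using hc by (intro bexI[of _ ?f]) auto
  qed
  then show ?thesis by blast
qed

section \<open>Exactness of the dual complex under Hom\<close>

context matrix_resolution
begin

text \<open>The differential of \<open>Hom(-, K)\<close> applied to the resolution, under the
  identification of \<open>Hom(R^m, K)\<close> with \<open>K^m\<close>: a row vector over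
  \<open>K\<close> times the matrix \<open>a j\<close>. It is linear over \<open>S\<close>.\<close>

definition dmap :: "nat \<Rightarrow> (nat \<Rightarrow> 'k) \<Rightarrow> nat \<Rightarrow> 'k" where
  "dmap j f = (\<lambda>y. if y < m (Suc j) then \<Oplus>\<^bsub>left_mod K\<^esub>x\<in>{..<m j}. rsmult K (f x) (a j x y) else \<zero>\<^bsub>K\<^esub>)"

abbreviation dpow :: "nat \<Rightarrow> ('s, nat \<Rightarrow> 'k) module" where
  "dpow j \<equiv> pow_mod (left_mod K) (m j)"

abbreviation dker :: "nat \<Rightarrow> ('s, nat \<Rightarrow> 'k) module" where
  "dker j \<equiv> ker_mod (dpow j) (dpow (Suc j)) (dmap j)"

lemma left: "lmodule S (left_mod K)" and right: "lmodule (op_ring R) (right_mod K)"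
  using bimodule by (auto simp: bimodule_def)

sublocale L: lmodule S "left_mod K" by (rule left)
sublocale Q: lmodule "op_ring R" "right_mod K" by (rule right)

lemma rsmult_closed: "x \<in> carrier K \<Longrightarrow> r \<in> carrier R \<Longrightarrow> rsmult K x r \<in> carrier K"
  using Q.smult_closed[of r x] by simp

lemma rsmult_hom: "r \<in> carrier R \<Longrightarrow> (\<lambda>x. rsmult K x r) \<in> lmod_hom S (left_mod K) (left_mod K)"
  using rsmult_closed Q.smult_r_distr[of r] bimodule by (intro lmod_homI) (auto simp: bimodule_def)

lemma dmap_hom: "dmap j \<in> lmod_hom S (dpow j) (dpow (Suc j))"
proof -
  have h: "(\<lambda>f. \<Oplus>\<^bsub>left_mod K\<^esub>x\<in>{..<m j}. rsmult K (f x) (a j x y)) \<in> lmod_hom S (dpow j) (left_mod K)"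
    if "y < m (Suc j)" for y
    using that by (intro hom_from_tuple[OF left left, of "m j" "\<lambda>x k. rsmult K k (a j x y)"] rsmult_hom a_closed)
  show ?thesis
  proof (rule lmod_homI)
    fix f assume f: "f \<in> carrier (dpow j)"
    show "dmap j f \<in> carrier (dpow (Suc j))" using lmod_hom_closed[OF h f] by (simp add: dmap_def)
    fix f' assume f': "f' \<in> carrier (dpow j)"
    show "dmap j (f \<oplus>\<^bsub>dpow j\<^esub> f') = dmap j f \<oplus>\<^bsub>dpow (Suc j)\<^esub> dmap j f'"
      using lmod_hom_add[OF h f f'] L.M.zero_closed L.M.l_zero[OF L.M.zero_closed] by (auto simp: dmap_def)
  next
    fix s f assume s: "s \<in> carrier S" and f: "f \<in> carrier (dpow j)"
    show "dmap j (s \<odot>\<^bsub>dpow j\<^esub> f) = s \<odot>\<^bsub>dpow (Suc j)\<^esub> dmap j f"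
      using lmod_hom_smult[OF h s f] L.smult_zero_right[OF s] by (auto simp: dmap_def)
  qed
qed

lemma dpow_module: "lmodule S (dpow j)" by (rule lmodule_pow_mod[OF left])

lemma dker_module: "lmodule S (dker j)" by (rule lmodule_ker_mod[OF dpow_module dpow_module dmap_hom])

lemma dmap_single:
  assumes x: "x < m j" and k: "k \<in> carrier K"
  shows "dmap j (single (left_mod K) x k) = (\<lambda>y. if y < m (Suc j) then rsmult K k (a j x y) else \<zero>\<^bsub>K\<^esub>)"
proof
  fix y
  show "dmap j (single (left_mod K) x k) y = (if y < m (Suc j) then rsmult K k (a j x y) else \<zero>\<^bsub>K\<^esub>)"
  proof (cases "y < m (Suc j)")
    case True
    have z: "rsmult K \<zero>\<^bsub>K\<^esub> (a j x' y) = \<zero>\<^bsub>K\<^esub>" if "x' < m j" for x'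
      using Q.smult_zero_right[of "a j x' y"] a_closed[OF that True] by simp
    have "(\<Oplus>\<^bsub>left_mod K\<^esub>x'\<in>{..<m j}. rsmult K (single (left_mod K) x k x') (a j x' y))
        = (\<Oplus>\<^bsub>left_mod K\<^esub>x'\<in>{..<m j}. if x = x' then rsmult K k (a j x y) else \<zero>\<^bsub>left_mod K\<^esub>)"
      using z k rsmult_closed a_closed[OF _ True] L.M.zero_closed by (intro L.M.finsum_cong') (auto simp: single_def)
    also have "\<dots> = rsmult K k (a j x y)"
      using L.M.finsum_singleton[of x "{..<m j}" "\<lambda>_. rsmult K k (a j x y)"] x k rsmult_closed a_closed[OF x True] by simp
    finally show ?thesis using True by (simp add: dmap_def)
  qed (simp add: dmap_def)
qed

lemma dmap_dmap:
  assumes f: "f \<in> carrier (dpow j)"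
  shows "dmap (Suc j) (dmap j f) = \<zero>\<^bsub>dpow (Suc (Suc j))\<^esub>"
proof -
  note dd = lmod_hom_comp[OF dmap_hom[of j] dmap_hom]
  have s: "dmap (Suc j) (dmap j (single (left_mod K) x k)) = \<zero>\<^bsub>dpow (Suc (Suc j))\<^esub>" if x: "x < m j" and k: "k \<in> carrier K" for x k
  proof
    fix z
    show "dmap (Suc j) (dmap j (single (left_mod K) x k)) z = \<zero>\<^bsub>dpow (Suc (Suc j))\<^esub> z"
    proof (cases "z < m (Suc (Suc j))")
      case True
      have ac: "a j x y \<in> carrier R" "a (Suc j) y z \<in> carrier R" if "y < m (Suc j)" for y
        using a_closed[OF x that] a_closed[OF that True] by auto
      have as: "rsmult K (rsmult K k (a j x y)) (a (Suc j) y z) = rsmult K k (a j x y \<otimes>\<^bsub>R\<^esub> a (Suc j) y z)"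
        if "y < m (Suc j)" for y
        using Q.smult_assoc1[of "a (Suc j) y z" "a j x y" k] ac[OF that] k by simp
      have "(\<Oplus>\<^bsub>left_mod K\<^esub>y\<in>{..<m (Suc j)}. rsmult K (dmap j (single (left_mod K) x k) y) (a (Suc j) y z))
          = (\<Oplus>\<^bsub>left_mod K\<^esub>y\<in>{..<m (Suc j)}. rsmult K k (a j x y \<otimes>\<^bsub>R\<^esub> a (Suc j) y z))"
        unfolding dmap_single[OF x k] using as ac k rsmult_closed ring.ring_simprules(5)[OF ringR] by (intro L.M.finsum_cong') auto
      also have "\<dots> = (\<Oplus>\<^bsub>right_mod K\<^esub>y\<in>{..<m (Suc j)}. (a j x y \<otimes>\<^bsub>R\<^esub> a (Suc j) y z) \<odot>\<^bsub>right_mod K\<^esub> k)"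
        using ac k rsmult_closed ring.ring_simprules(5)[OF ringR] by (subst finsum_right_mod[OF bimodule]) auto
      also have "\<dots> = (\<Oplus>\<^bsub>op_ring R\<^esub>y\<in>{..<m (Suc j)}. a j x y \<otimes>\<^bsub>R\<^esub> a (Suc j) y z) \<odot>\<^bsub>right_mod K\<^esub> k"
        using ac k ring.ring_simprules(5)[OF ringR] by (intro Q.finsum_smult[symmetric]) auto
      also have "\<dots> = \<zero>\<^bsub>K\<^esub>" unfolding finsum_op_ring complex[OF x True] using Q.smult_zero_left[of k] k by simp
      finally show ?thesis using True by (simp add: dmap_def[of "Suc j"])
    qed (simp add: dmap_def)
  qed
  interpret P: lmodule S "dpow (Suc (Suc j))" by (rule dpow_module)
  have "dmap (Suc j) (dmap j f) = (\<Oplus>\<^bsub>dpow (Suc (Suc j))\<^esub>i\<in>{..<m j}. \<zero>\<^bsub>dpow (Suc (Suc j))\<^esub>)"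
    unfolding hom_pow_mod_sum[OF left dpow_module dd f] using f s
    by (intro P.M.finsum_cong') (auto simp del: pow_mod_simps(2))
  then show ?thesis by (simp only: P.M.finsum_zero)
qed

text \<open>Cuts the dual complex into short pieces: by \<open>dual\<close>, the kernel of each
  differential after the first is the image of the preceding one.\<close>

lemma short_exact_dker: "short_exact S (dker j) (dpow j) (dker (Suc j)) (\<lambda>f. f) (dmap j)"
proof -
  have d: "dmap j \<in> lmod_hom S (dpow j) (dker (Suc j))"
    using dmap_hom dmap_dmap by (intro lmod_hom_into_ker_mod) 
  have "f \<in> dmap j ` carrier (dpow j)" if f: "f \<in> carrier (dker (Suc j))" for f
  proof -
    have fp: "f \<in> carrier (dpow (Suc j))" and z: "dmap (Suc j) f = (\<lambda>_. \<zero>\<^bsub>K\<^esub>)" using f by auto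
    have "(\<Oplus>\<^bsub>left_mod K\<^esub>y\<in>{..<m (Suc j)}. rsmult K (f y) (a (Suc j) y z)) = \<zero>\<^bsub>K\<^esub>" if "z < m (Suc (Suc j))" for z
      using fun_cong[OF z, of z] that by (simp add: dmap_def)
    from dual[OF fp this] obtain f' where f': "f' \<in> carrier (dpow j)"
      "\<And>y. y < m (Suc j) \<Longrightarrow> f y = (\<Oplus>\<^bsub>left_mod K\<^esub>x\<in>{..<m j}. rsmult K (f' x) (a j x y))" by blast
    have "f = dmap j f'" using f'(2) fp by (auto simp: dmap_def)
    then show ?thesis using f'(1) by blast
  qed
  then have "dmap j ` carrier (dpow j) = carrier (dker (Suc j))" using lmod_hom_closed[OF d] by blast
  from short_exact_ker_mod[OF dpow_module dker_module d this] show ?thesis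
    by (simp add: ker_mod_def a_kernel_def')
qed

text \<open>The map from \<open>S\<close> to \<open>K^(m 0)\<close> with which the dual complex
  begins: the homothety map followed by evaluation at the generators.\<close>

definition gmap :: "'s \<Rightarrow> nat \<Rightarrow> 'k" where
  "gmap s = (\<lambda>x. if x < m 0 then s \<odot>\<^bsub>K\<^esub> g x else \<zero>\<^bsub>K\<^esub>)"

lemma gmap_dker: assumes s: "s \<in> carrier S" shows "gmap s \<in> carrier (dker 0)"
proof -
  have gp: "gmap s \<in> carrier (dpow 0)" using s g_closed L.smult_closed by (simp add: gmap_def)
  have "dmap 0 (gmap s) y = \<zero>\<^bsub>K\<^esub>" for y
  proof (cases "y < m 1")
    case True
    have ac: "a 0 x y \<in> carrier R" if "x < m 0" for x using a_closed[OF that] True by simp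
    have "(\<Oplus>\<^bsub>left_mod K\<^esub>x\<in>{..<m 0}. rsmult K (gmap s x) (a 0 x y))
        = (\<Oplus>\<^bsub>left_mod K\<^esub>x\<in>{..<m 0}. s \<odot>\<^bsub>left_mod K\<^esub> rsmult K (g x) (a 0 x y))"
      using bimodule s g_closed ac rsmult_closed L.smult_closed
      by (intro L.M.finsum_cong') (auto simp: gmap_def bimodule_def)
    also have "\<dots> = s \<odot>\<^bsub>left_mod K\<^esub> (\<Oplus>\<^bsub>left_mod K\<^esub>x\<in>{..<m 0}. rsmult K (g x) (a 0 x y))"
      using s g_closed ac rsmult_closed by (intro L.smult_finsum[symmetric]) auto
    also have "\<dots> = \<zero>\<^bsub>K\<^esub>" using complex0[OF True] L.smult_zero_right[OF s] by simp
    finally show ?thesis using True by (simp add: dmap_def)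
  qed (simp add: dmap_def)
  then show ?thesis using gp by (auto simp: fun_eq_iff)
qed

text \<open>\<open>dual0\<close> makes \<open>gmap\<close> onto the first kernel and
  \<open>dual_inj\<close> makes it injective, so \<open>dker 0\<close> is a copy of
  \<open>S\<close>.\<close>

lemma presents_dker_0: "presents S (dker 0) 1 (\<lambda>v. gmap (v 0))" 
  and ker_presents_dker_0: "carrier (ker_mod (fpow S 1) (dker 0) (\<lambda>v. gmap (v 0))) = {\<zero>\<^bsub>fpow S 1\<^esub>}"
proof -
  let ?q = "\<lambda>v. gmap (v 0)"
  have h: "?q \<in> lmod_hom S (fpow S 1) (dker 0)"
  proof (rule lmod_homI)
    fix v assume "v \<in> carrier (fpow S 1)"
    then show "gmap (v 0) \<in> carrier (dker 0)" by (intro gmap_dker) (simp add: fpow_carrier)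
  next
    fix v w assume v: "v \<in> carrier (fpow S 1)" and w: "w \<in> carrier (fpow S 1)"
    then show "gmap ((v \<oplus>\<^bsub>fpow S 1\<^esub> w) 0) = gmap (v 0) \<oplus>\<^bsub>dker 0\<^esub> gmap (w 0)"
      using L.smult_l_distr[of "v 0" "w 0"] g_closed L.M.zero_closed L.M.l_zero[OF L.M.zero_closed]
      by (auto simp: gmap_def fun_eq_iff fpow_carrier free_module_simps(3))
  next
    fix s v assume s: "s \<in> carrier S" and v: "v \<in> carrier (fpow S 1)"
    then show "gmap ((s \<odot>\<^bsub>fpow S 1\<^esub> v) 0) = s \<odot>\<^bsub>dker 0\<^esub> gmap (v 0)"
      using L.smult_assoc1[of s "v 0"] g_closed L.smult_zero_right[OF s]
      by (auto simp: gmap_def fun_eq_iff fpow_carrier free_module_simps(4))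
  qed
  have "f \<in> ?q ` carrier (fpow S 1)" if f: "f \<in> carrier (dker 0)" for f
  proof -
    have fp: "f \<in> carrier (dpow 0)" and z: "dmap 0 f = (\<lambda>_. \<zero>\<^bsub>K\<^esub>)" using f by auto
    have "(\<Oplus>\<^bsub>left_mod K\<^esub>x\<in>{..<m 0}. rsmult K (f x) (a 0 x y)) = \<zero>\<^bsub>K\<^esub>" if "y < m 1" for y
      using fun_cong[OF z, of y] that by (simp add: dmap_def)
    from dual0[OF fp this] obtain s where s: "s \<in> carrier S" "\<And>x. x < m 0 \<Longrightarrow> f x = s \<odot>\<^bsub>K\<^esub> g x" by blast
    have "f = gmap s" using s(2) fp by (auto simp: gmap_def)
    moreover have "(\<lambda>i. if i = 0 then s else \<zero>\<^bsub>S\<^esub>) \<in> carrier (fpow S 1)" using s(1) by (auto simp: fpow_carrier)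
    ultimately show ?thesis by (intro image_eqI[of _ _ "\<lambda>i. if i = 0 then s else \<zero>\<^bsub>S\<^esub>"]) simp_all
  qed
  then show "presents S (dker 0) 1 ?q" using h lmod_hom_closed[OF h] by (auto simp: presents_def)
  interpret F: lmodule S "fpow S 1" by (rule lmodule_fpow[OF left])
  show "carrier (ker_mod (fpow S 1) (dker 0) ?q) = {\<zero>\<^bsub>fpow S 1\<^esub>}"
  proof (intro equalityI subsetI)
    fix v assume v: "v \<in> carrier (ker_mod (fpow S 1) (dker 0) ?q)"
    then have "gmap (v 0) = (\<lambda>_. \<zero>\<^bsub>K\<^esub>)" "v 0 \<in> carrier S" "\<And>i. i \<noteq> 0 \<Longrightarrow> v i = \<zero>\<^bsub>S\<^esub>" by (auto simp: fpow_carrier)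
    moreover from this have "v 0 = \<zero>\<^bsub>S\<^esub>" by (intro dual_inj) (auto simp: gmap_def fun_eq_iff split: if_splits)
    ultimately have "v i = \<zero>\<^bsub>S\<^esub>" for i by (cases "i = 0") auto
    then show "v \<in> {\<zero>\<^bsub>fpow S 1\<^esub>}" by (auto simp: free_module_simps(2))
  next
    fix v assume "v \<in> {\<zero>\<^bsub>fpow S 1\<^esub>}"
    then show "v \<in> carrier (ker_mod (fpow S 1) (dker 0) ?q)"
      using F.M.zero_closed lmod_hom_zero[OF lmodule_fpow[OF left] dker_module h] by simp
  qed
qed

text \<open>Starts from \<open>dker 0\<close>, free of rank one, and moves right along the complex
  by cokernels.\<close>

lemma super_fp_dker:
  assumes "super_fp S (left_mod K)" shows "super_fp S (dker j)"
proof (induction j)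
  case 0
  have "lmodule S (ker_mod (fpow S 1) (dker 0) (\<lambda>v. gmap (v 0)))"
    using presents_dker_0 by (intro lmodule_ker_mod lmodule_fpow[OF left] dker_module) (simp add: presents_def)
  then have "fp_syzygies S (ker_mod (fpow S 1) (dker 0) (\<lambda>v. gmap (v 0)))"
    by (rule zero_module_fp) (use ker_presents_dker_0 in simp)
  then show ?case using presents_dker_0 dker_module unfolding super_fp_def by blast
next
  case (Suc j)
  show ?case by (rule super_fp_cokernel[OF short_exact_dker Suc super_fp_pow_mod[OF assms]])
qed

text \<open>The induction counts how far the degree has dropped below \<open>d + 1\<close>. It is
  general in \<open>j\<close>, because each drop refers to the next kernel to the right; it can
  start anywhere, as all kernels are super finitely presented.\<close>

lemma ext_van_dker:
  assumes I: "nd_injective S n d I" and K: "super_fp S (left_mod K)" "\<And>k. k < d \<Longrightarrow> ext_van S I k (left_mod K)"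
  shows "ext_van S I 0 (dker j)"
proof -
  have Im: "lmodule S I" using I by (simp add: nd_injective_def)
  have "i \<le> d \<Longrightarrow> ext_van S I (d - i) (dker j)" for i
  proof (induction i arbitrary: j)
    case 0
    then show ?case using nd_injective_ext_van[OF I super_fp_dker[OF K(1)]] by simp
  next
    case (Suc i)
    have d: "d - i = Suc (d - Suc i)" and k: "d - Suc i < d" using Suc.prems by auto
    have C: "ext_van S I (Suc (d - Suc i)) (dker (Suc j))" using Suc.IH[of "Suc j"] Suc.prems by (simp add: d)
    have B: "ext_van S I (d - Suc i) (dpow j)" by (rule ext_van_pow_mod[OF I K(1) K(2)[OF k]]) simp
    show ?case by (rule ext_van_shift[OF short_exact_dker super_fp_dker[OF K(1)] super_fp_dker[OF K(1)] Im B C])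
  qed
  from this[of d] show ?thesis by simp
qed

lemma hom_dker_extend:
  assumes I: "nd_injective S n d I" and K: "super_fp S (left_mod K)" "\<And>k. k < d \<Longrightarrow> ext_van S I k (left_mod K)"
    and \<theta>: "\<theta> \<in> lmod_hom S (dker j) I"
  shows "\<exists>\<theta>'\<in>lmod_hom S (dpow j) I. \<forall>f\<in>carrier (dker j). \<theta>' f = \<theta> f"
proof -
  have Im: "lmodule S I" using I by (simp add: nd_injective_def)
  obtain l p where p: "presents S (dker (Suc j)) l p" using super_fp_presents[OF super_fp_dker[OF K(1)]] by blast
  show ?thesis by (rule ext_van_0_extends[OF short_exact_dker Im ext_van_dker[OF I K] p \<theta>])
qed

text \<open>Will give surjectivity of the evaluation \<open>K \<otimes> Hom(K, I) -> I\<close>. The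
  map from \<open>S\<close> to \<open>I\<close> sending 1 to \<open>y\<close> extends along
  \<open>gmap\<close> to \<open>K^(m 0)\<close>, and its components are the
  \<open>h x\<close>.\<close>

lemma hom_generators:
  assumes I: "nd_injective S n d I" and K: "super_fp S (left_mod K)" "\<And>k. k < d \<Longrightarrow> ext_van S I k (left_mod K)"
    and y: "y \<in> carrier I"
  shows "\<exists>h. (\<forall>x<m 0. h x \<in> lmod_hom S (left_mod K) I) \<and> y = (\<Oplus>\<^bsub>I\<^esub>x\<in>{..<m 0}. h x (g x))"
proof -
  have Im: "lmodule S I" using I by (simp add: nd_injective_def)
  interpret I: lmodule S I by (rule Im)
  let ?q = "\<lambda>v. gmap (v 0)"
  have q: "?q \<in> lmod_hom S (fpow S 1) (dker 0)" "?q ` carrier (fpow S 1) = carrier (dker 0)"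
    using presents_dker_0 by (auto simp: presents_def)
  have F: "lmodule S (fpow S 1)" by (rule lmodule_fpow[OF left])
  have f: "(\<lambda>v. v 0 \<odot>\<^bsub>I\<^esub> y) \<in> lmod_hom S (fpow S 1) I"
    using y by (intro lmod_homI) (auto simp: fpow_carrier free_module_simps(3,4) I.smult_l_distr I.smult_assoc1)
  have "\<exists>h\<in>lmod_hom S (dker 0) I. \<forall>v\<in>carrier (fpow S 1). h (?q v) = v 0 \<odot>\<^bsub>I\<^esub> y"
  proof (rule hom_factor[OF F dker_module Im q f])
    fix v assume "v \<in> carrier (fpow S 1)" "?q v = \<zero>\<^bsub>dker 0\<^esub>"
    then have "v \<in> carrier (ker_mod (fpow S 1) (dker 0) ?q)" by simp
    then have "v = \<zero>\<^bsub>fpow S 1\<^esub>" unfolding ker_presents_dker_0 by simp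
    then show "v 0 \<odot>\<^bsub>I\<^esub> y = \<zero>\<^bsub>I\<^esub>" using y by (simp add: free_module_simps(2) I.smult_zero_left)
  qed
  then obtain \<theta> where \<theta>: "\<theta> \<in> lmod_hom S (dker 0) I" "\<And>v. v \<in> carrier (fpow S 1) \<Longrightarrow> \<theta> (?q v) = v 0 \<odot>\<^bsub>I\<^esub> y" by blast
  obtain \<theta>' where \<theta>': "\<theta>' \<in> lmod_hom S (dpow 0) I" "\<And>f. f \<in> carrier (dker 0) \<Longrightarrow> \<theta>' f = \<theta> f"
    using hom_dker_extend[OF I K \<theta>(1)] by blast
  let ?u = "\<lambda>i::nat. if i = 0 then \<one>\<^bsub>S\<^esub> else \<zero>\<^bsub>S\<^esub>"
  have "?u \<in> carrier (fpow S 1)" by (auto simp: fpow_carrier)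
  then have "\<theta> (gmap \<one>\<^bsub>S\<^esub>) = y" using \<theta>(2)[of ?u] y by simp
  moreover have g1: "gmap \<one>\<^bsub>S\<^esub> \<in> carrier (dker 0)" by (rule gmap_dker) simp
  ultimately have "y = \<theta>' (gmap \<one>\<^bsub>S\<^esub>)" using \<theta>'(2) by simp
  also have "\<dots> = (\<Oplus>\<^bsub>I\<^esub>x\<in>{..<m 0}. \<theta>' (single (left_mod K) x (gmap \<one>\<^bsub>S\<^esub> x)))"
    using g1 by (intro hom_pow_mod_sum[OF left Im \<theta>'(1)]) simp
  also have "\<dots> = (\<Oplus>\<^bsub>I\<^esub>x\<in>{..<m 0}. \<theta>' (single (left_mod K) x (g x)))"
    using g_closed L.smult_one lmod_hom_closed[OF lmod_hom_comp[OF single_hom[OF left] \<theta>'(1)]]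
    by (intro I.M.finsum_cong') (auto simp: gmap_def)
  finally show ?thesis using lmod_hom_comp[OF single_hom[OF left] \<theta>'(1)]
    by (intro exI[of _ "\<lambda>x k. \<theta>' (single (left_mod K) x k)"]) simp
qed

text \<open>Exactness of \<open>Hom(-, I)\<close> on the dual complex: a map that vanishes on
  \<open>dker j\<close> descends to the image \<open>dker (Suc j)\<close> of \<open>dmap j\<close>
  and extends from there to the next power of \<open>K\<close>; \<open>b\<close> lists the
  components of the extension.\<close>

lemma hom_factor_dmap:
  assumes I: "nd_injective S n d I" and K: "super_fp S (left_mod K)" "\<And>k. k < d \<Longrightarrow> ext_van S I k (left_mod K)"
    and h: "\<And>x. x < m j \<Longrightarrow> h x \<in> lmod_hom S (left_mod K) I"
    and z: "\<And>f. f \<in> carrier (dker j) \<Longrightarrow> (\<Oplus>\<^bsub>I\<^esub>x\<in>{..<m j}. h x (f x)) = \<zero>\<^bsub>I\<^esub>"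
  shows "\<exists>b. (\<forall>y<m (Suc j). b y \<in> lmod_hom S (left_mod K) I) \<and>
    (\<forall>x<m j. \<forall>k\<in>carrier K. h x k = (\<Oplus>\<^bsub>I\<^esub>y\<in>{..<m (Suc j)}. b y (rsmult K k (a j x y))))"
proof -
  have Im: "lmodule S I" using I by (simp add: nd_injective_def)
  interpret I: lmodule S I by (rule Im)
  let ?\<theta> = "\<lambda>f. \<Oplus>\<^bsub>I\<^esub>x\<in>{..<m j}. h x (f x)"
  have \<theta>: "?\<theta> \<in> lmod_hom S (dpow j) I" by (rule hom_from_tuple[OF left Im h])
  note ex = short_exactD[OF short_exact_dker[of j]]
  have "\<exists>\<theta>1\<in>lmod_hom S (dker (Suc j)) I. \<forall>f\<in>carrier (dpow j). \<theta>1 (dmap j f) = ?\<theta> f"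
  proof (rule hom_factor[OF dpow_module dker_module Im ex(5) short_exact_onto[OF short_exact_dker] \<theta>])
    fix f assume "f \<in> carrier (dpow j)" "dmap j f = \<zero>\<^bsub>dker (Suc j)\<^esub>"
    then show "?\<theta> f = \<zero>\<^bsub>I\<^esub>" by (intro z) simp
  qed
  then obtain \<theta>1 where \<theta>1: "\<theta>1 \<in> lmod_hom S (dker (Suc j)) I" "\<And>f. f \<in> carrier (dpow j) \<Longrightarrow> \<theta>1 (dmap j f) = ?\<theta> f" by blast
  obtain \<theta>' where \<theta>': "\<theta>' \<in> lmod_hom S (dpow (Suc j)) I" "\<And>f. f \<in> carrier (dker (Suc j)) \<Longrightarrow> \<theta>' f = \<theta>1 f"
    using hom_dker_extend[OF I K \<theta>1(1)] by blast
  let ?b = "\<lambda>y k. \<theta>' (single (left_mod K) y k)"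
  have b: "?b y \<in> lmod_hom S (left_mod K) I" if "y < m (Suc j)" for y
    by (rule lmod_hom_comp[OF single_hom[OF left that] \<theta>'(1)])
  have "h x k = (\<Oplus>\<^bsub>I\<^esub>y\<in>{..<m (Suc j)}. ?b y (rsmult K k (a j x y)))" if x: "x < m j" and k: "k \<in> carrier K" for x k
  proof -
    let ?s = "single (left_mod K) x k"
    have s: "?s \<in> carrier (dpow j)" using lmod_hom_closed[OF single_hom[OF left x]] k by simp
    have "?\<theta> ?s = (\<Oplus>\<^bsub>I\<^esub>x'\<in>{..<m j}. if x = x' then h x k else \<zero>\<^bsub>I\<^esub>)"
      using h k x lmod_hom_zero[OF left Im h] lmod_hom_closed[OF h] by (intro I.M.finsum_cong') (auto simp: single_def)
    also have "\<dots> = h x k"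
      using I.M.finsum_singleton[of x "{..<m j}" "\<lambda>_. h x k"] x k lmod_hom_closed[OF h[OF x]] by simp
    finally have "h x k = \<theta>' (dmap j ?s)" using \<theta>1(2)[OF s] \<theta>'(2)[OF lmod_hom_closed[OF ex(5) s]] by simp
    also have "\<dots> = (\<Oplus>\<^bsub>I\<^esub>y\<in>{..<m (Suc j)}. ?b y (dmap j ?s y))"
      by (rule hom_pow_mod_sum[OF left Im \<theta>'(1) lmod_hom_closed[OF dmap_hom s]])
    also have "\<dots> = (\<Oplus>\<^bsub>I\<^esub>y\<in>{..<m (Suc j)}. ?b y (rsmult K k (a j x y)))"
      unfolding dmap_single[OF x k] using lmod_hom_closed[OF b] k x rsmult_closed a_closed
      by (intro I.M.finsum_cong') auto
    finally show ?thesis .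
  qed
  then show ?thesis using b by (intro exI[of _ ?b]) blast
qed

text \<open>\<open>dker 0\<close> is generated over \<open>S\<close> by the tuple of the
  \<open>g x\<close>, so vanishing on it is the single equation assumed here.\<close>

lemma hom_relations:
  assumes I: "nd_injective S n d I" and K: "super_fp S (left_mod K)" "\<And>k. k < d \<Longrightarrow> ext_van S I k (left_mod K)"
    and h: "\<And>x. x < m 0 \<Longrightarrow> h x \<in> lmod_hom S (left_mod K) I"
    and z: "(\<Oplus>\<^bsub>I\<^esub>x\<in>{..<m 0}. h x (g x)) = \<zero>\<^bsub>I\<^esub>"
  shows "\<exists>b. (\<forall>y<m 1. b y \<in> lmod_hom S (left_mod K) I) \<and>
    (\<forall>x<m 0. \<forall>k\<in>carrier K. h x k = (\<Oplus>\<^bsub>I\<^esub>y\<in>{..<m 1}. b y (rsmult K k (a 0 x y))))"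
proof -
  have Im: "lmodule S I" using I by (simp add: nd_injective_def)
  interpret I: lmodule S I by (rule Im)
  have "(\<Oplus>\<^bsub>I\<^esub>x\<in>{..<m 0}. h x (f x)) = \<zero>\<^bsub>I\<^esub>" if f: "f \<in> carrier (dker 0)" for f
  proof -
    have "f \<in> (\<lambda>v. gmap (v 0)) ` carrier (fpow S 1)" using presents_dker_0 f by (simp add: presents_def)
    then obtain s where s: "s \<in> carrier S" "f = gmap s" by (auto simp: fpow_carrier)
    have "(\<Oplus>\<^bsub>I\<^esub>x\<in>{..<m 0}. h x (f x)) = (\<Oplus>\<^bsub>I\<^esub>x\<in>{..<m 0}. s \<odot>\<^bsub>I\<^esub> h x (g x))"
      using s g_closed lmod_hom_smult[OF h _ , of _ s] lmod_hom_closed[OF h] by (intro I.M.finsum_cong') (auto simp: gmap_def)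
    also have "\<dots> = s \<odot>\<^bsub>I\<^esub> (\<Oplus>\<^bsub>I\<^esub>x\<in>{..<m 0}. h x (g x))"
      using s g_closed lmod_hom_closed[OF h] by (intro I.smult_finsum[symmetric]) auto
    finally show ?thesis using z s by (simp add: I.smult_zero_right)
  qed
  from hom_factor_dmap[OF I K h this] show ?thesis by simp
qed

text \<open>\<open>dker (Suc j)\<close> is the image of \<open>dmap j\<close>, so vanishing on it
  has to be checked only on images of tuples with one entry.\<close>

lemma hom_relations_Suc:
  assumes I: "nd_injective S n d I" and K: "super_fp S (left_mod K)" "\<And>k. k < d \<Longrightarrow> ext_van S I k (left_mod K)"
    and h: "\<And>y. y < m (Suc j) \<Longrightarrow> h y \<in> lmod_hom S (left_mod K) I"
    and z: "\<And>x k. x < m j \<Longrightarrow> k \<in> carrier K \<Longrightarrow> (\<Oplus>\<^bsub>I\<^esub>y\<in>{..<m (Suc j)}. h y (rsmult K k (a j x y))) = \<zero>\<^bsub>I\<^esub>"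
  shows "\<exists>b. (\<forall>y<m (Suc (Suc j)). b y \<in> lmod_hom S (left_mod K) I) \<and>
    (\<forall>x<m (Suc j). \<forall>k\<in>carrier K. h x k = (\<Oplus>\<^bsub>I\<^esub>y\<in>{..<m (Suc (Suc j))}. b y (rsmult K k (a (Suc j) x y))))"
proof -
  have Im: "lmodule S I" using I by (simp add: nd_injective_def)
  interpret I: lmodule S I by (rule Im)
  have "(\<Oplus>\<^bsub>I\<^esub>x\<in>{..<m (Suc j)}. h x (f x)) = \<zero>\<^bsub>I\<^esub>" if f: "f \<in> carrier (dker (Suc j))" for f
  proof -
    obtain f' where f': "f' \<in> carrier (dpow j)" "f = dmap j f'"
      using f short_exact_onto[OF short_exact_dker[of j]] by (metis imageE)
    let ?\<theta> = "\<lambda>f. \<Oplus>\<^bsub>I\<^esub>x\<in>{..<m (Suc j)}. h x (f x)"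
    have \<theta>: "?\<theta> \<in> lmod_hom S (dpow (Suc j)) I" by (rule hom_from_tuple[OF left Im h])
    note \<theta>d = lmod_hom_comp[OF dmap_hom \<theta>]
    have s: "?\<theta> (dmap j (single (left_mod K) x k)) = \<zero>\<^bsub>I\<^esub>" if x: "x < m j" and k: "k \<in> carrier K" for x k
    proof -
      have "?\<theta> (dmap j (single (left_mod K) x k)) = (\<Oplus>\<^bsub>I\<^esub>y\<in>{..<m (Suc j)}. h y (rsmult K k (a j x y)))"
        unfolding dmap_single[OF x k] using lmod_hom_closed[OF h] rsmult_closed k a_closed[OF x]
        by (intro I.M.finsum_cong') auto
      then show ?thesis using z[OF x k] by simp
    qed
    have "?\<theta> f = (\<Oplus>\<^bsub>I\<^esub>x\<in>{..<m j}. \<zero>\<^bsub>I\<^esub>)"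
      unfolding f'(2) hom_pow_mod_sum[OF left Im \<theta>d f'(1)] using s f'(1) by (intro I.M.finsum_cong') auto
    then show ?thesis by simp
  qed
  from hom_factor_dmap[OF I K h this] show ?thesis .
qed

end

text \<open>For the syzygy with index \<open>d - 1\<close>, the bound in
  \<open>ext_van_syzygy_module\<close> reads \<open>d \<le> d + k\<close>, so all \<open>k\<close>
  below \<open>d\<close> are covered.\<close>

lemma special_semidualizing_ext:
  assumes K: "special_semidualizing S R C F \<delta> \<epsilon> d K"
  shows "super_fp S (left_mod K)"
    and "nd_injective S n d I \<Longrightarrow> k < d \<Longrightarrow> ext_van S I k (left_mod K)"
proof -
  have KF: "K = syzygy C F \<delta> \<epsilon> (d - 1)" and d: "1 \<le> d" and F: "super_fp_bimodule_resolution S R C F \<delta> \<epsilon>"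
    using K by (auto simp: special_semidualizing_def)
  note b = super_fp_bimodule_resolution_left[OF F]
  show "super_fp S (left_mod K)" unfolding KF syzygy_syzygy_module by (rule super_fp_syzygy_module[OF b(1,3)])
  show "ext_van S I k (left_mod K)" if "nd_injective S n d I" "k < d"
    unfolding KF syzygy_syzygy_module using that by (intro ext_van_syzygy_module[OF b(1,3) that(1)]) auto
qed

section \<open>Tensor products\<close>

definition tens :: "'r ring \<Rightarrow> ('r, 'u) module \<Rightarrow> ('r, 'n) module \<Rightarrow> 'u \<Rightarrow> 'n \<Rightarrow> (('u \<times> 'n) \<Rightarrow>\<^sub>0 int) set" where
  "tens R U N u y = tensor_ker R U N #>\<^bsub>free_Abelian_group (carrier U \<times> carrier N)\<^esub> frag_of (u, y)"

locale tensor_pair =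
  fixes R :: "'r ring" and U :: "('r, 'u) module" and N :: "('r, 'n) module"
  assumes U_module: "lmodule (op_ring R) U" and N_module: "lmodule R N"
begin

sublocale U: lmodule "op_ring R" U by (rule U_module)
sublocale N: lmodule R N by (rule N_module)

abbreviation "FA \<equiv> free_Abelian_group (carrier U \<times> carrier N)"
abbreviation "TK \<equiv> tensor_ker R U N"
abbreviation "TG \<equiv> tensor_group R U N"
abbreviation "te \<equiv> tens R U N"

lemma keys_diff3:
  "a \<in> A \<Longrightarrow> b \<in> A \<Longrightarrow> c \<in> A \<Longrightarrow> Poly_Mapping.keys (frag_of a - frag_of b - frag_of c) \<subseteq> A"
  using keys_diff[of "frag_of a - frag_of b" "frag_of c"] keys_diff[of "frag_of a" "frag_of b"]
  by (auto simp: keys_frag_of)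

lemma tensor_rels_carrier: "tensor_rels R U N \<subseteq> carrier FA"
proof -
  have "Poly_Mapping.keys (frag_of a - frag_of b) \<subseteq> A" if "a \<in> A" "b \<in> A" for a b and A :: "('u \<times> 'n) set"
    using that keys_diff[of "frag_of a" "frag_of b"] by (auto simp: keys_frag_of)
  then show ?thesis using U.smult_closed keys_diff3[where A = "carrier U \<times> carrier N"]
    unfolding tensor_rels_def by (auto simp del: keys_diff)
qed

sublocale FA: comm_group FA by (rule abelian_free_Abelian_group)

lemma TK_subgroup: "subgroup TK FA"
  unfolding tensor_ker_def by (rule FA.generate_is_subgroup[OF tensor_rels_carrier])

lemma TK_normal: "TK \<lhd> FA" by (rule FA.subgroup_imp_normal[OF TK_subgroup])

sublocale TG: comm_group TG
  unfolding tensor_group_def by (rule FA.abelian_FactGroup[OF TK_subgroup])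

lemma tensor_one: "\<one>\<^bsub>TG\<^esub> = TK" by (simp add: tensor_group_def)

lemma coset_hom: "(\<lambda>c. TK #>\<^bsub>FA\<^esub> c) \<in> hom FA TG"
  unfolding tensor_group_def by (rule normal.r_coset_hom_Mod[OF TK_normal])

lemma tensor_carrier: "carrier TG = (\<lambda>c. TK #>\<^bsub>FA\<^esub> c) ` carrier FA"
  unfolding tensor_group_def by (rule carrier_FactGroup)

lemma coset_eq_iff:
  assumes "c \<in> carrier FA" "c' \<in> carrier FA"
  shows "TK #>\<^bsub>FA\<^esub> c = TK #>\<^bsub>FA\<^esub> c' \<longleftrightarrow> c - c' \<in> TK"
proof -
  interpret G: group_hom FA TG "\<lambda>c. TK #>\<^bsub>FA\<^esub> c" by (intro group_hom.intro group_hom_axioms.intro FA.group_axioms TG.group_axioms coset_hom)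
  have cc: "c - c' \<in> carrier FA" using assms keys_diff[of c c'] by auto
  have "TK #>\<^bsub>FA\<^esub> c = (TK #>\<^bsub>FA\<^esub> (c - c')) \<otimes>\<^bsub>TG\<^esub> (TK #>\<^bsub>FA\<^esub> c')"
    using G.hom_mult[OF cc assms(2)] by simp
  then have "TK #>\<^bsub>FA\<^esub> c = TK #>\<^bsub>FA\<^esub> c' \<longleftrightarrow> TK #>\<^bsub>FA\<^esub> (c - c') = \<one>\<^bsub>TG\<^esub>"
    using G.hom_closed[OF cc] G.hom_closed[OF assms(2)] by (metis TG.r_cancel_one' TG.l_one TG.r_cancel_one)
  also have "\<dots> \<longleftrightarrow> c - c' \<in> TK"
    unfolding tensor_one using FA.rcos_self[OF cc TK_subgroup] FA.coset_join2[OF cc TK_subgroup] by auto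
  finally show ?thesis .
qed

lemma TK_rel: "c \<in> tensor_rels R U N \<Longrightarrow> c \<in> TK"
  unfolding tensor_ker_def by (rule generate.incl)

lemma keys_pair: "u \<in> carrier U \<Longrightarrow> y \<in> carrier N \<Longrightarrow> Poly_Mapping.keys (frag_of (u, y)) \<subseteq> carrier U \<times> carrier N"
  by (simp add: keys_frag_of)

lemma tens_closed: "u \<in> carrier U \<Longrightarrow> y \<in> carrier N \<Longrightarrow> te u y \<in> carrier TG"
  unfolding tens_def tensor_carrier by (simp add: keys_pair)

lemma keys_sum: "Poly_Mapping.keys a \<subseteq> A \<Longrightarrow> Poly_Mapping.keys b \<subseteq> A \<Longrightarrow> Poly_Mapping.keys (a + b) \<subseteq> A"
  using keys_add[of a b] by blast

lemma tens_mult: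
  assumes "u \<in> carrier U" "y \<in> carrier N" "u' \<in> carrier U" "y' \<in> carrier N"
  shows "te u y \<otimes>\<^bsub>TG\<^esub> te u' y' = TK #>\<^bsub>FA\<^esub> (frag_of (u, y) + frag_of (u', y'))"
  unfolding tens_def using hom_mult[OF coset_hom, of "frag_of (u, y)" "frag_of (u', y')"] assms by (simp add: keys_pair)

lemma tens_add_left:
  assumes "u \<in> carrier U" "u' \<in> carrier U" "y \<in> carrier N"
  shows "te (u \<oplus>\<^bsub>U\<^esub> u') y = te u y \<otimes>\<^bsub>TG\<^esub> te u' y"
proof -
  have "frag_of (u \<oplus>\<^bsub>U\<^esub> u', y) - (frag_of (u, y) + frag_of (u', y)) \<in> TK"
    unfolding diff_diff_eq[symmetric] by (rule TK_rel) (use assms in \<open>unfold tensor_rels_def, blast\<close>)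
  then show ?thesis unfolding tens_mult[OF assms(1,3,2,3)] unfolding tens_def
    using assms by (subst coset_eq_iff) (simp_all add: keys_pair keys_sum)
qed

lemma tens_add_right:
  assumes "u \<in> carrier U" "y \<in> carrier N" "y' \<in> carrier N"
  shows "te u (y \<oplus>\<^bsub>N\<^esub> y') = te u y \<otimes>\<^bsub>TG\<^esub> te u y'"
proof -
  have "frag_of (u, y \<oplus>\<^bsub>N\<^esub> y') - (frag_of (u, y) + frag_of (u, y')) \<in> TK"
    unfolding diff_diff_eq[symmetric] by (rule TK_rel) (use assms in \<open>unfold tensor_rels_def, blast\<close>)
  then show ?thesis unfolding tens_mult[OF assms(1,2,1,3)] unfolding tens_def
    using assms by (subst coset_eq_iff) (simp_all add: keys_pair keys_sum)
qed

lemma tens_balanced: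
  assumes "u \<in> carrier U" "r \<in> carrier R" "y \<in> carrier N"
  shows "te (r \<odot>\<^bsub>U\<^esub> u) y = te u (r \<odot>\<^bsub>N\<^esub> y)"
proof -
  have "frag_of (r \<odot>\<^bsub>U\<^esub> u, y) - frag_of (u, r \<odot>\<^bsub>N\<^esub> y) \<in> TK"
    by (rule TK_rel) (use assms in \<open>unfold tensor_rels_def, blast\<close>)
  then show ?thesis unfolding tens_def using assms U.smult_closed[of r u]
    by (subst coset_eq_iff) (simp_all add: keys_pair)
qed

lemma tensor_induct [consumes 1, case_names tens diff]:
  assumes "t \<in> carrier TG"
    and "\<And>u y. u \<in> carrier U \<Longrightarrow> y \<in> carrier N \<Longrightarrow> P (te u y)"
    and "\<And>t t'. t \<in> carrier TG \<Longrightarrow> t' \<in> carrier TG \<Longrightarrow> P t \<Longrightarrow> P t' \<Longrightarrow> P (t \<otimes>\<^bsub>TG\<^esub> inv\<^bsub>TG\<^esub> t')"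
  shows "P t"
proof -
  interpret G: group_hom FA TG "\<lambda>c. TK #>\<^bsub>FA\<^esub> c" by (intro group_hom.intro group_hom_axioms.intro FA.group_axioms TG.group_axioms coset_hom)
  obtain c where c: "c \<in> carrier FA" "t = TK #>\<^bsub>FA\<^esub> c" using assms(1) unfolding tensor_carrier by blast
  then have "Poly_Mapping.keys c \<subseteq> carrier U \<times> carrier N" by simp
  then have "P (TK #>\<^bsub>FA\<^esub> c)"
  proof (induction c rule: free_Abelian_group_induct[consumes 1, case_names zero diff one])
    case zero
    have "P (te \<zero>\<^bsub>U\<^esub> \<zero>\<^bsub>N\<^esub> \<otimes>\<^bsub>TG\<^esub> inv\<^bsub>TG\<^esub> te \<zero>\<^bsub>U\<^esub> \<zero>\<^bsub>N\<^esub>)" by (intro assms tens_closed) auto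
    then have "P \<one>\<^bsub>TG\<^esub>" using tens_closed[OF U.M.zero_closed N.M.zero_closed] by simp
    then show ?case using G.hom_one by simp
  next
    case (diff x y)
    have "TK #>\<^bsub>FA\<^esub> (x - y) = (TK #>\<^bsub>FA\<^esub> x) \<otimes>\<^bsub>TG\<^esub> inv\<^bsub>TG\<^esub> (TK #>\<^bsub>FA\<^esub> y)"
      using G.hom_mult[of x "- y"] G.hom_inv[of y] diff by simp
    moreover have "TK #>\<^bsub>FA\<^esub> x \<in> carrier TG" "TK #>\<^bsub>FA\<^esub> y \<in> carrier TG" using diff G.hom_closed[of x] G.hom_closed[of y] by simp_all
    ultimately show ?case using assms(3) diff by simp
  next
    case (one p)
    then show ?case using assms(2) unfolding tens_def by auto
  qed
  then show ?thesis using c by simp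
qed

text \<open>The target is any commutative group, so that the same property yields maps into other
  tensor products, into modules, into factor groups and into the circle.\<close>

lemma tensor_universal:
  assumes H: "comm_group H"
    and c: "\<And>u y. u \<in> carrier U \<Longrightarrow> y \<in> carrier N \<Longrightarrow> \<beta> u y \<in> carrier H"
    and l: "\<And>u u' y. u \<in> carrier U \<Longrightarrow> u' \<in> carrier U \<Longrightarrow> y \<in> carrier N \<Longrightarrow> \<beta> (u \<oplus>\<^bsub>U\<^esub> u') y = \<beta> u y \<otimes>\<^bsub>H\<^esub> \<beta> u' y"
    and r: "\<And>u y y'. u \<in> carrier U \<Longrightarrow> y \<in> carrier N \<Longrightarrow> y' \<in> carrier N \<Longrightarrow> \<beta> u (y \<oplus>\<^bsub>N\<^esub> y') = \<beta> u y \<otimes>\<^bsub>H\<^esub> \<beta> u y'"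
    and b: "\<And>a u y. a \<in> carrier R \<Longrightarrow> u \<in> carrier U \<Longrightarrow> y \<in> carrier N \<Longrightarrow> \<beta> (a \<odot>\<^bsub>U\<^esub> u) y = \<beta> u (a \<odot>\<^bsub>N\<^esub> y)"
  shows "\<exists>\<phi>\<in>hom TG H. \<forall>u\<in>carrier U. \<forall>y\<in>carrier N. \<phi> (te u y) = \<beta> u y"
proof -
  interpret H: comm_group H by (rule H)
  have "(\<lambda>(u, y). \<beta> u y) ` (carrier U \<times> carrier N) \<subseteq> carrier H" using c by auto
  then obtain h where h: "h \<in> hom FA H" "\<And>p. p \<in> carrier U \<times> carrier N \<Longrightarrow> h (frag_of p) = (\<lambda>(u, y). \<beta> u y) p"
  proof (rule H.free_Abelian_group_universal)
    fix h assume "h \<in> hom FA H" "\<And>p. p \<in> carrier U \<times> carrier N \<Longrightarrow> h (frag_of p) = (\<lambda>(u, y). \<beta> u y) p"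
    then show thesis by (rule that)
  qed
  interpret h: group_hom FA H h by (intro group_hom.intro group_hom_axioms.intro FA.group_axioms H.group_axioms h)
  have hd: "h (x - y) = h x \<otimes>\<^bsub>H\<^esub> inv\<^bsub>H\<^esub> h y" if "x \<in> carrier FA" "y \<in> carrier FA" for x y
    using that h.hom_mult[of x "- y"] h.hom_inv[of y] by simp
  \<comment> \<open>The two additivity relations have the same shape and are treated
    together.\<close>
  have d3: "h (frag_of p - frag_of q - frag_of q') = \<one>\<^bsub>H\<^esub>"
    if "p \<in> carrier U \<times> carrier N" "q \<in> carrier U \<times> carrier N" "q' \<in> carrier U \<times> carrier N"
      "h (frag_of p) = h (frag_of q) \<otimes>\<^bsub>H\<^esub> h (frag_of q')" for p q q'
  proof -
    have k: "frag_of p \<in> carrier FA" "frag_of q + frag_of q' \<in> carrier FA" "frag_of q \<in> carrier FA" "frag_of q' \<in> carrier FA"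
      using that keys_sum[of "frag_of q"] by (simp_all add: keys_frag_of)
    have "h (frag_of p - (frag_of q + frag_of q')) = \<one>\<^bsub>H\<^esub>"
      using hd[OF k(1,2)] h.hom_mult[OF k(3,4)] that(4) h.hom_closed[OF k(1)] by simp
    then show ?thesis by (simp only: diff_diff_eq)
  qed
  have "tensor_rels R U N \<subseteq> kernel FA H h"
  proof
    fix x assume x: "x \<in> tensor_rels R U N"
    then have xc: "x \<in> carrier FA" using tensor_rels_carrier by blast
    from x consider
      u u' y where "x = frag_of (u \<oplus>\<^bsub>U\<^esub> u', y) - frag_of (u, y) - frag_of (u', y)" "u \<in> carrier U" "u' \<in> carrier U" "y \<in> carrier N"
      | u y y' where "x = frag_of (u, y \<oplus>\<^bsub>N\<^esub> y') - frag_of (u, y) - frag_of (u, y')" "u \<in> carrier U" "y \<in> carrier N" "y' \<in> carrier N"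
      | a u y where "x = frag_of (a \<odot>\<^bsub>U\<^esub> u, y) - frag_of (u, a \<odot>\<^bsub>N\<^esub> y)" "a \<in> carrier R" "u \<in> carrier U" "y \<in> carrier N"
      unfolding tensor_rels_def by blast
    then have "h x = \<one>\<^bsub>H\<^esub>"
    proof cases
      case 1
      show ?thesis unfolding 1(1) using 1(2-4) by (intro d3) (simp_all add: h(2) l)
    next
      case 2
      show ?thesis unfolding 2(1) using 2(2-4) by (intro d3) (simp_all add: h(2) r)
    next
      case 3
      have "a \<odot>\<^bsub>U\<^esub> u \<in> carrier U" "a \<odot>\<^bsub>N\<^esub> y \<in> carrier N" using 3 U.smult_closed[of a u] by auto
      then show ?thesis unfolding 3(1) using 3(2-4) c by (subst hd) (simp_all add: keys_pair h(2) b)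
    qed
    then show "x \<in> kernel FA H h" using xc by (simp add: kernel_def)
  qed
  then have "TK \<subseteq> kernel FA H h"
    unfolding tensor_ker_def by (intro FA.generate_subgroup_incl h.subgroup_kernel)
  from h.FactGroup_universal_kernel[OF TK_normal this] obtain \<phi> where
    "\<phi> \<in> hom (FA Mod TK) H" "\<And>x. x \<in> carrier FA \<Longrightarrow> \<phi> (TK #>\<^bsub>FA\<^esub> x) = h x" by blast
  then show ?thesis unfolding tensor_group_def[symmetric] using h(2)
    by (intro bexI[of _ \<phi>]) (auto simp: tens_def keys_pair)
qed

lemma tensor_hom_eq:
  assumes "group H" "\<phi> \<in> hom TG H" "\<psi> \<in> hom TG H"
    and "\<And>u y. u \<in> carrier U \<Longrightarrow> y \<in> carrier N \<Longrightarrow> \<phi> (te u y) = \<psi> (te u y)" and "t \<in> carrier TG"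
  shows "\<phi> t = \<psi> t"
proof -
  interpret p: group_hom TG H \<phi> by (intro group_hom.intro group_hom_axioms.intro TG.group_axioms assms)
  interpret q: group_hom TG H \<psi> by (intro group_hom.intro group_hom_axioms.intro TG.group_axioms assms)
  show ?thesis using assms(5)
    by (induction rule: tensor_induct) (simp_all add: assms(4))
qed

end

text \<open>\<open>tensor_map\<close> is defined by a union over representatives. It is compared
  with the map \<open>\<phi>\<close> from the universal property, which inherits no dependence on
  representatives.\<close>

lemma tensor_map_hom:
  assumes UN: "tensor_pair R U N" and VW: "tensor_pair R V W"
    and f: "f \<in> lmod_hom (op_ring R) U V" and g: "g \<in> lmod_hom R N W"
  shows "tensor_map R V W f g \<in> hom (tensor_group R U N) (tensor_group R V W)"
    and "\<And>u y. u \<in> carrier U \<Longrightarrow> y \<in> carrier N \<Longrightarrow> tensor_map R V W f g (tens R U N u y) = tens R V W (f u) (g y)"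
proof -
  interpret UN: tensor_pair R U N by (rule UN)
  interpret VW: tensor_pair R V W by (rule VW)
  note fc = lmod_hom_closed[OF f] and gc = lmod_hom_closed[OF g]
  have "\<exists>\<phi>\<in>hom UN.TG VW.TG. \<forall>u\<in>carrier U. \<forall>y\<in>carrier N. \<phi> (tens R U N u y) = tens R V W (f u) (g y)"
  proof (rule UN.tensor_universal[OF VW.TG.comm_group_axioms])
    fix a u y assume "a \<in> carrier R" "u \<in> carrier U" "y \<in> carrier N"
    then show "tens R V W (f (a \<odot>\<^bsub>U\<^esub> u)) (g y) = tens R V W (f u) (g (a \<odot>\<^bsub>N\<^esub> y))"
      using lmod_hom_smult[OF f, of a u] by (simp add: lmod_hom_smult[OF g] VW.tens_balanced fc gc)
  qed (simp_all add: lmod_hom_add[OF f] lmod_hom_add[OF g] fc gc VW.tens_closed VW.tens_add_left VW.tens_add_right)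
  then obtain \<phi> where \<phi>: "\<phi> \<in> hom UN.TG VW.TG"
    "\<And>u y. u \<in> carrier U \<Longrightarrow> y \<in> carrier N \<Longrightarrow> \<phi> (tens R U N u y) = tens R V W (f u) (g y)" by blast
  interpret \<phi>: group_hom UN.TG VW.TG \<phi> by (intro group_hom.intro group_hom_axioms.intro UN.TG.group_axioms VW.TG.group_axioms \<phi>)
  let ?e = "frag_extend (\<lambda>(u, y). frag_of (f u, g y))"
  interpret p: group_hom UN.FA UN.TG "\<lambda>c. UN.TK #>\<^bsub>UN.FA\<^esub> c" by (intro group_hom.intro group_hom_axioms.intro UN.FA.group_axioms UN.TG.group_axioms UN.coset_hom)
  interpret q: group_hom VW.FA VW.TG "\<lambda>c. VW.TK #>\<^bsub>VW.FA\<^esub> c" by (intro group_hom.intro group_hom_axioms.intro VW.FA.group_axioms VW.TG.group_axioms VW.coset_hom)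
  have e: "?e c \<in> carrier VW.FA \<and> VW.TK #>\<^bsub>VW.FA\<^esub> ?e c = \<phi> (UN.TK #>\<^bsub>UN.FA\<^esub> c)" if "c \<in> carrier UN.FA" for c
  proof -
    have "Poly_Mapping.keys c \<subseteq> carrier U \<times> carrier N" using that by simp
    then show ?thesis
    proof (induction c rule: free_Abelian_group_induct[consumes 1, case_names zero diff one])
      case zero
      then show ?case using p.hom_one q.hom_one by simp
    next
      case (diff x y)
      have "?e (x - y) = ?e x + - ?e y" by (simp add: frag_extend_diff)
      moreover have "?e x + - ?e y \<in> carrier VW.FA" using diff VW.FA.m_closed[of "?e x" "- ?e y"] by simp
      moreover have "VW.TK #>\<^bsub>VW.FA\<^esub> (?e x + - ?e y) = \<phi> (UN.TK #>\<^bsub>UN.FA\<^esub> (x - y))"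
      proof -
        have "VW.TK #>\<^bsub>VW.FA\<^esub> (?e x + - ?e y) = (VW.TK #>\<^bsub>VW.FA\<^esub> ?e x) \<otimes>\<^bsub>VW.TG\<^esub> inv\<^bsub>VW.TG\<^esub> (VW.TK #>\<^bsub>VW.FA\<^esub> ?e y)"
          using q.hom_mult[of "?e x" "- ?e y"] q.hom_inv[of "?e y"] diff by simp
        also have "\<dots> = \<phi> ((UN.TK #>\<^bsub>UN.FA\<^esub> x) \<otimes>\<^bsub>UN.TG\<^esub> inv\<^bsub>UN.TG\<^esub> (UN.TK #>\<^bsub>UN.FA\<^esub> y))"
          using diff p.hom_closed[of x] p.hom_closed[of y] by simp
        also have "\<dots> = \<phi> (UN.TK #>\<^bsub>UN.FA\<^esub> (x - y))"
          using p.hom_mult[of x "- y"] p.hom_inv[of y] diff by simp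
        finally show ?thesis .
      qed
      ultimately show ?case by simp
    next
      case (one a)
      then show ?case using \<phi>(2) fc gc by (auto simp: tens_def keys_frag_of)
    qed
  qed
  have tm: "tensor_map R V W f g t = \<phi> t" if t: "t \<in> carrier UN.TG" for t
  proof -
    obtain c where c: "c \<in> carrier UN.FA" "t = UN.TK #>\<^bsub>UN.FA\<^esub> c" using t unfolding UN.tensor_carrier by blast
    have "c \<in> t" unfolding c(2) by (rule UN.FA.rcos_self[OF c(1) UN.TK_subgroup])
    \<comment> \<open>Every representative of the coset gives the same value, so the union collapses
      to one coset.\<close>
    moreover have "VW.TK #>\<^bsub>VW.FA\<^esub> ?e c' = \<phi> t" if "c' \<in> t" for c'
    proof -
      have c': "c' \<in> carrier UN.FA" using that c UN.FA.r_coset_subset_G[OF subgroup.subset[OF UN.TK_subgroup] c(1)] by blast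
      have "t = UN.TK #>\<^bsub>UN.FA\<^esub> c'" using UN.FA.repr_independence[OF _ c(1) UN.TK_subgroup] that c(2) by simp
      then show ?thesis using e[OF c'] by simp
    qed
    ultimately show ?thesis unfolding tensor_map_def by blast
  qed
  show "tensor_map R V W f g \<in> hom UN.TG VW.TG"
    using \<phi>.hom_closed \<phi>.hom_mult by (intro homI) (simp_all add: tm)
  show "tensor_map R V W f g (tens R U N u y) = tens R V W (f u) (g y)" if "u \<in> carrier U" "y \<in> carrier N" for u y
    using that by (simp add: tm UN.tens_closed \<phi>(2))
qed

section \<open>Hom and tensor modules of a bimodule\<close>

lemma Hom_module_simps [simp]:
  "f \<in> carrier (Hom_module S K I) \<longleftrightarrow> f \<in> lmod_hom S (left_mod K) I \<and> f \<in> extensional (carrier K)"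
  "\<zero>\<^bsub>Hom_module S K I\<^esub> = (\<lambda>x\<in>carrier K. \<zero>\<^bsub>I\<^esub>)"
  "f \<oplus>\<^bsub>Hom_module S K I\<^esub> f' = (\<lambda>x\<in>carrier K. f x \<oplus>\<^bsub>I\<^esub> f' x)"
  "r \<odot>\<^bsub>Hom_module S K I\<^esub> f = (\<lambda>x\<in>carrier K. f (rsmult K x r))"
  by (simp_all add: Hom_module_def)

lemma ghom_closed: "h \<in> hom G H \<Longrightarrow> x \<in> carrier G \<Longrightarrow> h x \<in> carrier H"
  by (auto simp: hom_def)

lemma abelian_group_comm_group:
  assumes "comm_group G" "carrier M = carrier G" "\<zero>\<^bsub>M\<^esub> = \<one>\<^bsub>G\<^esub>" "ring.add M = monoid.mult G"
  shows "abelian_group M"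
proof -
  interpret comm_group G by fact
  show ?thesis using l_inv_ex by (intro abelian_groupI) (auto simp: assms(2-4) m_ac)
qed

lemma rsmult_left_hom:
  assumes "bimodule S R K" "r \<in> carrier R"
  shows "(\<lambda>x. rsmult K x r) \<in> lmod_hom S (left_mod K) (left_mod K)"
proof -
  interpret Q: lmodule "op_ring R" "right_mod K" using assms(1) by (simp add: bimodule_def)
  show ?thesis using assms Q.smult_closed[of r] Q.smult_r_distr[of r]
    by (intro lmod_homI) (auto simp: bimodule_def)
qed

lemma smult_right_hom:
  assumes "bimodule S R K" "s \<in> carrier S"
  shows "(\<lambda>x. s \<odot>\<^bsub>K\<^esub> x) \<in> lmod_hom (op_ring R) (right_mod K) (right_mod K)"
proof -
  interpret L: lmodule S "left_mod K" using assms(1) by (simp add: bimodule_def)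
  show ?thesis using assms L.smult_closed[of s] L.smult_r_distr[of s]
    by (intro lmod_homI) (auto simp: bimodule_def)
qed

lemma lmodule_Hom_module:
  assumes K: "bimodule S R K" and R: "ring R" and I: "lmodule S I"
  shows "lmodule R (Hom_module S K I)"
proof -
  interpret L: lmodule S "left_mod K" using K by (simp add: bimodule_def)
  interpret Q: lmodule "op_ring R" "right_mod K" using K by (simp add: bimodule_def)
  interpret I: lmodule S I by (rule I)
  have rc: "rsmult K x r \<in> carrier K" if "x \<in> carrier K" "r \<in> carrier R" for x r
    using Q.smult_closed[of r x] that by simp
  have "abelian_group (Hom_module S K I)"
    by (rule abelian_group_comm_group[OF comm_group_hom_group[OF L.lmodule_axioms I]]) (auto simp: Hom_module_def)
  moreover have "lmodule_axioms R (Hom_module S K I)"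
  proof
    fix r f assume r: "r \<in> carrier R" and f: "f \<in> carrier (Hom_module S K I)"
    have "(\<lambda>x. f (rsmult K x r)) \<in> lmod_hom S (left_mod K) I"
      using f by (intro lmod_hom_comp[OF rsmult_left_hom[OF K r]]) simp
    then show "r \<odot>\<^bsub>Hom_module S K I\<^esub> f \<in> carrier (Hom_module S K I)"
      using restrict_lmod_hom[OF L.lmodule_axioms] by force
    fix f' assume "f' \<in> carrier (Hom_module S K I)"
    then show "r \<odot>\<^bsub>Hom_module S K I\<^esub> (f \<oplus>\<^bsub>Hom_module S K I\<^esub> f') =
        r \<odot>\<^bsub>Hom_module S K I\<^esub> f \<oplus>\<^bsub>Hom_module S K I\<^esub> r \<odot>\<^bsub>Hom_module S K I\<^esub> f'"
      using r rc by (auto simp: fun_eq_iff)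
  next
    fix r r' f assume r: "r \<in> carrier R" "r' \<in> carrier R" and f: "f \<in> carrier (Hom_module S K I)"
    show "(r \<oplus>\<^bsub>R\<^esub> r') \<odot>\<^bsub>Hom_module S K I\<^esub> f =
        r \<odot>\<^bsub>Hom_module S K I\<^esub> f \<oplus>\<^bsub>Hom_module S K I\<^esub> r' \<odot>\<^bsub>Hom_module S K I\<^esub> f"
      using r f rc Q.smult_l_distr[of r r'] lmod_hom_add[of f S "left_mod K" I] by (auto simp: fun_eq_iff)
    show "r \<otimes>\<^bsub>R\<^esub> r' \<odot>\<^bsub>Hom_module S K I\<^esub> f = r \<odot>\<^bsub>Hom_module S K I\<^esub> (r' \<odot>\<^bsub>Hom_module S K I\<^esub> f)"
      using r f rc Q.smult_assoc1[of r' r] by (auto simp: fun_eq_iff)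
  next
    fix f assume "f \<in> carrier (Hom_module S K I)"
    then show "\<one>\<^bsub>R\<^esub> \<odot>\<^bsub>Hom_module S K I\<^esub> f = f"
      using Q.smult_one by (auto simp: fun_eq_iff extensional_def)
  qed
  ultimately show ?thesis using R by (simp add: lmodule_def)
qed

lemma tensor_module_simps [simp]:
  "carrier (tensor_module R K N) = carrier (tensor_group R (right_mod K) N)"
  "\<zero>\<^bsub>tensor_module R K N\<^esub> = \<one>\<^bsub>tensor_group R (right_mod K) N\<^esub>"
  "t \<oplus>\<^bsub>tensor_module R K N\<^esub> t' = t \<otimes>\<^bsub>tensor_group R (right_mod K) N\<^esub> t'"
  by (simp_all add: tensor_module_def)

abbreviation pure :: "'r ring \<Rightarrow> ('s, 'r, 'k) bimod \<Rightarrow> ('r, 'n) module \<Rightarrow> 'k \<Rightarrow> 'n \<Rightarrow> (('k \<times> 'n) \<Rightarrow>\<^sub>0 int) set" where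
  "pure R K N \<equiv> tens R (right_mod K) N"

locale bimod_tensor =
  fixes S :: "'s ring" and R :: "'r ring" and K :: "('s, 'r, 'k) bimod" and N :: "('r, 'n) module"
  assumes K: "bimodule S R K" and N: "lmodule R N"
begin

sublocale T: tensor_pair R "right_mod K" N
  using K N by (simp add: tensor_pair_def bimodule_def)

lemma left: "lmodule S (left_mod K)" using K by (simp add: bimodule_def)

sublocale L: lmodule S "left_mod K" by (rule left)

lemma smult_tensor_hom: "s \<in> carrier S \<Longrightarrow> module.smult (tensor_module R K N) s \<in> hom T.TG T.TG"
  and smult_pure: "s \<in> carrier S \<Longrightarrow> k \<in> carrier K \<Longrightarrow> y \<in> carrier N \<Longrightarrow>
    s \<odot>\<^bsub>tensor_module R K N\<^esub> pure R K N k y = pure R K N (s \<odot>\<^bsub>K\<^esub> k) y"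
  using tensor_map_hom[OF T.tensor_pair_axioms T.tensor_pair_axioms smult_right_hom[OF K], of s id]
  by (simp_all add: tensor_module_def id_def lmod_hom_id)

lemma lmodule_tensor_module: "lmodule S (tensor_module R K N)"
proof -
  have "abelian_group (tensor_module R K N)"
    by (rule abelian_group_comm_group[OF T.TG.comm_group_axioms]) (auto simp: tensor_module_def)
  moreover have "lmodule_axioms S (tensor_module R K N)"
  proof
    fix s t assume s: "s \<in> carrier S" and t: "t \<in> carrier (tensor_module R K N)"
    interpret h: group_hom T.TG T.TG "module.smult (tensor_module R K N) s"
      by (intro group_hom.intro group_hom_axioms.intro T.TG.group_axioms smult_tensor_hom s)
    show "s \<odot>\<^bsub>tensor_module R K N\<^esub> t \<in> carrier (tensor_module R K N)" using h.hom_closed t by (simp)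
    fix t' assume "t' \<in> carrier (tensor_module R K N)"
    then show "s \<odot>\<^bsub>tensor_module R K N\<^esub> (t \<oplus>\<^bsub>tensor_module R K N\<^esub> t') =
        s \<odot>\<^bsub>tensor_module R K N\<^esub> t \<oplus>\<^bsub>tensor_module R K N\<^esub> s \<odot>\<^bsub>tensor_module R K N\<^esub> t'"
      using t by (simp)
  next
    fix s s' t assume s: "s \<in> carrier S" "s' \<in> carrier S" and t: "t \<in> carrier (tensor_module R K N)"
    let ?m = "module.smult (tensor_module R K N)"
    have hs: "?m s \<in> hom T.TG T.TG" "?m s' \<in> hom T.TG T.TG" "?m (s \<oplus>\<^bsub>S\<^esub> s') \<in> hom T.TG T.TG" "?m (s \<otimes>\<^bsub>S\<^esub> s') \<in> hom T.TG T.TG"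
      using s by (auto intro!: smult_tensor_hom)
    have sc: "x \<odot>\<^bsub>K\<^esub> k \<in> carrier K" if "x \<in> carrier S" "k \<in> carrier K" for x k using L.smult_closed that by simp
    have "?m (s \<oplus>\<^bsub>S\<^esub> s') t = (\<lambda>t. ?m s t \<otimes>\<^bsub>T.TG\<^esub> ?m s' t) t"
    proof (rule T.tensor_hom_eq[OF T.TG.group_axioms hs(3)])
      show "(\<lambda>t. ?m s t \<otimes>\<^bsub>T.TG\<^esub> ?m s' t) \<in> hom T.TG T.TG"
        using hs(1,2) by (intro homI) (auto simp: ghom_closed hom_mult T.TG.m_ac)
      show "t \<in> carrier T.TG" using t by simp
      fix k y assume k: "k \<in> carrier (right_mod K)" and y: "y \<in> carrier N"
      then show "?m (s \<oplus>\<^bsub>S\<^esub> s') (T.te k y) = ?m s (T.te k y) \<otimes>\<^bsub>T.TG\<^esub> ?m s' (T.te k y)"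
        using s sc L.smult_l_distr[of s s' k] T.tens_add_left[of "s \<odot>\<^bsub>K\<^esub> k" "s' \<odot>\<^bsub>K\<^esub> k" y]
        by (simp add: smult_pure)
    qed
    then show "(s \<oplus>\<^bsub>S\<^esub> s') \<odot>\<^bsub>tensor_module R K N\<^esub> t =
        s \<odot>\<^bsub>tensor_module R K N\<^esub> t \<oplus>\<^bsub>tensor_module R K N\<^esub> s' \<odot>\<^bsub>tensor_module R K N\<^esub> t"
      by (simp)
    have "?m (s \<otimes>\<^bsub>S\<^esub> s') t = (\<lambda>t. ?m s (?m s' t)) t"
    proof (rule T.tensor_hom_eq[OF T.TG.group_axioms hs(4)])
      show "(\<lambda>t. ?m s (?m s' t)) \<in> hom T.TG T.TG"
        using hs(1,2) by (intro homI) (auto simp: ghom_closed hom_mult)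
      show "t \<in> carrier T.TG" using t by simp
      fix k y assume k: "k \<in> carrier (right_mod K)" and y: "y \<in> carrier N"
      then show "?m (s \<otimes>\<^bsub>S\<^esub> s') (T.te k y) = ?m s (?m s' (T.te k y))"
        using s sc L.smult_assoc1[of s s' k] by (simp add: smult_pure)
    qed
    then show "s \<otimes>\<^bsub>S\<^esub> s' \<odot>\<^bsub>tensor_module R K N\<^esub> t = s \<odot>\<^bsub>tensor_module R K N\<^esub> (s' \<odot>\<^bsub>tensor_module R K N\<^esub> t)"
      by simp
  next
    fix t assume t: "t \<in> carrier (tensor_module R K N)"
    let ?m = "module.smult (tensor_module R K N)"
    have "?m \<one>\<^bsub>S\<^esub> t = (\<lambda>t. t) t"
    proof (rule T.tensor_hom_eq[OF T.TG.group_axioms smult_tensor_hom])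
      show "(\<lambda>t. t) \<in> hom T.TG T.TG" by (rule homI) auto
      show "t \<in> carrier T.TG" using t by simp
      fix k y assume k: "k \<in> carrier (right_mod K)" and y: "y \<in> carrier N"
      then show "?m \<one>\<^bsub>S\<^esub> (T.te k y) = T.te k y"
        using L.smult_one[of k] by (simp add: smult_pure)
    qed simp
    then show "\<one>\<^bsub>S\<^esub> \<odot>\<^bsub>tensor_module R K N\<^esub> t = t" by simp
  qed
  ultimately show ?thesis using L.R.ring_axioms by (simp add: lmodule_def)
qed

sublocale KN: lmodule S "tensor_module R K N" by (rule lmodule_tensor_module)

abbreviation "X \<equiv> tensor_module R K N"
abbreviation "pu \<equiv> pure R K N"

lemma pure_closed: "k \<in> carrier K \<Longrightarrow> y \<in> carrier N \<Longrightarrow> pu k y \<in> carrier X"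
  using T.tens_closed by simp

lemma pure_add_left: "k \<in> carrier K \<Longrightarrow> k' \<in> carrier K \<Longrightarrow> y \<in> carrier N \<Longrightarrow> pu (k \<oplus>\<^bsub>K\<^esub> k') y = pu k y \<oplus>\<^bsub>X\<^esub> pu k' y"
  using T.tens_add_left by simp

lemma pure_add_right: "k \<in> carrier K \<Longrightarrow> y \<in> carrier N \<Longrightarrow> y' \<in> carrier N \<Longrightarrow> pu k (y \<oplus>\<^bsub>N\<^esub> y') = pu k y \<oplus>\<^bsub>X\<^esub> pu k y'"
  using T.tens_add_right by simp

lemma pure_balanced: "k \<in> carrier K \<Longrightarrow> r \<in> carrier R \<Longrightarrow> y \<in> carrier N \<Longrightarrow> pu (rsmult K k r) y = pu k (r \<odot>\<^bsub>N\<^esub> y)"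
  using T.tens_balanced[of k r y] by simp

lemma pure_smult: "s \<in> carrier S \<Longrightarrow> k \<in> carrier K \<Longrightarrow> y \<in> carrier N \<Longrightarrow> s \<odot>\<^bsub>X\<^esub> pu k y = pu (s \<odot>\<^bsub>K\<^esub> k) y"
  by (rule smult_pure)

lemma pure_zero_left: "y \<in> carrier N \<Longrightarrow> pu \<zero>\<^bsub>K\<^esub> y = \<zero>\<^bsub>X\<^esub>"
  using pure_add_left[of "\<zero>\<^bsub>K\<^esub>" "\<zero>\<^bsub>K\<^esub>" y] L.M.zero_closed L.M.l_zero[of "\<zero>\<^bsub>K\<^esub>"] pure_closed[of "\<zero>\<^bsub>K\<^esub>" y]
  by (metis KN.M.add.r_cancel_one' left_mod_simps(1,2,3))

lemma pure_zero_right: "k \<in> carrier K \<Longrightarrow> pu k \<zero>\<^bsub>N\<^esub> = \<zero>\<^bsub>X\<^esub>"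
  using pure_add_right[of k "\<zero>\<^bsub>N\<^esub>" "\<zero>\<^bsub>N\<^esub>"] pure_closed[of k "\<zero>\<^bsub>N\<^esub>"]
  by (metis KN.M.add.r_cancel_one' T.N.M.zero_closed T.N.M.l_zero)

lemma X_induct [consumes 1, case_names pure diff]:
  assumes "t \<in> carrier X"
    and "\<And>k y. k \<in> carrier K \<Longrightarrow> y \<in> carrier N \<Longrightarrow> P (pu k y)"
    and "\<And>t t'. t \<in> carrier X \<Longrightarrow> t' \<in> carrier X \<Longrightarrow> P t \<Longrightarrow> P t' \<Longrightarrow> P (t \<ominus>\<^bsub>X\<^esub> t')"
  shows "P t"
proof -
  have inv: "inv\<^bsub>T.TG\<^esub> t = \<ominus>\<^bsub>X\<^esub> t" if "t \<in> carrier X" for t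
  proof (rule T.TG.inv_equality)
    show "\<ominus>\<^bsub>X\<^esub> t \<otimes>\<^bsub>T.TG\<^esub> t = \<one>\<^bsub>T.TG\<^esub>" using KN.M.l_neg[OF that] by simp
  qed (use that KN.M.a_inv_closed in auto)
  have "t \<in> carrier T.TG" using assms(1) by simp
  then show ?thesis
    by (induction rule: T.tensor_induct)
      (use assms(2,3) inv in \<open>auto simp: a_minus_def\<close>)
qed

lemma X_hom:
  assumes J: "lmodule S J"
    and c: "\<And>k y. k \<in> carrier K \<Longrightarrow> y \<in> carrier N \<Longrightarrow> \<beta> k y \<in> carrier J"
    and l: "\<And>k k' y. k \<in> carrier K \<Longrightarrow> k' \<in> carrier K \<Longrightarrow> y \<in> carrier N \<Longrightarrow> \<beta> (k \<oplus>\<^bsub>K\<^esub> k') y = \<beta> k y \<oplus>\<^bsub>J\<^esub> \<beta> k' y"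
    and r: "\<And>k y y'. k \<in> carrier K \<Longrightarrow> y \<in> carrier N \<Longrightarrow> y' \<in> carrier N \<Longrightarrow> \<beta> k (y \<oplus>\<^bsub>N\<^esub> y') = \<beta> k y \<oplus>\<^bsub>J\<^esub> \<beta> k y'"
    and b: "\<And>a k y. a \<in> carrier R \<Longrightarrow> k \<in> carrier K \<Longrightarrow> y \<in> carrier N \<Longrightarrow> \<beta> (rsmult K k a) y = \<beta> k (a \<odot>\<^bsub>N\<^esub> y)"
    and s: "\<And>a k y. a \<in> carrier S \<Longrightarrow> k \<in> carrier K \<Longrightarrow> y \<in> carrier N \<Longrightarrow> \<beta> (a \<odot>\<^bsub>K\<^esub> k) y = a \<odot>\<^bsub>J\<^esub> \<beta> k y"
  shows "\<exists>\<phi>\<in>lmod_hom S X J. \<forall>k\<in>carrier K. \<forall>y\<in>carrier N. \<phi> (pu k y) = \<beta> k y"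
proof -
  interpret J: lmodule S J by (rule J)
  have "\<exists>\<phi>\<in>hom T.TG (add_monoid J). \<forall>k\<in>carrier (right_mod K). \<forall>y\<in>carrier N. \<phi> (pu k y) = \<beta> k y"
    by (rule T.tensor_universal[OF J.M.a_comm_group]) (use c l r b in auto)
  then obtain \<phi> where \<phi>: "\<phi> \<in> hom T.TG (add_monoid J)" "\<And>k y. k \<in> carrier K \<Longrightarrow> y \<in> carrier N \<Longrightarrow> \<phi> (pu k y) = \<beta> k y" by auto
  have \<phi>s: "\<phi> (a \<odot>\<^bsub>X\<^esub> t) = a \<odot>\<^bsub>J\<^esub> \<phi> t" if a: "a \<in> carrier S" and t: "t \<in> carrier X" for a t
  proof -
    have "(\<lambda>t. \<phi> (a \<odot>\<^bsub>X\<^esub> t)) t = (\<lambda>t. a \<odot>\<^bsub>J\<^esub> \<phi> t) t"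
    proof (rule T.tensor_hom_eq[OF J.M.a_group])
      show "(\<lambda>t. \<phi> (a \<odot>\<^bsub>X\<^esub> t)) \<in> hom T.TG (add_monoid J)"
        using ghom_closed[OF smult_tensor_hom[OF a]] hom_mult[OF smult_tensor_hom[OF a]] ghom_closed[OF \<phi>(1)] hom_mult[OF \<phi>(1)]
        by (intro homI) (simp_all)
      show "(\<lambda>t. a \<odot>\<^bsub>J\<^esub> \<phi> t) \<in> hom T.TG (add_monoid J)"
        using a ghom_closed[OF \<phi>(1)] hom_mult[OF \<phi>(1)] by (intro homI) (simp_all add: J.smult_r_distr)
      show "t \<in> carrier T.TG" using t by simp
      fix k y assume "k \<in> carrier (right_mod K)" "y \<in> carrier N"
      then show "\<phi> (a \<odot>\<^bsub>X\<^esub> pu k y) = a \<odot>\<^bsub>J\<^esub> \<phi> (pu k y)"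
        using a L.smult_closed[of a k] by (simp add: smult_pure \<phi>(2) s)
    qed
    then show ?thesis .
  qed
  have "\<phi> \<in> lmod_hom S X J"
    using ghom_closed[OF \<phi>(1)] hom_mult[OF \<phi>(1)] \<phi>s by (intro lmod_homI) (simp_all)
  then show ?thesis using \<phi>(2) by blast
qed

end

lemma tensor_module_map:
  assumes K: "bimodule S R K" and M: "lmodule R M" and N: "lmodule R N" and f: "f \<in> lmod_hom R M N"
  shows "\<exists>\<phi>\<in>lmod_hom S (tensor_module R K M) (tensor_module R K N).
    \<forall>k\<in>carrier K. \<forall>y\<in>carrier M. \<phi> (pure R K M k y) = pure R K N k (f y)"
proof -
  interpret M: bimod_tensor S R K M using K M by (simp add: bimod_tensor_def)
  interpret N: bimod_tensor S R K N using K N by (simp add: bimod_tensor_def)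
  note fc = lmod_hom_closed[OF f]
  show ?thesis
    by (rule M.X_hom[OF N.lmodule_tensor_module])
      (simp_all add: N.pure_closed N.pure_add_left N.pure_add_right N.pure_balanced N.pure_smult fc
        lmod_hom_add[OF f] lmod_hom_smult[OF f] del: tensor_module_simps)
qed

text \<open>The two modules may live over different rings; this is for maps such as
  \<open>x \<mapsto> h x k\<close>, which go from an \<open>R\<close>-module to an
  \<open>S\<close>-module.\<close>

lemma additive_finsum:
  assumes "lmodule T M" "lmodule T' N" "finite A" "h \<in> A \<rightarrow> carrier M"
    and c: "\<And>x. x \<in> carrier M \<Longrightarrow> f x \<in> carrier N"
    and add: "\<And>x y. x \<in> carrier M \<Longrightarrow> y \<in> carrier M \<Longrightarrow> f (x \<oplus>\<^bsub>M\<^esub> y) = f x \<oplus>\<^bsub>N\<^esub> f y"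
  shows "f (\<Oplus>\<^bsub>M\<^esub>x\<in>A. h x) = (\<Oplus>\<^bsub>N\<^esub>x\<in>A. f (h x))"
proof -
  interpret M: lmodule T M by fact
  interpret N: lmodule T' N by fact
  have "f \<zero>\<^bsub>M\<^esub> \<oplus>\<^bsub>N\<^esub> f \<zero>\<^bsub>M\<^esub> = f \<zero>\<^bsub>M\<^esub>" by (simp flip: add)
  then have z: "f \<zero>\<^bsub>M\<^esub> = \<zero>\<^bsub>N\<^esub>" using c by (metis M.M.zero_closed N.M.add.r_cancel_one')
  show ?thesis using assms(3,4)
    by (induction A rule: finite_induct) (auto simp: z add c M.M.finsum_closed Pi_def)
qed

lemma pow_mod_induct [consumes 2, case_names zero single add]:
  fixes T :: "'t ring"
  assumes M: "lmodule T M" and f: "f \<in> carrier (pow_mod M m)"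
    and P0: "P (\<lambda>_. \<zero>\<^bsub>M\<^esub>)" and P1: "\<And>i x. i < m \<Longrightarrow> x \<in> carrier M \<Longrightarrow> P (single M i x)"
    and P2: "\<And>u v. u \<in> carrier (pow_mod M m) \<Longrightarrow> v \<in> carrier (pow_mod M m) \<Longrightarrow> P u \<Longrightarrow> P v \<Longrightarrow> P (u \<oplus>\<^bsub>pow_mod M m\<^esub> v)"
  shows "P f"
proof -
  interpret M: lmodule T M by fact
  have fM: "f i \<in> carrier M" for i by (rule pow_mod_nth[OF M f])
  have "P (\<lambda>i. if i < k then f i else \<zero>\<^bsub>M\<^esub>)" if "k \<le> m" for k
    using that
  proof (induction k)
    case (Suc k)
    let ?f = "\<lambda>i. if i < k then f i else \<zero>\<^bsub>M\<^esub>"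
    have "(\<lambda>i. if i < Suc k then f i else \<zero>\<^bsub>M\<^esub>) = ?f \<oplus>\<^bsub>pow_mod M m\<^esub> single M k (f k)"
      using fM by (auto simp: single_def fun_eq_iff less_Suc_eq)
    moreover have "P (?f \<oplus>\<^bsub>pow_mod M m\<^esub> single M k (f k))"
    proof (rule P2)
      show "single M k (f k) \<in> carrier (pow_mod M m)"
        using Suc.prems by (intro lmod_hom_closed[OF single_hom[OF M]] fM) simp
    qed (use Suc fM P1 in auto)
    ultimately show ?case by simp
  qed (simp add: P0)
  moreover have "(\<lambda>i. if i < m then f i else \<zero>\<^bsub>M\<^esub>) = f" using f by auto
  ultimately show ?thesis by (metis order_refl)
qed

section \<open>Presentations of tensor products\<close>

locale matrix_resolution_tensor = matrix_resolution S R K m g a + bimod_tensor S R K N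
  for S :: "'s ring" and R :: "'r ring" and K :: "('s, 'r, 'k) bimod" and m g a and N :: "('r, 'n) module"
begin

text \<open>The augmentation of the resolution tensored with \<open>N\<close>, under the
  identification of \<open>R^m \<otimes> N\<close> with \<open>N^m\<close>.\<close>

definition gsum :: "(nat \<Rightarrow> 'n) \<Rightarrow> (('k \<times> 'n) \<Rightarrow>\<^sub>0 int) set" where
  "gsum f = (\<Oplus>\<^bsub>X\<^esub>x\<in>{..<m 0}. pu (g x) (f x))"

text \<open>The differential tensored with \<open>N\<close>: the matrix \<open>a j\<close> times a
  column over \<open>N\<close>. Compared with \<open>dmap\<close> the direction is reversed.\<close>

definition amap :: "nat \<Rightarrow> (nat \<Rightarrow> 'n) \<Rightarrow> nat \<Rightarrow> 'n" where
  "amap j f = (\<lambda>x. if x < m j then \<Oplus>\<^bsub>N\<^esub>y\<in>{..<m (Suc j)}. a j x y \<odot>\<^bsub>N\<^esub> f y else \<zero>\<^bsub>N\<^esub>)"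

abbreviation "P j \<equiv> pow_mod N (m j)"

sublocale P: lmodule R "pow_mod N i" for i by (rule lmodule_pow_mod[OF N])

lemma pure_g_closed: "f \<in> carrier (P 0) \<Longrightarrow> x < m 0 \<Longrightarrow> pu (g x) (f x) \<in> carrier X"
  using g_closed by (intro pure_closed) auto

lemma gsum_closed: "f \<in> carrier (P 0) \<Longrightarrow> gsum f \<in> carrier X"
  unfolding gsum_def using pure_g_closed by (intro KN.M.finsum_closed) auto

lemma gsum_add: "f \<in> carrier (P 0) \<Longrightarrow> f' \<in> carrier (P 0) \<Longrightarrow> gsum (f \<oplus>\<^bsub>P 0\<^esub> f') = gsum f \<oplus>\<^bsub>X\<^esub> gsum f'"
proof -
  assume f: "f \<in> carrier (P 0)" "f' \<in> carrier (P 0)"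
  have "gsum (f \<oplus>\<^bsub>P 0\<^esub> f') = (\<Oplus>\<^bsub>X\<^esub>x\<in>{..<m 0}. pu (g x) (f x) \<oplus>\<^bsub>X\<^esub> pu (g x) (f' x))"
    unfolding gsum_def using f g_closed pure_g_closed
    by (intro KN.M.finsum_cong') (auto simp: pure_add_right simp del: tensor_module_simps intro!: KN.M.a_closed)
  also have "\<dots> = gsum f \<oplus>\<^bsub>X\<^esub> gsum f'"
    unfolding gsum_def using pure_g_closed f by (intro KN.M.finsum_addf) auto
  finally show ?thesis .
qed

lemma gsum_single:
  assumes "x < m 0" "n \<in> carrier N" shows "gsum (single N x n) = pu (g x) n"
proof -
  have "gsum (single N x n) = (\<Oplus>\<^bsub>X\<^esub>x'\<in>{..<m 0}. if x = x' then pu (g x) n else \<zero>\<^bsub>X\<^esub>)"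
    unfolding gsum_def using assms g_closed pure_closed
    by (intro KN.M.finsum_cong') (auto simp: single_def pure_zero_right)
  also have "\<dots> = pu (g x) n"
    using KN.M.finsum_singleton[of x "{..<m 0}" "\<lambda>_. pu (g x) n"] assms g_closed pure_closed by simp
  finally show ?thesis .
qed

lemma gsum_minus: "f \<in> carrier (P 0) \<Longrightarrow> f' \<in> carrier (P 0) \<Longrightarrow> gsum (f \<ominus>\<^bsub>P 0\<^esub> f') = gsum f \<ominus>\<^bsub>X\<^esub> gsum f'"
  by (metis P.M.minus_closed P.minus_add_cancel gsum_add gsum_closed KN.add_minus_cancel' KN.M.a_comm)

lemma amap_closed: "f \<in> carrier (P (Suc j)) \<Longrightarrow> amap j f \<in> carrier (P j)"
  using a_closed by (auto simp: amap_def intro!: T.N.M.finsum_closed)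

lemma amap_add:
  assumes "f \<in> carrier (P (Suc j))" "f' \<in> carrier (P (Suc j))"
  shows "amap j (f \<oplus>\<^bsub>P (Suc j)\<^esub> f') = amap j f \<oplus>\<^bsub>P j\<^esub> amap j f'"
proof
  fix x
  show "amap j (f \<oplus>\<^bsub>P (Suc j)\<^esub> f') x = (amap j f \<oplus>\<^bsub>P j\<^esub> amap j f') x"
  proof (cases "x < m j")
    case True
    have "(\<Oplus>\<^bsub>N\<^esub>y\<in>{..<m (Suc j)}. a j x y \<odot>\<^bsub>N\<^esub> (f \<oplus>\<^bsub>P (Suc j)\<^esub> f') y)
        = (\<Oplus>\<^bsub>N\<^esub>y\<in>{..<m (Suc j)}. a j x y \<odot>\<^bsub>N\<^esub> f y \<oplus>\<^bsub>N\<^esub> a j x y \<odot>\<^bsub>N\<^esub> f' y)"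
      using assms a_closed[OF True] by (intro T.N.M.finsum_cong') (auto simp: T.N.smult_r_distr)
    also have "\<dots> = (\<Oplus>\<^bsub>N\<^esub>y\<in>{..<m (Suc j)}. a j x y \<odot>\<^bsub>N\<^esub> f y) \<oplus>\<^bsub>N\<^esub> (\<Oplus>\<^bsub>N\<^esub>y\<in>{..<m (Suc j)}. a j x y \<odot>\<^bsub>N\<^esub> f' y)"
      using assms a_closed[OF True] by (intro T.N.M.finsum_addf) auto
    finally show ?thesis using True by (simp add: amap_def)
  qed (simp add: amap_def)
qed

lemma amap_single:
  assumes y: "y < m (Suc j)" and n: "n \<in> carrier N"
  shows "amap j (single N y n) = (\<lambda>x. if x < m j then a j x y \<odot>\<^bsub>N\<^esub> n else \<zero>\<^bsub>N\<^esub>)"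
proof
  fix x
  show "amap j (single N y n) x = (if x < m j then a j x y \<odot>\<^bsub>N\<^esub> n else \<zero>\<^bsub>N\<^esub>)"
  proof (cases "x < m j")
    case True
    have "(\<Oplus>\<^bsub>N\<^esub>y'\<in>{..<m (Suc j)}. a j x y' \<odot>\<^bsub>N\<^esub> single N y n y')
        = (\<Oplus>\<^bsub>N\<^esub>y'\<in>{..<m (Suc j)}. if y = y' then a j x y \<odot>\<^bsub>N\<^esub> n else \<zero>\<^bsub>N\<^esub>)"
      using n a_closed[OF True] by (intro T.N.M.finsum_cong') (auto simp: single_def T.N.smult_zero_right)
    also have "\<dots> = a j x y \<odot>\<^bsub>N\<^esub> n"
      using T.N.M.finsum_singleton[of y "{..<m (Suc j)}" "\<lambda>_. a j x y \<odot>\<^bsub>N\<^esub> n"] y n a_closed[OF True] by simp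
    finally show ?thesis using True by (simp add: amap_def)
  qed (simp add: amap_def)
qed

lemma amap_zero: "amap j (\<lambda>_. \<zero>\<^bsub>N\<^esub>) = (\<lambda>_. \<zero>\<^bsub>N\<^esub>)"
proof
  fix x
  have "(\<Oplus>\<^bsub>N\<^esub>y\<in>{..<m (Suc j)}. a j x y \<odot>\<^bsub>N\<^esub> \<zero>\<^bsub>N\<^esub>) = (\<Oplus>\<^bsub>N\<^esub>y\<in>{..<m (Suc j)}. \<zero>\<^bsub>N\<^esub>)" if "x < m j"
    using a_closed[OF that] by (intro T.N.M.finsum_cong') (auto simp: T.N.smult_zero_right)
  then show "amap j (\<lambda>_. \<zero>\<^bsub>N\<^esub>) x = \<zero>\<^bsub>N\<^esub>" by (simp add: amap_def)
qed

lemma amap_minus: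
  "f \<in> carrier (P (Suc j)) \<Longrightarrow> f' \<in> carrier (P (Suc j)) \<Longrightarrow> amap j (f \<ominus>\<^bsub>P (Suc j)\<^esub> f') = amap j f \<ominus>\<^bsub>P j\<^esub> amap j f'"
  by (metis P.M.minus_closed P.minus_add_cancel amap_add amap_closed P.add_minus_cancel' P.M.a_comm)

lemma amap_amap:
  assumes f: "f \<in> carrier (P (Suc (Suc j)))" shows "amap j (amap (Suc j) f) = (\<lambda>_. \<zero>\<^bsub>N\<^esub>)"
  using N f
proof (induction rule: pow_mod_induct)
  case (single z n)
  show ?case
  proof
    fix x
    show "amap j (amap (Suc j) (single N z n)) x = \<zero>\<^bsub>N\<^esub>"
    proof (cases "x < m j")
      case True
      have ac: "a j x y \<in> carrier R" "a (Suc j) y z \<in> carrier R" if "y < m (Suc j)" for y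
        using a_closed[OF True that] a_closed[OF that single(1)] by auto
      have "(\<Oplus>\<^bsub>N\<^esub>y\<in>{..<m (Suc j)}. a j x y \<odot>\<^bsub>N\<^esub> amap (Suc j) (single N z n) y)
          = (\<Oplus>\<^bsub>N\<^esub>y\<in>{..<m (Suc j)}. (a j x y \<otimes>\<^bsub>R\<^esub> a (Suc j) y z) \<odot>\<^bsub>N\<^esub> n)"
        unfolding amap_single[OF single] using ac single(2) by (intro T.N.M.finsum_cong') (auto simp: T.N.smult_assoc1)
      also have "\<dots> = (\<Oplus>\<^bsub>R\<^esub>y\<in>{..<m (Suc j)}. a j x y \<otimes>\<^bsub>R\<^esub> a (Suc j) y z) \<odot>\<^bsub>N\<^esub> n"
        using ac single(2) by (intro T.N.finsum_smult[symmetric]) auto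
      also have "\<dots> = \<zero>\<^bsub>N\<^esub>" using complex[OF True single(1)] single(2) by (simp add: T.N.smult_zero_left)
      finally show ?thesis using True by (simp add: amap_def[of j])
    qed (simp add: amap_def)
  qed
next
  case (add u v)
  have "amap j (amap (Suc j) (u \<oplus>\<^bsub>P (Suc (Suc j))\<^esub> v)) = amap j (amap (Suc j) u) \<oplus>\<^bsub>P j\<^esub> amap j (amap (Suc j) v)"
    using add(1,2) by (simp add: amap_add amap_closed del: pow_mod_simps)
  then show ?case using add(3,4) by simp
qed (simp add: amap_zero)

lemma gsum_zero: "gsum (\<lambda>_. \<zero>\<^bsub>N\<^esub>) = \<zero>\<^bsub>X\<^esub>"
proof -
  have "gsum (\<lambda>_. \<zero>\<^bsub>N\<^esub>) = (\<Oplus>\<^bsub>X\<^esub>x\<in>{..<m 0}. \<zero>\<^bsub>X\<^esub>)" unfolding gsum_def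
    using g_closed KN.M.zero_closed by (intro KN.M.finsum_cong') (auto simp: pure_zero_right)
  then show ?thesis by (simp del: tensor_module_simps)
qed

lemma gsum_amap:
  assumes f: "f \<in> carrier (P (Suc 0))" shows "gsum (amap 0 f) = \<zero>\<^bsub>X\<^esub>"
  using N f
proof (induction rule: pow_mod_induct)
  case (single y n)
  have ac: "a 0 x y \<in> carrier R" if "x < m 0" for x using a_closed[OF that single(1)] .
  have "gsum (amap 0 (single N y n)) = (\<Oplus>\<^bsub>X\<^esub>x\<in>{..<m 0}. pu (rsmult K (g x) (a 0 x y)) n)"
    unfolding gsum_def amap_single[OF single] using ac g_closed single(2) rsmult_closed pure_closed
    by (intro KN.M.finsum_cong') (auto simp: pure_balanced)
  also have "\<dots> = pu (\<Oplus>\<^bsub>left_mod K\<^esub>x\<in>{..<m 0}. rsmult K (g x) (a 0 x y)) n"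
    using ac g_closed single(2) rsmult_closed pure_closed
    by (intro additive_finsum[OF left lmodule_tensor_module, of _ _ "\<lambda>k. pu k n", symmetric])
      (auto simp: pure_add_left simp del: tensor_module_simps)
  also have "\<dots> = \<zero>\<^bsub>X\<^esub>" using complex0[of y] single by (simp add: pure_zero_left)
  finally show ?case .
next
  case (add u v)
  have "gsum (amap 0 (u \<oplus>\<^bsub>P (Suc 0)\<^esub> v)) = gsum (amap 0 u) \<oplus>\<^bsub>X\<^esub> gsum (amap 0 v)"
    using add(1,2) by (simp add: amap_add amap_closed gsum_add del: pow_mod_simps tensor_module_simps)
  then show ?case using add(3,4) KN.M.l_zero[OF KN.M.zero_closed] by (simp only:)
qed (simp add: amap_zero gsum_zero)

text \<open>If \<open>r\<close> are coordinates of \<open>k\<close> with respect to the generators,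
  then \<open>scale r n\<close> is a preimage of \<open>k \<otimes> n\<close> under
  \<open>gsum\<close>.\<close>

definition scale :: "(nat \<Rightarrow> 'r) \<Rightarrow> 'n \<Rightarrow> nat \<Rightarrow> 'n" where
  "scale r n = (\<lambda>x. if x < m 0 then r x \<odot>\<^bsub>N\<^esub> n else \<zero>\<^bsub>N\<^esub>)"

definition gcomb :: "(nat \<Rightarrow> 'r) \<Rightarrow> 'k" where
  "gcomb r = (\<Oplus>\<^bsub>left_mod K\<^esub>x\<in>{..<m 0}. rsmult K (g x) (r x))"

lemma gcomb_closed: "r \<in> {..<m 0} \<rightarrow> carrier R \<Longrightarrow> gcomb r \<in> carrier K"
  unfolding gcomb_def using g_closed rsmult_closed L.M.finsum_closed[of "\<lambda>x. rsmult K (g x) (r x)" "{..<m 0}"] by (auto simp: Pi_iff)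

lemma scale_closed: "r \<in> {..<m 0} \<rightarrow> carrier R \<Longrightarrow> n \<in> carrier N \<Longrightarrow> scale r n \<in> carrier (P 0)"
  by (auto simp: scale_def)

lemma gcomb_sum:
  assumes "r \<in> {..<m 0} \<rightarrow> carrier R" "r' \<in> {..<m 0} \<rightarrow> carrier R"
  shows "gcomb (\<lambda>x. r x \<oplus>\<^bsub>R\<^esub> r' x) = gcomb r \<oplus>\<^bsub>K\<^esub> gcomb r'"
proof -
  have rc: "r x \<in> carrier R" "r' x \<in> carrier R" if "x < m 0" for x using that assms by auto
  have "gcomb (\<lambda>x. r x \<oplus>\<^bsub>R\<^esub> r' x) = (\<Oplus>\<^bsub>left_mod K\<^esub>x\<in>{..<m 0}. rsmult K (g x) (r x) \<oplus>\<^bsub>left_mod K\<^esub> rsmult K (g x) (r' x))"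
    unfolding gcomb_def using g_closed rc rsmult_closed Q.smult_l_distr L.M.a_closed
    by (intro L.M.finsum_cong') auto
  also have "\<dots> = gcomb r \<oplus>\<^bsub>left_mod K\<^esub> gcomb r'"
    unfolding gcomb_def using g_closed rc rsmult_closed by (intro L.M.finsum_addf) auto
  finally show ?thesis by simp
qed

text \<open>Two coordinate vectors of the same element differ by a relation, that is, by
  \<open>a 0\<close> applied to some \<open>q\<close>; multiplied by \<open>n\<close> this becomes
  \<open>amap 0\<close> of the tuple \<open>q n\<close>. So the inverse of \<open>gsum\<close> is
  well defined modulo the image of \<open>amap 0\<close>.\<close>

lemma gcomb_scale:
  assumes r: "r \<in> {..<m 0} \<rightarrow> carrier R" "r' \<in> {..<m 0} \<rightarrow> carrier R" and n: "n \<in> carrier N"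
    and eq: "gcomb r = gcomb r'"
  shows "\<exists>f\<in>carrier (P (Suc 0)). scale r n = scale r' n \<oplus>\<^bsub>P 0\<^esub> amap 0 f"
proof -
  have rc: "r x \<in> carrier R" "r' x \<in> carrier R" if "x < m 0" for x using that r by auto
  let ?d = "\<lambda>x. r x \<ominus>\<^bsub>R\<^esub> r' x"
  have d: "?d \<in> {..<m 0} \<rightarrow> carrier R" using rc by auto
  have "gcomb (\<lambda>x. ?d x \<oplus>\<^bsub>R\<^esub> r' x) = gcomb r" unfolding gcomb_def
    using rc g_closed rsmult_closed by (intro L.M.finsum_cong') (auto simp: a_minus_def T.N.R.add.m_assoc T.N.R.l_neg)
  then have "gcomb ?d \<oplus>\<^bsub>K\<^esub> gcomb r' = gcomb r'" using gcomb_sum[OF d r(2)] eq by simp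
  then have "gcomb ?d = \<zero>\<^bsub>K\<^esub>"
    using gcomb_closed[OF d] gcomb_closed[OF r(2)] L.M.add.l_cancel_one[of "gcomb r'" "gcomb ?d"]
      L.M.add.r_cancel_one[of "gcomb r'" "gcomb ?d"] by simp
  then obtain q where q: "q \<in> {..<m 1} \<rightarrow> carrier R" "\<And>x. x < m 0 \<Longrightarrow> ?d x = (\<Oplus>\<^bsub>R\<^esub>y\<in>{..<m 1}. a 0 x y \<otimes>\<^bsub>R\<^esub> q y)"
    using relations[OF d] unfolding gcomb_def by blast
  let ?f = "\<lambda>y. if y < m 1 then q y \<odot>\<^bsub>N\<^esub> n else \<zero>\<^bsub>N\<^esub>"
  have f: "?f \<in> carrier (P (Suc 0))" using q(1) n by auto
  have "r x \<odot>\<^bsub>N\<^esub> n = r' x \<odot>\<^bsub>N\<^esub> n \<oplus>\<^bsub>N\<^esub> amap 0 ?f x" if x: "x < m 0" for x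
  proof -
    have qc: "q y \<in> carrier R" "a 0 x y \<in> carrier R" if "y < m 1" for y using q(1) that a_closed[OF x] by auto
    have "amap 0 ?f x = (\<Oplus>\<^bsub>N\<^esub>y\<in>{..<m 1}. (a 0 x y \<otimes>\<^bsub>R\<^esub> q y) \<odot>\<^bsub>N\<^esub> n)"
      using x qc n by (auto simp: amap_def T.N.smult_assoc1 intro!: T.N.M.finsum_cong')
    also have "\<dots> = ?d x \<odot>\<^bsub>N\<^esub> n" unfolding q(2)[OF x] using qc n by (intro T.N.finsum_smult[symmetric]) auto
    finally have "r' x \<odot>\<^bsub>N\<^esub> n \<oplus>\<^bsub>N\<^esub> amap 0 ?f x = (r' x \<oplus>\<^bsub>R\<^esub> ?d x) \<odot>\<^bsub>N\<^esub> n"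
      using rc[OF x] n by (simp add: T.N.smult_l_distr)
    also have "r' x \<oplus>\<^bsub>R\<^esub> ?d x = r x" using rc[OF x] by (simp add: a_minus_def T.N.R.a_lcomm T.N.R.r_neg)
    finally show ?thesis by simp
  qed
  then have "scale r n = scale r' n \<oplus>\<^bsub>P 0\<^esub> amap 0 ?f" by (auto simp: scale_def fun_eq_iff) (simp add: amap_def)
  then show ?thesis using f by blast
qed

text \<open>The tensor product \<open>K \<otimes> N\<close> is the cokernel of the map \<open>N\<^bsup>m 1\<^esup> \<rightarrow> N\<^bsup>m 0\<^esup>\<close> given by the matrix \<open>a 0\<close>:
  sending \<open>k \<otimes> n\<close> to the class of \<open>r n\<close>, where \<open>k = \<Sum> g x r x\<close>, inverts \<open>gsum\<close> modulo its image.\<close>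

lemma gsum_eq_zero:
  assumes f: "f \<in> carrier (P 0)" and z: "gsum f = \<zero>\<^bsub>X\<^esub>"
  shows "\<exists>f'\<in>carrier (P (Suc 0)). f = amap 0 f'"
proof -
  let ?A = "add_monoid (P 0)"
  have "amap 0 \<in> hom (add_monoid (P (Suc 0))) ?A"
    using amap_closed amap_add by (intro homI) (simp_all del: pow_mod_simps)
  then interpret am: group_hom "add_monoid (P (Suc 0))" ?A "amap 0"
    by (intro group_hom.intro group_hom_axioms.intro P.M.a_group)
  define B where "B = amap 0 ` carrier (P (Suc 0))"
  have B: "subgroup B ?A" using am.img_is_subgroup by (simp add: B_def)
  have Bn: "B \<lhd> ?A" by (rule P.M.add.subgroup_imp_normal[OF B])
  let ?H = "?A Mod B" and ?\<pi> = "\<lambda>v. B #>\<^bsub>?A\<^esub> v"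
  interpret H: comm_group ?H by (rule P.M.add.abelian_FactGroup[OF B])
  have \<pi>: "?\<pi> \<in> hom ?A ?H" by (rule normal.r_coset_hom_Mod[OF Bn])
  have \<pi>m: "?\<pi> (u \<oplus>\<^bsub>P 0\<^esub> v) = ?\<pi> u \<otimes>\<^bsub>?H\<^esub> ?\<pi> v" if "u \<in> carrier (P 0)" "v \<in> carrier (P 0)" for u v
    using hom_mult[OF \<pi>, of u v] that by simp
  have \<pi>c: "?\<pi> u \<in> carrier ?H" if "u \<in> carrier (P 0)" for u using ghom_closed[OF \<pi>, of u] that by simp
  have \<pi>1: "?\<pi> (amap 0 v) = \<one>\<^bsub>?H\<^esub>" if "v \<in> carrier (P (Suc 0))" for v
    using that P.M.add.coset_join2[OF _ B, of "amap 0 v"] amap_closed[OF that] by (simp add: B_def)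
  have \<pi>s: "?\<pi> (scale r n) = ?\<pi> (scale r' n)"
    if h: "r \<in> {..<m 0} \<rightarrow> carrier R" "r' \<in> {..<m 0} \<rightarrow> carrier R" "n \<in> carrier N" "gcomb r = gcomb r'" for r r' n
  proof -
    obtain v where v: "v \<in> carrier (P (Suc 0))" "scale r n = scale r' n \<oplus>\<^bsub>P 0\<^esub> amap 0 v"
      using gcomb_scale[OF h] by blast
    show ?thesis unfolding v(2) \<pi>m[OF scale_closed[OF h(2,3)] amap_closed[OF v(1)]] \<pi>1[OF v(1)]
      by (rule H.r_one[OF \<pi>c[OF scale_closed[OF h(2,3)]]])
  qed
  \<comment> \<open>An arbitrary choice of coordinates, in general not additive;
    \<open>\<pi>s\<close> makes the class of \<open>scale (\<sigma> k) n\<close> additive and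
    balanced nevertheless.\<close>
  define \<sigma> where "\<sigma> k = (SOME r. r \<in> {..<m 0} \<rightarrow> carrier R \<and> k = gcomb r)" for k
  have \<sigma>: "\<sigma> k \<in> {..<m 0} \<rightarrow> carrier R" "gcomb (\<sigma> k) = k" if "k \<in> carrier K" for k
  proof -
    have "\<exists>r. r \<in> {..<m 0} \<rightarrow> carrier R \<and> k = gcomb r" using generators[OF that] unfolding gcomb_def by blast
    then have "\<sigma> k \<in> {..<m 0} \<rightarrow> carrier R \<and> k = gcomb (\<sigma> k)" unfolding \<sigma>_def by (rule someI_ex)
    then show "\<sigma> k \<in> {..<m 0} \<rightarrow> carrier R" "gcomb (\<sigma> k) = k" by auto
  qed
  have "\<exists>\<phi>\<in>hom T.TG ?H. \<forall>k\<in>carrier (right_mod K). \<forall>n\<in>carrier N. \<phi> (pu k n) = ?\<pi> (scale (\<sigma> k) n)"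
  proof (rule T.tensor_universal[OF H.comm_group_axioms])
    fix k n assume k: "k \<in> carrier (right_mod K)" and n: "n \<in> carrier N"
    then have kK: "k \<in> carrier K" by simp
    show "?\<pi> (scale (\<sigma> k) n) \<in> carrier ?H" by (intro \<pi>c scale_closed \<sigma> kK n)
    {
      fix k' assume k': "k' \<in> carrier (right_mod K)"
      then have kK': "k' \<in> carrier K" by simp
      have kk: "k \<oplus>\<^bsub>K\<^esub> k' \<in> carrier K" using L.M.a_closed[of k k'] kK kK' by simp
      have s: "(\<lambda>x. \<sigma> k x \<oplus>\<^bsub>R\<^esub> \<sigma> k' x) \<in> {..<m 0} \<rightarrow> carrier R" using \<sigma>(1)[OF kK] \<sigma>(1)[OF kK'] by (auto simp: Pi_iff)
      have "?\<pi> (scale (\<sigma> (k \<oplus>\<^bsub>K\<^esub> k')) n) = ?\<pi> (scale (\<lambda>x. \<sigma> k x \<oplus>\<^bsub>R\<^esub> \<sigma> k' x) n)"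
        using kK kK' by (intro \<pi>s \<sigma>(1)[OF kk] s n) (simp add: \<sigma>(2)[OF kk] gcomb_sum \<sigma>)
      also have "scale (\<lambda>x. \<sigma> k x \<oplus>\<^bsub>R\<^esub> \<sigma> k' x) n = scale (\<sigma> k) n \<oplus>\<^bsub>P 0\<^esub> scale (\<sigma> k') n"
        using \<sigma>(1)[OF kK] \<sigma>(1)[OF kK'] n by (auto simp: scale_def fun_eq_iff Pi_iff T.N.smult_l_distr)
      also have "?\<pi> \<dots> = ?\<pi> (scale (\<sigma> k) n) \<otimes>\<^bsub>?H\<^esub> ?\<pi> (scale (\<sigma> k') n)"
        by (intro \<pi>m scale_closed \<sigma> kK kK' n)
      finally show "?\<pi> (scale (\<sigma> (k \<oplus>\<^bsub>right_mod K\<^esub> k')) n) = ?\<pi> (scale (\<sigma> k) n) \<otimes>\<^bsub>?H\<^esub> ?\<pi> (scale (\<sigma> k') n)"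
        by (simp only: right_mod_simps)
    }
    {
      fix n' assume n': "n' \<in> carrier N"
      have "scale (\<sigma> k) (n \<oplus>\<^bsub>N\<^esub> n') = scale (\<sigma> k) n \<oplus>\<^bsub>P 0\<^esub> scale (\<sigma> k) n'"
        using \<sigma>(1)[OF kK] n n' by (auto simp: scale_def fun_eq_iff Pi_iff T.N.smult_r_distr)
      then show "?\<pi> (scale (\<sigma> k) (n \<oplus>\<^bsub>N\<^esub> n')) = ?\<pi> (scale (\<sigma> k) n) \<otimes>\<^bsub>?H\<^esub> ?\<pi> (scale (\<sigma> k) n')"
        using \<pi>m[OF scale_closed scale_closed, OF \<sigma>(1)[OF kK] n \<sigma>(1)[OF kK] n'] by (simp only:)
    }
    {
      fix b assume b: "b \<in> carrier R"
      have kb: "rsmult K k b \<in> carrier K" by (rule rsmult_closed[OF kK b])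
      have s: "(\<lambda>x. \<sigma> k x \<otimes>\<^bsub>R\<^esub> b) \<in> {..<m 0} \<rightarrow> carrier R" using \<sigma>(1)[OF kK] b by (auto simp: Pi_iff)
      have "gcomb (\<lambda>x. \<sigma> k x \<otimes>\<^bsub>R\<^esub> b) = (\<Oplus>\<^bsub>left_mod K\<^esub>x\<in>{..<m 0}. rsmult K (rsmult K (g x) (\<sigma> k x)) b)"
        unfolding gcomb_def using \<sigma>(1)[OF kK] b g_closed rsmult_closed Q.smult_assoc1[of b]
        by (intro L.M.finsum_cong') (auto simp: Pi_iff)
      also have "\<dots> = rsmult K (gcomb (\<sigma> k)) b"
        unfolding gcomb_def using \<sigma>(1)[OF kK] g_closed rsmult_closed
        by (intro lmod_hom_finsum[OF left left rsmult_hom[OF b], symmetric]) (auto simp: Pi_iff)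
      finally have "?\<pi> (scale (\<sigma> (rsmult K k b)) n) = ?\<pi> (scale (\<lambda>x. \<sigma> k x \<otimes>\<^bsub>R\<^esub> b) n)"
        by (intro \<pi>s \<sigma>(1)[OF kb] s n) (simp add: \<sigma>(2)[OF kb] \<sigma>(2)[OF kK])
      also have "scale (\<lambda>x. \<sigma> k x \<otimes>\<^bsub>R\<^esub> b) n = scale (\<sigma> k) (b \<odot>\<^bsub>N\<^esub> n)"
        using \<sigma>(1)[OF kK] b n by (auto simp: scale_def fun_eq_iff Pi_iff T.N.smult_assoc1)
      finally show "?\<pi> (scale (\<sigma> (b \<odot>\<^bsub>right_mod K\<^esub> k)) n) = ?\<pi> (scale (\<sigma> k) (b \<odot>\<^bsub>N\<^esub> n))"
        by (simp only: right_mod_simps)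
    }
  qed
  then obtain \<phi> where \<phi>: "\<phi> \<in> hom T.TG ?H" "\<And>k n. k \<in> carrier K \<Longrightarrow> n \<in> carrier N \<Longrightarrow> \<phi> (pu k n) = ?\<pi> (scale (\<sigma> k) n)"
    by auto
  interpret \<phi>: group_hom T.TG ?H \<phi> by (intro group_hom.intro group_hom_axioms.intro T.TG.group_axioms H.group_axioms \<phi>)
  interpret p: group_hom ?A ?H ?\<pi> by (intro group_hom.intro group_hom_axioms.intro P.M.a_group H.group_axioms \<pi>)
  \<comment> \<open>\<open>\<phi>\<close> undoes \<open>gsum\<close> modulo \<open>B\<close>, as one
    sees on tuples with one entry. Thus \<open>gsum f = 0\<close> puts \<open>f\<close> into
    \<open>B\<close>.\<close>
  have "\<phi> (gsum f) = ?\<pi> f"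
    using N f
  proof (induction rule: pow_mod_induct)
    case zero
    have "?\<pi> (\<lambda>_. \<zero>\<^bsub>N\<^esub>) = \<one>\<^bsub>?H\<^esub>" using \<pi>1[of "\<lambda>_. \<zero>\<^bsub>N\<^esub>"] unfolding amap_zero by simp
    then show ?case using \<phi>.hom_one by (simp only: gsum_zero tensor_module_simps)
  next
    case (single x n)
    let ?u = "\<lambda>x'. if x' = x then \<one>\<^bsub>R\<^esub> else \<zero>\<^bsub>R\<^esub>"
    have u: "?u \<in> {..<m 0} \<rightarrow> carrier R" by auto
    have gx: "g x \<in> carrier K" by (rule g_closed[OF single(1)])
    have "gcomb ?u = (\<Oplus>\<^bsub>left_mod K\<^esub>x'\<in>{..<m 0}. if x = x' then g x else \<zero>\<^bsub>left_mod K\<^esub>)"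
      unfolding gcomb_def using Q.smult_one Q.smult_zero_left L.M.zero_closed g_closed
      by (intro L.M.finsum_cong') auto
    also have "\<dots> = g x" using L.M.finsum_singleton[of x "{..<m 0}" "\<lambda>_. g x"] single g_closed by simp
    finally have "?\<pi> (scale (\<sigma> (g x)) n) = ?\<pi> (scale ?u n)"
      by (intro \<pi>s \<sigma>(1)[OF gx] u single(2)) (simp add: \<sigma>(2)[OF gx])
    also have "scale ?u n = single N x n" using single by (auto simp: scale_def single_def fun_eq_iff T.N.smult_zero_left)
    finally show ?case unfolding gsum_single[OF single] \<phi>(2)[OF gx single(2)] .
  next
    case (add u v)
    have "\<phi> (gsum (u \<oplus>\<^bsub>P 0\<^esub> v)) = \<phi> (gsum u) \<otimes>\<^bsub>?H\<^esub> \<phi> (gsum v)"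
      using gsum_add[OF add(1,2)] gsum_closed[OF add(1)] gsum_closed[OF add(2)] by simp
    then show ?case unfolding add(3,4) \<pi>m[OF add(1,2)] .
  qed
  then have "B = ?\<pi> f" using z \<phi>.hom_one by (simp only: tensor_module_simps one_FactGroup)
  then have "f \<in> B" using P.M.add.rcos_self[OF _ B] f by (metis partial_object.select_convs(1))
  then show ?thesis unfolding B_def by blast
qed

lemma gsum_surj:
  assumes "t \<in> carrier X" shows "\<exists>f\<in>carrier (P 0). t = gsum f"
  using assms
proof (induction rule: X_induct)
  case (pure k n)
  obtain r where r: "r \<in> {..<m 0} \<rightarrow> carrier R" "k = (\<Oplus>\<^bsub>left_mod K\<^esub>x\<in>{..<m 0}. rsmult K (g x) (r x))"
    using generators[OF pure(1)] by blast
  have rc: "r x \<in> carrier R" if "x < m 0" for x using that r by auto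
  have "pu k n = (\<Oplus>\<^bsub>X\<^esub>x\<in>{..<m 0}. pu (rsmult K (g x) (r x)) n)"
    unfolding r(2) using rc g_closed pure(2) rsmult_closed pure_closed
    by (intro additive_finsum[OF left lmodule_tensor_module, of _ _ "\<lambda>k. pu k n"])
      (auto simp: pure_add_left simp del: tensor_module_simps)
  also have "\<dots> = gsum (scale r n)" unfolding gsum_def scale_def
    using rc g_closed pure(2) pure_closed by (intro KN.M.finsum_cong') (auto simp: pure_balanced)
  finally show ?case using scale_closed[OF r(1) pure(2)] by blast
next
  case (diff t t')
  then show ?case using gsum_minus P.M.minus_closed by metis
qed

end

section \<open>Modules of the form \<open>Hom(K, I)\<close>\<close>

text \<open>An isomorphism of \<open>M\<close> with \<open>Hom(K, I)\<close>, written as a pairing of \<open>M\<close> and \<open>K\<close> with values in \<open>I\<close>.\<close>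

locale hom_pairing =
  fixes S :: "'s ring" and R :: "'r ring" and K :: "('s, 'r, 'k) bimod"
    and M :: "('r, 'm) module" and I :: "('s, 'i) module" and h :: "'m \<Rightarrow> 'k \<Rightarrow> 'i"
  assumes M: "lmodule R M" and I: "lmodule S I"
    and h_hom: "x \<in> carrier M \<Longrightarrow> h x \<in> lmod_hom S (left_mod K) I"
    and h_add: "x \<in> carrier M \<Longrightarrow> y \<in> carrier M \<Longrightarrow> k \<in> carrier K \<Longrightarrow> h (x \<oplus>\<^bsub>M\<^esub> y) k = h x k \<oplus>\<^bsub>I\<^esub> h y k"
    and h_smult: "r \<in> carrier R \<Longrightarrow> x \<in> carrier M \<Longrightarrow> k \<in> carrier K \<Longrightarrow> h (r \<odot>\<^bsub>M\<^esub> x) k = h x (rsmult K k r)"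
    and h_inj: "x \<in> carrier M \<Longrightarrow> (\<And>k. k \<in> carrier K \<Longrightarrow> h x k = \<zero>\<^bsub>I\<^esub>) \<Longrightarrow> x = \<zero>\<^bsub>M\<^esub>"
    and h_surj: "\<phi> \<in> lmod_hom S (left_mod K) I \<Longrightarrow> \<exists>x\<in>carrier M. \<forall>k\<in>carrier K. h x k = \<phi> k"
begin

sublocale M: lmodule R M by (rule M)
sublocale I: lmodule S I by (rule I)

lemma h_closed: "x \<in> carrier M \<Longrightarrow> k \<in> carrier K \<Longrightarrow> h x k \<in> carrier I"
  using lmod_hom_closed[OF h_hom, of x k] by simp

lemma h_minus: "x \<in> carrier M \<Longrightarrow> y \<in> carrier M \<Longrightarrow> k \<in> carrier K \<Longrightarrow> h (x \<ominus>\<^bsub>M\<^esub> y) k = h x k \<ominus>\<^bsub>I\<^esub> h y k"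
  by (metis M.M.minus_closed M.minus_add_cancel h_add h_closed I.add_minus_cancel' I.M.a_comm)

lemma h_eq: "x \<in> carrier M \<Longrightarrow> y \<in> carrier M \<Longrightarrow> (\<And>k. k \<in> carrier K \<Longrightarrow> h x k = h y k) \<Longrightarrow> x = y"
  using h_inj[of "x \<ominus>\<^bsub>M\<^esub> y"] by (simp add: h_minus h_closed I.minus_self M.minus_eq_zero_iff)

lemma h_sum:
  assumes "finite A" "\<And>y. y \<in> A \<Longrightarrow> c y \<in> carrier R" "\<And>y. y \<in> A \<Longrightarrow> x y \<in> carrier M" "k \<in> carrier K"
    and K: "\<And>y. y \<in> A \<Longrightarrow> rsmult K k (c y) \<in> carrier K"
  shows "h (\<Oplus>\<^bsub>M\<^esub>y\<in>A. c y \<odot>\<^bsub>M\<^esub> x y) k = (\<Oplus>\<^bsub>I\<^esub>y\<in>A. h (x y) (rsmult K k (c y)))"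
proof -
  have "h (\<Oplus>\<^bsub>M\<^esub>y\<in>A. c y \<odot>\<^bsub>M\<^esub> x y) k = (\<Oplus>\<^bsub>I\<^esub>y\<in>A. h (c y \<odot>\<^bsub>M\<^esub> x y) k)"
    using assms by (intro additive_finsum[OF M I, of _ _ "\<lambda>x. h x k"]) (auto simp: h_add h_closed)
  also have "\<dots> = (\<Oplus>\<^bsub>I\<^esub>y\<in>A. h (x y) (rsmult K k (c y)))"
    using assms by (intro I.M.finsum_cong') (auto simp: h_smult h_closed)
  finally show ?thesis .
qed

end

lemma hom_pairing_exists:
  assumes K: "bimodule S R K" and R: "ring R" and I: "lmodule S I" and M: "lmodule R M"
    and iso: "lmod_iso R (Hom_module S K I) M"
  shows "\<exists>h. hom_pairing S R K M I h"
proof -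
  let ?H = "Hom_module S K I"
  have H: "lmodule R ?H" by (rule lmodule_Hom_module[OF K R I])
  interpret H: lmodule R ?H by (rule H)
  interpret M: lmodule R M by (rule M)
  interpret I: lmodule S I by (rule I)
  have L: "lmodule S (left_mod K)" using K by (simp add: bimodule_def)
  obtain e where e: "e \<in> lmod_hom R ?H M" "bij_betw e (carrier ?H) (carrier M)"
    using iso unfolding lmod_iso_def by blast
  let ?h = "inv_into (carrier ?H) e"
  have h: "?h \<in> lmod_hom R M ?H" by (rule lmod_hom_inv_into[OF H e])
  have hb: "bij_betw ?h (carrier M) (carrier ?H)" by (rule bij_betw_inv_into[OF e(2)])
  have hc: "?h x \<in> carrier ?H" if "x \<in> carrier M" for x by (rule lmod_hom_closed[OF h that])
  show ?thesis
  proof (intro exI[of _ ?h] hom_pairing.intro M I)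
    fix x assume x: "x \<in> carrier M"
    show "?h x \<in> lmod_hom S (left_mod K) I" using hc[OF x] by simp
    show "?h (x \<oplus>\<^bsub>M\<^esub> y) k = ?h x k \<oplus>\<^bsub>I\<^esub> ?h y k" if "y \<in> carrier M" "k \<in> carrier K" for y k
      using lmod_hom_add[OF h x that(1)] that by simp
    show "?h (r \<odot>\<^bsub>M\<^esub> x) k = ?h x (rsmult K k r)" if "r \<in> carrier R" "k \<in> carrier K" for r k
      using lmod_hom_smult[OF h that(1) x] that by simp
    assume z: "\<And>k. k \<in> carrier K \<Longrightarrow> ?h x k = \<zero>\<^bsub>I\<^esub>"
    have "?h x = \<zero>\<^bsub>?H\<^esub>" using hc[OF x] z by (auto simp: fun_eq_iff extensional_def)
    then show "x = \<zero>\<^bsub>M\<^esub>" using hb x lmod_hom_inj_iff[OF M H h] by (simp add: bij_betw_def)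
  next
    fix \<phi> assume \<phi>: "\<phi> \<in> lmod_hom S (left_mod K) I"
    then have "restrict \<phi> (carrier K) \<in> carrier ?H" using restrict_lmod_hom[OF L \<phi>] by simp
    then have "restrict \<phi> (carrier K) \<in> ?h ` carrier M" using hb by (simp add: bij_betw_def)
    then obtain x where x: "x \<in> carrier M" "restrict \<phi> (carrier K) = ?h x" by blast
    have "?h x k = \<phi> k" if "k \<in> carrier K" for k using fun_cong[OF x(2), of k] that by simp
    then show "\<exists>x\<in>carrier M. \<forall>k\<in>carrier K. ?h x k = \<phi> k" using x(1) by blast
  qed
qed

text \<open>\<open>h\<close> identifies \<open>M\<close> with \<open>Hom(K, I)\<close>;
  \<open>Kfp\<close> and \<open>Kvan\<close> are what being a \<open>d\<close>-th syzygy of a super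
  finitely presented module contributes.\<close>

locale injective_pairing = matrix_resolution S R K m g a + hom_pairing S R K M I h
  for S :: "'s ring" and R :: "'r ring" and K :: "('s, 'r, 'k) bimod" and m g a
    and M :: "('r, 'm) module" and I :: "('s, 'i) module" and h +
  fixes n :: enat and d :: nat
  assumes inj: "nd_injective S n d I" and Kfp: "super_fp S (left_mod K)"
    and Kvan: "k < d \<Longrightarrow> ext_van S I k (left_mod K)"
begin

sublocale matrix_resolution_tensor S R K m g a M
  using M bimodule by unfold_locales

text \<open>Through the pairing, tuples over \<open>M\<close> are the homomorphisms from a power of
  \<open>K\<close> to \<open>I\<close>.\<close>

lemma tuple_from_homs:
  assumes "\<And>y. y < l \<Longrightarrow> b y \<in> lmod_hom S (left_mod K) I"
  shows "\<exists>f\<in>carrier (pow_mod M l). \<forall>y<l. \<forall>k\<in>carrier K. h (f y) k = b y k"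
proof -
  have "\<forall>y. \<exists>x. y < l \<longrightarrow> x \<in> carrier M \<and> (\<forall>k\<in>carrier K. h x k = b y k)"
    using h_surj[OF assms] by blast
  then obtain x where x: "\<And>y. y < l \<Longrightarrow> x y \<in> carrier M \<and> (\<forall>k\<in>carrier K. h (x y) k = b y k)" by metis
  then show ?thesis by (intro bexI[of _ "\<lambda>y. if y < l then x y else \<zero>\<^bsub>M\<^esub>"]) auto
qed

lemma h_amap:
  assumes f: "f \<in> carrier (P (Suc j))" and x: "x < m j" and k: "k \<in> carrier K"
  shows "h (amap j f x) k = (\<Oplus>\<^bsub>I\<^esub>y\<in>{..<m (Suc j)}. h (f y) (rsmult K k (a j x y)))"
  unfolding amap_def using assms a_closed[OF x] rsmult_closed
  by (auto intro!: h_sum)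

text \<open>This is \<open>Tor_(j+1)(K, M) = 0\<close>. By \<open>h_amap\<close>,
  \<open>amap\<close> corresponds under the pairing to composition with \<open>dmap\<close>, so
  exactness is that of the dual complex under \<open>Hom(-, I)\<close>.\<close>

lemma amap_eq_zero:
  assumes f: "f \<in> carrier (P (Suc j))" and z: "amap j f = (\<lambda>_. \<zero>\<^bsub>M\<^esub>)"
  shows "\<exists>f'\<in>carrier (P (Suc (Suc j))). f = amap (Suc j) f'"
proof -
  have hf: "h (f y) \<in> lmod_hom S (left_mod K) I" if "y < m (Suc j)" for y using f that by (intro h_hom) simp
  have "(\<Oplus>\<^bsub>I\<^esub>y\<in>{..<m (Suc j)}. h (f y) (rsmult K k (a j x y))) = \<zero>\<^bsub>I\<^esub>" if x: "x < m j" and k: "k \<in> carrier K" for x k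
    using h_amap[OF f x k] z h_add[of "\<zero>\<^bsub>M\<^esub>" "\<zero>\<^bsub>M\<^esub>" k] h_closed[of "\<zero>\<^bsub>M\<^esub>" k] k
    by (metis I.M.add.r_cancel_one' M.M.l_zero M.M.zero_closed)
  from hom_relations_Suc[where h = "\<lambda>y. h (f y)", OF inj Kfp Kvan hf this] obtain b where
    b: "\<And>z. z < m (Suc (Suc j)) \<Longrightarrow> b z \<in> lmod_hom S (left_mod K) I"
    "\<And>y k. y < m (Suc j) \<Longrightarrow> k \<in> carrier K \<Longrightarrow> h (f y) k = (\<Oplus>\<^bsub>I\<^esub>z\<in>{..<m (Suc (Suc j))}. b z (rsmult K k (a (Suc j) y z)))"
    by blast
  obtain f' where f': "f' \<in> carrier (P (Suc (Suc j)))" "\<And>z k. z < m (Suc (Suc j)) \<Longrightarrow> k \<in> carrier K \<Longrightarrow> h (f' z) k = b z k"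
    using tuple_from_homs[of "m (Suc (Suc j))" b] b(1) by blast
  have "f y = amap (Suc j) f' y" for y
  proof (cases "y < m (Suc j)")
    case True
    show ?thesis
    proof (rule h_eq)
      show "f y \<in> carrier M" "amap (Suc j) f' y \<in> carrier M" using f amap_closed[OF f'(1)] True by auto
      fix k assume k: "k \<in> carrier K"
      show "h (f y) k = h (amap (Suc j) f' y) k"
        unfolding h_amap[OF f'(1) True k] b(2)[OF True k]
        using f'(2) b(1) rsmult_closed[OF k] a_closed[OF True] lmod_hom_closed[of "b _" S "left_mod K" I]
        by (intro I.M.finsum_cong') auto
    qed
  qed (use f in \<open>simp add: amap_def\<close>)
  then show ?thesis using f'(1) by blast
qed

text \<open>Injectivity comes from \<open>hom_relations\<close>: an element with value zero is
  \<open>gsum\<close> of a tuple in the image of \<open>amap 0\<close>. Surjectivity comes from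
  \<open>hom_generators\<close>.\<close>

lemma evaluation:
  "\<exists>e\<in>lmod_hom S X I. (\<forall>k\<in>carrier K. \<forall>x\<in>carrier M. e (pu k x) = h x k) \<and> bij_betw e (carrier X) (carrier I)"
proof -
  have "\<exists>e\<in>lmod_hom S X I. \<forall>k\<in>carrier K. \<forall>x\<in>carrier M. e (pu k x) = h x k"
    by (rule X_hom[OF I])
      (simp_all add: h_closed h_add h_smult lmod_hom_add[OF h_hom, of _ _ _, simplified] lmod_hom_smult[OF h_hom, of _ _ _, simplified])
  then obtain e where e: "e \<in> lmod_hom S X I" "\<And>k x. k \<in> carrier K \<Longrightarrow> x \<in> carrier M \<Longrightarrow> e (pu k x) = h x k" by blast
  have eg: "e (gsum f) = (\<Oplus>\<^bsub>I\<^esub>x\<in>{..<m 0}. h (f x) (g x))" if f: "f \<in> carrier (P 0)" for f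
  proof -
    have "e (gsum f) = (\<Oplus>\<^bsub>I\<^esub>x\<in>{..<m 0}. e (pu (g x) (f x)))"
      unfolding gsum_def using pure_g_closed[OF f] by (intro lmod_hom_finsum[OF lmodule_tensor_module I e(1)]) auto
    then show ?thesis using e(2) g_closed f h_closed by (simp cong: I.M.finsum_cong add: Pi_def)
  qed
  have "bij_betw e (carrier X) (carrier I)"
  proof (rule bij_betw_lmod_iso[OF lmodule_tensor_module I e(1)])
    fix t assume t: "t \<in> carrier X" "e t = \<zero>\<^bsub>I\<^esub>"
    obtain f where f: "f \<in> carrier (P 0)" "t = gsum f" using gsum_surj[OF t(1)] by blast
    have z: "(\<Oplus>\<^bsub>I\<^esub>x\<in>{..<m 0}. h (f x) (g x)) = \<zero>\<^bsub>I\<^esub>" using eg[OF f(1)] t(2) f(2) by simp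
    have hf: "h (f y) \<in> lmod_hom S (left_mod K) I" if "y < m 0" for y using f(1) that by (intro h_hom) simp
    from hom_relations[where h = "\<lambda>x. h (f x)", OF inj Kfp Kvan hf z] obtain b where
      b: "\<And>y. y < m (Suc 0) \<Longrightarrow> b y \<in> lmod_hom S (left_mod K) I"
      "\<And>x k. x < m 0 \<Longrightarrow> k \<in> carrier K \<Longrightarrow> h (f x) k = (\<Oplus>\<^bsub>I\<^esub>y\<in>{..<m (Suc 0)}. b y (rsmult K k (a 0 x y)))"
      by auto
    obtain f' where f': "f' \<in> carrier (P (Suc 0))" "\<And>y k. y < m (Suc 0) \<Longrightarrow> k \<in> carrier K \<Longrightarrow> h (f' y) k = b y k"
      using tuple_from_homs[of "m (Suc 0)" b] b(1) by blast
    have "f x = amap 0 f' x" for x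
    proof (cases "x < m 0")
      case True
      show ?thesis
      proof (rule h_eq)
        show "f x \<in> carrier M" "amap 0 f' x \<in> carrier M" using f amap_closed[OF f'(1)] True by auto
        fix k assume k: "k \<in> carrier K"
        show "h (f x) k = h (amap 0 f' x) k"
          unfolding h_amap[OF f'(1) True k] b(2)[OF True k]
          using f'(2) b(1) rsmult_closed[OF k] a_closed[OF True] lmod_hom_closed[of "b _" S "left_mod K" I]
          by (intro I.M.finsum_cong') auto
      qed
    qed (use f in \<open>simp add: amap_def\<close>)
    then have "f = amap 0 f'" by blast
    then show "t = \<zero>\<^bsub>X\<^esub>" using f(2) gsum_amap[OF f'(1)] by simp
  next
    fix y assume "y \<in> carrier I"
    from hom_generators[OF inj Kfp Kvan this] obtain b where b: "\<And>x. x < m 0 \<Longrightarrow> b x \<in> lmod_hom S (left_mod K) I"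
      "y = (\<Oplus>\<^bsub>I\<^esub>x\<in>{..<m 0}. b x (g x))" by blast
    obtain f where f: "f \<in> carrier (P 0)" "\<And>x k. x < m 0 \<Longrightarrow> k \<in> carrier K \<Longrightarrow> h (f x) k = b x k"
      using tuple_from_homs[of "m 0" b] b(1) by blast
    have "y = e (gsum f)" unfolding eg[OF f(1)] b(2) using f h_closed g_closed lmod_hom_closed[OF b(1)]
      by (intro I.M.finsum_cong') auto
    then show "\<exists>t\<in>carrier X. y = e t" using gsum_closed[OF f(1)] by blast
  qed
  then show ?thesis using e by blast
qed

end

section \<open>Exactness of the tensored short exact sequence\<close>

lemma amap_natural:
  assumes M: "matrix_resolution_tensor S R K m g a M" and N: "matrix_resolution_tensor S R K m g a N"
    and f: "f \<in> lmod_hom R M N" and u: "u \<in> carrier (pow_mod M (m (Suc j)))"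
  shows "matrix_resolution_tensor.amap m a N j (\<lambda>y. f (u y)) = (\<lambda>x. f (matrix_resolution_tensor.amap m a M j u x))"
proof -
  interpret M: matrix_resolution_tensor S R K m g a M by (rule M)
  interpret N: matrix_resolution_tensor S R K m g a N by (rule N)
  have "(\<Oplus>\<^bsub>N\<^esub>y\<in>{..<m (Suc j)}. a j x y \<odot>\<^bsub>N\<^esub> f (u y)) = f (\<Oplus>\<^bsub>M\<^esub>y\<in>{..<m (Suc j)}. a j x y \<odot>\<^bsub>M\<^esub> u y)" if x: "x < m j" for x
  proof -
    have "(\<Oplus>\<^bsub>N\<^esub>y\<in>{..<m (Suc j)}. a j x y \<odot>\<^bsub>N\<^esub> f (u y)) = (\<Oplus>\<^bsub>N\<^esub>y\<in>{..<m (Suc j)}. f (a j x y \<odot>\<^bsub>M\<^esub> u y))"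
      using u M.a_closed[OF x] lmod_hom_closed[OF f] by (intro N.T.N.M.finsum_cong') (auto simp: lmod_hom_smult[OF f])
    also have "\<dots> = f (\<Oplus>\<^bsub>M\<^esub>y\<in>{..<m (Suc j)}. a j x y \<odot>\<^bsub>M\<^esub> u y)"
      using u M.a_closed[OF x] by (intro lmod_hom_finsum[OF M.N N.N f, symmetric]) auto
    finally show ?thesis .
  qed
  then show ?thesis using lmod_hom_zero[OF M.N N.N f] by (auto simp: M.amap_def N.amap_def)
qed

lemma gsum_natural:
  assumes M: "matrix_resolution_tensor S R K m g a M" and N: "matrix_resolution_tensor S R K m g a N"
    and f: "f \<in> lmod_hom R M N" and \<phi>: "\<phi> \<in> lmod_hom S (tensor_module R K M) (tensor_module R K N)"
    and \<phi>p: "\<And>k x. k \<in> carrier K \<Longrightarrow> x \<in> carrier M \<Longrightarrow> \<phi> (pure R K M k x) = pure R K N k (f x)"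
    and u: "u \<in> carrier (pow_mod M (m 0))"
  shows "\<phi> (matrix_resolution_tensor.gsum R K m g M u) = matrix_resolution_tensor.gsum R K m g N (\<lambda>x. f (u x))"
proof -
  interpret M: matrix_resolution_tensor S R K m g a M by (rule M)
  interpret N: matrix_resolution_tensor S R K m g a N by (rule N)
  have "\<phi> (M.gsum u) = (\<Oplus>\<^bsub>N.X\<^esub>x\<in>{..<m 0}. \<phi> (M.pu (g x) (u x)))"
    unfolding M.gsum_def using M.pure_g_closed[OF u]
    by (intro lmod_hom_finsum[OF M.lmodule_tensor_module N.lmodule_tensor_module \<phi>]) auto
  also have "\<dots> = N.gsum (\<lambda>x. f (u x))"
    unfolding N.gsum_def using u M.g_closed lmod_hom_closed[OF f] N.pure_closed
    by (intro N.KN.M.finsum_cong') (auto simp: \<phi>p)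
  finally show ?thesis .
qed

text \<open>Right exactness of the tensor product, and exactness on the left because \<open>Tor\<^sub>1(K, L) = 0\<close> for
  \<open>L\<close> of the form \<open>Hom(K, J)\<close>.\<close>

lemma tensor_exact:
  assumes mr: "matrix_resolution S R K m g a" and ex: "short_exact R M N L f p"
    and Lp: "injective_pairing S R K m g a L J h n d"
    and \<phi>: "\<phi> \<in> lmod_hom S (tensor_module R K M) (tensor_module R K N)"
      "\<And>k x. k \<in> carrier K \<Longrightarrow> x \<in> carrier M \<Longrightarrow> \<phi> (pure R K M k x) = pure R K N k (f x)"
    and \<psi>: "\<psi> \<in> lmod_hom S (tensor_module R K N) (tensor_module R K L)"
      "\<And>k x. k \<in> carrier K \<Longrightarrow> x \<in> carrier N \<Longrightarrow> \<psi> (pure R K N k x) = pure R K L k (p x)"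
  shows "short_exact S (tensor_module R K M) (tensor_module R K N) (tensor_module R K L) \<phi> \<psi>"
proof -
  note x = short_exactD[OF ex]
  have bi: "bimodule S R K" using mr by (simp add: matrix_resolution_def)
  have Mt: "matrix_resolution_tensor S R K m g a M" and Nt: "matrix_resolution_tensor S R K m g a N"
    and Lt: "matrix_resolution_tensor S R K m g a L"
    using mr bi x(1-3) by (simp_all add: matrix_resolution_tensor_def bimod_tensor_def)
  interpret M: matrix_resolution_tensor S R K m g a M by (rule Mt)
  interpret N: matrix_resolution_tensor S R K m g a N by (rule Nt)
  interpret L: injective_pairing S R K m g a L J h n d by (rule Lp)
  note fz = lmod_hom_zero[OF x(1,2,4)] and pz = lmod_hom_zero[OF x(2,3,5)]
  have liftL: "\<exists>w\<in>carrier (pow_mod N i). (\<lambda>y. p (w y)) = v" if v: "v \<in> carrier (pow_mod L i)" for v i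
  proof -
    have "\<forall>y. \<exists>b. y < i \<longrightarrow> b \<in> carrier N \<and> v y = p b"
    proof
      fix y show "\<exists>b. y < i \<longrightarrow> b \<in> carrier N \<and> v y = p b" using x(9)[of "v y"] v by auto
    qed
    then obtain b where "\<And>y. y < i \<Longrightarrow> b y \<in> carrier N \<and> v y = p (b y)" by metis
    then show ?thesis using v pz by (intro bexI[of _ "\<lambda>y. if y < i then b y else \<zero>\<^bsub>N\<^esub>"]) auto
  qed
  have liftM: "\<exists>u\<in>carrier (pow_mod M i). (\<lambda>y. f (u y)) = w"
    if w: "w \<in> carrier (pow_mod N i)" and z: "\<And>y. y < i \<Longrightarrow> p (w y) = \<zero>\<^bsub>L\<^esub>" for w i
  proof -
    have "\<forall>y. \<exists>b. y < i \<longrightarrow> b \<in> carrier M \<and> w y = f b"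
    proof
      fix y show "\<exists>b. y < i \<longrightarrow> b \<in> carrier M \<and> w y = f b" using x(8)[of "w y"] w z[of y] by auto
    qed
    then obtain b where "\<And>y. y < i \<Longrightarrow> b y \<in> carrier M \<and> w y = f (b y)" by metis
    then show ?thesis using w fz by (intro bexI[of _ "\<lambda>y. if y < i then b y else \<zero>\<^bsub>M\<^esub>"]) auto
  qed
  have fcl: "(\<lambda>y. f (u y)) \<in> carrier (pow_mod N i)" if "u \<in> carrier (pow_mod M i)" for u i
    using that lmod_hom_closed[OF x(4)] fz by auto
  have pcl: "(\<lambda>y. p (u y)) \<in> carrier (pow_mod L i)" if "u \<in> carrier (pow_mod N i)" for u i
    using that lmod_hom_closed[OF x(5)] pz by auto
  have finj: "b = b'" if "f b = f b'" "b \<in> carrier M" "b' \<in> carrier M" for b b' using x(6) that by (auto dest: inj_onD)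
  have pminus: "(\<lambda>y. p ((w \<ominus>\<^bsub>pow_mod N i\<^esub> w') y)) = (\<lambda>_. \<zero>\<^bsub>L\<^esub>)"
    if "w \<in> carrier (pow_mod N i)" "w' \<in> carrier (pow_mod N i)" "(\<lambda>y. p (w y)) = (\<lambda>y. p (w' y))" for w w' i
  proof
    fix y
    have wc: "w \<ominus>\<^bsub>pow_mod N i\<^esub> w' \<in> carrier (pow_mod N i)" using that by (intro N.P.M.minus_closed)
    have c: "w y \<in> carrier N" "w' y \<in> carrier N" "(w \<ominus>\<^bsub>pow_mod N i\<^esub> w') y \<in> carrier N"
      by (rule pow_mod_nth[OF x(2)], rule that wc)+
    have "w = (w \<ominus>\<^bsub>pow_mod N i\<^esub> w') \<oplus>\<^bsub>pow_mod N i\<^esub> w'" using that by (intro N.P.minus_add_cancel[symmetric])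
    from fun_cong[OF this, of y] have "w y = (w \<ominus>\<^bsub>pow_mod N i\<^esub> w') y \<oplus>\<^bsub>N\<^esub> w' y" by simp
    then have "p (w y) = p ((w \<ominus>\<^bsub>pow_mod N i\<^esub> w') y) \<oplus>\<^bsub>L\<^esub> p (w' y)" using c by (metis lmod_hom_add[OF x(5)])
    moreover have "p (w y) = p (w' y)" using fun_cong[OF that(3), of y] .
    ultimately show "p ((w \<ominus>\<^bsub>pow_mod N i\<^esub> w') y) = \<zero>\<^bsub>L\<^esub>"
      using lmod_hom_closed[OF x(5) c(2)] lmod_hom_closed[OF x(5) c(3)]
        L.M.M.add.l_cancel_one[of "p (w' y)" "p ((w \<ominus>\<^bsub>pow_mod N i\<^esub> w') y)"]
        L.M.M.add.r_cancel_one[of "p (w' y)" "p ((w \<ominus>\<^bsub>pow_mod N i\<^esub> w') y)"] by simp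
  qed
  show ?thesis
  proof (rule short_exactI[OF M.lmodule_tensor_module N.lmodule_tensor_module L.lmodule_tensor_module \<phi>(1) \<psi>(1)])
    fix t assume t: "t \<in> carrier M.X" "\<phi> t = \<zero>\<^bsub>N.X\<^esub>"
    obtain u where u: "u \<in> carrier (M.P 0)" "t = M.gsum u" using M.gsum_surj[OF t(1)] by blast
    have "N.gsum (\<lambda>x. f (u x)) = \<zero>\<^bsub>N.X\<^esub>" using gsum_natural[OF Mt Nt x(4) \<phi> u(1)] t(2) u(2) by simp
    then obtain w where w: "w \<in> carrier (N.P (Suc 0))" "(\<lambda>x. f (u x)) = N.amap 0 w"
      using N.gsum_eq_zero[OF fcl[OF u(1)]] by blast
    have "L.amap 0 (\<lambda>y. p (w y)) = (\<lambda>x. p (f (u x)))" using amap_natural[OF Nt Lt x(5) w(1)] fun_cong[OF w(2)] by simp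
    also have "\<dots> = (\<lambda>_. \<zero>\<^bsub>L\<^esub>)" using x(7) pow_mod_nth[OF x(1) u(1)] by simp
    \<comment> \<open>Here \<open>Tor_1(K, L) = 0\<close> enters: the image of \<open>w\<close> in
      \<open>L\<close> is a cycle, hence a boundary.\<close>
    finally obtain v where v: "v \<in> carrier (L.P (Suc (Suc 0)))" "(\<lambda>y. p (w y)) = L.amap (Suc 0) v"
      using L.amap_eq_zero[OF pcl[OF w(1)]] by blast
    obtain v' where v': "v' \<in> carrier (N.P (Suc (Suc 0)))" "(\<lambda>y. p (v' y)) = v" using liftL[OF v(1)] by blast
    have ac: "N.amap (Suc 0) v' \<in> carrier (N.P (Suc 0))" by (rule N.amap_closed[OF v'(1)])
    have pe: "(\<lambda>y. p (w y)) = (\<lambda>y. p (N.amap (Suc 0) v' y))"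
      using amap_natural[OF Nt Lt x(5) v'(1)] v(2) v'(2) by simp
    \<comment> \<open>Subtracting the lifted boundary does not change \<open>N.amap 0 w\<close>, but
      makes the image in \<open>L\<close> zero, so that the tuple comes from
      \<open>M\<close>.\<close>
    let ?w = "w \<ominus>\<^bsub>N.P (Suc 0)\<^esub> N.amap (Suc 0) v'"
    have wc: "?w \<in> carrier (N.P (Suc 0))" using w(1) ac by (rule N.P.M.minus_closed)
    obtain q where q: "q \<in> carrier (M.P (Suc 0))" "(\<lambda>y. f (q y)) = ?w"
      using liftM[OF wc] fun_cong[OF pminus[OF w(1) ac pe]] by blast
    have "N.amap 0 ?w = N.amap 0 w \<ominus>\<^bsub>N.P 0\<^esub> \<zero>\<^bsub>N.P 0\<^esub>"
      using N.amap_minus[OF w(1) ac] N.amap_amap[OF v'(1)] by simp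
    also have "\<dots> = N.amap 0 w"
      using N.P.add_minus_cancel'[OF N.amap_closed[OF w(1)] N.P.M.zero_closed]
      unfolding N.P.M.l_zero[OF N.amap_closed[OF w(1)]] .
    finally have "(\<lambda>x. f (u x)) = (\<lambda>x. f (M.amap 0 q x))"
      using amap_natural[OF Mt Nt x(4) q(1)] w(2) q(2) by simp
    then have "u x = M.amap 0 q x" for x
      using fun_cong[of _ _ x] pow_mod_nth[OF x(1) u(1)] pow_mod_nth[OF x(1) M.amap_closed[OF q(1)]] by (intro finj) metis+
    then have "u = M.amap 0 q" by blast
    then show "t = \<zero>\<^bsub>M.X\<^esub>" using u(2) M.gsum_amap[OF q(1)] by simp
  next
    fix t assume t: "t \<in> carrier M.X"
    obtain u where u: "u \<in> carrier (M.P 0)" "t = M.gsum u" using M.gsum_surj[OF t(1)] by blast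
    have "\<phi> t = N.gsum (\<lambda>x. f (u x))"
      unfolding u(2) by (rule gsum_natural[OF Mt Nt x(4) \<phi> u(1)])
    then have "\<psi> (\<phi> t) = L.gsum (\<lambda>x. p (f (u x)))"
      using gsum_natural[OF Nt Lt x(5) \<psi> fcl[OF u(1)]] by simp
    also have "(\<lambda>x. p (f (u x))) = (\<lambda>_. \<zero>\<^bsub>L\<^esub>)" using x(7) pow_mod_nth[OF x(1) u(1)] by simp
    finally show "\<psi> (\<phi> t) = \<zero>\<^bsub>L.X\<^esub>" by (simp only: L.gsum_zero)
  next
    fix t assume t: "t \<in> carrier N.X" "\<psi> t = \<zero>\<^bsub>L.X\<^esub>"
    obtain u where u: "u \<in> carrier (N.P 0)" "t = N.gsum u" using N.gsum_surj[OF t(1)] by blast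
    have "L.gsum (\<lambda>x. p (u x)) = \<zero>\<^bsub>L.X\<^esub>" using gsum_natural[OF Nt Lt x(5) \<psi> u(1)] t(2) u(2) by simp
    then obtain w where w: "w \<in> carrier (L.P (Suc 0))" "(\<lambda>x. p (u x)) = L.amap 0 w"
      using L.gsum_eq_zero[OF pcl[OF u(1)]] by blast
    obtain w' where w': "w' \<in> carrier (N.P (Suc 0))" "(\<lambda>y. p (w' y)) = w" using liftL[OF w(1)] by blast
    have ac: "N.amap 0 w' \<in> carrier (N.P 0)" by (rule N.amap_closed[OF w'(1)])
    have pe: "(\<lambda>y. p (u y)) = (\<lambda>y. p (N.amap 0 w' y))"
      using amap_natural[OF Nt Lt x(5) w'(1)] w(2) w'(2) by simp
    \<comment> \<open>The correction is killed by \<open>gsum\<close>; the rest of \<open>u\<close>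
      maps to zero in \<open>L\<close> and comes from \<open>M\<close>.\<close>
    let ?u = "u \<ominus>\<^bsub>N.P 0\<^esub> N.amap 0 w'"
    have uc: "?u \<in> carrier (N.P 0)" using u(1) ac by (rule N.P.M.minus_closed)
    obtain q where q: "q \<in> carrier (M.P 0)" "(\<lambda>y. f (q y)) = ?u"
      using liftM[OF uc] fun_cong[OF pminus[OF u(1) ac pe]] by blast
    have "t = N.gsum ?u \<oplus>\<^bsub>N.X\<^esub> N.gsum (N.amap 0 w')"
      unfolding u(2) N.gsum_add[OF uc ac, symmetric] N.P.minus_add_cancel[OF u(1) ac] by simp
    also have "\<dots> = N.gsum ?u" unfolding N.gsum_amap[OF w'(1)] by (rule N.KN.M.r_zero[OF N.gsum_closed[OF uc]])
    also have "\<dots> = \<phi> (M.gsum q)" using gsum_natural[OF Mt Nt x(4) \<phi> q(1)] q(2) by simp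
    finally show "\<exists>s\<in>carrier M.X. t = \<phi> s" using M.gsum_closed[OF q(1)] by blast
  next
    fix t assume t: "t \<in> carrier L.X"
    obtain u where u: "u \<in> carrier (L.P 0)" "t = L.gsum u" using L.gsum_surj[OF t(1)] by blast
    obtain w where w: "w \<in> carrier (N.P 0)" "(\<lambda>y. p (w y)) = u" using liftL[OF u(1)] by blast
    have "t = \<psi> (N.gsum w)" using gsum_natural[OF Nt Lt x(5) \<psi> w(1)] u(2) w(2) by simp
    then show "\<exists>s\<in>carrier N.X. t = \<psi> s" using N.gsum_closed[OF w(1)] by blast
  qed
qed

lemma short_exact_iso_ends:
  assumes ex: "short_exact T A B C \<iota> \<pi>"
    and e: "e \<in> lmod_hom T A A'" "bij_betw e (carrier A) (carrier A')" "lmodule T A'"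
    and e': "e' \<in> lmod_hom T C C'" "bij_betw e' (carrier C) (carrier C')" "lmodule T C'"
  shows "short_exact T A' B C' (\<lambda>x. \<iota> (inv_into (carrier A) e x)) (\<lambda>x. e' (\<pi> x))"
proof -
  note x = short_exactD[OF ex]
  let ?k = "inv_into (carrier A) e"
  have k: "?k \<in> lmod_hom T A' A" by (rule lmod_hom_inv_into[OF x(1) e(1,2)])
  have ke: "?k (e a) = a" if "a \<in> carrier A" for a using e(2) that by (simp add: bij_betw_def inv_into_f_f)
  have ek: "e (?k a) = a" if "a \<in> carrier A'" for a using e(2) that by (simp add: bij_betw_def f_inv_into_f)
  have e'0: "e' c = \<zero>\<^bsub>C'\<^esub> \<longleftrightarrow> c = \<zero>\<^bsub>C\<^esub>" if "c \<in> carrier C" for c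
  proof -
    have "inj_on e' (carrier C)" using e'(2) by (simp add: bij_betw_def)
    then show ?thesis using that lmod_hom_inj_iff[OF x(3) e'(3,1)] lmod_hom_zero[OF x(3) e'(3,1)] by metis
  qed
  note kc = lmod_hom_closed[OF k] and \<pi>c = lmod_hom_closed[OF x(5)]
  show ?thesis
  proof (rule short_exactI[OF e(3) x(2) e'(3) lmod_hom_comp[OF k x(4)] lmod_hom_comp[OF x(5) e'(1)]])
    fix a assume a: "a \<in> carrier A'"
    show "e' (\<pi> (\<iota> (?k a))) = \<zero>\<^bsub>C'\<^esub>" using x(7)[OF kc[OF a]] lmod_hom_zero[OF x(3) e'(3,1)] by simp
    assume "\<iota> (?k a) = \<zero>\<^bsub>B\<^esub>"
    then have "?k a = \<zero>\<^bsub>A\<^esub>" by (rule x(10)[OF kc[OF a]])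
    then show "a = \<zero>\<^bsub>A'\<^esub>" using ek[OF a] lmod_hom_zero[OF x(1) e(3,1)] by simp
  next
    fix b assume b: "b \<in> carrier B" "e' (\<pi> b) = \<zero>\<^bsub>C'\<^esub>"
    then obtain a where a: "a \<in> carrier A" "b = \<iota> a" using x(8)[OF b(1)] e'0[OF \<pi>c[OF b(1)]] by blast
    then show "\<exists>a\<in>carrier A'. b = \<iota> (?k a)" using ke lmod_hom_closed[OF e(1)] by (intro bexI[of _ "e a"]) auto
  next
    fix c assume "c \<in> carrier C'"
    then obtain c' where c': "c' \<in> carrier C" "c = e' c'" using e'(2) by (auto simp: bij_betw_def)
    then show "\<exists>b\<in>carrier B. c = e' (\<pi> b)" using x(9)[OF c'(1)] by blast
  qed
qed

section \<open>The coevaluation, and part (1)\<close>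

context bimod_tensor
begin

text \<open>The coevaluation, unit of the adjunction between \<open>K \<otimes> -\<close> and
  \<open>Hom(K, -)\<close>.\<close>

definition unit :: "'n \<Rightarrow> 'k \<Rightarrow> (('k \<times> 'n) \<Rightarrow>\<^sub>0 int) set" where
  "unit n = (\<lambda>k\<in>carrier K. pu k n)"

lemma pure_hom: "n \<in> carrier N \<Longrightarrow> (\<lambda>k. pu k n) \<in> lmod_hom S (left_mod K) X"
  by (intro lmod_homI)
    (simp_all add: pure_closed pure_add_left pure_smult[symmetric] del: tensor_module_simps)

lemma unit_closed: "n \<in> carrier N \<Longrightarrow> unit n \<in> carrier (Hom_module S K X)"
  unfolding unit_def using restrict_lmod_hom[OF left pure_hom[of n]] by simp

lemma rsmult_K: "k \<in> carrier K \<Longrightarrow> r \<in> carrier R \<Longrightarrow> rsmult K k r \<in> carrier K"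
  using T.U.smult_closed[of r k] by simp

lemma unit_hom: "unit \<in> lmod_hom R N (Hom_module S K X)"
proof (rule lmod_homI)
  fix n n' assume n: "n \<in> carrier N" "n' \<in> carrier N"
  then show "unit (n \<oplus>\<^bsub>N\<^esub> n') = unit n \<oplus>\<^bsub>Hom_module S K X\<^esub> unit n'"
    by (auto simp: unit_def fun_eq_iff pure_add_right simp del: tensor_module_simps)
next
  fix r n assume r: "r \<in> carrier R" and n: "n \<in> carrier N"
  then show "unit (r \<odot>\<^bsub>N\<^esub> n) = r \<odot>\<^bsub>Hom_module S K X\<^esub> unit n"
    by (auto simp: unit_def fun_eq_iff pure_balanced rsmult_K)
qed (rule unit_closed)

end

text \<open>Injectivity of \<open>K \<otimes> N\<close> holds because it is an extension of
  \<open>J\<close> by \<open>I\<close>, up to the evaluation isomorphisms at the ends. The second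
  claim is a five lemma argument in which the pairings \<open>hM\<close> and \<open>hL\<close> take
  the place of bijective coevaluations for \<open>M\<close> and \<open>L\<close>.\<close>

lemma tensor_unit_bij:
  fixes N :: "('r, 'n) module" and K :: "('s, 'r, 'k) bimod"
  assumes sd: "special_semidualizing S R C F \<delta> \<epsilon> d K" and R: "ring R" and S: "ring S"
    and ex: "short_exact R M N L f p"
    and MI: "in_IK TYPE('i) S R K n d M" and LI: "in_IK TYPE('j) S R K n d L"
  shows "nd_injective S n d (tensor_module R K N)"
    and "bij_betw (\<lambda>b. \<lambda>k\<in>carrier K. pure R K N k b) (carrier N) (carrier (Hom_module S K (tensor_module R K N)))"
proof -
  note x = short_exactD[OF ex]
  obtain m g a where mr: "matrix_resolution S R K m g a" using matrix_resolution_exists[OF sd R S] by blast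
  interpret mr: matrix_resolution S R K m g a by (rule mr)
  note bi = mr.bimodule
  obtain I :: "('s, 'i) module" where I: "nd_injective S n d I" "lmod_iso R (Hom_module S K I) M"
    using MI unfolding in_IK_def by blast
  obtain J :: "('s, 'j) module" where J: "nd_injective S n d J" "lmod_iso R (Hom_module S K J) L"
    using LI unfolding in_IK_def by blast
  have Im: "lmodule S I" "lmodule S J" using I J by (auto simp: nd_injective_def)
  obtain hM where hM: "hom_pairing S R K M I hM" using hom_pairing_exists[OF bi R Im(1) x(1) I(2)] by blast
  obtain hL where hL: "hom_pairing S R K L J hL" using hom_pairing_exists[OF bi R Im(2) x(3) J(2)] by blast
  note ext = special_semidualizing_ext[OF sd]
  have Mp: "injective_pairing S R K m g a M I hM n d"
    using mr hM I(1) ext(1) ext(2)[OF I(1)] by (simp add: injective_pairing_def injective_pairing_axioms_def)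
  have Lp: "injective_pairing S R K m g a L J hL n d"
    using mr hL J(1) ext(1) ext(2)[OF J(1)] by (simp add: injective_pairing_def injective_pairing_axioms_def)
  interpret M: injective_pairing S R K m g a M I hM n d by (rule Mp)
  interpret L: injective_pairing S R K m g a L J hL n d by (rule Lp)
  interpret N: bimod_tensor S R K N using bi x(2) by (simp add: bimod_tensor_def)
  obtain \<phi> where \<phi>: "\<phi> \<in> lmod_hom S M.X N.X" "\<And>k y. k \<in> carrier K \<Longrightarrow> y \<in> carrier M \<Longrightarrow> \<phi> (M.pu k y) = N.pu k (f y)"
    using tensor_module_map[OF bi x(1,2,4)] by blast
  obtain \<psi> where \<psi>: "\<psi> \<in> lmod_hom S N.X L.X" "\<And>k y. k \<in> carrier K \<Longrightarrow> y \<in> carrier N \<Longrightarrow> \<psi> (N.pu k y) = L.pu k (p y)"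
    using tensor_module_map[OF bi x(2,3,5)] by blast
  have tex: "short_exact S M.X N.X L.X \<phi> \<psi>" by (rule tensor_exact[OF mr ex Lp \<phi> \<psi>])
  obtain eM where eM: "eM \<in> lmod_hom S M.X I" "\<And>k y. k \<in> carrier K \<Longrightarrow> y \<in> carrier M \<Longrightarrow> eM (M.pu k y) = hM y k"
    "bij_betw eM (carrier M.X) (carrier I)" using M.evaluation by blast
  obtain eL where eL: "eL \<in> lmod_hom S L.X J" "\<And>k y. k \<in> carrier K \<Longrightarrow> y \<in> carrier L \<Longrightarrow> eL (L.pu k y) = hL y k"
    "bij_betw eL (carrier L.X) (carrier J)" using L.evaluation by blast
  have Xinj: "nd_injective S n d N.X"
    by (rule nd_injective_extension[OF short_exact_iso_ends[OF tex eM(1,3) Im(1) eL(1,3) Im(2)] I(1) J(1)])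
  note y = short_exactD[OF tex]
  let ?H = "Hom_module S K N.X"
  have H: "lmodule R ?H" by (rule lmodule_Hom_module[OF bi R N.lmodule_tensor_module])
  have "bij_betw N.unit (carrier N) (carrier ?H)"
  proof (rule bij_betw_lmod_iso[OF x(2) H N.unit_hom])
    fix b assume b: "b \<in> carrier N" "N.unit b = \<zero>\<^bsub>?H\<^esub>"
    have z: "N.pu k b = \<zero>\<^bsub>N.X\<^esub>" if "k \<in> carrier K" for k
      using fun_cong[OF b(2), of k] that by (simp add: N.unit_def)
    have "hL (p b) k = \<zero>\<^bsub>J\<^esub>" if k: "k \<in> carrier K" for k
    proof -
      have "L.pu k (p b) = \<zero>\<^bsub>L.X\<^esub>" using \<psi>(2)[OF k b(1)] z[OF k] lmod_hom_zero[OF y(2,3,5)] by simp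
      then show ?thesis using eL(2)[OF k lmod_hom_closed[OF x(5) b(1)]] lmod_hom_zero[OF y(3) Im(2) eL(1)] by simp
    qed
    then have "p b = \<zero>\<^bsub>L\<^esub>" using L.h_inj lmod_hom_closed[OF x(5) b(1)] by blast
    then obtain c where c: "c \<in> carrier M" "b = f c" using x(8)[OF b(1)] by blast
    have "hM c k = \<zero>\<^bsub>I\<^esub>" if k: "k \<in> carrier K" for k
    proof -
      have "\<phi> (M.pu k c) = \<zero>\<^bsub>N.X\<^esub>" using \<phi>(2)[OF k c(1)] z[OF k] c(2) by simp
      then have "M.pu k c = \<zero>\<^bsub>M.X\<^esub>" by (rule y(10)[OF M.pure_closed[OF k c(1)]])
      then show ?thesis using eM(2)[OF k c(1)] lmod_hom_zero[OF y(1) Im(1) eM(1)] by simp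
    qed
    then have "c = \<zero>\<^bsub>M\<^esub>" using M.h_inj[OF c(1)] by blast
    then show "b = \<zero>\<^bsub>N\<^esub>" using c(2) lmod_hom_zero[OF x(1,2,4)] by simp
  next
    fix \<theta> assume \<theta>: "\<theta> \<in> carrier ?H"
    then have \<theta>h: "\<theta> \<in> lmod_hom S (left_mod K) N.X" "\<theta> \<in> extensional (carrier K)" by auto
    \<comment> \<open>\<open>\<psi> o \<theta>\<close> corresponds to an element \<open>l\<close> of
      \<open>L\<close>. Coevaluating a preimage \<open>b\<close> of \<open>l\<close> agrees with
      \<open>\<theta>\<close> up to values in the image of \<open>\<phi>\<close>.\<close>
    obtain l where l: "l \<in> carrier L" "\<And>k. k \<in> carrier K \<Longrightarrow> hL l k = eL (\<psi> (\<theta> k))"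
      using L.h_surj[OF lmod_hom_comp[OF lmod_hom_comp[OF \<theta>h(1) y(5)] eL(1)]] by blast
    obtain b where b: "b \<in> carrier N" "l = p b" using x(9)[OF l(1)] by blast
    note dh = lmod_hom_difference[OF mr.left N.lmodule_tensor_module \<theta>h(1) N.pure_hom[OF b(1)]]
    let ?d = "\<lambda>k. \<theta> k \<ominus>\<^bsub>N.X\<^esub> N.pu k b"
    have eLinj: "u = v" if "eL u = eL v" "u \<in> carrier L.X" "v \<in> carrier L.X" for u v
      using eL(3) that by (auto simp: bij_betw_def dest: inj_onD)
    have "?d ` carrier (left_mod K) \<subseteq> \<phi> ` carrier M.X"
    proof (rule image_subsetI)
      fix k assume "k \<in> carrier (left_mod K)"
      then have k: "k \<in> carrier K" by simp
      have c: "\<theta> k \<in> carrier N.X" "N.pu k b \<in> carrier N.X"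
        using lmod_hom_closed[OF \<theta>h(1)] k N.pure_closed[OF k b(1)] by auto
      have "\<psi> (\<theta> k) = \<psi> (N.pu k b)"
        using l(2)[OF k] eL(2)[OF k l(1)] \<psi>(2)[OF k b(1)] b(2) lmod_hom_closed[OF y(5) c(1)] lmod_hom_closed[OF y(5) c(2)]
        by (intro eLinj) auto
      then have "\<psi> (?d k) = \<zero>\<^bsub>L.X\<^esub>"
        using lmod_hom_diff[OF y(2,3,5) c] lmod_hom_closed[OF y(5) c(2)] by (simp add: L.KN.minus_self del: tensor_module_simps)
      moreover have "?d k \<in> carrier N.X" using lmod_hom_closed[OF dh, of k] k by simp
      ultimately obtain s where "s \<in> carrier M.X" "?d k = \<phi> s" using y(8) by blast
      then show "?d k \<in> \<phi> ` carrier M.X" by blast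
    qed
    note v = hom_through_inj[OF y(1,2,4,6) mr.left dh this]
    \<comment> \<open>The remainder, pulled back along \<open>\<phi>\<close>, corresponds to an
      element \<open>c\<close> of \<open>M\<close>; the preimage of \<open>\<theta>\<close> will be
      \<open>b + f c\<close>.\<close>
    obtain c where c: "c \<in> carrier M" "\<And>k. k \<in> carrier K \<Longrightarrow> hM c k = eM (inv_into (carrier M.X) \<phi> (?d k))"
      using M.h_surj[OF lmod_hom_comp[OF v(3) eM(1)]] by blast
    have eMinj: "u = v" if "eM u = eM v" "u \<in> carrier M.X" "v \<in> carrier M.X" for u v
      using eM(3) that by (auto simp: bij_betw_def dest: inj_onD)
    have fc: "f c \<in> carrier N" by (rule lmod_hom_closed[OF x(4) c(1)])
    have "\<theta> k = N.unit (b \<oplus>\<^bsub>N\<^esub> f c) k" for k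
    proof (cases "k \<in> carrier K")
      case True
      then have kl: "k \<in> carrier (left_mod K)" by simp
      have "inv_into (carrier M.X) \<phi> (?d k) = M.pu k c"
        using c(2)[OF True] eM(2)[OF True c(1)] v(1)[OF kl] M.pure_closed[OF True c(1)] by (intro eMinj) auto
      then have "N.pu k (f c) = ?d k" using v(2)[OF kl] \<phi>(2)[OF True c(1)] by simp
      moreover have "\<theta> k \<in> carrier N.X" "N.pu k b \<in> carrier N.X"
        using lmod_hom_closed[OF \<theta>h(1) kl] N.pure_closed[OF True b(1)] by auto
      ultimately have "N.pu k b \<oplus>\<^bsub>N.X\<^esub> N.pu k (f c) = \<theta> k" using N.KN.add_minus_cancel by metis
      then show ?thesis using True N.pure_add_right[OF True b(1) fc] by (simp add: N.unit_def del: tensor_module_simps)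
    qed (use \<theta>h(2) in \<open>simp add: N.unit_def extensional_def\<close>)
    then show "\<exists>b\<in>carrier N. \<theta> = N.unit b" using b(1) fc by (intro bexI[of _ "b \<oplus>\<^bsub>N\<^esub> f c"]) auto
  qed
  then show "nd_injective S n d N.X" "bij_betw (\<lambda>b. \<lambda>k\<in>carrier K. N.pu k b) (carrier N) (carrier ?H)"
    using Xinj by (simp_all add: N.unit_def[abs_def])
qed

lemma in_IK_extension:
  fixes N :: "('r, 'n) module" and K :: "('s, 'r, 'k) bimod"
  assumes sd: "special_semidualizing S R C F \<delta> \<epsilon> d K" and R: "ring R" and S: "ring S"
    and ex: "short_exact R M N L f p"
    and MI: "in_IK TYPE('i) S R K n d M" and LI: "in_IK TYPE('j) S R K n d L"
  shows "in_IK TYPE((('k \<times> 'n) \<Rightarrow>\<^sub>0 int) set) S R K n d N"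
proof -
  have "bimodule S R K" using matrix_resolution_exists[OF sd R S] by (auto simp: matrix_resolution_def)
  then interpret N: bimod_tensor S R K N using short_exactD(2)[OF ex] by (simp add: bimod_tensor_def)
  have "(\<lambda>b. \<lambda>k\<in>carrier K. N.pu k b) \<in> lmod_hom R N (Hom_module S K N.X)"
    using N.unit_hom by (simp add: N.unit_def[abs_def])
  note u = tensor_unit_bij[OF assms] this
  have "lmod_iso R (Hom_module S K N.X) N"
    unfolding lmod_iso_def using lmod_hom_inv_into[OF short_exactD(2)[OF ex] u(3,2)] bij_betw_inv_into[OF u(2)] by blast
  then show ?thesis unfolding in_IK_def using short_exactD(2)[OF ex] u(1) by blast
qed

section \<open>Characters of abelian groups\<close>

text \<open>An injective cogenerator of abelian groups, as is Q/Z. Extending characters uses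
  existence of roots; separating points uses that for \<open>n \<ge> 2\<close> there is always a
  root other than 1.\<close>

definition circle :: "complex monoid" where
  "circle = \<lparr>carrier = {z. cmod z = 1}, monoid.mult = (*), monoid.one = 1\<rparr>"

lemma circle_simps [simp]:
  "z \<in> carrier circle \<longleftrightarrow> cmod z = 1" "z \<otimes>\<^bsub>circle\<^esub> w = z * w" "\<one>\<^bsub>circle\<^esub> = 1"
  by (simp_all add: circle_def)

lemma comm_group_circle: "comm_group circle"
proof (rule comm_groupI)
  fix z assume "z \<in> carrier circle"
  then have "cmod z = 1" by simp
  then have "z \<noteq> 0" by auto
  then show "\<exists>y\<in>carrier circle. y \<otimes>\<^bsub>circle\<^esub> z = \<one>\<^bsub>circle\<^esub>"
    using \<open>cmod z = 1\<close> by (intro bexI[of _ "inverse z"]) (auto simp: norm_inverse)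
qed (auto simp: norm_mult)

text \<open>There are \<open>n \<ge> 2\<close> roots of a nonzero number, so not all of them can be
  1.\<close>

lemma root_in_circle:
  assumes "cmod w = 1" "n \<ge> 2" shows "\<exists>z. cmod z = 1 \<and> z ^ n = w \<and> z \<noteq> 1"
proof -
  have "w \<noteq> 0" using assms(1) by auto
  then have c: "card {z. z ^ n = w} = n" using assms(2) by (intro card_nth_roots) auto
  have "\<not> {z. z ^ n = w} \<subseteq> {1}"
  proof
    assume "{z. z ^ n = w} \<subseteq> {1}"
    then have "card {z. z ^ n = w} \<le> card {1::complex}" by (intro card_mono) auto
    then show False using c assms(2) by simp
  qed
  then obtain z where z: "z ^ n = w" "z \<noteq> 1" by auto
  have "cmod z ^ n = 1" using z(1) assms(1) by (metis norm_power)
  then have "cmod z = 1" using assms(2) power_eq_imp_eq_base[of "cmod z" n 1] by simp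
  then show ?thesis using z by blast
qed

text \<open>Characters of subgroups are extended as graphs; the value of the extension at a new element is
  a root of unity condition, and can be chosen different from 1.\<close>

locale abelian_characters = comm_group G for G (structure)
begin

abbreviation "D \<equiv> G \<times>\<times> circle"

lemma D_comm_group: "comm_group D"
proof -
  interpret c: comm_group circle by (rule comm_group_circle)
  interpret D: group D by (rule DirProd_group[OF is_group c.is_group])
  show ?thesis by (rule D.group_comm_groupI) (auto simp: m_comm)
qed

sublocale D: comm_group D by (rule D_comm_group)

text \<open>For a subgroup of the product, triviality over \<open>\<one>\<close> already means
  single valued: two values over one element differ by a pair over \<open>\<one>\<close>.\<close>

definition char_graph :: "('a \<times> complex) set \<Rightarrow> bool" where
  "char_graph \<Gamma> \<longleftrightarrow> subgroup \<Gamma> D \<and> (\<forall>z. (\<one>, z) \<in> \<Gamma> \<longrightarrow> z = 1)"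

lemma char_graph_step:
  assumes \<Gamma>: "char_graph \<Gamma>" and b: "b \<in> carrier G" "b \<notin> fst ` \<Gamma>"
  shows "\<exists>\<Gamma>' \<zeta>. char_graph \<Gamma>' \<and> \<Gamma> \<subseteq> \<Gamma>' \<and> (b, \<zeta>) \<in> \<Gamma>' \<and> \<zeta> \<noteq> 1"
proof -
  have sub: "subgroup \<Gamma> D" and func: "\<And>z. (\<one>, z) \<in> \<Gamma> \<Longrightarrow> z = 1" using \<Gamma> by (auto simp: char_graph_def)
  note sc = subgroup.subset[OF sub, THEN subsetD]
  have pw: "(b, \<zeta>) [^]\<^bsub>D\<^esub> n = (b [^] n, \<zeta> ^ n)" for n :: nat and \<zeta> by (induction n) auto
  \<comment> \<open>The condition on powers says that the subgroup generated by
    \<open>(b, \<zeta>)\<close> agrees with \<open>\<Gamma>\<close> over the old domain, which keeps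
    the enlarged graph single valued.\<close>
  have "\<exists>\<zeta>. cmod \<zeta> = 1 \<and> \<zeta> \<noteq> 1 \<and> (\<forall>k::int. fst ((b, \<zeta>) [^]\<^bsub>D\<^esub> k) \<in> fst ` \<Gamma> \<longrightarrow> (b, \<zeta>) [^]\<^bsub>D\<^esub> k \<in> \<Gamma>)"
  proof (cases "\<exists>n::nat. n > 0 \<and> b [^] n \<in> fst ` \<Gamma>")
    case True
    \<comment> \<open>\<open>n\<close> is the order of \<open>b\<close> modulo the domain, and
      \<open>\<zeta>\<close> has to be an \<open>n\<close>-th root of the value already prescribed
      at the \<open>n\<close>-th power of \<open>b\<close>. Since \<open>b\<close> lies outside the
      domain, \<open>n\<close> is at least 2, which leaves a root different from 1.\<close>
    define n where "n = (LEAST n::nat. n > 0 \<and> b [^] n \<in> fst ` \<Gamma>)"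
    have n: "n > 0" "b [^] n \<in> fst ` \<Gamma>" using LeastI_ex[OF True] by (auto simp: n_def)
    have nmin: "\<not> (r > 0 \<and> b [^] r \<in> fst ` \<Gamma>)" if "r < n" for r
      using not_less_Least[OF that[unfolded n_def]] .
    have "n \<noteq> 1"
    proof
      assume "n = 1"
      then have "b [^] n = b" using b by simp
      then show False using n(2) b by simp
    qed
    then have n2: "n \<ge> 2" using n(1) by simp
    obtain w where w: "(b [^] n, w) \<in> \<Gamma>" using n(2) by auto
    have "cmod w = 1" using sc[OF w] by simp
    from root_in_circle[OF this n2] obtain \<zeta> where \<zeta>: "cmod \<zeta> = 1" "\<zeta> ^ n = w" "\<zeta> \<noteq> 1" by blast
    let ?\<beta> = "(b, \<zeta>)"
    have \<beta>: "?\<beta> \<in> carrier D" using b \<zeta> by simp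
    have \<beta>n: "?\<beta> [^]\<^bsub>D\<^esub> n \<in> \<Gamma>" using w \<zeta> by (simp add: pw)
    have "?\<beta> [^]\<^bsub>D\<^esub> k \<in> \<Gamma>" if k: "fst (?\<beta> [^]\<^bsub>D\<^esub> k) \<in> fst ` \<Gamma>" for k :: int
    proof -
      \<comment> \<open>Division by \<open>n\<close>: the power with the remainder as exponent also
        lies over the domain, so the remainder is 0 by minimality.\<close>
      let ?q = "k div int n" and ?r = "k mod int n"
      have r: "0 \<le> ?r" "?r < int n" using n(1) by auto
      have q\<Gamma>: "?\<beta> [^]\<^bsub>D\<^esub> (int n * ?q) \<in> \<Gamma>"
        using D.subgroup_int_pow_closed[OF sub \<beta>n, of ?q] D.int_pow_pow[OF \<beta>, of "int n" ?q]
        by (simp add: int_pow_int)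
      have "?\<beta> [^]\<^bsub>D\<^esub> k = ?\<beta> [^]\<^bsub>D\<^esub> (int n * ?q) \<otimes>\<^bsub>D\<^esub> ?\<beta> [^]\<^bsub>D\<^esub> ?r"
        using D.int_pow_mult[OF \<beta>, of "int n * ?q" ?r] by simp
      then have "?\<beta> [^]\<^bsub>D\<^esub> ?r = inv\<^bsub>D\<^esub> (?\<beta> [^]\<^bsub>D\<^esub> (int n * ?q)) \<otimes>\<^bsub>D\<^esub> ?\<beta> [^]\<^bsub>D\<^esub> k"
        by (rule iffD2[OF D.inv_solve_left[OF D.int_pow_closed[OF \<beta>] D.int_pow_closed[OF \<beta>] D.int_pow_closed[OF \<beta>]]])
      moreover obtain u where u: "u \<in> \<Gamma>" "fst (?\<beta> [^]\<^bsub>D\<^esub> k) = fst u" using k by auto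
      ultimately have "fst (?\<beta> [^]\<^bsub>D\<^esub> ?r) = fst (inv\<^bsub>D\<^esub> (?\<beta> [^]\<^bsub>D\<^esub> (int n * ?q)) \<otimes>\<^bsub>D\<^esub> u)"
        by (simp add: mult_DirProd')
      moreover have "inv\<^bsub>D\<^esub> (?\<beta> [^]\<^bsub>D\<^esub> (int n * ?q)) \<otimes>\<^bsub>D\<^esub> u \<in> \<Gamma>"
        using q\<Gamma> u(1) subgroup.m_inv_closed[OF sub] subgroup.m_closed[OF sub] by blast
      ultimately have "fst (?\<beta> [^]\<^bsub>D\<^esub> ?r) \<in> fst ` \<Gamma>" by blast
      moreover have "?\<beta> [^]\<^bsub>D\<^esub> ?r = ?\<beta> [^]\<^bsub>D\<^esub> nat ?r"
      proof -
        have "?\<beta> [^]\<^bsub>D\<^esub> ?r = ?\<beta> [^]\<^bsub>D\<^esub> int (nat ?r)" using r by simp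
        then show ?thesis by (simp only: int_pow_int)
      qed
      ultimately have "b [^] nat ?r \<in> fst ` \<Gamma>" by (simp add: pw)
      then have "nat ?r = 0" using nmin[of "nat ?r"] r by linarith
      then have "int n * ?q = k" using r by (metis add.right_neutral int_nat_eq mult_div_mod_eq of_nat_0)
      then show ?thesis using q\<Gamma> by simp
    qed
    then show ?thesis using \<zeta> by blast
  next
    case False
    \<comment> \<open>No positive power of \<open>b\<close> lies in the domain, so the value is
      free; -1 is a choice different from 1. Only the exponent 0 can occur.\<close>
    let ?\<beta> = "(b, -1 :: complex)"
    have \<beta>: "?\<beta> \<in> carrier D" using b by simp
    have "?\<beta> [^]\<^bsub>D\<^esub> k \<in> \<Gamma>" if k: "fst (?\<beta> [^]\<^bsub>D\<^esub> k) \<in> fst ` \<Gamma>" for k :: int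
    proof -
      have pos: False if "l > 0" "fst (?\<beta> [^]\<^bsub>D\<^esub> l) \<in> fst ` \<Gamma>" for l :: int
      proof -
        have "?\<beta> [^]\<^bsub>D\<^esub> l = ?\<beta> [^]\<^bsub>D\<^esub> int (nat l)" using that by simp
        then have "b [^] nat l \<in> fst ` \<Gamma>" using that(2) by (simp add: pw int_pow_int del: int_nat_eq)
        moreover have "0 < nat l" using that(1) by simp
        ultimately show False using False by blast
      qed
      have "k = 0"
      proof (rule ccontr)
        assume "k \<noteq> 0"
        moreover have "\<not> 0 < k" using pos[of k] k by blast
        ultimately have "k < 0" by simp
        obtain u where u: "u \<in> \<Gamma>" "fst (?\<beta> [^]\<^bsub>D\<^esub> k) = fst u" using k by auto
        have fi: "fst (inv\<^bsub>D\<^esub> v) = inv (fst v)" if "v \<in> carrier D" for v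
          using inv_DirProd[OF is_group comm_group.axioms(2)[OF comm_group_circle], of "fst v" "snd v"] that by auto
        have "fst (?\<beta> [^]\<^bsub>D\<^esub> (- k)) = fst (inv\<^bsub>D\<^esub> u)"
          using D.int_pow_neg[OF \<beta>, of k] fi[OF D.int_pow_closed[OF \<beta>]] fi[OF sc[OF u(1)]] u(2) by simp
        then have "fst (?\<beta> [^]\<^bsub>D\<^esub> (- k)) \<in> fst ` \<Gamma>" using subgroup.m_inv_closed[OF sub u(1)] by auto
        then show False using pos[of "- k"] \<open>k < 0\<close> by simp
      qed
      then show ?thesis using subgroup.one_closed[OF sub] by simp
    qed
    then show ?thesis by (intro exI[of _ "-1"]) auto
  qed
  then obtain \<zeta> where \<zeta>: "cmod \<zeta> = 1" "\<zeta> \<noteq> 1"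
    "\<And>k::int. fst ((b, \<zeta>) [^]\<^bsub>D\<^esub> k) \<in> fst ` \<Gamma> \<Longrightarrow> (b, \<zeta>) [^]\<^bsub>D\<^esub> k \<in> \<Gamma>" by blast
  let ?\<beta> = "(b, \<zeta>)"
  have \<beta>: "?\<beta> \<in> carrier D" using b \<zeta> by simp
  note \<beta>c = D.int_pow_closed[OF \<beta>]
  define \<Gamma>' where "\<Gamma>' = {u \<otimes>\<^bsub>D\<^esub> ?\<beta> [^]\<^bsub>D\<^esub> (k::int) | u k. u \<in> \<Gamma>}"
  have "subgroup \<Gamma>' D"
  proof (rule D.subgroupI)
    show "\<Gamma>' \<subseteq> carrier D" using sc \<beta>c unfolding \<Gamma>'_def by (blast intro: D.m_closed)
    show "\<Gamma>' \<noteq> {}" using subgroup.one_closed[OF sub] unfolding \<Gamma>'_def by blast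
    fix x assume "x \<in> \<Gamma>'"
    then obtain u k where u: "u \<in> \<Gamma>" "x = u \<otimes>\<^bsub>D\<^esub> ?\<beta> [^]\<^bsub>D\<^esub> (k::int)" unfolding \<Gamma>'_def by blast
    have "inv\<^bsub>D\<^esub> x = inv\<^bsub>D\<^esub> u \<otimes>\<^bsub>D\<^esub> ?\<beta> [^]\<^bsub>D\<^esub> (- k)"
      unfolding u(2) D.int_pow_neg[OF \<beta>] using D.inv_mult[OF sc[OF u(1)] \<beta>c] .
    then show "inv\<^bsub>D\<^esub> x \<in> \<Gamma>'" using subgroup.m_inv_closed[OF sub u(1)] unfolding \<Gamma>'_def by blast
    fix y assume "y \<in> \<Gamma>'"
    then obtain v l where v: "v \<in> \<Gamma>" "y = v \<otimes>\<^bsub>D\<^esub> ?\<beta> [^]\<^bsub>D\<^esub> (l::int)" unfolding \<Gamma>'_def by blast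
    have "x \<otimes>\<^bsub>D\<^esub> y = (u \<otimes>\<^bsub>D\<^esub> v) \<otimes>\<^bsub>D\<^esub> ?\<beta> [^]\<^bsub>D\<^esub> (k + l)"
      unfolding u(2) v(2) D.int_pow_mult[OF \<beta>]
      using sc[OF u(1)] sc[OF v(1)] \<beta>c[of k] \<beta>c[of l] by (simp only: D.m_ac D.m_closed)
    then show "x \<otimes>\<^bsub>D\<^esub> y \<in> \<Gamma>'" using subgroup.m_closed[OF sub u(1) v(1)] unfolding \<Gamma>'_def by blast
  qed
  moreover have "z = 1" if z: "(\<one>, z) \<in> \<Gamma>'" for z
  proof -
    obtain u k where u: "u \<in> \<Gamma>" "(\<one>, z) = u \<otimes>\<^bsub>D\<^esub> ?\<beta> [^]\<^bsub>D\<^esub> (k::int)" using z unfolding \<Gamma>'_def by blast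
    have "(\<one>, z) \<in> carrier D" unfolding u(2) by (intro D.m_closed sc u(1) \<beta>c)
    then have "?\<beta> [^]\<^bsub>D\<^esub> k = inv\<^bsub>D\<^esub> u \<otimes>\<^bsub>D\<^esub> (\<one>, z)"
      using u(2) by (intro iffD2[OF D.inv_solve_left[OF \<beta>c sc[OF u(1)]]])
    then have "fst (?\<beta> [^]\<^bsub>D\<^esub> k) = fst (inv\<^bsub>D\<^esub> u)"
      using sc[OF subgroup.m_inv_closed[OF sub u(1)]] by (auto simp: mult_DirProd')
    then have "?\<beta> [^]\<^bsub>D\<^esub> k \<in> \<Gamma>" using subgroup.m_inv_closed[OF sub u(1)] by (intro \<zeta>(3)) auto
    then have "(\<one>, z) \<in> \<Gamma>" unfolding u(2) using subgroup.m_closed[OF sub u(1)] by blast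
    then show ?thesis by (rule func)
  qed
  moreover have "u \<in> \<Gamma>'" if "u \<in> \<Gamma>" for u
  proof -
    have "u = u \<otimes>\<^bsub>D\<^esub> ?\<beta> [^]\<^bsub>D\<^esub> (0::int)" using D.r_one[OF sc[OF that]] by (simp only: int_pow_0)
    then show ?thesis using that unfolding \<Gamma>'_def by blast
  qed
  moreover have "?\<beta> \<in> \<Gamma>'"
  proof -
    have "?\<beta> = \<one>\<^bsub>D\<^esub> \<otimes>\<^bsub>D\<^esub> ?\<beta> [^]\<^bsub>D\<^esub> (1::int)" using D.l_one[OF \<beta>] by (simp only: D.int_pow_1[OF \<beta>])
    then show ?thesis using subgroup.one_closed[OF sub] unfolding \<Gamma>'_def by blast
  qed
  ultimately show ?thesis using \<zeta>(2) unfolding char_graph_def by (intro exI[of _ \<Gamma>'] exI[of _ \<zeta>]) auto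
qed

text \<open>Zorn's lemma: a maximal graph is total, because \<open>char_graph_step\<close> would
  enlarge it at a missing element.\<close>

lemma char_graph_total:
  assumes \<Gamma>: "char_graph \<Gamma>"
  shows "\<exists>\<chi>\<in>hom G circle. \<forall>(x, z)\<in>\<Gamma>. \<chi> x = z"
proof -
  let ?S = "{\<Delta>. char_graph \<Delta> \<and> \<Gamma> \<subseteq> \<Delta>}"
  have "\<exists>M\<in>?S. \<forall>X\<in>?S. M \<subseteq> X \<longrightarrow> X = M"
  proof (rule subset_Zorn_nonempty)
    show "?S \<noteq> {}" using \<Gamma> by auto
    fix \<C> assume c: "\<C> \<noteq> {}" "subset.chain ?S \<C>"
    have cs: "\<And>\<Delta>. \<Delta> \<in> \<C> \<Longrightarrow> char_graph \<Delta> \<and> \<Gamma> \<subseteq> \<Delta>" using c(2) by (auto simp: subset.chain_def)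
    have lin: "\<And>\<Delta> \<Delta>'. \<Delta> \<in> \<C> \<Longrightarrow> \<Delta>' \<in> \<C> \<Longrightarrow> \<Delta> \<subseteq> \<Delta>' \<or> \<Delta>' \<subseteq> \<Delta>"
      using c(2) by (metis order.strict_implies_order subset_chain_def)
    have sub: "\<And>\<Delta>. \<Delta> \<in> \<C> \<Longrightarrow> subgroup \<Delta> D" using cs by (simp add: char_graph_def)
    obtain \<Delta>0 where \<Delta>0: "\<Delta>0 \<in> \<C>" using c(1) by blast
    have "subgroup (\<Union>\<C>) D"
    proof (rule D.subgroupI)
      show "\<Union>\<C> \<subseteq> carrier D" using subgroup.subset[OF sub] by blast
      show "\<Union>\<C> \<noteq> {}" using \<Delta>0 subgroup.one_closed[OF sub[OF \<Delta>0]] by blast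
      show "inv\<^bsub>D\<^esub> x \<in> \<Union>\<C>" if x: "x \<in> \<Union>\<C>" for x
      proof -
        obtain \<Delta> where "\<Delta> \<in> \<C>" "x \<in> \<Delta>" using x by blast
        then show ?thesis using subgroup.m_inv_closed[OF sub] by blast
      qed
      fix x y assume "x \<in> \<Union>\<C>" "y \<in> \<Union>\<C>"
      then obtain \<Delta> \<Delta>' where "\<Delta> \<in> \<C>" "\<Delta>' \<in> \<C>" "x \<in> \<Delta>" "y \<in> \<Delta>'" by blast
      then obtain \<Theta> where "\<Theta> \<in> \<C>" "x \<in> \<Theta>" "y \<in> \<Theta>" using lin[of \<Delta> \<Delta>'] by blast
      then show "x \<otimes>\<^bsub>D\<^esub> y \<in> \<Union>\<C>" using subgroup.m_closed[OF sub, of \<Theta>] by blast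
    qed
    then show "\<Union>\<C> \<in> ?S" using cs \<Delta>0 unfolding char_graph_def by blast
  qed
  then obtain M where M: "char_graph M" "\<Gamma> \<subseteq> M" and mx: "\<And>X. char_graph X \<Longrightarrow> M \<subseteq> X \<Longrightarrow> X = M"
    by clarsimp
  have sub: "subgroup M D" and func: "\<And>z. (\<one>, z) \<in> M \<Longrightarrow> z = 1" using M(1) by (auto simp: char_graph_def)
  have total: "\<exists>z. (b, z) \<in> M" if b: "b \<in> carrier G" for b
  proof (rule ccontr)
    assume n: "\<nexists>z. (b, z) \<in> M"
    then have "b \<notin> fst ` M" by auto
    from char_graph_step[OF M(1) b this] obtain X z where "char_graph X" "M \<subseteq> X" "(b, z) \<in> X" by blast
    then show False using mx n by blast
  qed
  have uniq: "z = w" if zw: "(b, z) \<in> M" "(b, w) \<in> M" for b z w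
  proof -
    have bw: "b \<in> carrier G" "cmod w = 1" using subgroup.subset[OF sub] zw(2) by auto
    have "(b, z) \<otimes>\<^bsub>D\<^esub> inv\<^bsub>D\<^esub> (b, w) \<in> M" by (intro subgroup.m_closed[OF sub] subgroup.m_inv_closed[OF sub] zw)
    moreover have "inv\<^bsub>D\<^esub> (b, w) = (inv b, inv\<^bsub>circle\<^esub> w)"
      using bw by (intro inv_DirProd is_group comm_group.axioms(2)[OF comm_group_circle]) auto
    moreover have "inv\<^bsub>circle\<^esub> w = inverse w"
    proof (rule group.inv_equality[OF comm_group.axioms(2)[OF comm_group_circle]])
      have "w \<noteq> 0" using bw by auto
      then show "inverse w \<otimes>\<^bsub>circle\<^esub> w = \<one>\<^bsub>circle\<^esub>" by simp
    qed (use bw in \<open>auto simp: norm_inverse\<close>)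
    ultimately have "z * inverse w = 1" using bw by (intro func) simp
    moreover have "w \<noteq> 0" using bw by auto
    ultimately show "z = w" by (simp add: field_simps)
  qed
  define \<chi> where "\<chi> x = (THE z. (x, z) \<in> M)" for x
  have \<chi>: "\<chi> x = z" if "(x, z) \<in> M" for x z unfolding \<chi>_def using that uniq by blast
  have \<chi>M: "(x, \<chi> x) \<in> M" if "x \<in> carrier G" for x using total[OF that] \<chi> by auto
  have "\<chi> \<in> hom G circle"
  proof (rule homI)
    fix x assume x: "x \<in> carrier G"
    show "\<chi> x \<in> carrier circle" using subgroup.subset[OF sub] \<chi>M[OF x] by auto
    fix y assume y: "y \<in> carrier G"
    show "\<chi> (x \<otimes> y) = \<chi> x \<otimes>\<^bsub>circle\<^esub> \<chi> y"
      using subgroup.m_closed[OF sub \<chi>M[OF x] \<chi>M[OF y]] by (intro \<chi>) simp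
  qed
  then show ?thesis using \<chi> M(2) by (intro bexI[of _ \<chi>]) auto
qed

lemma char_graph_hom:
  assumes A: "subgroup A G" and c: "\<And>x. x \<in> A \<Longrightarrow> cmod (\<chi> x) = 1"
    and h: "\<And>x y. x \<in> A \<Longrightarrow> y \<in> A \<Longrightarrow> \<chi> (x \<otimes> y) = \<chi> x * \<chi> y"
  shows "char_graph ((\<lambda>x. (x, \<chi> x)) ` A)"
proof -
  have sc: "x \<in> carrier G" if "x \<in> A" for x using subgroup.subset[OF A] that by blast
  have one: "\<one> \<in> A" by (rule subgroup.one_closed[OF A])
  have nz: "\<chi> x \<noteq> 0" if "x \<in> A" for x using c[OF that] by auto
  have \<chi>1: "\<chi> \<one> = 1" using h[OF one one] nz[OF one] by simp
  have "subgroup ((\<lambda>x. (x, \<chi> x)) ` A) D"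
  proof (rule D.subgroupI)
    show "(\<lambda>x. (x, \<chi> x)) ` A \<subseteq> carrier D" using sc c by auto
    show "(\<lambda>x. (x, \<chi> x)) ` A \<noteq> {}" using one by blast
    fix u assume "u \<in> (\<lambda>x. (x, \<chi> x)) ` A"
    then obtain x where x: "x \<in> A" "u = (x, \<chi> x)" by blast
    have ix: "inv x \<in> A" by (rule subgroup.m_inv_closed[OF A x(1)])
    have "\<chi> (inv x) * \<chi> x = 1" using h[OF ix x(1)] \<chi>1 sc[OF x(1)] by simp
    then have "inv\<^bsub>D\<^esub> u = (inv x, \<chi> (inv x))" unfolding x(2)
      using sc[OF x(1)] c[OF x(1)] c[OF ix] by (intro D.inv_equality) auto
    then show "inv\<^bsub>D\<^esub> u \<in> (\<lambda>x. (x, \<chi> x)) ` A" using ix by blast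
  next
    fix u v assume "u \<in> (\<lambda>x. (x, \<chi> x)) ` A" "v \<in> (\<lambda>x. (x, \<chi> x)) ` A"
    then obtain x y where "x \<in> A" "u = (x, \<chi> x)" "y \<in> A" "v = (y, \<chi> y)" by blast
    then show "u \<otimes>\<^bsub>D\<^esub> v \<in> (\<lambda>x. (x, \<chi> x)) ` A"
      using subgroup.m_closed[OF A] by (intro image_eqI[of _ _ "x \<otimes> y"]) (auto simp: h)
  qed
  then show ?thesis using \<chi>1 by (auto simp: char_graph_def)
qed

lemma char_extend:
  assumes A: "subgroup A G" and c: "\<And>x. x \<in> A \<Longrightarrow> cmod (\<chi> x) = 1"
    and h: "\<And>x y. x \<in> A \<Longrightarrow> y \<in> A \<Longrightarrow> \<chi> (x \<otimes> y) = \<chi> x * \<chi> y"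
  shows "\<exists>\<chi>'\<in>hom G circle. \<forall>x\<in>A. \<chi>' x = \<chi> x"
  using char_graph_total[OF char_graph_hom[OF assms]] by auto

text \<open>The trivial character of \<open>A\<close> is extended first to \<open>b\<close>, where
  \<open>char_graph_step\<close> supplies a value other than 1, and then to all of
  \<open>G\<close>.\<close>

lemma char_separate:
  assumes A: "subgroup A G" and b: "b \<in> carrier G" "b \<notin> A"
  shows "\<exists>\<chi>\<in>hom G circle. (\<forall>x\<in>A. \<chi> x = 1) \<and> \<chi> b \<noteq> 1"
proof -
  let ?\<Gamma> = "(\<lambda>x. (x, 1 :: complex)) ` A"
  have "char_graph ?\<Gamma>" by (rule char_graph_hom[OF A]) auto
  moreover have "b \<notin> fst ` ?\<Gamma>" using b(2) by auto
  ultimately obtain \<Gamma>' \<zeta> where \<Gamma>': "char_graph \<Gamma>'" "?\<Gamma> \<subseteq> \<Gamma>'" "(b, \<zeta>) \<in> \<Gamma>'" "\<zeta> \<noteq> 1"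
    using char_graph_step[of ?\<Gamma>, OF _ b(1)] by metis
  obtain \<chi> where \<chi>: "\<chi> \<in> hom G circle" "\<And>x z. (x, z) \<in> \<Gamma>' \<Longrightarrow> \<chi> x = z"
    using char_graph_total[OF \<Gamma>'(1)] by fast
  have "\<chi> x = 1" if "x \<in> A" for x using that \<Gamma>'(2) by (intro \<chi>(2)) auto
  then show ?thesis using \<chi>(2)[OF \<Gamma>'(3)] \<Gamma>'(4) \<chi>(1) by (intro bexI[of _ \<chi>]) auto
qed

end

text \<open>A character killing the image of \<open>u\<close> kills the kernel of \<open>v\<close>,
  hence descends to the image of \<open>v\<close> and extends to \<open>C\<close>. Conversely, an
  element of the kernel outside the image of \<open>u\<close> would be separated from that image by
  a character.\<close>

lemma dual_exact_iff:
  assumes A: "comm_group A" and B: "comm_group B" and C: "comm_group C"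
    and u: "u \<in> hom A B" and v: "v \<in> hom B C"
  shows "kernel B C v \<subseteq> u ` carrier A \<longleftrightarrow>
    (\<forall>\<chi>\<in>hom B circle. (\<forall>x\<in>carrier A. \<chi> (u x) = 1) \<longrightarrow> (\<exists>\<chi>'\<in>hom C circle. \<forall>y\<in>carrier B. \<chi> y = \<chi>' (v y)))"
    (is "?L \<longleftrightarrow> ?R")
proof -
  interpret A: comm_group A by (rule A)
  interpret B: abelian_characters B by (intro abelian_characters.intro B)
  interpret C: abelian_characters C by (intro abelian_characters.intro C)
  interpret u: group_hom A B u by (intro group_hom.intro group_hom_axioms.intro A.group_axioms B.group_axioms u)
  interpret v: group_hom B C v by (intro group_hom.intro group_hom_axioms.intro B.group_axioms C.group_axioms v)
  interpret circ: comm_group circle by (rule comm_group_circle)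
  show ?thesis
  proof
    assume L: ?L
    show ?R
    proof (intro ballI impI)
      fix \<chi> assume \<chi>: "\<chi> \<in> hom B circle" and z: "\<forall>x\<in>carrier A. \<chi> (u x) = 1"
      interpret \<chi>: group_hom B circle \<chi> by (intro group_hom.intro group_hom_axioms.intro B.group_axioms circ.group_axioms \<chi>)
      have eq: "\<chi> y = \<chi> y'" if y: "y \<in> carrier B" "y' \<in> carrier B" "v y = v y'" for y y'
      proof -
        have "y \<otimes>\<^bsub>B\<^esub> inv\<^bsub>B\<^esub> y' \<in> kernel B C v" using y by (simp add: kernel_def)
        then obtain x where "x \<in> carrier A" "y \<otimes>\<^bsub>B\<^esub> inv\<^bsub>B\<^esub> y' = u x" using L by blast
        then have "\<chi> (y \<otimes>\<^bsub>B\<^esub> inv\<^bsub>B\<^esub> y') = 1" using z by simp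
        moreover have "\<chi> y = \<chi> (y \<otimes>\<^bsub>B\<^esub> inv\<^bsub>B\<^esub> y') \<otimes>\<^bsub>circle\<^esub> \<chi> y'"
          using y by (simp only: \<chi>.hom_mult[symmetric] B.m_closed B.inv_closed B.m_assoc B.l_inv B.r_one)
        ultimately show ?thesis by simp
      qed
      define \<chi>0 where "\<chi>0 c = \<chi> (SOME y. y \<in> carrier B \<and> v y = c)" for c
      have \<chi>0: "\<chi>0 (v y) = \<chi> y" if "y \<in> carrier B" for y
      proof -
        have "\<exists>y'. y' \<in> carrier B \<and> v y' = v y" using that by blast
        from someI_ex[OF this] show ?thesis unfolding \<chi>0_def using that by (intro eq) auto
      qed
      have "\<exists>\<chi>'\<in>hom C circle. \<forall>x\<in>v ` carrier B. \<chi>' x = \<chi>0 x"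
      proof (rule C.char_extend[OF v.img_is_subgroup])
        fix x assume "x \<in> v ` carrier B"
        then obtain y where y: "y \<in> carrier B" "x = v y" by blast
        then show "cmod (\<chi>0 x) = 1" using \<chi>.hom_closed[OF y(1)] by (simp add: \<chi>0)
        fix x' assume "x' \<in> v ` carrier B"
        then obtain y' where y': "y' \<in> carrier B" "x' = v y'" by blast
        show "\<chi>0 (x \<otimes>\<^bsub>C\<^esub> x') = \<chi>0 x * \<chi>0 x'"
          using \<chi>0[of "y \<otimes>\<^bsub>B\<^esub> y'"] y y' \<chi>.hom_mult[OF y(1) y'(1)] by (simp add: \<chi>0)
      qed
      then show "\<exists>\<chi>'\<in>hom C circle. \<forall>y\<in>carrier B. \<chi> y = \<chi>' (v y)" using \<chi>0 by force
    qed
  next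
    assume R: ?R
    show ?L
    proof
      fix b assume b: "b \<in> kernel B C v"
      show "b \<in> u ` carrier A"
      proof (rule ccontr)
        assume "b \<notin> u ` carrier A"
        moreover have "b \<in> carrier B" using b by (simp add: kernel_def)
        ultimately obtain \<chi> where \<chi>: "\<chi> \<in> hom B circle" "\<forall>x\<in>u ` carrier A. \<chi> x = 1" "\<chi> b \<noteq> 1"
          using B.char_separate[OF u.img_is_subgroup] by blast
        then obtain \<chi>' where \<chi>': "\<chi>' \<in> hom C circle" "\<forall>y\<in>carrier B. \<chi> y = \<chi>' (v y)" using R by blast
        interpret \<chi>': group_hom C circle \<chi>' by (intro group_hom.intro group_hom_axioms.intro C.group_axioms circ.group_axioms \<chi>')
        have "\<chi> b = 1" using \<chi>'(2) b \<chi>'.hom_one by (simp add: kernel_def)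
        then show False using \<chi>(3) by blast
      qed
    qed
  qed
qed

lemma char_factor:
  assumes "comm_group A" "comm_group B" "comm_group C" "u \<in> hom A B" "v \<in> hom B C"
    and "kernel B C v \<subseteq> u ` carrier A" "\<chi> \<in> hom B circle" "\<And>x. x \<in> carrier A \<Longrightarrow> \<chi> (u x) = 1"
  obtains \<chi>' where "\<chi>' \<in> hom C circle" "\<And>y. y \<in> carrier B \<Longrightarrow> \<chi> y = \<chi>' (v y)"
  using dual_exact_iff[OF assms(1-5)] assms(6-8) by blast

section \<open>Character modules\<close>

text \<open>The action is \<open>(\<chi> r)(x) = \<chi>(r x)\<close>, so this is a module over
  \<open>op_ring R\<close>. The group of values is multiplicative: zero is the constant 1 and
  addition is the pointwise product.\<close>

definition char_module :: "('r, 'n) module \<Rightarrow> ('r, 'n \<Rightarrow> complex) module" where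
  "char_module N = \<lparr>carrier = hom (add_monoid N) circle \<inter> extensional (carrier N),
     monoid.mult = undefined, monoid.one = undefined, ring.zero = (\<lambda>x\<in>carrier N. 1),
     ring.add = (\<lambda>\<chi> \<psi>. \<lambda>x\<in>carrier N. \<chi> x * \<psi> x), module.smult = (\<lambda>r \<chi>. \<lambda>x\<in>carrier N. \<chi> (r \<odot>\<^bsub>N\<^esub> x))\<rparr>"

lemma char_module_simps [simp]:
  "\<chi> \<in> carrier (char_module N) \<longleftrightarrow> \<chi> \<in> hom (add_monoid N) circle \<and> \<chi> \<in> extensional (carrier N)"
  "\<zero>\<^bsub>char_module N\<^esub> = (\<lambda>x\<in>carrier N. 1)"
  "\<chi> \<oplus>\<^bsub>char_module N\<^esub> \<psi> = (\<lambda>x\<in>carrier N. \<chi> x * \<psi> x)"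
  "r \<odot>\<^bsub>char_module N\<^esub> \<chi> = (\<lambda>x\<in>carrier N. \<chi> (r \<odot>\<^bsub>N\<^esub> x))"
  by (simp_all add: char_module_def)

lemma add_charI:
  assumes "\<And>x. x \<in> carrier N \<Longrightarrow> cmod (\<chi> x) = 1"
    "\<And>x y. x \<in> carrier N \<Longrightarrow> y \<in> carrier N \<Longrightarrow> \<chi> (x \<oplus>\<^bsub>N\<^esub> y) = \<chi> x * \<chi> y"
  shows "\<chi> \<in> hom (add_monoid N) circle"
  using assms by (intro homI) auto

lemma add_charD:
  assumes "\<chi> \<in> hom (add_monoid N) circle"
  shows "x \<in> carrier N \<Longrightarrow> cmod (\<chi> x) = 1"
    "x \<in> carrier N \<Longrightarrow> y \<in> carrier N \<Longrightarrow> \<chi> (x \<oplus>\<^bsub>N\<^esub> y) = \<chi> x * \<chi> y"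
    "x \<in> carrier N \<Longrightarrow> \<chi> x \<noteq> 0"
  using ghom_closed[OF assms, of x] hom_mult[OF assms, of x y] by auto

lemma add_char_zero:
  assumes "\<chi> \<in> hom (add_monoid M) circle" "lmodule R M" shows "\<chi> \<zero>\<^bsub>M\<^esub> = 1"
proof -
  interpret M: lmodule R M by (rule assms)
  show ?thesis using add_charD(2)[OF assms(1), of "\<zero>\<^bsub>M\<^esub>" "\<zero>\<^bsub>M\<^esub>"] add_charD(3)[OF assms(1), of "\<zero>\<^bsub>M\<^esub>"] by simp
qed

lemma ring_op_ring: "ring R \<Longrightarrow> ring (op_ring R)"
proof -
  assume "ring R"
  then interpret ring R .
  show ?thesis
  proof (rule ringI)
    show "abelian_group (op_ring R)"
    proof (rule abelian_groupI)
      fix x assume "x \<in> carrier (op_ring R)"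
      then show "\<exists>y\<in>carrier (op_ring R). y \<oplus>\<^bsub>op_ring R\<^esub> x = \<zero>\<^bsub>op_ring R\<^esub>"
        by (intro bexI[of _ "\<ominus>\<^bsub>R\<^esub> x"]) (auto simp: l_neg)
    qed (auto simp: a_ac)
    show "monoid (op_ring R)" by (rule monoidI) (auto simp: m_assoc)
  qed (auto simp: l_distr r_distr)
qed

lemma lmodule_char_module:
  assumes N: "lmodule R N" shows "lmodule (op_ring R) (char_module N)"
proof -
  interpret N: lmodule R N by (rule N)
  let ?C = "char_module N"
  note d = add_charD
  have mem: "restrict \<chi> (carrier N) \<in> carrier ?C"
    if "\<And>x. x \<in> carrier N \<Longrightarrow> cmod (\<chi> x) = 1" "\<And>x y. x \<in> carrier N \<Longrightarrow> y \<in> carrier N \<Longrightarrow> \<chi> (x \<oplus>\<^bsub>N\<^esub> y) = \<chi> x * \<chi> y" for \<chi>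
    using that by (auto intro!: add_charI)
  have add: "\<chi> \<oplus>\<^bsub>?C\<^esub> \<psi> \<in> carrier ?C" if "\<chi> \<in> carrier ?C" "\<psi> \<in> carrier ?C" for \<chi> \<psi>
    using that unfolding char_module_simps(3) by (intro mem) (auto simp: norm_mult d)
  have smult: "r \<odot>\<^bsub>?C\<^esub> \<chi> \<in> carrier ?C" if "r \<in> carrier R" "\<chi> \<in> carrier ?C" for r \<chi>
    using that unfolding char_module_simps(4) by (intro mem) (auto simp: d N.smult_r_distr)
  have zero: "\<zero>\<^bsub>?C\<^esub> \<in> carrier ?C" unfolding char_module_simps(2) by (intro mem) auto
  show ?thesis
  proof (intro lmodule.intro lmodule_axioms.intro abelian_groupI ring_op_ring N.R.ring_axioms add zero)
    fix \<chi> assume \<chi>: "\<chi> \<in> carrier ?C"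
    show "\<zero>\<^bsub>?C\<^esub> \<oplus>\<^bsub>?C\<^esub> \<chi> = \<chi>" "\<one>\<^bsub>op_ring R\<^esub> \<odot>\<^bsub>?C\<^esub> \<chi> = \<chi>" using \<chi> by (auto simp: fun_eq_iff extensional_def)
    have "(\<lambda>x\<in>carrier N. inverse (\<chi> x)) \<in> carrier ?C"
      using \<chi> by (intro mem) (auto simp: norm_inverse d)
    then show "\<exists>\<psi>\<in>carrier ?C. \<psi> \<oplus>\<^bsub>?C\<^esub> \<chi> = \<zero>\<^bsub>?C\<^esub>"
      using \<chi> by (intro bexI[of _ "\<lambda>x\<in>carrier N. inverse (\<chi> x)"]) (auto simp: fun_eq_iff d(3))
    fix \<psi> assume \<psi>: "\<psi> \<in> carrier ?C"
    show "\<chi> \<oplus>\<^bsub>?C\<^esub> \<psi> = \<psi> \<oplus>\<^bsub>?C\<^esub> \<chi>" by (auto simp: fun_eq_iff)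
    fix \<theta> assume "\<theta> \<in> carrier ?C"
    show "\<chi> \<oplus>\<^bsub>?C\<^esub> \<psi> \<oplus>\<^bsub>?C\<^esub> \<theta> = \<chi> \<oplus>\<^bsub>?C\<^esub> (\<psi> \<oplus>\<^bsub>?C\<^esub> \<theta>)" by (auto simp: fun_eq_iff)
  next
    fix r \<chi> assume r: "r \<in> carrier (op_ring R)" and \<chi>: "\<chi> \<in> carrier ?C"
    then show "r \<odot>\<^bsub>?C\<^esub> \<chi> \<in> carrier ?C" by (intro smult) simp_all
    fix \<psi> assume \<psi>: "\<psi> \<in> carrier ?C"
    show "r \<odot>\<^bsub>?C\<^esub> (\<chi> \<oplus>\<^bsub>?C\<^esub> \<psi>) = r \<odot>\<^bsub>?C\<^esub> \<chi> \<oplus>\<^bsub>?C\<^esub> r \<odot>\<^bsub>?C\<^esub> \<psi>" using r by (auto simp: fun_eq_iff)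
  next
    fix r r' \<chi> assume r: "r \<in> carrier (op_ring R)" "r' \<in> carrier (op_ring R)" and \<chi>: "\<chi> \<in> carrier ?C"
    show "(r \<oplus>\<^bsub>op_ring R\<^esub> r') \<odot>\<^bsub>?C\<^esub> \<chi> = r \<odot>\<^bsub>?C\<^esub> \<chi> \<oplus>\<^bsub>?C\<^esub> r' \<odot>\<^bsub>?C\<^esub> \<chi>"
      using r \<chi> by (auto simp: fun_eq_iff N.smult_l_distr d(2))
    show "r \<otimes>\<^bsub>op_ring R\<^esub> r' \<odot>\<^bsub>?C\<^esub> \<chi> = r \<odot>\<^bsub>?C\<^esub> (r' \<odot>\<^bsub>?C\<^esub> \<chi>)"
      using r by (auto simp: fun_eq_iff N.smult_assoc1)
  qed
qed

section \<open>Adjunction with characters; flatness as injectivity of the dual\<close>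

context tensor_pair
begin

text \<open>With \<open>hom_of_char\<close> this is the adjunction between characters of
  \<open>U \<otimes> N\<close> and homomorphisms from \<open>U\<close> to the dual of
  \<open>N\<close>; a homomorphism into the dual is exactly a balanced biadditive map to the
  circle.\<close>

lemma char_of_hom:
  assumes f: "f \<in> lmod_hom (op_ring R) U (char_module N)"
  shows "\<exists>\<chi>\<in>hom TG circle. \<forall>u\<in>carrier U. \<forall>y\<in>carrier N. \<chi> (te u y) = f u y"
proof (rule tensor_universal[OF comm_group_circle])
  have fc: "f u \<in> hom (add_monoid N) circle" if "u \<in> carrier U" for u using lmod_hom_closed[OF f that] by simp
  fix u y assume u: "u \<in> carrier U" and y: "y \<in> carrier N"
  show "f u y \<in> carrier circle" using add_charD(1)[OF fc[OF u] y] by simp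
  show "f (u \<oplus>\<^bsub>U\<^esub> u') y = f u y \<otimes>\<^bsub>circle\<^esub> f u' y" if "u' \<in> carrier U" for u'
    using lmod_hom_add[OF f u that] y by simp
  show "f u (y \<oplus>\<^bsub>N\<^esub> y') = f u y \<otimes>\<^bsub>circle\<^esub> f u y'" if "y' \<in> carrier N" for y'
    using add_charD(2)[OF fc[OF u] y that] by simp
  show "f (b \<odot>\<^bsub>U\<^esub> u) y = f u (b \<odot>\<^bsub>N\<^esub> y)" if "b \<in> carrier R" for b
    using lmod_hom_smult[OF f _ u, of b] that y by simp
qed

lemma hom_of_char:
  assumes \<chi>: "\<chi> \<in> hom TG circle"
  shows "(\<lambda>u. \<lambda>y\<in>carrier N. \<chi> (te u y)) \<in> lmod_hom (op_ring R) U (char_module N)"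
proof (rule lmod_homI)
  fix u assume u: "u \<in> carrier U"
  note m = hom_mult[OF \<chi>]
  have "restrict (\<lambda>y. \<chi> (te u y)) (carrier N) \<in> hom (add_monoid N) circle"
    using u ghom_closed[OF \<chi> tens_closed[OF u]] m tens_closed[OF u] tens_add_right[OF u] by (intro add_charI) auto
  then show "(\<lambda>y\<in>carrier N. \<chi> (te u y)) \<in> carrier (char_module N)" by simp
  show "(\<lambda>y\<in>carrier N. \<chi> (te (u \<oplus>\<^bsub>U\<^esub> u') y)) =
      (\<lambda>y\<in>carrier N. \<chi> (te u y)) \<oplus>\<^bsub>char_module N\<^esub> (\<lambda>y\<in>carrier N. \<chi> (te u' y))" if "u' \<in> carrier U" for u'
    using u that m tens_closed tens_add_left by (auto simp: fun_eq_iff)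
  show "(\<lambda>y\<in>carrier N. \<chi> (te (b \<odot>\<^bsub>U\<^esub> u) y)) = b \<odot>\<^bsub>char_module N\<^esub> (\<lambda>y\<in>carrier N. \<chi> (te u y))"
    if "b \<in> carrier (op_ring R)" for b
    using u that tens_balanced by (auto simp: fun_eq_iff)
qed

end

text \<open>Dualizing the complex \<open>P \<otimes> N\<close> preserves and reflects its exactness,
  and by adjunction the dual complex is \<open>Hom(P, -)\<close> applied to the character
  module.\<close>

lemma trivial_Tor_group_iff:
  assumes P: "resolution (op_ring R) \<infinity> U P \<delta> \<epsilon>" and N: "lmodule R N"
  shows "trivial_group (Tor_group R P \<delta> N (Suc j)) \<longleftrightarrow> cochain_exact (op_ring R) P \<delta> (char_module N) j"
proof -
  note r = resolutionD[OF P]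
  have tp: "tensor_pair R (P i) N" for i using r(2) N by (simp add: tensor_pair_def)
  interpret T: tensor_pair R "P i" N for i by (rule tp)
  let ?T = "\<lambda>i. tensor_group R (P i) N"
  define d where "d i = tensor_map R (P i) N (\<delta> i) id" for i
  have idh: "id \<in> lmod_hom R N N" by (simp add: id_def lmod_hom_id)
  have d: "d i \<in> hom (?T (Suc i)) (?T i)" for i unfolding d_def by (rule tensor_map_hom(1)[OF tp tp r(4) idh])
  have dt: "d i (tens R (P (Suc i)) N u y) = tens R (P i) N (\<delta> i u) y" if "u \<in> carrier (P (Suc i))" "y \<in> carrier N" for i u y
    unfolding d_def using tensor_map_hom(2)[OF tp tp r(4) idh that] by simp
  interpret d: group_hom "?T (Suc i)" "?T i" "d i" for i
    by (intro group_hom.intro group_hom_axioms.intro T.TG.group_axioms d)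
  have dd: "d j (d (Suc j) t) = \<one>\<^bsub>?T j\<^esub>" if t: "t \<in> carrier (?T (Suc (Suc j)))" for t
  proof -
    have "(\<lambda>t. d j (d (Suc j) t)) t = (\<lambda>t. \<one>\<^bsub>?T j\<^esub>) t"
    proof (rule T.tensor_hom_eq[OF T.TG.group_axioms _ _ _ t])
      show "(\<lambda>t. d j (d (Suc j) t)) \<in> hom (?T (Suc (Suc j))) (?T j)" by (intro homI) auto
      show "(\<lambda>t. \<one>\<^bsub>?T j\<^esub>) \<in> hom (?T (Suc (Suc j))) (?T j)" by (intro homI) auto
      fix u y assume u: "u \<in> carrier (P (Suc (Suc j)))" and y: "y \<in> carrier N"
      have "d j (d (Suc j) (tens R (P (Suc (Suc j))) N u y)) = tens R (P j) N \<zero>\<^bsub>P j\<^esub> y"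
        using dt u y lmod_hom_closed[OF r(4) u] resolution_complex[OF P u] by simp
      also have "\<dots> = \<one>\<^bsub>?T j\<^esub>"
      proof -
        have z: "tens R (P j) N \<zero>\<^bsub>P j\<^esub> y \<in> carrier (?T j)" using y by (intro T.tens_closed) auto
        have "tens R (P j) N \<zero>\<^bsub>P j\<^esub> y \<otimes>\<^bsub>?T j\<^esub> tens R (P j) N \<zero>\<^bsub>P j\<^esub> y = tens R (P j) N \<zero>\<^bsub>P j\<^esub> y"
          using T.tens_add_left[of "\<zero>\<^bsub>P j\<^esub>" j "\<zero>\<^bsub>P j\<^esub>" y] y by simp
        then show ?thesis using z T.TG.l_cancel_one[OF z z] by simp
      qed
      finally show "d j (d (Suc j) (tens R (P (Suc (Suc j))) N u y)) = \<one>\<^bsub>?T j\<^esub>" .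
    qed
    then show ?thesis .
  qed
  let ?K = "kernel (?T (Suc j)) (?T j) (d j)" and ?B = "d (Suc j) ` carrier (?T (Suc (Suc j)))"
  have B: "subgroup ?B (?T (Suc j))" by (rule d.img_is_subgroup)
  have BK: "?B \<subseteq> ?K" using dd by (auto simp: kernel_def)
  have "trivial_group (Tor_group R P \<delta> N (Suc j)) \<longleftrightarrow> ?K \<subseteq> ?B"
    using trivial_subquotient_iff[OF T.TG.comm_group_axioms d.subgroup_kernel B BK]
    by (simp add: Tor_group_def d_def)
  also have "\<dots> \<longleftrightarrow> (\<forall>\<chi>\<in>hom (?T (Suc j)) circle. (\<forall>t\<in>carrier (?T (Suc (Suc j))). \<chi> (d (Suc j) t) = 1) \<longrightarrow>
      (\<exists>\<chi>'\<in>hom (?T j) circle. \<forall>t\<in>carrier (?T (Suc j)). \<chi> t = \<chi>' (d j t)))"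
    by (rule dual_exact_iff[OF T.TG.comm_group_axioms T.TG.comm_group_axioms T.TG.comm_group_axioms d d])
  also have "\<dots> \<longleftrightarrow> cochain_exact (op_ring R) P \<delta> (char_module N) j"
    unfolding cochain_exact_def
  proof (intro iffI ballI impI)
    fix f assume R: "\<forall>\<chi>\<in>hom (?T (Suc j)) circle. (\<forall>t\<in>carrier (?T (Suc (Suc j))). \<chi> (d (Suc j) t) = 1) \<longrightarrow>
      (\<exists>\<chi>'\<in>hom (?T j) circle. \<forall>t\<in>carrier (?T (Suc j)). \<chi> t = \<chi>' (d j t))"
      and f: "f \<in> lmod_hom (op_ring R) (P (Suc j)) (char_module N)"
      and z: "\<forall>x\<in>carrier (P (Suc (Suc j))). f (\<delta> (Suc j) x) = \<zero>\<^bsub>char_module N\<^esub>"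
    obtain \<chi> where \<chi>: "\<chi> \<in> hom (?T (Suc j)) circle"
      "\<And>u y. u \<in> carrier (P (Suc j)) \<Longrightarrow> y \<in> carrier N \<Longrightarrow> \<chi> (tens R (P (Suc j)) N u y) = f u y"
      using T.char_of_hom[OF f] by blast
    have "(\<lambda>t. \<chi> (d (Suc j) t)) t = (\<lambda>t. 1) t" if t: "t \<in> carrier (?T (Suc (Suc j)))" for t
    proof (rule T.tensor_hom_eq[OF comm_group.axioms(2)[OF comm_group_circle] _ _ _ t])
      show "(\<lambda>t. \<chi> (d (Suc j) t)) \<in> hom (?T (Suc (Suc j))) circle"
        using ghom_closed[OF \<chi>(1)] hom_mult[OF \<chi>(1)] by (intro homI) auto
      show "(\<lambda>t. 1) \<in> hom (?T (Suc (Suc j))) circle" by (intro homI) auto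
      fix u y assume u: "u \<in> carrier (P (Suc (Suc j)))" and y: "y \<in> carrier N"
      show "\<chi> (d (Suc j) (tens R (P (Suc (Suc j))) N u y)) = 1"
        using dt[OF u y] \<chi>(2)[OF lmod_hom_closed[OF r(4) u] y] z u y by simp
    qed
    then obtain \<chi>' where \<chi>': "\<chi>' \<in> hom (?T j) circle" "\<And>t. t \<in> carrier (?T (Suc j)) \<Longrightarrow> \<chi> t = \<chi>' (d j t)" using R \<chi>(1) by blast
    have "f u = (\<lambda>y\<in>carrier N. \<chi>' (tens R (P j) N (\<delta> j u) y))" if u: "u \<in> carrier (P (Suc j))" for u
    proof
      fix y
      show "f u y = (\<lambda>y\<in>carrier N. \<chi>' (tens R (P j) N (\<delta> j u) y)) y"
      proof (cases "y \<in> carrier N")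
        case True
        then show ?thesis using \<chi>(2)[OF u True] \<chi>'(2)[OF T.tens_closed[OF u True]] dt[OF u True] by simp
      qed (use lmod_hom_closed[OF f u] in \<open>auto simp: extensional_def\<close>)
    qed
    then show "\<exists>h\<in>lmod_hom (op_ring R) (P j) (char_module N). \<forall>x\<in>carrier (P (Suc j)). f x = h (\<delta> j x)"
      by (intro bexI[OF _ T.hom_of_char[OF \<chi>'(1)]]) blast
  next
    fix \<chi> assume ce: "\<forall>f\<in>lmod_hom (op_ring R) (P (Suc j)) (char_module N).
        (\<forall>x\<in>carrier (P (Suc (Suc j))). f (\<delta> (Suc j) x) = \<zero>\<^bsub>char_module N\<^esub>) \<longrightarrow>
        (\<exists>h\<in>lmod_hom (op_ring R) (P j) (char_module N). \<forall>x\<in>carrier (P (Suc j)). f x = h (\<delta> j x))"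
      and \<chi>: "\<chi> \<in> hom (?T (Suc j)) circle" and z: "\<forall>t\<in>carrier (?T (Suc (Suc j))). \<chi> (d (Suc j) t) = 1"
    let ?f = "\<lambda>u. \<lambda>y\<in>carrier N. \<chi> (tens R (P (Suc j)) N u y)"
    have fz: "?f (\<delta> (Suc j) x) = \<zero>\<^bsub>char_module N\<^esub>" if x: "x \<in> carrier (P (Suc (Suc j)))" for x
    proof -
      have "\<chi> (tens R (P (Suc j)) N (\<delta> (Suc j) x) y) = 1" if "y \<in> carrier N" for y
        using dt[OF x that] z T.tens_closed[OF x that] by metis
      then show "?f (\<delta> (Suc j) x) = \<zero>\<^bsub>char_module N\<^esub>" by (auto simp: fun_eq_iff)
    qed
    then obtain h where h: "h \<in> lmod_hom (op_ring R) (P j) (char_module N)"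
      "\<And>x. x \<in> carrier (P (Suc j)) \<Longrightarrow> ?f x = h (\<delta> j x)"
      using bspec[OF ce T.hom_of_char[OF \<chi>]] fz by blast
    obtain \<chi>' where \<chi>': "\<chi>' \<in> hom (?T j) circle"
      "\<And>u y. u \<in> carrier (P j) \<Longrightarrow> y \<in> carrier N \<Longrightarrow> \<chi>' (tens R (P j) N u y) = h u y"
      using T.char_of_hom[OF h(1)] by blast
    have "\<chi> t = (\<lambda>t. \<chi>' (d j t)) t" if t: "t \<in> carrier (?T (Suc j))" for t
    proof (rule T.tensor_hom_eq[OF comm_group.axioms(2)[OF comm_group_circle] \<chi> _ _ t])
      show "(\<lambda>t. \<chi>' (d j t)) \<in> hom (?T (Suc j)) circle"
        using ghom_closed[OF \<chi>'(1)] hom_mult[OF \<chi>'(1)] by (intro homI) auto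
      fix u y assume u: "u \<in> carrier (P (Suc j))" and y: "y \<in> carrier N"
      show "\<chi> (tens R (P (Suc j)) N u y) = \<chi>' (d j (tens R (P (Suc j)) N u y))"
        using dt[OF u y] \<chi>'(2)[OF lmod_hom_closed[OF r(4) u] y] fun_cong[OF h(2)[OF u], of y] y by simp
    qed
    then show "\<exists>\<chi>'\<in>hom (?T j) circle. \<forall>t\<in>carrier (?T (Suc j)). \<chi> t = \<chi>' (d j t)" using \<chi>'(1) by blast
  qed
  finally show ?thesis .
qed

text \<open>Both notions test the same modules \<open>U\<close> and resolutions of the same type, so
  the equivalence of Tor and Ext can be applied resolution by resolution.\<close>

lemma nd_flat_iff: "nd_flat R n d N \<longleftrightarrow> lmodule R N \<and> nd_injective (op_ring R) n d (char_module N)"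
proof (cases "lmodule R N")
  case True
  note C = lmodule_char_module[OF True]
  have "Tor_zero R U N (Suc d) \<longleftrightarrow> Ext_zero (op_ring R) U (char_module N) (Suc d)" for U :: "('a, nat \<Rightarrow> 'a) module"
    unfolding Ext_zero_iff[OF C] Tor_zero_def projective_resolution_def using trivial_Tor_group_iff[OF _ True] by blast
  then show ?thesis using True C by (simp add: nd_flat_def nd_injective_def)
qed (simp add: nd_flat_def)

text \<open>Injectivity on the left is surjectivity of \<open>\<pi>\<close>, exactness in the middle
  is \<open>char_factor\<close>, and surjectivity on the right is extension of characters from the
  image of \<open>\<iota>\<close>.\<close>

lemma short_exact_char_module:
  assumes ex: "short_exact R A B C \<iota> \<pi>"
  shows "short_exact (op_ring R) (char_module C) (char_module B) (char_module A)
    (\<lambda>\<chi>. \<lambda>b\<in>carrier B. \<chi> (\<pi> b)) (\<lambda>\<chi>. \<lambda>a\<in>carrier A. \<chi> (\<iota> a))"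
proof -
  note x = short_exactD[OF ex]
  interpret A: lmodule R A by fact
  interpret B: lmodule R B by fact
  interpret C: lmodule R C by fact
  have pull: "(\<lambda>\<chi>. \<lambda>m\<in>carrier M. \<chi> (f m)) \<in> lmod_hom (op_ring R) (char_module N) (char_module M)"
    if M: "lmodule R M" and f: "f \<in> lmod_hom R M N" for M :: "('a, 'x) module" and N :: "('a, 'y) module" and f
  proof -
    interpret M: lmodule R M by (rule M)
    note fc = lmod_hom_closed[OF f]
    show ?thesis
      by (intro lmod_homI)
        (auto intro!: add_charI simp: fun_eq_iff fc add_charD lmod_hom_add[OF f] lmod_hom_smult[OF f])
  qed
  interpret Bg: abelian_characters "add_monoid B" by (intro abelian_characters.intro B.M.a_comm_group)
  have \<pi>g: "\<pi> \<in> hom (add_monoid B) (add_monoid C)"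
    by (intro homI) (auto simp: lmod_hom_closed[OF x(5)] lmod_hom_add[OF x(5)])
  have \<iota>g: "\<iota> \<in> hom (add_monoid A) (add_monoid B)"
    by (intro homI) (auto simp: lmod_hom_closed[OF x(4)] lmod_hom_add[OF x(4)])
  show ?thesis
  proof (rule short_exactI[OF lmodule_char_module[OF x(3)] lmodule_char_module[OF x(2)] lmodule_char_module[OF x(1)]
        pull[OF x(2,5)] pull[OF x(1,4)]])
    fix \<chi> assume \<chi>: "\<chi> \<in> carrier (char_module C)"
    show "(\<lambda>a\<in>carrier A. (\<lambda>b\<in>carrier B. \<chi> (\<pi> b)) (\<iota> a)) = \<zero>\<^bsub>char_module A\<^esub>"
      using \<chi> x(7) lmod_hom_closed[OF x(4)] add_char_zero[OF _ x(3)] by (auto simp: fun_eq_iff)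
    assume z: "(\<lambda>b\<in>carrier B. \<chi> (\<pi> b)) = \<zero>\<^bsub>char_module B\<^esub>"
    have "\<chi> c = 1" if c: "c \<in> carrier C" for c
    proof -
      obtain b where b: "b \<in> carrier B" "c = \<pi> b" using x(9)[OF c] by blast
      show ?thesis using fun_cong[OF z, of b] b by simp
    qed
    then show "\<chi> = \<zero>\<^bsub>char_module C\<^esub>" using \<chi> by (auto simp: fun_eq_iff extensional_def)
  next
    fix \<chi> assume \<chi>: "\<chi> \<in> carrier (char_module B)" and z: "(\<lambda>a\<in>carrier A. \<chi> (\<iota> a)) = \<zero>\<^bsub>char_module A\<^esub>"
    have k: "kernel (add_monoid B) (add_monoid C) \<pi> \<subseteq> \<iota> ` carrier (add_monoid A)"
      using x(8) by (force simp: kernel_def)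
    have \<chi>h: "\<chi> \<in> hom (add_monoid B) circle" using \<chi> by simp
    have "\<chi> (\<iota> a) = 1" if "a \<in> carrier (add_monoid A)" for a using fun_cong[OF z, of a] that by simp
    from char_factor[OF A.M.a_comm_group B.M.a_comm_group C.M.a_comm_group \<iota>g \<pi>g k \<chi>h this] obtain \<chi>' where
      \<chi>': "\<chi>' \<in> hom (add_monoid C) circle" "\<And>y. y \<in> carrier B \<Longrightarrow> \<chi> y = \<chi>' (\<pi> y)" by auto
    have "restrict \<chi>' (carrier C) \<in> carrier (char_module C)"
      using add_charD[OF \<chi>'(1)] by (auto intro!: add_charI)
    moreover have "\<chi> = (\<lambda>b\<in>carrier B. restrict \<chi>' (carrier C) (\<pi> b))"
      using \<chi> \<chi>'(2) lmod_hom_closed[OF x(5)] by (auto simp: fun_eq_iff extensional_def)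
    ultimately show "\<exists>\<chi>'\<in>carrier (char_module C). \<chi> = (\<lambda>b\<in>carrier B. \<chi>' (\<pi> b))" by blast
  next
    fix \<chi> assume \<chi>: "\<chi> \<in> carrier (char_module A)"
    let ?k = "inv_into (carrier A) \<iota>"
    have k: "?k (\<iota> a) = a" if "a \<in> carrier A" for a using x(6) that by (rule inv_into_f_f)
    have sub: "subgroup (\<iota> ` carrier A) (add_monoid B)"
      using group_hom.img_is_subgroup[OF group_hom.intro[OF A.M.a_group B.M.a_group group_hom_axioms.intro[OF \<iota>g]]] by simp
    have "\<exists>\<chi>'\<in>hom (add_monoid B) circle. \<forall>y\<in>\<iota> ` carrier A. \<chi>' y = \<chi> (?k y)"
    proof (rule Bg.char_extend[OF sub])
      fix y assume "y \<in> \<iota> ` carrier A"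
      then obtain a where a: "a \<in> carrier A" "y = \<iota> a" by blast
      show "cmod (\<chi> (?k y)) = 1" using \<chi> a k add_charD(1) by auto
      fix y' assume "y' \<in> \<iota> ` carrier A"
      then obtain a' where a': "a' \<in> carrier A" "y' = \<iota> a'" by blast
      have "y \<otimes>\<^bsub>add_monoid B\<^esub> y' = \<iota> (a \<oplus>\<^bsub>A\<^esub> a')" using a a' by (simp add: lmod_hom_add[OF x(4)])
      then show "\<chi> (?k (y \<otimes>\<^bsub>add_monoid B\<^esub> y')) = \<chi> (?k y) * \<chi> (?k y')"
        using \<chi> a a' k add_charD(2)[of \<chi> A a a'] by simp
    qed
    then obtain \<chi>' where \<chi>': "\<chi>' \<in> hom (add_monoid B) circle" "\<And>a. a \<in> carrier A \<Longrightarrow> \<chi>' (\<iota> a) = \<chi> a" using k by auto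
    have "restrict \<chi>' (carrier B) \<in> carrier (char_module B)"
      using add_charD[OF \<chi>'(1)] by (auto intro!: add_charI)
    moreover have "\<chi> = (\<lambda>a\<in>carrier A. restrict \<chi>' (carrier B) (\<iota> a))"
      using \<chi> \<chi>'(2) lmod_hom_closed[OF x(4)] by (auto simp: fun_eq_iff extensional_def)
    ultimately show "\<exists>\<chi>'\<in>carrier (char_module B). \<chi> = (\<lambda>a\<in>carrier A. \<chi>' (\<iota> a))" by blast
  qed
qed

section \<open>The dual of \<open>Hom(K, N)\<close> as a tensor product\<close>

lemma finsum_char_module:
  fixes R :: "'r ring" and N :: "('r, 'n) module"
  assumes N: "lmodule R N" and "finite A" "h \<in> A \<rightarrow> carrier (char_module N)" and y: "y \<in> carrier N"
  shows "(\<Oplus>\<^bsub>char_module N\<^esub>x\<in>A. h x) y = (\<Prod>x\<in>A. h x y)"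
proof -
  interpret C: lmodule "op_ring R" "char_module N" by (rule lmodule_char_module[OF N])
  show ?thesis using assms(2,3)
  proof (induction A rule: finite_induct)
    case empty
    then show ?case using y by simp
  next
    case (insert x A)
    have "h \<in> A \<rightarrow> carrier (char_module N)" "h x \<in> carrier (char_module N)" using insert.prems by auto
    then show ?case using C.M.finsum_insert[OF insert.hyps] insert y by (simp only: char_module_simps(3)) simp
  qed
qed

lemma single_zero: "single M i \<zero>\<^bsub>M\<^esub> = (\<lambda>_. \<zero>\<^bsub>M\<^esub>)"
  by (auto simp: single_def)

lemma char_single:
  fixes T :: "'t ring" and M :: "('t, 'm) module"
  assumes M: "lmodule T M" and \<Psi>: "\<Psi> \<in> hom (add_monoid (pow_mod M m)) circle" and i: "i < m"
  shows "(\<lambda>x\<in>carrier M. \<Psi> (single M i x)) \<in> carrier (char_module M)"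
proof -
  interpret M: lmodule T M by (rule M)
  note s = lmod_hom_closed[OF single_hom[OF M i]]
  have "restrict (\<lambda>x. \<Psi> (single M i x)) (carrier M) \<in> hom (add_monoid M) circle"
  proof (rule add_charI)
    fix x y assume x: "x \<in> carrier M" and y: "y \<in> carrier M"
    show "cmod (restrict (\<lambda>x. \<Psi> (single M i x)) (carrier M) x) = 1" using add_charD(1)[OF \<Psi> s[OF x]] x by simp
    show "restrict (\<lambda>x. \<Psi> (single M i x)) (carrier M) (x \<oplus>\<^bsub>M\<^esub> y) =
        restrict (\<lambda>x. \<Psi> (single M i x)) (carrier M) x * restrict (\<lambda>x. \<Psi> (single M i x)) (carrier M) y"
      using add_charD(2)[OF \<Psi> s[OF x] s[OF y]] lmod_hom_add[OF single_hom[OF M i] x y] x y by simp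
  qed
  then show ?thesis by simp
qed

text \<open>The dual of a power is the power of the dual: a tuple is the sum of its single entries,
  and a character turns the sum into a product.\<close>

lemma char_pow_mod:
  fixes T :: "'t ring" and M :: "('t, 'm) module"
  assumes M: "lmodule T M" and \<Psi>: "\<Psi> \<in> hom (add_monoid (pow_mod M m)) circle" and v: "v \<in> carrier (pow_mod M m)"
  shows "\<Psi> v = (\<Prod>x<m. \<Psi> (single M x (v x)))"
  using M v
proof (induction rule: pow_mod_induct)
  case zero
  then show ?case using add_char_zero[OF \<Psi> lmodule_pow_mod[OF M]] by (simp add: single_zero)
next
  case (single i n)
  have "(\<Prod>x<m. \<Psi> (single M x (single M i n x))) = (\<Prod>x<m. if x = i then \<Psi> (single M i n) else 1)"
    using add_char_zero[OF \<Psi> lmodule_pow_mod[OF M]] by (intro prod.cong) (auto simp: single_zero single_def)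
  then show ?case using single(1) by (simp add: prod.delta)
next
  case (add u w)
  have "\<Psi> (single M x ((u \<oplus>\<^bsub>pow_mod M m\<^esub> w) x)) = \<Psi> (single M x (u x)) * \<Psi> (single M x (w x))" if x: "x < m" for x
  proof -
    note s = lmod_hom_closed[OF single_hom[OF M x]]
    have c: "u x \<in> carrier M" "w x \<in> carrier M" using add(1,2) x by auto
    show ?thesis using lmod_hom_add[OF single_hom[OF M x] c] add_charD(2)[OF \<Psi> s[OF c(1)] s[OF c(2)]] by simp
  qed
  then have "(\<Prod>x<m. \<Psi> (single M x ((u \<oplus>\<^bsub>pow_mod M m\<^esub> w) x))) = \<Psi> u * \<Psi> w"
    using add(3,4) by (simp add: prod.distrib del: pow_mod_simps)
  then show ?case using add_charD(2)[OF \<Psi> add(1,2)] by simp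
qed

text \<open>The columns of \<open>a 0\<close> generate the relations among the \<open>g x\<close>,
  so values that satisfy them extend to \<open>K\<close>. The matrix belongs to the swapped bimodule
  and therefore resolves \<open>K\<close> as a left \<open>S\<close>-module.\<close>

lemma hom_from_generators:
  fixes K :: "('s, 'r, 'k) bimod"
  assumes mr: "matrix_resolution (op_ring R) (op_ring S) (swap K) m g a" and K: "bimodule S R K"
    and N: "lmodule S N" and v: "v \<in> carrier (pow_mod N (m 0))"
    and z: "\<And>y. y < m 1 \<Longrightarrow> (\<Oplus>\<^bsub>N\<^esub>x\<in>{..<m 0}. a 0 x y \<odot>\<^bsub>N\<^esub> v x) = \<zero>\<^bsub>N\<^esub>"
  shows "\<exists>\<phi>\<in>lmod_hom S (left_mod K) N. \<forall>x<m 0. \<phi> (g x) = v x"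
proof -
  interpret mr: matrix_resolution "op_ring R" "op_ring S" "swap K" m g a by (rule mr)
  interpret N: lmodule S N by (rule N)
  interpret L: lmodule S "left_mod K" using K by (simp add: bimodule_def)
  let ?B = "fpow S (m 0)" and ?X = "{..<m 0}"
  have B: "lmodule S ?B" by (rule lmodule_fpow[OF N])
  interpret B: lmodule S ?B by (rule B)
  have gc: "g \<in> ?X \<rightarrow> carrier (left_mod K)" using mr.g_closed by auto
  have vc: "v \<in> ?X \<rightarrow> carrier N" using v by auto
  let ?q = "lin_ext S ?X (left_mod K) g" and ?f = "lin_ext S ?X N v"
  have q: "?q \<in> lmod_hom S ?B (left_mod K)" by (rule lin_ext_hom[OF L.lmodule_axioms gc])
  have f: "?f \<in> lmod_hom S ?B N" by (rule lin_ext_hom[OF N vc])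
  have sc: "r x \<odot>\<^bsub>K\<^esub> g x \<in> carrier K" if "r \<in> ?X \<rightarrow> carrier S" "x < m 0" for r x
    using L.smult_closed[of "r x" "g x"] that gc by auto
  have gs: "(\<Oplus>\<^bsub>right_mod K\<^esub>x\<in>?X. r x \<odot>\<^bsub>K\<^esub> g x) = (\<Oplus>\<^bsub>left_mod K\<^esub>x\<in>?X. r x \<odot>\<^bsub>K\<^esub> g x)"
    if "r \<in> ?X \<rightarrow> carrier S" for r
    using sc[OF that] by (intro finsum_right_mod[OF K]) auto
  have qe: "?q u = (\<Oplus>\<^bsub>left_mod K\<^esub>x\<in>?X. u x \<odot>\<^bsub>K\<^esub> g x)" if "u \<in> carrier ?B" for u
    using lin_ext_superset[OF L.lmodule_axioms gc that, of ?X] that by (force simp: fpow_carrier linorder_not_less[symmetric])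
  have fe: "?f u = (\<Oplus>\<^bsub>N\<^esub>x\<in>?X. u x \<odot>\<^bsub>N\<^esub> v x)" if "u \<in> carrier ?B" for u
    using lin_ext_superset[OF N vc that, of ?X] that by (force simp: fpow_carrier linorder_not_less[symmetric])
  have uc: "u \<in> ?X \<rightarrow> carrier S" if "u \<in> carrier ?B" for u using that by (auto simp: fpow_carrier)
  have "\<exists>\<phi>\<in>lmod_hom S (left_mod K) N. \<forall>u\<in>carrier ?B. \<phi> (?q u) = ?f u"
  proof (rule hom_factor[OF B L.lmodule_axioms N q _ f])
    show "?q ` carrier ?B = carrier (left_mod K)"
    proof
      show "?q ` carrier ?B \<subseteq> carrier (left_mod K)" using lmod_hom_closed[OF q] by blast
      show "carrier (left_mod K) \<subseteq> ?q ` carrier ?B"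
      proof
        fix k assume "k \<in> carrier (left_mod K)"
        then obtain r where r: "r \<in> ?X \<rightarrow> carrier S" "k = (\<Oplus>\<^bsub>right_mod K\<^esub>x\<in>?X. r x \<odot>\<^bsub>K\<^esub> g x)"
          using mr.generators[of k] by auto
        let ?u = "\<lambda>x. if x < m 0 then r x else \<zero>\<^bsub>S\<^esub>"
        have u: "?u \<in> carrier ?B" using r(1) by (auto simp: fpow_carrier)
        have "?q ?u = k" unfolding qe[OF u] r(2) gs[OF r(1)]
          using sc[OF r(1)] by (intro L.M.finsum_cong') auto
        then show "k \<in> ?q ` carrier ?B" using u by blast
      qed
    qed
    fix u assume u: "u \<in> carrier ?B" and z0: "?q u = \<zero>\<^bsub>left_mod K\<^esub>"
    have "(\<Oplus>\<^bsub>right_mod K\<^esub>x\<in>?X. u x \<odot>\<^bsub>K\<^esub> g x) = \<zero>\<^bsub>K\<^esub>"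
      using z0 qe[OF u] gs[OF uc[OF u]] by simp
    \<comment> \<open>Products in \<open>op_ring S\<close> are reversed, so the coefficients of the
      relations stand on the left, as is right for a left module.\<close>
    then obtain q where q: "q \<in> {..<m 1} \<rightarrow> carrier S" "\<And>x. x < m 0 \<Longrightarrow> u x = (\<Oplus>\<^bsub>S\<^esub>y\<in>{..<m 1}. q y \<otimes>\<^bsub>S\<^esub> a 0 x y)"
      using mr.relations[of u] uc[OF u] by (auto simp: finsum_op_ring)
    let ?r = "\<lambda>y x. if x < m 0 then a 0 x y else \<zero>\<^bsub>S\<^esub>"
    have ac: "a 0 x y \<in> carrier S" if "x < m 0" "y < m 1" for x y using mr.a_closed[of x 0 y] that by simp
    have r: "?r y \<in> carrier ?B" if "y < m 1" for y using ac that by (auto simp: fpow_carrier)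
    have qr: "(\<lambda>y. q y \<odot>\<^bsub>?B\<^esub> ?r y) \<in> {..<m 1} \<rightarrow> carrier ?B" using q(1) r by auto
    have "u = (\<Oplus>\<^bsub>?B\<^esub>y\<in>{..<m 1}. q y \<odot>\<^bsub>?B\<^esub> ?r y)"
    proof
      fix x
      show "u x = (\<Oplus>\<^bsub>?B\<^esub>y\<in>{..<m 1}. q y \<odot>\<^bsub>?B\<^esub> ?r y) x"
      proof (cases "x < m 0")
        case True
        have "(\<Oplus>\<^bsub>S\<^esub>y\<in>{..<m 1}. (q y \<odot>\<^bsub>?B\<^esub> ?r y) x) = (\<Oplus>\<^bsub>S\<^esub>y\<in>{..<m 1}. q y \<otimes>\<^bsub>S\<^esub> a 0 x y)"
          using q(1) ac[OF True] True by (intro N.R.finsum_cong') (auto simp: free_module_simps)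
        then show ?thesis using finsum_fpow_nth[OF B _ qr] q(2)[OF True] by simp
      next
        case False
        have "(\<Oplus>\<^bsub>?B\<^esub>y\<in>{..<m 1}. q y \<odot>\<^bsub>?B\<^esub> ?r y) \<in> carrier ?B" by (rule B.M.finsum_closed[OF qr])
        then show ?thesis using u False by (simp add: fpow_carrier)
      qed
    qed
    then have "?f u = (\<Oplus>\<^bsub>N\<^esub>y\<in>{..<m 1}. ?f (q y \<odot>\<^bsub>?B\<^esub> ?r y))"
      using lmod_hom_finsum[OF B N f _ qr] by simp
    also have "\<dots> = (\<Oplus>\<^bsub>N\<^esub>y\<in>{..<m 1}. \<zero>\<^bsub>N\<^esub>)"
    proof (rule N.M.finsum_cong')
      fix y assume "y \<in> {..<m 1}"
      then have y: "y < m 1" by simp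
      have "?f (?r y) = (\<Oplus>\<^bsub>N\<^esub>x\<in>?X. a 0 x y \<odot>\<^bsub>N\<^esub> v x)"
        unfolding fe[OF r[OF y]] using ac[OF _ y] vc by (intro N.M.finsum_cong') auto
      then show "?f (q y \<odot>\<^bsub>?B\<^esub> ?r y) = \<zero>\<^bsub>N\<^esub>"
        using lmod_hom_smult[OF f _ r[OF y], of "q y"] q(1) y z[OF y] N.smult_zero_right[of "q y"] by auto
    qed auto
    finally show "?f u = \<zero>\<^bsub>N\<^esub>" by simp
  qed
  then obtain \<phi> where \<phi>: "\<phi> \<in> lmod_hom S (left_mod K) N" "\<And>u. u \<in> carrier ?B \<Longrightarrow> \<phi> (?q u) = ?f u" by blast
  have "\<phi> (g x) = v x" if x: "x < m 0" for x
    using \<phi>(2)[OF unit_vec_carrier[OF N.R.ring_axioms, of x ?X]] lin_ext_unit_vec[OF L.lmodule_axioms gc, of x]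
      lin_ext_unit_vec[OF N vc, of x] x by simp
  then show ?thesis using \<phi>(1) by blast
qed

text \<open>For finitely presented \<open>K\<close>, the functor \<open>Hom(K, -)\<close> is a kernel of powers, and its character dual is
  therefore the cokernel of the dual powers, that is, a tensor product.\<close>

lemma tensor_char_iso:
  fixes K :: "('s, 'r, 'k) bimod" and N :: "('s, 'n) module"
  assumes mr: "matrix_resolution (op_ring R) (op_ring S) (swap K) m g a" and K: "bimodule S R K"
    and R: "ring R" and N: "lmodule S N"
  shows "\<exists>\<theta>\<in>lmod_hom (op_ring R) (tensor_module (op_ring S) (swap K) (char_module N)) (char_module (Hom_module S K N)).
    bij_betw \<theta> (carrier (tensor_module (op_ring S) (swap K) (char_module N))) (carrier (char_module (Hom_module S K N))) \<and>
    (\<forall>k\<in>carrier K. \<forall>\<chi>\<in>carrier (char_module N).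
      \<theta> (pure (op_ring S) (swap K) (char_module N) k \<chi>) = (\<lambda>\<phi>\<in>carrier (Hom_module S K N). \<chi> (\<phi> k)))"
proof -
  let ?C = "char_module N" and ?H = "Hom_module S K N"
  note C = lmodule_char_module[OF N]
  have H: "lmodule R ?H" by (rule lmodule_Hom_module[OF K R N])
  note CH = lmodule_char_module[OF H]
  interpret D: matrix_resolution_tensor "op_ring R" "op_ring S" "swap K" m g a ?C
    using mr C bimodule_swap[OF K] by (simp add: matrix_resolution_tensor_def bimod_tensor_def)
  interpret N: lmodule S N by (rule N)
  interpret H: lmodule R ?H by (rule H)
  interpret L: lmodule S "left_mod K" using K by (simp add: bimodule_def)
  have Hc: "\<phi> k \<in> carrier N" if "\<phi> \<in> carrier ?H" "k \<in> carrier K" for \<phi> k using lmod_hom_closed that by force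
  have Ha: "\<phi> (k \<oplus>\<^bsub>K\<^esub> k') = \<phi> k \<oplus>\<^bsub>N\<^esub> \<phi> k'" if "\<phi> \<in> carrier ?H" "k \<in> carrier K" "k' \<in> carrier K" for \<phi> k k'
    using lmod_hom_add[of \<phi> S "left_mod K" N k k'] that by simp
  have Hs: "\<phi> (s \<odot>\<^bsub>K\<^esub> k) = s \<odot>\<^bsub>N\<^esub> \<phi> k" if "\<phi> \<in> carrier ?H" "s \<in> carrier S" "k \<in> carrier K" for \<phi> k s
    using lmod_hom_smult[of \<phi> S "left_mod K" N s k] that by simp
  note Hclosed = H.M.a_closed H.smult_closed
  have "\<exists>\<theta>\<in>lmod_hom (op_ring R) D.X (char_module ?H). \<forall>k\<in>carrier (swap K). \<forall>\<chi>\<in>carrier ?C.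
      \<theta> (D.pu k \<chi>) = (\<lambda>\<phi>\<in>carrier ?H. \<chi> (\<phi> k))"
  proof (rule D.X_hom[OF CH])
    fix k \<chi> assume "k \<in> carrier (swap K)" and \<chi>: "\<chi> \<in> carrier ?C"
    then have k: "k \<in> carrier K" and \<chi>h: "\<chi> \<in> hom (add_monoid N) circle" by auto
    note \<chi>d = add_charD[OF \<chi>h]
    have "restrict (\<lambda>\<phi>. \<chi> (\<phi> k)) (carrier ?H) \<in> hom (add_monoid ?H) circle"
    proof (rule add_charI)
      fix \<phi> \<phi>' assume \<phi>: "\<phi> \<in> carrier ?H" "\<phi>' \<in> carrier ?H"
      show "cmod (restrict (\<lambda>\<phi>. \<chi> (\<phi> k)) (carrier ?H) \<phi>) = 1" using \<phi> \<chi>d(1) Hc[OF _ k] by simp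
      show "restrict (\<lambda>\<phi>. \<chi> (\<phi> k)) (carrier ?H) (\<phi> \<oplus>\<^bsub>?H\<^esub> \<phi>') =
          restrict (\<lambda>\<phi>. \<chi> (\<phi> k)) (carrier ?H) \<phi> * restrict (\<lambda>\<phi>. \<chi> (\<phi> k)) (carrier ?H) \<phi>'"
        using \<phi> k \<chi>d(2)[OF Hc[OF \<phi>(1) k] Hc[OF \<phi>(2) k]] H.M.a_closed[OF \<phi>] by (simp only: restrict_apply' Hom_module_simps(3))
    qed
    then show "(\<lambda>\<phi>\<in>carrier ?H. \<chi> (\<phi> k)) \<in> carrier (char_module ?H)" by simp
    show "(\<lambda>\<phi>\<in>carrier ?H. \<chi> (\<phi> (k \<oplus>\<^bsub>swap K\<^esub> k'))) =
        (\<lambda>\<phi>\<in>carrier ?H. \<chi> (\<phi> k)) \<oplus>\<^bsub>char_module ?H\<^esub> (\<lambda>\<phi>\<in>carrier ?H. \<chi> (\<phi> k'))" if k': "k' \<in> carrier (swap K)" for k'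
    proof -
      have "\<chi> (\<phi> (k \<oplus>\<^bsub>K\<^esub> k')) = \<chi> (\<phi> k) * \<chi> (\<phi> k')" if "\<phi> \<in> carrier ?H" for \<phi>
        using \<chi>d(2)[OF Hc[OF that k] Hc[OF that, of k']] Ha[OF that k, of k'] k' by simp
      then show ?thesis by (auto simp: fun_eq_iff simp del: Hom_module_simps)
    qed
    show "(\<lambda>\<phi>\<in>carrier ?H. (\<chi> \<oplus>\<^bsub>?C\<^esub> \<chi>') (\<phi> k)) =
        (\<lambda>\<phi>\<in>carrier ?H. \<chi> (\<phi> k)) \<oplus>\<^bsub>char_module ?H\<^esub> (\<lambda>\<phi>\<in>carrier ?H. \<chi>' (\<phi> k))" if "\<chi>' \<in> carrier ?C" for \<chi>'
      using k Hc by (auto simp: fun_eq_iff simp del: Hom_module_simps)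
    show "(\<lambda>\<phi>\<in>carrier ?H. \<chi> (\<phi> (rsmult (swap K) k s))) = (\<lambda>\<phi>\<in>carrier ?H. (s \<odot>\<^bsub>?C\<^esub> \<chi>) (\<phi> k))"
      if "s \<in> carrier (op_ring S)" for s
      using k that Hc Hs by (auto simp: fun_eq_iff simp del: Hom_module_simps)
    show "(\<lambda>\<phi>\<in>carrier ?H. \<chi> (\<phi> (r \<odot>\<^bsub>swap K\<^esub> k))) = r \<odot>\<^bsub>char_module ?H\<^esub> (\<lambda>\<phi>\<in>carrier ?H. \<chi> (\<phi> k))"
      if "r \<in> carrier (op_ring R)" for r
    proof -
      have "(r \<odot>\<^bsub>?H\<^esub> \<phi>) k = \<phi> (rsmult K k r)" for \<phi> using k by simp
      then show ?thesis using that H.smult_closed[of r] by (auto simp: fun_eq_iff simp del: Hom_module_simps)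
    qed
  qed
  then obtain \<theta> where \<theta>: "\<theta> \<in> lmod_hom (op_ring R) D.X (char_module ?H)"
    "\<And>k \<chi>. k \<in> carrier K \<Longrightarrow> \<chi> \<in> carrier ?C \<Longrightarrow> \<theta> (D.pu k \<chi>) = (\<lambda>\<phi>\<in>carrier ?H. \<chi> (\<phi> k))" by auto
  have gc: "g x \<in> carrier K" if "x < m 0" for x using D.g_closed[OF that] by simp
  have ac: "a 0 x y \<in> carrier S" if "x < m 0" "y < m 1" for x y using D.a_closed[of x 0 y] that by simp
  let ?N0 = "pow_mod N (m 0)" and ?N1 = "pow_mod N (m 1)"
  \<comment> \<open>\<open>E\<close> and \<open>A\<close> realise
    \<open>0 -> Hom(K, N) -> N^(m 0) -> N^(m 1)\<close>: the values at the generators, followed by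
    the relations that they must satisfy.\<close>
  define E where "E \<phi> = (\<lambda>x. if x < m 0 then \<phi> (g x) else \<zero>\<^bsub>N\<^esub>)" for \<phi> :: "'k \<Rightarrow> 'n"
  define A where "A v = (\<lambda>y. if y < m 1 then \<Oplus>\<^bsub>N\<^esub>x\<in>{..<m 0}. a 0 x y \<odot>\<^bsub>N\<^esub> v x else \<zero>\<^bsub>N\<^esub>)" for v :: "nat \<Rightarrow> 'n"
  have Ec: "E \<phi> \<in> carrier ?N0" if "\<phi> \<in> carrier ?H" for \<phi> using Hc[OF that] gc by (simp add: E_def)
  have E: "E \<in> hom (add_monoid ?H) (add_monoid ?N0)"
    using gc Ec by (intro homI) (auto simp: E_def fun_eq_iff)
  have A: "A \<in> hom (add_monoid ?N0) (add_monoid ?N1)"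
  proof (rule homI)
    fix v w assume v: "v \<in> carrier (add_monoid ?N0)" and w: "w \<in> carrier (add_monoid ?N0)"
    then have vc: "v x \<in> carrier N" "w x \<in> carrier N" if "x < m 0" for x using that by auto
    show "A v \<in> carrier (add_monoid ?N1)" using ac vc by (auto simp: A_def intro!: N.M.finsum_closed)
    have "(\<Oplus>\<^bsub>N\<^esub>x\<in>{..<m 0}. a 0 x y \<odot>\<^bsub>N\<^esub> (v x \<oplus>\<^bsub>N\<^esub> w x)) =
        (\<Oplus>\<^bsub>N\<^esub>x\<in>{..<m 0}. a 0 x y \<odot>\<^bsub>N\<^esub> v x) \<oplus>\<^bsub>N\<^esub> (\<Oplus>\<^bsub>N\<^esub>x\<in>{..<m 0}. a 0 x y \<odot>\<^bsub>N\<^esub> w x)" if y: "y < m 1" for y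
    proof -
      have "(\<Oplus>\<^bsub>N\<^esub>x\<in>{..<m 0}. a 0 x y \<odot>\<^bsub>N\<^esub> (v x \<oplus>\<^bsub>N\<^esub> w x)) = (\<Oplus>\<^bsub>N\<^esub>x\<in>{..<m 0}. a 0 x y \<odot>\<^bsub>N\<^esub> v x \<oplus>\<^bsub>N\<^esub> a 0 x y \<odot>\<^bsub>N\<^esub> w x)"
        using vc ac[OF _ y] by (intro N.M.finsum_cong') (auto simp: N.smult_r_distr)
      also have "\<dots> = (\<Oplus>\<^bsub>N\<^esub>x\<in>{..<m 0}. a 0 x y \<odot>\<^bsub>N\<^esub> v x) \<oplus>\<^bsub>N\<^esub> (\<Oplus>\<^bsub>N\<^esub>x\<in>{..<m 0}. a 0 x y \<odot>\<^bsub>N\<^esub> w x)"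
        using vc ac[OF _ y] by (intro N.M.finsum_addf) auto
      finally show ?thesis .
    qed
    then show "A (v \<otimes>\<^bsub>add_monoid ?N0\<^esub> w) = A v \<otimes>\<^bsub>add_monoid ?N1\<^esub> A w" by (auto simp: A_def fun_eq_iff)
  qed
  have A_single: "A (single N x n) y = a 0 x y \<odot>\<^bsub>N\<^esub> n" if x: "x < m 0" "n \<in> carrier N" "y < m 1" for x n y
  proof -
    have "(\<Oplus>\<^bsub>N\<^esub>x'\<in>{..<m 0}. a 0 x' y \<odot>\<^bsub>N\<^esub> single N x n x')
        = (\<Oplus>\<^bsub>N\<^esub>x'\<in>{..<m 0}. if x = x' then a 0 x y \<odot>\<^bsub>N\<^esub> n else \<zero>\<^bsub>N\<^esub>)"
      using x ac[OF _ x(3)] by (intro N.M.finsum_cong') (auto simp: single_def N.smult_zero_right)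
    also have "\<dots> = a 0 x y \<odot>\<^bsub>N\<^esub> n"
      using N.M.finsum_singleton[of x "{..<m 0}" "\<lambda>_. a 0 x y \<odot>\<^bsub>N\<^esub> n"] x ac[OF x(1,3)] by simp
    finally show ?thesis using x(3) by (simp add: A_def)
  qed
  interpret N0: lmodule S ?N0 by (rule lmodule_pow_mod[OF N])
  interpret N1: lmodule S ?N1 by (rule lmodule_pow_mod[OF N])
  have E_ker: "kernel (add_monoid ?N0) (add_monoid ?N1) A \<subseteq> E ` carrier (add_monoid ?H)"
  proof
    fix v assume "v \<in> kernel (add_monoid ?N0) (add_monoid ?N1) A"
    then have v: "v \<in> carrier ?N0" "A v = (\<lambda>_. \<zero>\<^bsub>N\<^esub>)" by (simp_all add: kernel_def)
    have "(\<Oplus>\<^bsub>N\<^esub>x\<in>{..<m 0}. a 0 x y \<odot>\<^bsub>N\<^esub> v x) = \<zero>\<^bsub>N\<^esub>" if "y < m 1" for y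
      using fun_cong[OF v(2), of y] that by (simp add: A_def)
    from hom_from_generators[OF mr K N v(1) this] obtain \<phi> where
      \<phi>: "\<phi> \<in> lmod_hom S (left_mod K) N" "\<And>x. x < m 0 \<Longrightarrow> \<phi> (g x) = v x" by blast
    have "restrict \<phi> (carrier K) \<in> carrier ?H" using restrict_lmod_hom[OF L.lmodule_axioms \<phi>(1)] by simp
    moreover have "v = E (restrict \<phi> (carrier K))" using v(1) \<phi>(2) gc by (auto simp: E_def fun_eq_iff)
    ultimately show "v \<in> E ` carrier (add_monoid ?H)" by auto
  qed
  have E_inj: "\<phi> = \<zero>\<^bsub>?H\<^esub>" if \<phi>: "\<phi> \<in> carrier ?H" "E \<phi> = (\<lambda>_. \<zero>\<^bsub>N\<^esub>)" for \<phi>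
  proof -
    have "\<phi> k = \<zero>\<^bsub>N\<^esub>" if k: "k \<in> carrier K" for k
    proof -
      obtain r where r: "r \<in> {..<m 0} \<rightarrow> carrier S" "k = (\<Oplus>\<^bsub>right_mod K\<^esub>x\<in>{..<m 0}. r x \<odot>\<^bsub>K\<^esub> g x)"
        using D.generators[of k] k by auto
      have sc: "r x \<odot>\<^bsub>K\<^esub> g x \<in> carrier K" if "x < m 0" for x using L.smult_closed[of "r x" "g x"] r(1) gc that by auto
      have "\<phi> k = (\<Oplus>\<^bsub>N\<^esub>x\<in>{..<m 0}. \<phi> (r x \<odot>\<^bsub>K\<^esub> g x))" unfolding r(2)
        using sc \<phi>(1) by (subst finsum_right_mod[OF K]) (auto intro!: lmod_hom_finsum[OF L.lmodule_axioms N])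
      also have "\<dots> = (\<Oplus>\<^bsub>N\<^esub>x\<in>{..<m 0}. \<zero>\<^bsub>N\<^esub>)"
      proof (rule N.M.finsum_cong')
        fix x assume "x \<in> {..<m 0}"
        then have x: "x < m 0" "r x \<in> carrier S" using r(1) by auto
        have "\<phi> (g x) = \<zero>\<^bsub>N\<^esub>" using fun_cong[OF \<phi>(2), of x] x by (simp add: E_def)
        then show "\<phi> (r x \<odot>\<^bsub>K\<^esub> g x) = \<zero>\<^bsub>N\<^esub>" using Hs[OF \<phi>(1) x(2) gc[OF x(1)]] N.smult_zero_right[OF x(2)] by simp
      qed auto
      finally show ?thesis by simp
    qed
    then show ?thesis using \<phi>(1) by (auto simp: fun_eq_iff extensional_def)
  qed
  have \<theta>_gsum: "\<theta> (D.gsum f) \<phi> = (\<Prod>x<m 0. f x (\<phi> (g x)))" if f: "f \<in> carrier (D.P 0)" and \<phi>: "\<phi> \<in> carrier ?H" for f \<phi>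
  proof -
    have fc: "f x \<in> carrier ?C" if "x < m 0" for x using f that by simp
    have pc: "(\<lambda>x. D.pu (g x) (f x)) \<in> {..<m 0} \<rightarrow> carrier D.X" using D.pure_closed gc fc by (auto simp del: D.T.N.M.zero_closed)
    have s: "\<theta> (D.gsum f) = (\<Oplus>\<^bsub>char_module ?H\<^esub>x\<in>{..<m 0}. \<theta> (D.pu (g x) (f x)))"
      unfolding D.gsum_def by (rule lmod_hom_finsum[OF D.lmodule_tensor_module CH \<theta>(1) _ pc]) simp
    have "(\<lambda>x. \<theta> (D.pu (g x) (f x))) \<in> {..<m 0} \<rightarrow> carrier (char_module ?H)"
      by (intro Pi_I lmod_hom_closed[OF \<theta>(1)] funcset_mem[OF pc])
    from finsum_char_module[OF H finite_lessThan this \<phi>]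
    have "\<theta> (D.gsum f) \<phi> = (\<Prod>x<m 0. \<theta> (D.pu (g x) (f x)) \<phi>)" unfolding s .
    also have "\<dots> = (\<Prod>x<m 0. f x (\<phi> (g x)))"
    proof (rule prod.cong)
      fix x assume "x \<in> {..<m 0}"
      then have x: "x < m 0" by simp
      show "\<theta> (D.pu (g x) (f x)) \<phi> = f x (\<phi> (g x))" unfolding \<theta>(2)[OF gc[OF x] fc[OF x]] using \<phi> by (simp only: restrict_apply')
    qed simp
    finally show ?thesis .
  qed
  note groups = H.M.a_comm_group N0.M.a_comm_group N1.M.a_comm_group
  have "bij_betw \<theta> (carrier D.X) (carrier (char_module ?H))"
  proof (rule bij_betw_lmod_iso[OF D.lmodule_tensor_module CH \<theta>(1)])
    fix t assume t: "t \<in> carrier D.X" and z: "\<theta> t = \<zero>\<^bsub>char_module ?H\<^esub>"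
    obtain f where f: "f \<in> carrier (D.P 0)" "t = D.gsum f" using D.gsum_surj[OF t] by blast
    have fh: "f x \<in> hom (add_monoid N) circle" if "x < m 0" for x using f(1) that by simp
    \<comment> \<open>A tuple of characters is a character of the power. As
      \<open>\<theta> t\<close> is trivial, it is trivial on the image of \<open>E\<close>, hence
      factors through \<open>A\<close>; the components of the factor form a tuple \<open>w\<close>
      with \<open>f = D.amap 0 w\<close>.\<close>
    define \<Psi> where "\<Psi> v = (\<Prod>x<m 0. f x (v x))" for v
    have \<Psi>: "\<Psi> \<in> hom (add_monoid ?N0) circle" unfolding \<Psi>_def
    proof (rule add_charI)
      fix v w assume v: "v \<in> carrier ?N0" and w: "w \<in> carrier ?N0"
      show "cmod (\<Prod>x<m 0. f x (v x)) = 1" using add_charD(1)[OF fh] v by (simp add: prod_norm[symmetric])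
      show "(\<Prod>x<m 0. f x ((v \<oplus>\<^bsub>?N0\<^esub> w) x)) = (\<Prod>x<m 0. f x (v x)) * (\<Prod>x<m 0. f x (w x))"
        unfolding prod.distrib[symmetric] using v w add_charD(2)[OF fh] by (intro prod.cong) auto
    qed
    have "\<Psi> (E \<phi>) = 1" if "\<phi> \<in> carrier (add_monoid ?H)" for \<phi>
    proof -
      have \<phi>: "\<phi> \<in> carrier ?H" using that by simp
      have "\<Psi> (E \<phi>) = \<theta> t \<phi>" unfolding \<Psi>_def f(2) \<theta>_gsum[OF f(1) \<phi>] by (intro prod.cong) (simp_all add: E_def)
      also have "\<dots> = 1" unfolding z char_module_simps(2) using \<phi> by (simp only: restrict_apply')
      finally show ?thesis .
    qed
    from char_factor[where \<chi> = \<Psi> and u = E, OF groups E A E_ker \<Psi> this] obtain \<Psi>' where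
      \<Psi>': "\<Psi>' \<in> hom (add_monoid ?N1) circle" "\<And>v. v \<in> carrier ?N0 \<Longrightarrow> \<Psi> v = \<Psi>' (A v)" by auto
    define w where "w y = (if y < m 1 then \<lambda>n\<in>carrier N. \<Psi>' (single N y n) else \<zero>\<^bsub>?C\<^esub>)" for y
    have w: "w \<in> carrier (D.P (Suc 0))"
      using char_single[OF N \<Psi>'(1)] by (simp add: w_def del: char_module_simps)
    have "f x = D.amap 0 w x" for x
    proof (cases "x < m 0")
      case True
      have fx: "f x \<in> carrier ?C" using f(1) True by simp
      have wa: "(\<lambda>y. a 0 x y \<odot>\<^bsub>?C\<^esub> w y) \<in> {..<m (Suc 0)} \<rightarrow> carrier ?C"
      proof
        fix y assume "y \<in> {..<m (Suc 0)}"
        then show "a 0 x y \<odot>\<^bsub>?C\<^esub> w y \<in> carrier ?C"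
          using D.T.N.smult_closed[of "a 0 x y" "w y"] ac[OF True, of y] w by (simp del: char_module_simps)
      qed
      have s: "single N x n \<in> carrier ?N0" if "n \<in> carrier N" for n by (rule lmod_hom_closed[OF single_hom[OF N True] that])
      have "f x n = D.amap 0 w x n" if n: "n \<in> carrier N" for n
      proof -
        have "f x n = (\<Prod>x'<m 0. if x' = x then f x n else 1)" using True by (simp add: prod.delta)
        also have "\<dots> = \<Psi> (single N x n)" unfolding \<Psi>_def
          using add_char_zero[OF fh N] by (intro prod.cong) (auto simp: single_def)
        also have "\<dots> = \<Psi>' (A (single N x n))" by (rule \<Psi>'(2)[OF s[OF n]])
        also have "\<dots> = (\<Prod>y<m 1. \<Psi>' (single N y (A (single N x n) y)))"
          using ghom_closed[OF A, of "single N x n"] s[OF n] by (intro char_pow_mod[OF N \<Psi>'(1)]) simp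
        also have "\<dots> = (\<Prod>y<m (Suc 0). (a 0 x y \<odot>\<^bsub>?C\<^esub> w y) n)"
          using A_single[OF True n] ac[OF True] n by (intro prod.cong) (auto simp: w_def)
        also have "\<dots> = D.amap 0 w x n"
          using finsum_char_module[OF N _ wa n] True by (simp add: D.amap_def del: char_module_simps)
        finally show ?thesis .
      qed
      moreover have "D.amap 0 w x \<in> carrier ?C" by (rule pow_mod_nth[OF C D.amap_closed[OF w]])
      ultimately show ?thesis using fx by (intro extensionalityI[of _ "carrier N"]) simp_all
    next
      case False
      then show ?thesis using f(1) by (simp add: D.amap_def)
    qed
    then have "f = D.amap 0 w" by blast
    then show "t = \<zero>\<^bsub>D.X\<^esub>" unfolding f(2) using D.gsum_amap[OF w] by simp
  next
    fix \<eta> assume \<eta>: "\<eta> \<in> carrier (char_module ?H)"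
    \<comment> \<open>Injectivity of \<open>E\<close>, phrased as exactness behind a zero map, so
      that \<open>char_factor\<close> extends \<open>\<eta>\<close> from \<open>Hom(K, N)\<close> to
      the power.\<close>
    have k: "kernel (add_monoid ?H) (add_monoid ?N0) E \<subseteq> (\<lambda>_. \<zero>\<^bsub>?H\<^esub>) ` carrier (add_monoid ?H)"
    proof
      fix \<phi> assume "\<phi> \<in> kernel (add_monoid ?H) (add_monoid ?N0) E"
      then have "\<phi> = \<zero>\<^bsub>?H\<^esub>" by (intro E_inj) (simp_all add: kernel_def del: Hom_module_simps)
      then show "\<phi> \<in> (\<lambda>_. \<zero>\<^bsub>?H\<^esub>) ` carrier (add_monoid ?H)" using H.M.zero_closed by (simp del: Hom_module_simps) blast
    qed
    have o: "(\<lambda>_. \<zero>\<^bsub>?H\<^esub>) \<in> hom (add_monoid ?H) (add_monoid ?H)"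
      using H.M.zero_closed H.M.l_zero by (intro homI) (simp_all del: Hom_module_simps)
    have \<eta>h: "\<eta> \<in> hom (add_monoid ?H) circle" using \<eta> by simp
    from char_factor[where \<chi> = \<eta> and u = "\<lambda>_. \<zero>\<^bsub>?H\<^esub>", OF groups(1,1,2) o E k \<eta>h add_char_zero[OF \<eta>h H]] obtain \<Psi> where
      \<Psi>: "\<Psi> \<in> hom (add_monoid ?N0) circle" "\<And>\<phi>. \<phi> \<in> carrier ?H \<Longrightarrow> \<eta> \<phi> = \<Psi> (E \<phi>)" by auto
    define f where "f x = (if x < m 0 then \<lambda>n\<in>carrier N. \<Psi> (single N x n) else \<zero>\<^bsub>?C\<^esub>)" for x
    have f: "f \<in> carrier (D.P 0)" using char_single[OF N \<Psi>(1)] by (simp add: f_def del: char_module_simps)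
    have "\<eta> \<phi> = \<theta> (D.gsum f) \<phi>" if \<phi>: "\<phi> \<in> carrier ?H" for \<phi>
    proof -
      have "\<eta> \<phi> = (\<Prod>x<m 0. \<Psi> (single N x (E \<phi> x)))" unfolding \<Psi>(2)[OF \<phi>] by (rule char_pow_mod[OF N \<Psi>(1) Ec[OF \<phi>]])
      also have "\<dots> = (\<Prod>x<m 0. f x (\<phi> (g x)))" using Hc[OF \<phi>] gc by (intro prod.cong) (auto simp: f_def E_def)
      finally show ?thesis unfolding \<theta>_gsum[OF f \<phi>] .
    qed
    moreover have "\<theta> (D.gsum f) \<in> carrier (char_module ?H)" by (rule lmod_hom_closed[OF \<theta>(1) D.gsum_closed[OF f]])
    ultimately have "\<eta> = \<theta> (D.gsum f)"
      using \<eta> by (intro extensionalityI[of _ "carrier ?H"]) (simp_all del: Hom_module_simps)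
    then show "\<exists>t\<in>carrier D.X. \<eta> = \<theta> t" using D.gsum_closed[OF f] by blast
  qed
  then show ?thesis using \<theta> by blast
qed

section \<open>Duality between the two classes, and part (2)\<close>

lemma nd_injective_iso:
  assumes I: "nd_injective T n d I" and e: "e \<in> lmod_hom T I J" "bij_betw e (carrier I) (carrier J)" and J: "lmodule T J"
  shows "nd_injective T n d J"
proof -
  have Im: "lmodule T I" using I by (simp add: nd_injective_def)
  let ?k = "inv_into (carrier I) e"
  have k: "?k \<in> lmod_hom T J I" by (rule lmod_hom_inv_into[OF Im e])
  have ek: "e (?k j) = j" if "j \<in> carrier J" for j using e(2) that by (simp add: bij_betw_def f_inv_into_f)
  have "cochain_exact T P \<delta> J d" if ce: "cochain_exact T P \<delta> I d"
    for P :: "nat \<Rightarrow> ('a, (nat \<Rightarrow> 'a) + 'a + nat \<Rightarrow> 'a) module" and \<delta>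
    unfolding cochain_exact_def
  proof (intro ballI impI)
    fix f assume f: "f \<in> lmod_hom T (P (Suc d)) J" and z: "\<forall>x\<in>carrier (P (Suc (Suc d))). f (\<delta> (Suc d) x) = \<zero>\<^bsub>J\<^esub>"
    have "\<forall>x\<in>carrier (P (Suc (Suc d))). ?k (f (\<delta> (Suc d) x)) = \<zero>\<^bsub>I\<^esub>"
      using z lmod_hom_zero[OF J Im k] by simp
    then obtain h where h: "h \<in> lmod_hom T (P d) I" "\<And>x. x \<in> carrier (P (Suc d)) \<Longrightarrow> ?k (f x) = h (\<delta> d x)"
      using bspec[OF ce[unfolded cochain_exact_def] lmod_hom_comp[OF f k]] by blast
    have "f x = e (h (\<delta> d x))" if "x \<in> carrier (P (Suc d))" for x
      using ek[OF lmod_hom_closed[OF f that]] h(2)[OF that] by simp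
    then show "\<exists>h\<in>lmod_hom T (P d) J. \<forall>x\<in>carrier (P (Suc d)). f x = h (\<delta> d x)"
      by (intro bexI[OF _ lmod_hom_comp[OF h(1) e(1)]]) blast
  qed
  then have "Ext_zero T U J (Suc d)" if "Ext_zero T U I (Suc d)" for U :: "('a, nat \<Rightarrow> 'a) module"
    using that unfolding Ext_zero_iff[OF Im] Ext_zero_iff[OF J] by blast
  then show ?thesis using I J by (simp add: nd_injective_def)
qed

text \<open>If \<open>M\<close> is \<open>K \<otimes> F\<close>, its dual is
  \<open>Hom(K, -)\<close> of the dual of \<open>F\<close> by adjunction, and that dual is injective
  as \<open>F\<close> is flat.\<close>

lemma in_FK_char_module:
  fixes K :: "('s, 'r, 'k) bimod" and M :: "('s, 'm) module"
  assumes K: "bimodule S R K" and S: "ring S" and M: "in_FK TYPE('f) S R K n d M"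
  shows "in_IK TYPE('f \<Rightarrow> complex) (op_ring R) (op_ring S) (swap K) n d (char_module M)"
proof -
  have Mm: "lmodule S M" using M by (simp add: in_FK_def)
  obtain F :: "('r, 'f) module" and e where F: "nd_flat R n d F" and
    e: "e \<in> lmod_hom S (tensor_module R K F) M" "bij_betw e (carrier (tensor_module R K F)) (carrier M)"
    using M unfolding in_FK_def lmod_iso_def by blast
  have Fi: "lmodule R F" "nd_injective (op_ring R) n d (char_module F)" using F by (auto simp: nd_flat_iff)
  interpret F: bimod_tensor S R K F using K Fi by (simp add: bimod_tensor_def)
  interpret M: lmodule S M by (rule Mm)
  note ec = lmod_hom_closed[OF e(1)] and ea = lmod_hom_add[OF e(1)]
  have eg: "e \<in> hom F.T.TG (add_monoid M)" using ec ea by (intro homI) simp_all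
  let ?H = "Hom_module (op_ring R) (swap K) (char_module F)"
  define h where "h \<chi> = (\<lambda>k\<in>carrier K. \<lambda>y\<in>carrier F. \<chi> (e (F.pu k y)))" for \<chi> :: "'m \<Rightarrow> complex"
  have M': "lmodule (op_ring S) (char_module M)" by (rule lmodule_char_module[OF Mm])
  have H: "lmodule (op_ring S) ?H"
    by (rule lmodule_Hom_module[OF bimodule_swap[OF K] ring_op_ring[OF S] lmodule_char_module[OF Fi(1)]])
  have epc: "e (F.pu k y) \<in> carrier M" if "k \<in> carrier K" "y \<in> carrier F" for k y by (rule ec[OF F.pure_closed[OF that]])
  have hh: "h \<in> lmod_hom (op_ring S) (char_module M) ?H"
  proof (rule lmod_homI)
    fix \<chi> assume \<chi>: "\<chi> \<in> carrier (char_module M)"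
    then have \<chi>h: "\<chi> \<in> hom (add_monoid M) circle" by simp
    have "(\<lambda>t. \<chi> (e t)) \<in> hom F.T.TG circle"
      using ghom_closed[OF eg] hom_mult[OF eg] ghom_closed[OF \<chi>h] hom_mult[OF \<chi>h] by (intro homI) auto
    from F.T.hom_of_char[OF this] have "(\<lambda>k. \<lambda>y\<in>carrier F. \<chi> (e (F.pu k y))) \<in> lmod_hom (op_ring R) (right_mod K) (char_module F)" .
    from restrict_lmod_hom[OF F.T.U_module this] show "h \<chi> \<in> carrier ?H" by (simp add: h_def)
    show "h (\<chi> \<oplus>\<^bsub>char_module M\<^esub> \<psi>) = h \<chi> \<oplus>\<^bsub>?H\<^esub> h \<psi>" if "\<psi> \<in> carrier (char_module M)" for \<psi>
      using epc by (auto simp: h_def fun_eq_iff)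
    show "h (s \<odot>\<^bsub>char_module M\<^esub> \<chi>) = s \<odot>\<^bsub>?H\<^esub> h \<chi>" if s: "s \<in> carrier (op_ring S)" for s
    proof -
      have sk: "s \<odot>\<^bsub>K\<^esub> k \<in> carrier K" if "k \<in> carrier K" for k using F.L.smult_closed[of s k] s that by simp
      have "s \<odot>\<^bsub>M\<^esub> e (F.pu k y) = e (F.pu (s \<odot>\<^bsub>K\<^esub> k) y)" if "k \<in> carrier K" "y \<in> carrier F" for k y
        using lmod_hom_smult[OF e(1) _ F.pure_closed[OF that], of s] F.pure_smult[OF _ that, of s] s by simp
      then show ?thesis using epc sk by (auto simp: h_def fun_eq_iff)
    qed
  qed
  have "bij_betw h (carrier (char_module M)) (carrier ?H)"
  proof (rule bij_betw_lmod_iso[OF M' H hh])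
    fix \<chi> assume \<chi>: "\<chi> \<in> carrier (char_module M)" and z: "h \<chi> = \<zero>\<^bsub>?H\<^esub>"
    then have \<chi>h: "\<chi> \<in> hom (add_monoid M) circle" by simp
    have "\<chi> (e t) = 1" if t: "t \<in> carrier F.X" for t
    proof (rule F.T.tensor_hom_eq[OF comm_group.axioms(2)[OF comm_group_circle], where \<phi> = "\<lambda>t. \<chi> (e t)" and \<psi> = "\<lambda>_. 1"])
      show "(\<lambda>t. \<chi> (e t)) \<in> hom F.T.TG circle"
        using ghom_closed[OF eg] hom_mult[OF eg] ghom_closed[OF \<chi>h] hom_mult[OF \<chi>h] by (intro homI) auto
      show "(\<lambda>_. 1) \<in> hom F.T.TG circle" by (intro homI) auto
      show "t \<in> carrier F.T.TG" using t by simp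
      fix k y assume k: "k \<in> carrier (right_mod K)" and y: "y \<in> carrier F"
      then show "\<chi> (e (F.pu k y)) = 1" using fun_cong[OF fun_cong[OF z, of k], of y] by (simp add: h_def)
    qed
    then have "\<chi> x = 1" if "x \<in> carrier M" for x using e(2) that unfolding bij_betw_def by (metis imageE)
    then show "\<chi> = \<zero>\<^bsub>char_module M\<^esub>" using \<chi> by (auto simp: fun_eq_iff extensional_def)
  next
    fix f assume f: "f \<in> carrier ?H"
    then have fh: "f \<in> lmod_hom (op_ring R) (right_mod K) (char_module F)" by simp
    obtain \<Psi> where \<Psi>: "\<Psi> \<in> hom F.T.TG circle" "\<And>k y. k \<in> carrier K \<Longrightarrow> y \<in> carrier F \<Longrightarrow> \<Psi> (F.pu k y) = f k y"
      using F.T.char_of_hom[OF fh] by auto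
    let ?k = "inv_into (carrier F.X) e"
    have k: "?k \<in> lmod_hom S M F.X" by (rule lmod_hom_inv_into[OF F.lmodule_tensor_module e])
    have ke: "?k (e t) = t" if "t \<in> carrier F.X" for t using e(2) that by (simp add: bij_betw_def inv_into_f_f)
    have "restrict (\<lambda>x. \<Psi> (?k x)) (carrier M) \<in> hom (add_monoid M) circle"
    proof (rule add_charI)
      fix x y assume x: "x \<in> carrier M" "y \<in> carrier M"
      have c: "?k x \<in> carrier F.T.TG" "?k y \<in> carrier F.T.TG"
        using lmod_hom_closed[OF k x(1)] lmod_hom_closed[OF k x(2)] by (simp_all only: tensor_module_simps)
      show "cmod (restrict (\<lambda>x. \<Psi> (?k x)) (carrier M) x) = 1" using ghom_closed[OF \<Psi>(1) c(1)] x by simp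
      show "restrict (\<lambda>x. \<Psi> (?k x)) (carrier M) (x \<oplus>\<^bsub>M\<^esub> y) = restrict (\<lambda>x. \<Psi> (?k x)) (carrier M) x * restrict (\<lambda>x. \<Psi> (?k x)) (carrier M) y"
        using hom_mult[OF \<Psi>(1) c] lmod_hom_add[OF k x] x M.M.a_closed[OF x] by (simp only: tensor_module_simps circle_simps restrict_apply')
    qed
    then have "(\<lambda>x\<in>carrier M. \<Psi> (?k x)) \<in> carrier (char_module M)" by simp
    moreover have "f = h (\<lambda>x\<in>carrier M. \<Psi> (?k x))"
    proof (intro ext)
      fix k y
      consider "k \<notin> carrier K" | "k \<in> carrier K" "y \<notin> carrier F" | "k \<in> carrier K" "y \<in> carrier F" by blast
      then show "f k y = h (\<lambda>x\<in>carrier M. \<Psi> (?k x)) k y"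
      proof cases
        case 1
        then show ?thesis using f by (simp add: h_def extensional_def)
      next
        case 2
        then show ?thesis using lmod_hom_closed[OF fh, of k] by (simp add: h_def extensional_def)
      next
        case 3
        then show ?thesis using ke[OF F.pure_closed[OF 3]] epc[OF 3] \<Psi>(2)[OF 3] by (simp add: h_def)
      qed
    qed
    ultimately show "\<exists>\<chi>\<in>carrier (char_module M). f = h \<chi>" by blast
  qed
  then have "lmod_iso (op_ring S) ?H (char_module M)"
    unfolding lmod_iso_def using lmod_hom_inv_into[OF M' hh] bij_betw_inv_into by blast
  then show ?thesis unfolding in_IK_def using M' Fi(2) by blast
qed

text \<open>The witness is \<open>Hom(K, N)\<close>, and the isomorphism with \<open>N\<close> is
  evaluation. Its bijectivity is deduced from that of the coevaluation of the dual of
  \<open>N\<close>, by means of the isomorphism \<open>\<theta>\<close>.\<close>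

lemma in_FK_extension:
  fixes N :: "('s, 'n) module" and K :: "('s, 'r, 'k) bimod"
  assumes sd: "special_semidualizing S R C F \<delta> \<epsilon> d K" and R: "ring R" and S: "ring S"
    and ex: "short_exact S M N L f p"
    and MF: "in_FK TYPE('i) S R K n d M" and LF: "in_FK TYPE('j) S R K n d L"
  shows "in_FK TYPE('k \<Rightarrow> 'n) S R K n d N"
proof -
  have K: "bimodule S R K" using matrix_resolution_exists[OF sd R S] by (auto simp: matrix_resolution_def)
  have N: "lmodule S N" by (rule short_exactD(2)[OF ex])
  note sd' = special_semidualizing_swap[OF sd] and R' = ring_op_ring[OF R] and S' = ring_op_ring[OF S]
  obtain m g a where mr: "matrix_resolution (op_ring R) (op_ring S) (swap K) m g a"
    using matrix_resolution_exists[OF sd' S' R'] by blast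
  let ?C = "char_module N" and ?Y = "Hom_module S K N"
  note C = lmodule_char_module[OF N]
  have Y: "lmodule R ?Y" by (rule lmodule_Hom_module[OF K R N])
  have CY: "lmodule (op_ring R) (char_module ?Y)" by (rule lmodule_char_module[OF Y])
  interpret D: bimod_tensor "op_ring R" "op_ring S" "swap K" ?C using bimodule_swap[OF K] C by (simp add: bimod_tensor_def)
  interpret Y: bimod_tensor S R K ?Y using K Y by (simp add: bimod_tensor_def)
  interpret N: lmodule S N by (rule N)
  \<comment> \<open>Dualizing reverses the sequence: the dual of \<open>L\<close> is the submodule
    and the dual of \<open>M\<close> the quotient.\<close>
  note u = tensor_unit_bij[OF sd' S' R' short_exact_char_module[OF ex] in_FK_char_module[OF K S LF] in_FK_char_module[OF K S MF]]
  obtain \<theta> where \<theta>: "\<theta> \<in> lmod_hom (op_ring R) D.X (char_module ?Y)" "bij_betw \<theta> (carrier D.X) (carrier (char_module ?Y))"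
    "\<And>k \<chi>. k \<in> carrier K \<Longrightarrow> \<chi> \<in> carrier ?C \<Longrightarrow> \<theta> (D.pu k \<chi>) = (\<lambda>\<phi>\<in>carrier ?Y. \<chi> (\<phi> k))"
    using tensor_char_iso[OF mr K R N] by blast
  have Yflat: "nd_flat R n d ?Y" unfolding nd_flat_iff using Y nd_injective_iso[OF u(1) \<theta>(1,2) CY] by blast
  have Yc: "\<phi> k \<in> carrier N" if "\<phi> \<in> carrier ?Y" "k \<in> carrier K" for \<phi> k using lmod_hom_closed that by force
  have "\<exists>ev\<in>lmod_hom S Y.X N. \<forall>k\<in>carrier K. \<forall>\<phi>\<in>carrier ?Y. ev (Y.pu k \<phi>) = \<phi> k"
  proof (rule Y.X_hom[OF N])
    fix k \<phi> assume k: "k \<in> carrier K" and \<phi>: "\<phi> \<in> carrier ?Y"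
    then have \<phi>h: "\<phi> \<in> lmod_hom S (left_mod K) N" by simp
    show "\<phi> k \<in> carrier N" by (rule Yc[OF \<phi> k])
    show "\<phi> (k \<oplus>\<^bsub>K\<^esub> k') = \<phi> k \<oplus>\<^bsub>N\<^esub> \<phi> k'" if "k' \<in> carrier K" for k' using lmod_hom_add[OF \<phi>h, of k k'] k that by simp
    show "(\<phi> \<oplus>\<^bsub>?Y\<^esub> \<phi>') k = \<phi> k \<oplus>\<^bsub>N\<^esub> \<phi>' k" if "\<phi>' \<in> carrier ?Y" for \<phi>' using k by simp
    show "\<phi> (rsmult K k r) = (r \<odot>\<^bsub>?Y\<^esub> \<phi>) k" if "r \<in> carrier R" for r using k by simp
    show "\<phi> (s \<odot>\<^bsub>K\<^esub> k) = s \<odot>\<^bsub>N\<^esub> \<phi> k" if "s \<in> carrier S" for s using lmod_hom_smult[OF \<phi>h that, of k] k by simp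
  qed
  then obtain ev where ev: "ev \<in> lmod_hom S Y.X N" "\<And>k \<phi>. k \<in> carrier K \<Longrightarrow> \<phi> \<in> carrier ?Y \<Longrightarrow> ev (Y.pu k \<phi>) = \<phi> k" by blast
  have evg: "ev \<in> hom Y.T.TG (add_monoid N)"
    using lmod_hom_closed[OF ev(1)] lmod_hom_add[OF ev(1)] by (intro homI) simp_all
  interpret evg: group_hom Y.T.TG "add_monoid N" ev
    by (intro group_hom.intro group_hom_axioms.intro Y.T.TG.group_axioms N.M.a_group evg)
  interpret Ng: abelian_characters "add_monoid N" by (intro abelian_characters.intro N.M.a_comm_group)
  interpret Xg: abelian_characters Y.T.TG by (intro abelian_characters.intro Y.T.TG.comm_group_axioms)
  have \<theta>0: "\<theta> \<zero>\<^bsub>D.X\<^esub> = \<zero>\<^bsub>char_module ?Y\<^esub>" by (rule lmod_hom_zero[OF D.lmodule_tensor_module CY \<theta>(1)])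
  have "bij_betw ev (carrier Y.X) (carrier N)"
  proof (rule bij_betw_lmod_iso[OF Y.lmodule_tensor_module N ev(1)])
    fix x assume x: "x \<in> carrier N"
    have "x \<in> ev ` carrier Y.T.TG"
    proof (rule ccontr)
      assume "x \<notin> ev ` carrier Y.T.TG"
      then have "\<exists>\<chi>\<in>hom (add_monoid N) circle. (\<forall>y\<in>ev ` carrier Y.T.TG. \<chi> y = 1) \<and> \<chi> x \<noteq> 1"
        using x by (intro Ng.char_separate[OF evg.img_is_subgroup]) simp_all
      then obtain \<chi> where \<chi>: "\<chi> \<in> hom (add_monoid N) circle" "\<And>t. t \<in> carrier Y.T.TG \<Longrightarrow> \<chi> (ev t) = 1" "\<chi> x \<noteq> 1" by blast
      let ?\<chi> = "\<lambda>x\<in>carrier N. \<chi> x"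
      have "restrict \<chi> (carrier N) \<in> hom (add_monoid N) circle"
        using add_charD[OF \<chi>(1)] by (intro add_charI) auto
      then have c: "?\<chi> \<in> carrier ?C" by simp
      \<comment> \<open>\<open>\<chi>\<close> is trivial on all values \<open>\<phi> k\<close>, so
        \<open>\<theta>\<close> sends \<open>k \<otimes> \<chi>\<close> to zero. The coevaluation of
        \<open>?\<chi>\<close> is therefore zero, and its injectivity contradicts
        \<open>\<chi> x \<noteq> 1\<close>.\<close>
      have "D.pu k ?\<chi> = D.pu k \<zero>\<^bsub>?C\<^esub>" if k: "k \<in> carrier K" for k
      proof -
        have ks: "k \<in> carrier (swap K)" using k by simp
        have "\<chi> (\<phi> k) = 1" if "\<phi> \<in> carrier ?Y" for \<phi>
          using \<chi>(2)[of "Y.pu k \<phi>"] Y.pure_closed[OF k that] ev(2)[OF k that] by simp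
        then have "\<theta> (D.pu k ?\<chi>) = \<theta> \<zero>\<^bsub>D.X\<^esub>"
          unfolding \<theta>(3)[OF k c] \<theta>0 using Yc k by (auto simp: fun_eq_iff simp del: Hom_module_simps)
        then have "D.pu k ?\<chi> = \<zero>\<^bsub>D.X\<^esub>"
          by (rule inj_onD[OF bij_betw_imp_inj_on[OF \<theta>(2)] _ D.pure_closed[OF ks c] D.KN.M.zero_closed])
        then show ?thesis using D.pure_zero_right[OF ks] by (simp only:)
      qed
      then have "(\<lambda>k\<in>carrier (swap K). D.pu k ?\<chi>) = (\<lambda>k\<in>carrier (swap K). D.pu k \<zero>\<^bsub>?C\<^esub>)" by (intro restrict_ext) simp
      then have "?\<chi> = \<zero>\<^bsub>?C\<^esub>"
        by (rule inj_onD[OF bij_betw_imp_inj_on[OF u(2)] _ c D.T.N.M.zero_closed])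
      from fun_cong[OF this, of x] show False using \<chi>(3) x by simp
    qed
    then show "\<exists>t\<in>carrier Y.X. x = ev t" by auto
  next
    fix t assume t: "t \<in> carrier Y.X" and z: "ev t = \<zero>\<^bsub>N\<^esub>"
    show "t = \<zero>\<^bsub>Y.X\<^esub>"
    proof (rule ccontr)
      assume "t \<noteq> \<zero>\<^bsub>Y.X\<^esub>"
      then have "\<exists>\<Psi>\<in>hom Y.T.TG circle. (\<forall>y\<in>{\<one>\<^bsub>Y.T.TG\<^esub>}. \<Psi> y = 1) \<and> \<Psi> t \<noteq> 1"
        using t by (intro Xg.char_separate[OF Y.T.TG.triv_subgroup]) simp_all
      then obtain \<Psi> where \<Psi>: "\<Psi> \<in> hom Y.T.TG circle" "\<Psi> t \<noteq> 1" by blast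
      \<comment> \<open>By adjunction \<open>\<Psi>\<close> is a homomorphism from \<open>K\<close>
        to the dual of \<open>Hom(K, N)\<close>. Moved back along \<open>\<theta>\<close> it is the
        coevaluation of some \<open>\<chi>\<close>, as coevaluation is onto. Hence
        \<open>\<Psi>\<close> equals \<open>\<chi> o ev\<close> and is trivial at
        \<open>t\<close>.\<close>
      define f where "f k = (\<lambda>\<phi>\<in>carrier ?Y. \<Psi> (Y.pu k \<phi>))" for k
      have f: "f \<in> lmod_hom (op_ring R) (right_mod K) (char_module ?Y)"
        using Y.T.hom_of_char[OF \<Psi>(1)] by (simp only: f_def[abs_def])
      let ?i = "inv_into (carrier D.X) \<theta>"
      have "(\<lambda>k. ?i (f k)) \<in> lmod_hom (op_ring R) (right_mod K) D.X"
        by (rule lmod_hom_comp[OF f lmod_hom_inv_into[OF D.lmodule_tensor_module \<theta>(1,2)]])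
      from restrict_lmod_hom[OF Y.T.U_module this]
      have "(\<lambda>k\<in>carrier K. ?i (f k)) \<in> carrier (Hom_module (op_ring R) (swap K) D.X)" by simp
      then obtain \<chi> where \<chi>: "\<chi> \<in> carrier ?C" "(\<lambda>k\<in>carrier K. ?i (f k)) = (\<lambda>k\<in>carrier (swap K). D.pu k \<chi>)"
        using bij_betw_imp_surj_on[OF u(2)] by (smt (verit) imageE)
      have \<chi>h: "\<chi> \<in> hom (add_monoid N) circle" using \<chi>(1) by simp
      have "\<Psi> (Y.pu k \<phi>) = \<chi> (\<phi> k)" if k: "k \<in> carrier K" and \<phi>: "\<phi> \<in> carrier ?Y" for k \<phi>
      proof -
        have "f k \<in> carrier (char_module ?Y)" by (rule lmod_hom_closed[OF f]) (simp add: k)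
        then have "f k = \<theta> (?i (f k))" using \<theta>(2) by (simp only: bij_betw_def f_inv_into_f)
        also have "?i (f k) = D.pu k \<chi>" using fun_cong[OF \<chi>(2), of k] k by simp
        finally have "f k \<phi> = \<theta> (D.pu k \<chi>) \<phi>" by simp
        then show ?thesis unfolding \<theta>(3)[OF k \<chi>(1)] f_def using \<phi> by (simp only: restrict_apply')
      qed
      then have eq: "\<Psi> (Y.pu k \<phi>) = \<chi> (ev (Y.pu k \<phi>))" if "k \<in> carrier (right_mod K)" "\<phi> \<in> carrier ?Y" for k \<phi>
        using ev(2) that by simp
      have "(\<lambda>t. \<chi> (ev t)) \<in> hom Y.T.TG circle"
        using ghom_closed[OF evg] hom_mult[OF evg] ghom_closed[OF \<chi>h] hom_mult[OF \<chi>h] by (intro homI) auto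
      from Y.T.tensor_hom_eq[OF comm_group.axioms(2)[OF comm_group_circle] \<Psi>(1) this eq, of t]
      have "\<Psi> t = \<chi> (ev t)" using t by simp
      then show False using z add_char_zero[OF \<chi>h N] \<Psi>(2) by simp
    qed
  qed
  then show ?thesis unfolding in_FK_def lmod_iso_def using N Yflat ev(1) by blast
qed

theorem proposition3p14:
  fixes R :: "'r ring" and S :: "'s ring"
    and C :: "('s, 'r, 'c) bimod"
    and F :: "nat \<Rightarrow> ('s, 'r, 'k) bimod" and \<delta> :: "nat \<Rightarrow> 'k \<Rightarrow> 'k" and \<epsilon> :: "'k \<Rightarrow> 'c"
    and K :: "('s, 'r, 'k) bimod"
    and d :: nat and n :: enat
  assumes "ring R" and "ring S"
    and "d \<ge> 1" and "n > enat (d + 1)"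
    and "special_semidualizing S R C F \<delta> \<epsilon> d K"
  shows
    "(\<forall>(M :: ('r, 'm) module) (N :: ('r, 'n) module) (L :: ('r, 'l) module) f g.
        short_exact R M N L f g \<and>
        in_IK TYPE('i) S R K n d M \<and> in_IK TYPE('j) S R K n d L \<longrightarrow>
        in_IK TYPE((('k \<times> 'n) \<Rightarrow>\<^sub>0 int) set) S R K n d N) \<and>
     (\<forall>(M :: ('s, 'm2) module) (N :: ('s, 'n2) module) (L :: ('s, 'l2) module) f g.
        short_exact S M N L f g \<and>
        in_FK TYPE('i2) S R K n d M \<and> in_FK TYPE('j2) S R K n d L \<longrightarrow>
        in_FK TYPE('k \<Rightarrow> 'n2) S R K n d N)"
  using in_IK_extension[OF assms(5,1,2)] in_FK_extension[OF assms(5,1,2)] by blast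

end
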